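(* Let $V\subset H\simeq H^*\subset V^*$ be a Gel'fand triple of real separable Hilbert spaces and let $A\in\mathcal{L}(V,V^* )$ be self-adjoint with bilinear form $a(v,w)={}_{V^*}\langle Av,w\rangle_V$ such that, for some $0<\lambda_-\le\lambda_+<\infty$, $a(v,v)\ge\lambda_-\|v\|_V^2$ and $|a(v,w)|\le\lambda_+\|v\|_V\|w\|_V$ for all $v,w\in V$. Let $$X=H^{1/2}_{00,\{0\}}(\mathbb{R}_>;H)\cap L^2(\mathbb{R}_>;V),\qquad Y=H^{1/2}(\mathbb{R}_>;H)\cap L^2(\mathbb{R}_>;V),$$ and define $$\mathcal{B}(w,v)=\int_{\mathbb{R}_>}\Big\{(\mathrm{D}_+^{1/2}w,\mathrm{D}_-^{1/2}v)_H+a(w,v)\Big\}\,\mathrm{d}t,\qquad w\in X,\ v\in Y.$$ Then: (i) there is a constant $C$ such that $|\mathcal{B}(w,v)|\le C\|w\|_X\|v\|_Y$ for all $w\in X$, $v\in Y$; (ii) there is $\gamma>0$ such that $\displaystyle\inf_{0\ne w\in X}\ \sup_{0\ne v\in Y}\frac{\mathcal{B}(w,v)}{\|w\|_X\|v\|_Y}\ge\gamma$; (iii) $\displaystyle\sup_{w\in X}\mathcal{B}(w,v)>0$ for every $0\ne v\in Y$. In particular, for every $f\in Y^*$ there exists a unique $u\in X$ such that $\mathcal{B}(u,v)=\langle f,v\rangle$ for all $v\in Y$, where $\langle\cdot,\cdot\rangle$ is the $Y^*\times Y$ duality pairing.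
   Context: All vector spaces are real. $\mathbb{R}_>=(0,\infty)$. The Gel'fand triple has dense (continuous) embeddings, $H$ being identified with $H^*$ by the Riesz theorem. Spaces: $H^1_{0,\{0\}}(\mathbb{R}_>;H)=\{v\in H^1(\mathbb{R}_>;H):v(0)=0\}$; with $[\cdot,\cdot]_s$ the Hilbert space interpolation of Lions–Magenes, $H^{1/2}(\mathbb{R}_>;H)=[L^2(\mathbb{R}_>;H),H^1(\mathbb{R}_>;H)]_{1/2}$ and $H^{1/2}_{00,\{0\}}(\mathbb{R}_>;H)=[L^2(\mathbb{R}_>;H),H^1_{0,\{0\}}(\mathbb{R}_>;H)]_{1/2}$. Equivalent intrinsic norms are $$\|u\|^2_{H^{1/2}(\mathbb{R}_>;H)}=\|u\|^2_{L^2(\mathbb{R}_>;H)}+\int_{\mathbb{R}_>}\int_{\mathbb{R}_>}\frac{\|u(s)-u(t)\|_H^2}{|s-t|^2}\,\mathrm{d}s\,\mathrm{d}t,$$ $$\|u\|^2_{H^{1/2}_{00,\{0\}}(\mathbb{R}_>;H)}=\|u\|^2_{H^{1/2}(\mathbb{R}_>;H)}+\int_{\mathbb{R}_>}\frac1s\|u(s)\|_H^2\,\mathrm{d}s .$$ $X$ and $Y$ carry the usual intersection norms (e.g. $\|w\|_X^2=\|w\|^2_{H^{1/2}_{00,\{0\}}(\mathbb{R}_>;H)}+\|w\|^2_{L^2(\mathbb{R}_>;V)}$). Fractional derivatives: for smooth functions, $$(\mathrm{D}_+^{1/2}u)(t)=\frac1{\Gamma(1/2)}\frac{\mathrm{d}}{\mathrm{d}t}\int_0^t(t-s)^{-1/2}u(s)\,\mathrm{d}s,\qquad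 (\mathrm{D}_-^{1/2}u)(t)=-\frac1{\Gamma(1/2)}\frac{\mathrm{d}}{\mathrm{d}t}\int_t^\infty(s-t)^{-1/2}u(s)\,\mathrm{d}s .$$ $\mathrm{D}_+^{1/2}$ extends by continuity to a bounded operator $H^{1/2}_{00,\{0\}}(\mathbb{R}_>;H)\to L^2(\mathbb{R}_>;H)$ and $\mathrm{D}_-^{1/2}$ to a bounded operator $H^{1/2}(\mathbb{R}_>;H)\to L^2(\mathbb{R}_>;H)$; these extensions are used in $\mathcal{B}$. *)

theory Defs
  imports "HOL-Analysis.Analysis"
begin

text \<open>
  Elements of the function spaces below are represented by functions on \<^typ>\<open>real\<close>, of which only
  the values on the open half line matter, and two representatives are identified when they agree
  almost everywhere there. Strong and Borel measurability coincide because the value spaces are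
  separable; every class of Lebesgue measurable functions has a Borel measurable representative.
\<close>

abbreviation half_line :: "real measure" where
  "half_line \<equiv> restrict_space lborel {0<..}"

section \<open>Bochner and fractional Sobolev spaces on the half line\<close>

text \<open>
  The squared norms take values in \<^typ>\<open>ennreal\<close>, so that finiteness of the norm is meaningful;
  the real-valued norms are meant for members of the respective space only.
\<close>

definition L2_normsq :: "(real \<Rightarrow> 'b::real_normed_vector) \<Rightarrow> ennreal" where
  "L2_normsq u = (\<integral>\<^sup>+t. ennreal ((norm (u t))\<^sup>2) \<partial>half_line)"

definition L2_space :: "(real \<Rightarrow> 'b::real_normed_vector) set" where
  "L2_space = {u \<in> borel_measurable half_line. L2_normsq u < \<infinity>}"

definition L2_norm :: "(real \<Rightarrow> 'b::real_normed_vector) \<Rightarrow> real" where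
  "L2_norm u = sqrt (enn2real (L2_normsq u))"

text \<open>
  The interpolation spaces between \<open>L\<^sup>2\<close> and \<open>H\<^sup>1\<close> (respectively the functions in \<open>H\<^sup>1\<close> vanishing
  at \<open>0\<close>) of order \<open>1/2\<close>, given through their intrinsic (Sobolev--Slobodeckij) norms, which
  are equivalent to the interpolation norms. The integrand on the diagonal is \<open>0\<close> by the convention \<open>0 / 0 = 0\<close>; the diagonal is a null set.
\<close>

definition H12_normsq :: "(real \<Rightarrow> 'h::real_normed_vector) \<Rightarrow> ennreal" where
  "H12_normsq u = L2_normsq u +
     (\<integral>\<^sup>+s. (\<integral>\<^sup>+t. ennreal ((norm (u s - u t))\<^sup>2 / \<bar>s - t\<bar>\<^sup>2) \<partial>half_line) \<partial>half_line)"

definition H12_space :: "(real \<Rightarrow> 'h::real_normed_vector) set" where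
  "H12_space = {u \<in> borel_measurable half_line. H12_normsq u < \<infinity>}"

definition H12_norm :: "(real \<Rightarrow> 'h::real_normed_vector) \<Rightarrow> real" where
  "H12_norm u = sqrt (enn2real (H12_normsq u))"

definition H12_00_normsq :: "(real \<Rightarrow> 'h::real_normed_vector) \<Rightarrow> ennreal" where
  "H12_00_normsq u = H12_normsq u + (\<integral>\<^sup>+s. ennreal (1 / s * (norm (u s))\<^sup>2) \<partial>half_line)"

definition H12_00_space :: "(real \<Rightarrow> 'h::real_normed_vector) set" where
  "H12_00_space = {u \<in> borel_measurable half_line. H12_00_normsq u < \<infinity>}"

definition H12_00_norm :: "(real \<Rightarrow> 'h::real_normed_vector) \<Rightarrow> real" where
  "H12_00_norm u = sqrt (enn2real (H12_00_normsq u))"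

section \<open>Fractional derivatives of order one half\<close>

definition smooth_compact :: "(real \<Rightarrow> 'h::real_normed_vector) set" where
  "smooth_compact = {\<phi>.
     (\<exists>F. F 0 = \<phi> \<and> (\<forall>(k::nat) t. (F k has_vector_derivative F (Suc k) t) (at t))) \<and>
     compact (closure {t. \<phi> t \<noteq> 0})}"

definition smooth_compact_0 :: "(real \<Rightarrow> 'h::real_normed_vector) set" where
  "smooth_compact_0 = {\<phi> \<in> smooth_compact. closure {t. \<phi> t \<noteq> 0} \<subseteq> {0<..}}"

definition smooth_D_plus ::
    "(real \<Rightarrow> 'h::{banach, second_countable_topology}) \<Rightarrow> real \<Rightarrow> 'h" where
  "smooth_D_plus u t = (1 / Gamma (1/2)) *\<^sub>R
     vector_derivative (\<lambda>\<tau>. LINT s:{0<..<\<tau>}|lborel. ((\<tau> - s) powr (-1/2)) *\<^sub>R u s) (at t)"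

definition smooth_D_minus ::
    "(real \<Rightarrow> 'h::{banach, second_countable_topology}) \<Rightarrow> real \<Rightarrow> 'h" where
  "smooth_D_minus u t = - (1 / Gamma (1/2)) *\<^sub>R
     vector_derivative (\<lambda>\<tau>. LINT s:{\<tau><..}|lborel. ((s - \<tau>) powr (-1/2)) *\<^sub>R u s) (at t)"

text \<open>
  Extension by continuity of an operator \<open>T\<close> with values in \<open>L\<^sup>2\<close>, given on a set \<open>S\<close> of functions
  that is dense for the squared norm \<open>N\<close>: the \<open>L\<^sup>2\<close> limit of \<open>T (\<phi> n)\<close> along a sequence
  in \<open>S\<close> that converges to \<open>u\<close>; for bounded \<open>T\<close> every such sequence yields the same limit. It is unique only up to null sets, hence the choice of a
  representative.
\<close>

definition L2_extension ::
    "(real \<Rightarrow> 'h::real_normed_vector) set \<Rightarrow> ((real \<Rightarrow> 'h) \<Rightarrow> ennreal) \<Rightarrow>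
     ((real \<Rightarrow> 'h) \<Rightarrow> real \<Rightarrow> 'h) \<Rightarrow> (real \<Rightarrow> 'h) \<Rightarrow> real \<Rightarrow> 'h" where
  "L2_extension S N T u = (SOME g. g \<in> L2_space \<and>
     (\<exists>\<phi>. (\<forall>n::nat. \<phi> n \<in> S) \<and>
          (\<lambda>n. N (\<lambda>t. \<phi> n t - u t)) \<longlonglongrightarrow> 0 \<and>
          (\<lambda>n. L2_normsq (\<lambda>t. T (\<phi> n) t - g t)) \<longlonglongrightarrow> 0))"

text \<open>
  The dense classes are the smooth functions with compact support in the open half line for
  \<open>D_plus\<close> and the restrictions of compactly supported smooth functions on the whole line for
  \<open>D_minus\<close> (for positive times \<^const>\<open>smooth_D_minus\<close> only sees values at positive times).
\<close>

definition D_plus ::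
    "(real \<Rightarrow> 'h::{banach, second_countable_topology}) \<Rightarrow> real \<Rightarrow> 'h" where
  "D_plus = L2_extension smooth_compact_0 H12_00_normsq smooth_D_plus"

definition D_minus ::
    "(real \<Rightarrow> 'h::{banach, second_countable_topology}) \<Rightarrow> real \<Rightarrow> 'h" where
  "D_minus = L2_extension smooth_compact H12_normsq smooth_D_minus"

section \<open>The space-time variational formulation\<close>

text \<open>
  The Gel'fand triple is given by the embedding \<open>j\<close> of \<open>V\<close> into \<open>H\<close>. The dual of \<open>V\<close> is the
  type of bounded linear functionals on \<open>V\<close>, into which \<open>H\<close> embeds by \<open>h \<mapsto> (v \<mapsto> h \<bullet> j v)\<close>.
\<close>

definition gelfand_embedding :: "('v::real_normed_vector \<Rightarrow> 'h::real_inner) \<Rightarrow> bool" where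
  "gelfand_embedding j \<longleftrightarrow> bounded_linear j \<and> inj j \<and> closure (range j) = UNIV"

text \<open>
  As \<open>j\<close> is injective, a member of an intersection of spaces of \<open>H\<close>-valued and \<open>V\<close>-valued
  functions is represented by its \<open>V\<close>-valued version \<open>w\<close>; the corresponding \<open>H\<close>-valued function
  is \<open>j \<circ> w\<close>.
\<close>

definition X_space ::
    "('v::real_normed_vector \<Rightarrow> 'h::real_normed_vector) \<Rightarrow> (real \<Rightarrow> 'v) set" where
  "X_space j = {w. j \<circ> w \<in> H12_00_space \<and> w \<in> L2_space}"

definition X_norm ::
    "('v::real_normed_vector \<Rightarrow> 'h::real_normed_vector) \<Rightarrow> (real \<Rightarrow> 'v) \<Rightarrow> real" where
  "X_norm j w = sqrt ((H12_00_norm (j \<circ> w))\<^sup>2 + (L2_norm w)\<^sup>2)"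

definition Y_space ::
    "('v::real_normed_vector \<Rightarrow> 'h::real_normed_vector) \<Rightarrow> (real \<Rightarrow> 'v) set" where
  "Y_space j = {v. j \<circ> v \<in> H12_space \<and> v \<in> L2_space}"

definition Y_norm ::
    "('v::real_normed_vector \<Rightarrow> 'h::real_normed_vector) \<Rightarrow> (real \<Rightarrow> 'v) \<Rightarrow> real" where
  "Y_norm j v = sqrt ((H12_norm (j \<circ> v))\<^sup>2 + (L2_norm v)\<^sup>2)"

text \<open>
  A functional in the dual of \<open>Y\<close> acts on representatives; boundedness and linearity force it to
  take the same value on representatives that agree almost everywhere.
\<close>

definition Y_dual ::
    "('v::real_normed_vector \<Rightarrow> 'h::real_normed_vector) \<Rightarrow> ((real \<Rightarrow> 'v) \<Rightarrow> real) set" where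
  "Y_dual j = {f.
     (\<forall>u\<in>Y_space j. \<forall>v\<in>Y_space j. f (\<lambda>t. u t + v t) = f u + f v) \<and>
     (\<forall>c. \<forall>v\<in>Y_space j. f (\<lambda>t. c *\<^sub>R v t) = c * f v) \<and>
     (\<exists>K. \<forall>v\<in>Y_space j. \<bar>f v\<bar> \<le> K * Y_norm j v)}"

definition nonnull :: "(real \<Rightarrow> 'b::zero) \<Rightarrow> bool" where
  "nonnull u \<longleftrightarrow> \<not> (AE t in half_line. u t = 0)"

definition B_form ::
    "('v::real_normed_vector \<Rightarrow> 'h::{real_inner, banach, second_countable_topology}) \<Rightarrow>
     ('v \<Rightarrow>\<^sub>L 'v \<Rightarrow>\<^sub>L real) \<Rightarrow> (real \<Rightarrow> 'v) \<Rightarrow> (real \<Rightarrow> 'v) \<Rightarrow> real" where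
  "B_form j A w v =
     (LINT t|half_line. D_plus (j \<circ> w) t \<bullet> D_minus (j \<circ> v) t
        + blinfun_apply (blinfun_apply A (w t)) (v t))"

end

theory Submission
  imports Defs
begin

text \<open>
  On smooth compactly supported functions, integration by parts turns the square norm of a half
  derivative into the squared Gagliardo seminorm (through the kernels \<open>- ln \<bar>r\<bar>\<close>, \<open>- 1 / r\<close>, \<open>1 / r\<^sup>2\<close>) and
  \<open>(D_plus u, D_minus v)\<close> into \<open>(u', v)\<close>; by density both half derivatives are bounded. In particular the
  time part of \<open>B\<close> vanishes for \<open>v = w\<close>, whereas for the Hilbert transform \<open>v = H w\<close> of the extension of \<open>w\<close>
  by zero it is a multiple of the squared Gagliardo seminorm. Hence \<open>v = w + d H w\<close> with small \<open>d > 0\<close> proves the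
  inf-sup condition: as \<open>H\<close> commutes with \<open>j\<close> and is an \<open>L\<^sup>2\<close> contraction, the spatial term \<open>d a(w, H w)\<close>
  is absorbed by \<open>a(w, w)\<close>. If \<open>B(w, v) = 0\<close> for all \<open>w\<close>, then \<open>v\<close> solves \<open>v' = A v\<close> on the half
  line, so that its norm does not decrease, and square integrability forces \<open>v = 0\<close>.
\<close>

text \<open>The norm of a half derivative is a quadratic form in the derivative whose kernel, an
  integral of two inverse square roots, diverges logarithmically. Derivatives of compactly supported
  functions have mean zero, so the divergent constant drops out and \<open>- ln |s - s'|\<close>
  remains.

  Each half derivative looks in one direction of time only: \<open>D_minus\<close> can be estimated
  through the even extension, \<open>D_plus\<close> through the zero extension, and the weight
  \<open>1 / s\<close> is the interaction of the latter with the negative axis.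

  The Hilbert transform enters only through conjugate Poisson operators. Their bounds are uniform in
  the parameter; the energy identity holds in the limit and is used up to a small loss that
  coercivity pays for, so the test function may depend on \<open>w\<close> nonlinearly.

  Functions are representatives, so all products are semi-definite. Existence comes from two Riesz
  representations, of the functional in Y and then in X for the product pulled back from Y by the
  form; injectivity of the adjoint removes the residual.\<close>

abbreviation (input) seq_tendsto :: "(nat \<Rightarrow> 'a::topological_space) \<Rightarrow> 'a \<Rightarrow> bool" ("(_/ ---> _)" [60, 60] 60) where
  "X ---> L \<equiv> X \<longlonglongrightarrow> L"

section \<open>Square-integrable functions over an arbitrary measure\<close>

definition sqnorm :: "'a measure => ('a => 'b::real_normed_vector) => ennreal" where
  "sqnorm M f = (\<integral>\<^sup>+x. ennreal ((norm (f x))\<^sup>2) \<partial>M)"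

definition sq_integrable :: "'a measure => ('a => 'b::real_normed_vector) => bool" where
  "sq_integrable M f \<longleftrightarrow> f \<in> borel_measurable M \<and> sqnorm M f < \<infinity>"

lemma L2_normsq_eq: "L2_normsq u = sqnorm half_line u"
  by (simp add: L2_normsq_def sqnorm_def)

lemma sq_integrable_measurable[measurable_dest]: "sq_integrable M f ==> f \<in> borel_measurable M"
  by (simp add: sq_integrable_def)

lemma norm_add_sq_le:
  fixes x y :: "'b::real_normed_vector"
  shows "(norm (x + y))\<^sup>2 <= 2 * (norm x)\<^sup>2 + 2 * (norm y)\<^sup>2"
proof -
  have "(norm (x + y))\<^sup>2 <= (norm x + norm y)\<^sup>2" by (intro power_mono norm_triangle_ineq) auto
  also have "... <= 2 * (norm x)\<^sup>2 + 2 * (norm y)\<^sup>2" using sum_squares_bound[of "norm x" "norm y"] by (simp add: power2_sum)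
  finally show ?thesis .
qed

lemma sqnorm_mono:
  assumes "AE x in M. norm (f x) <= norm (g x)"
  shows "sqnorm M f <= sqnorm M g"
  unfolding sqnorm_def
  by (rule nn_integral_mono_AE) (use assms in \<open>auto elim!: eventually_mono intro!: ennreal_leI power_mono\<close>)

lemma sqnorm_cong_AE: "AE x in M. norm (f x) = norm (g x) ==> sqnorm M f = sqnorm M g"
  by (intro antisym sqnorm_mono) (auto elim: eventually_mono)

lemma sqnorm_cong: "(\<And>x. x \<in> space M ==> norm (f x) = norm (g x)) ==> sqnorm M f = sqnorm M g"
  by (rule sqnorm_cong_AE) auto

lemma sqnorm_scale:
  fixes f :: "'a => 'b::{real_normed_vector,second_countable_topology}"
  assumes [measurable]: "f \<in> borel_measurable M"
  shows "sqnorm M (\<lambda>x. c *\<^sub>R f x) = ennreal (c\<^sup>2) * sqnorm M f"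
  unfolding sqnorm_def
  by (subst nn_integral_cmult[symmetric]) (auto simp: power_mult_distrib ennreal_mult)

lemma sqnorm_uminus[simp]: "sqnorm M (\<lambda>x. - f x) = sqnorm M f"
  by (simp add: sqnorm_def)

lemma sqnorm_zero[simp]: "sqnorm M (\<lambda>x. 0) = 0"
  by (simp add: sqnorm_def)

lemma sqnorm_add:
  fixes f g :: "'a => 'b::{real_normed_vector,second_countable_topology}"
  assumes [measurable]: "f \<in> borel_measurable M" "g \<in> borel_measurable M"
  shows "sqnorm M (\<lambda>x. f x + g x) <= 2 * sqnorm M f + 2 * sqnorm M g"
proof -
  have "sqnorm M (\<lambda>x. f x + g x) <= (\<integral>\<^sup>+x. 2 * ennreal ((norm (f x))\<^sup>2) + 2 * ennreal ((norm (g x))\<^sup>2) \<partial>M)"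
    unfolding sqnorm_def
  proof (intro nn_integral_mono)
    fix x
    show "ennreal ((norm (f x + g x))\<^sup>2) <= 2 * ennreal ((norm (f x))\<^sup>2) + 2 * ennreal ((norm (g x))\<^sup>2)"
      using ennreal_leI[OF norm_add_sq_le[of "f x" "g x"]] by (simp add: ennreal_mult)
  qed
  also have "... = 2 * sqnorm M f + 2 * sqnorm M g"
    by (simp add: nn_integral_add nn_integral_cmult sqnorm_def)
  finally show ?thesis .
qed

lemma sqnorm_diff:
  fixes f g :: "'a => 'b::{real_normed_vector,second_countable_topology}"
  assumes [measurable]: "f \<in> borel_measurable M" "g \<in> borel_measurable M"
  shows "sqnorm M (\<lambda>x. f x - g x) <= 2 * sqnorm M f + 2 * sqnorm M g"
  using sqnorm_add[of f M "\<lambda>x. - g x"] by simp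

lemma sqnorm_eq_0_iff:
  fixes f :: "'a => 'b::{real_normed_vector,second_countable_topology}"
  assumes [measurable]: "f \<in> borel_measurable M"
  shows "sqnorm M f = 0 \<longleftrightarrow> (AE x in M. f x = 0)"
  unfolding sqnorm_def by (subst nn_integral_0_iff_AE) auto

lemma sq_integrable_scale:
  fixes f :: "'a => 'b::{real_normed_vector,second_countable_topology}"
  shows "sq_integrable M f ==> sq_integrable M (\<lambda>x. c *\<^sub>R f x)"
  by (auto simp: sq_integrable_def sqnorm_scale ennreal_mult_less_top)

lemma sq_integrable_add:
  fixes f g :: "'a => 'b::{real_normed_vector,second_countable_topology}"
  assumes "sq_integrable M f" "sq_integrable M g"
  shows "sq_integrable M (\<lambda>x. f x + g x)"
  using sqnorm_add[of f M g] assms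
  by (auto simp: sq_integrable_def ennreal_mult_less_top intro: le_less_trans)

lemma sq_integrable_diff:
  fixes f g :: "'a => 'b::{real_normed_vector,second_countable_topology}"
  assumes "sq_integrable M f" "sq_integrable M g"
  shows "sq_integrable M (\<lambda>x. f x - g x)"
  using sqnorm_diff[of f M g] assms
  by (auto simp: sq_integrable_def ennreal_mult_less_top intro: le_less_trans)

definition l2norm :: "'a measure => ('a => 'b::real_normed_vector) => real" where
  "l2norm M f = sqrt (enn2real (sqnorm M f))"

lemma l2norm_nonneg[simp]: "0 <= l2norm M f"
  by (simp add: l2norm_def)

lemma l2norm_sq: "(l2norm M f)\<^sup>2 = enn2real (sqnorm M f)"
  by (simp add: l2norm_def)

lemma sqnorm_eq_l2norm: "sq_integrable M f ==> sqnorm M f = ennreal ((l2norm M f)\<^sup>2)"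
  by (simp add: l2norm_sq sq_integrable_def)

lemma sq_integrable_integrable:
  fixes f :: "'a => 'b::{real_normed_vector,second_countable_topology}"
  assumes "sq_integrable M f"
  shows "integrable M (\<lambda>x. (norm (f x))\<^sup>2)" "(LINT x|M. (norm (f x))\<^sup>2) = (l2norm M f)\<^sup>2"
proof -
  have [measurable]: "f \<in> borel_measurable M" using assms by (simp add: sq_integrable_def)
  show i: "integrable M (\<lambda>x. (norm (f x))\<^sup>2)"
    by (rule integrableI_nonneg) (use assms in \<open>auto simp: sq_integrable_def sqnorm_def\<close>)
  show "(LINT x|M. (norm (f x))\<^sup>2) = (l2norm M f)\<^sup>2"
    unfolding l2norm_sq sqnorm_def by (rule integral_eq_nn_integral) auto
qed

text \<open>Cauchy-Schwarz from the pointwise inequality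
  \<open>2 * t * |f| * |g| <= t^2 * |f|^2 + |g|^2\<close>, integrated and then optimised at the
  ratio of the two norms.\<close>

lemma integrable_norm_mult:
  fixes f :: "'a => 'b::{real_normed_vector,second_countable_topology}"
    and g :: "'a => 'c::{real_normed_vector,second_countable_topology}"
  assumes f: "sq_integrable M f" and g: "sq_integrable M g"
  shows "integrable M (\<lambda>x. norm (f x) * norm (g x))"
    and "(LINT x|M. norm (f x) * norm (g x)) <= l2norm M f * l2norm M g"
proof -
  have [measurable]: "f \<in> borel_measurable M" "g \<in> borel_measurable M" using assms by (auto simp: sq_integrable_def)
  have i: "integrable M (\<lambda>x. (norm (f x))\<^sup>2 + (norm (g x))\<^sup>2)"
    using sq_integrable_integrable(1)[OF f] sq_integrable_integrable(1)[OF g] by auto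
  show I: "integrable M (\<lambda>x. norm (f x) * norm (g x))"
  proof (rule Bochner_Integration.integrable_bound[OF i])
    show "AE x in M. norm (norm (f x) * norm (g x)) <= norm ((norm (f x))\<^sup>2 + (norm (g x))\<^sup>2)"
    proof (intro AE_I2)
      fix x
      show "norm (norm (f x) * norm (g x)) <= norm ((norm (f x))\<^sup>2 + (norm (g x))\<^sup>2)"
        using sum_squares_bound[of "norm (f x)" "norm (g x)"] mult_nonneg_nonneg[OF norm_ge_zero norm_ge_zero, of "f x" "g x"]
          zero_le_power2[of "norm (f x)"] zero_le_power2[of "norm (g x)"]
        unfolding real_norm_def abs_mult abs_norm_cancel by linarith
    qed
  qed auto
  let ?a = "l2norm M f" and ?b = "l2norm M g"
  have *: "2 * t * (LINT x|M. norm (f x) * norm (g x)) <= t\<^sup>2 * ?a\<^sup>2 + ?b\<^sup>2" for t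
  proof -
    have "2 * t * (LINT x|M. norm (f x) * norm (g x)) = (LINT x|M. (2 * t) * (norm (f x) * norm (g x)))" by simp
    also have "... <= (LINT x|M. t\<^sup>2 * (norm (f x))\<^sup>2 + (norm (g x))\<^sup>2)"
    proof (intro integral_mono)
      fix x
      show "(2 * t) * (norm (f x) * norm (g x)) <= t\<^sup>2 * (norm (f x))\<^sup>2 + (norm (g x))\<^sup>2"
        using sum_squares_bound[of "t * norm (f x)" "norm (g x)"] by (simp add: power_mult_distrib algebra_simps)
    qed (use I sq_integrable_integrable(1)[OF f] sq_integrable_integrable(1)[OF g] in auto)
    also have "... = t\<^sup>2 * ?a\<^sup>2 + ?b\<^sup>2"
      using sq_integrable_integrable[OF f] sq_integrable_integrable[OF g] by auto
    finally show ?thesis .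
  qed
  let ?I = "LINT x|M. norm (f x) * norm (g x)"
  \<comment> \<open>Adding e to both norms makes the optimal t, the ratio of g's norm to f's norm,
    available even if the norm of f vanishes; e tends to 0 afterwards.\<close>
  have **: "?I <= (?a + e) * (?b + e)" if "e > 0" for e
  proof -
    have a: "?a + e > 0" and b: "?b + e > 0" using that by (auto intro: add_nonneg_pos)
    have "2 * ((?b + e) / (?a + e)) * ?I <= ((?b + e) / (?a + e))\<^sup>2 * ?a\<^sup>2 + ?b\<^sup>2" by (rule *)
    also have "... <= ((?b + e) / (?a + e))\<^sup>2 * (?a + e)\<^sup>2 + (?b + e)\<^sup>2"
      using that by (intro add_mono mult_left_mono power_mono) auto
    also have "... = 2 * ((?b + e) / (?a + e)) * ((?a + e) * (?b + e))"
      using a by (simp add: power_divide) (simp add: power2_eq_square)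
    finally show ?thesis
      using a b by (subst (asm) mult_le_cancel_left_pos) auto
  qed
  have "((\<lambda>e. (?a + e) * (?b + e)) \<longlongrightarrow> (?a + 0) * (?b + 0)) (at_right 0)" by (intro tendsto_intros)
  then have "?I <= (?a + 0) * (?b + 0)"
    by (rule tendsto_lowerbound) (auto simp: eventually_at_right_less ** intro: eventually_mono[OF eventually_at_right_less])
  then show "?I <= ?a * ?b" by simp
qed

lemma integrable_inner:
  fixes f g :: "'a => 'b::{real_inner,second_countable_topology}"
  assumes f: "sq_integrable M f" and g: "sq_integrable M g"
  shows "integrable M (\<lambda>x. f x \<bullet> g x)"
    and "\<bar>LINT x|M. f x \<bullet> g x\<bar> <= l2norm M f * l2norm M g"
proof -
  have [measurable]: "f \<in> borel_measurable M" "g \<in> borel_measurable M" using assms by (auto simp: sq_integrable_def)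
  show I: "integrable M (\<lambda>x. f x \<bullet> g x)"
    by (rule Bochner_Integration.integrable_bound[OF integrable_norm_mult(1)[OF f g]])
       (auto simp: abs_mult Cauchy_Schwarz_ineq2)
  have "\<bar>LINT x|M. f x \<bullet> g x\<bar> <= (LINT x|M. \<bar>f x \<bullet> g x\<bar>)" using integral_abs_bound by blast
  also have "... <= (LINT x|M. norm (f x) * norm (g x))"
    by (intro integral_mono integrable_norm_mult[OF f g] integrable_abs I) (auto simp: Cauchy_Schwarz_ineq2)
  also have "... <= l2norm M f * l2norm M g" by (rule integrable_norm_mult(2)[OF f g])
  finally show "\<bar>LINT x|M. f x \<bullet> g x\<bar> <= l2norm M f * l2norm M g" .
qed

lemma l2norm_tendsto:
  assumes "(\<lambda>n. sqnorm M (f n)) ---> 0"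
  shows "(\<lambda>n. l2norm M (f n)) ---> 0"
proof -
  have "(\<lambda>n. enn2real (sqnorm M (f n))) ---> 0"
    by (rule tendsto_enn2real) (use assms in auto)
  then show ?thesis unfolding l2norm_def using tendsto_real_sqrt by fastforce
qed

lemma sq_integrable_limit:
  fixes f :: "nat => 'a => 'b::{real_normed_vector,second_countable_topology}"
  assumes "\<And>n. sq_integrable M (f n)" "g \<in> borel_measurable M"
    and "(\<lambda>n. sqnorm M (\<lambda>x. f n x - g x)) ---> 0"
  shows "sq_integrable M g"
proof -
  have "eventually (\<lambda>n. sqnorm M (\<lambda>x. f n x - g x) < 1) sequentially"
    using assms(3) by (rule order_tendstoD) auto
  then obtain n where n: "sqnorm M (\<lambda>x. f n x - g x) < 1" by (auto simp: eventually_sequentially)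
  have [measurable]: "f n \<in> borel_measurable M" using assms(1) by (simp add: sq_integrable_def)
  have "sq_integrable M (\<lambda>x. f n x - g x)"
    using n assms(2) by (auto simp: sq_integrable_def intro: less_trans)
  from sq_integrable_diff[OF assms(1)[of n] this] show ?thesis by simp
qed

lemma inner_integral_tendsto:
  fixes f g :: "nat => 'a => 'b::{real_inner,second_countable_topology}"
  assumes f: "\<And>n. sq_integrable M (f n)" and f': "sq_integrable M f'"
    and g: "\<And>n. sq_integrable M (g n)" and g': "sq_integrable M g'"
    and lf: "(\<lambda>n. sqnorm M (\<lambda>x. f n x - f' x)) ---> 0"
    and lg: "(\<lambda>n. sqnorm M (\<lambda>x. g n x - g' x)) ---> 0"
  shows "(\<lambda>n. LINT x|M. f n x \<bullet> g n x) ---> (LINT x|M. f' x \<bullet> g' x)"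
proof -
  have df: "sq_integrable M (\<lambda>x. f n x - f' x)" for n by (rule sq_integrable_diff[OF f f'])
  have dg: "sq_integrable M (\<lambda>x. g n x - g' x)" for n by (rule sq_integrable_diff[OF g g'])
  let ?a = "\<lambda>n. LINT x|M. (f n x - f' x) \<bullet> (g n x - g' x)"
  let ?b = "\<lambda>n. LINT x|M. (f n x - f' x) \<bullet> g' x"
  let ?c = "\<lambda>n. LINT x|M. f' x \<bullet> (g n x - g' x)"
  \<comment> \<open>Expanding both factors around their limits leaves three error terms, each of
    which contains at least one factor that tends to 0 in norm.\<close>
  have eq: "(LINT x|M. f n x \<bullet> g n x) = ?a n + ?b n + ?c n + (LINT x|M. f' x \<bullet> g' x)" for n
  proof -
    have "(\<lambda>x. f n x \<bullet> g n x) = (\<lambda>x. (f n x - f' x) \<bullet> (g n x - g' x) + (f n x - f' x) \<bullet> g' x + f' x \<bullet> (g n x - g' x) + f' x \<bullet> g' x)"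
      by (auto simp: algebra_simps)
    then show ?thesis
      using integrable_inner(1)[OF df dg] integrable_inner(1)[OF df g'] integrable_inner(1)[OF f' dg] integrable_inner(1)[OF f' g']
      by simp
  qed
  have "(\<lambda>n. l2norm M (\<lambda>x. f n x - f' x) * l2norm M (\<lambda>x. g n x - g' x)) ---> 0 * 0"
    by (intro tendsto_mult l2norm_tendsto lf lg)
  then have 1: "?a ---> 0"
    by (intro Lim_null_comparison[of ?a]) (auto intro!: always_eventually integrable_inner(2) df dg)
  have "(\<lambda>n. l2norm M (\<lambda>x. f n x - f' x) * l2norm M g') ---> 0 * l2norm M g'"
    by (intro tendsto_mult l2norm_tendsto lf tendsto_const)
  then have 2: "?b ---> 0"
    by (intro Lim_null_comparison[of ?b]) (auto intro!: always_eventually integrable_inner(2) df g')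
  have "(\<lambda>n. l2norm M f' * l2norm M (\<lambda>x. g n x - g' x)) ---> l2norm M f' * 0"
    by (intro tendsto_mult l2norm_tendsto lg tendsto_const)
  then have 3: "?c ---> 0"
    by (intro Lim_null_comparison[of ?c]) (auto intro!: always_eventually integrable_inner(2) f' dg)
  have "(\<lambda>n. ?a n + ?b n + ?c n + (LINT x|M. f' x \<bullet> g' x)) ---> 0 + 0 + 0 + (LINT x|M. f' x \<bullet> g' x)"
    by (intro tendsto_add 1 2 3 tendsto_const)
  then show ?thesis by (simp add: eq)
qed

section \<open>Almost everywhere limits and completeness of L2\<close>

lemma sqnorm_Fatou:
  fixes f :: "nat => 'a => 'b::{real_normed_vector,second_countable_topology}"
  assumes [measurable]: "\<And>n. f n \<in> borel_measurable M"
    and "AE x in M. (\<lambda>n. f n x) ---> g x"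
    and "eventually (\<lambda>n. sqnorm M (f n) <= C) sequentially"
  shows "sqnorm M g <= C"
proof -
  have "sqnorm M g <= (\<integral>\<^sup>+x. liminf (\<lambda>n. ennreal ((norm (f n x))\<^sup>2)) \<partial>M)"
    unfolding sqnorm_def
  proof (rule nn_integral_mono_AE)
    show "AE x in M. ennreal ((norm (g x))\<^sup>2) <= liminf (\<lambda>n. ennreal ((norm (f n x))\<^sup>2))"
      using assms(2)
    proof eventually_elim
      case (elim x)
      then have "(\<lambda>n. ennreal ((norm (f n x))\<^sup>2)) ---> ennreal ((norm (g x))\<^sup>2)"
        by (intro tendsto_intros)
      then have "liminf (\<lambda>n. ennreal ((norm (f n x))\<^sup>2)) = ennreal ((norm (g x))\<^sup>2)"
        by (intro lim_imp_Liminf) auto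
      then show ?case by simp
    qed
  qed
  also have "... <= liminf (\<lambda>n. sqnorm M (f n))"
    unfolding sqnorm_def by (rule nn_integral_liminf) auto
  also have "... <= liminf (\<lambda>n. C)" by (rule Liminf_mono) (rule assms(3))
  also have "... = C" by (simp add: Liminf_const)
  finally show ?thesis .
qed

text \<open>The Riesz-Fischer argument. Along a subsequence with successive squared distances below
  \<open>(1/8)^k\<close>, the increments squared and weighted with \<open>4^k\<close> have an
  integrable sum. Wherever that sum is finite the increments are of order \<open>(1/2)^k\<close>, so
  the subsequence converges.\<close>

lemma sqnorm_Cauchy_AE_convergent:
  fixes f :: "nat => 'a => 'b::{banach,second_countable_topology}"
  assumes [measurable]: "\<And>n. f n \<in> borel_measurable M"
    and cauchy: "\<And>e. e > 0 ==> \<exists>N. \<forall>m\<ge>N. \<forall>n\<ge>N. sqnorm M (\<lambda>x. f m x - f n x) < ennreal e"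
  shows "\<exists>r g. strict_mono (r::nat=>nat) \<and> g \<in> borel_measurable M \<and> (AE x in M. (\<lambda>n. f (r n) x) ---> g x)"
proof -
  have "\<exists>N. \<forall>m\<ge>N. \<forall>n\<ge>N. sqnorm M (\<lambda>x. f m x - f n x) < ennreal ((1/8)^k)" for k :: nat
    by (rule cauchy) simp
  then obtain N where N: "\<And>k m n. m >= N k ==> n >= N k ==> sqnorm M (\<lambda>x. f m x - f n x) < ennreal ((1/8)^k)"
    by metis
  define r where "r = rec_nat (N 0) (\<lambda>k x. max (Suc x) (N (Suc k)))"
  have r_Suc: "r (Suc k) = max (Suc (r k)) (N (Suc k))" for k by (simp add: r_def)
  have sm: "strict_mono r" by (simp add: strict_mono_Suc_iff r_Suc less_max_iff_disj)
  have rN: "r k >= N k" for k by (cases k) (auto simp: r_Suc, simp add: r_def)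
  have d: "sqnorm M (\<lambda>x. f (r (Suc k)) x - f (r k) x) < ennreal ((1/8)^k)" for k
    using rN[of k] sm[THEN strict_monoD, of k "Suc k"] by (intro N) auto
  let ?h = "\<lambda>x. \<Sum>k. ennreal (4^k * (norm (f (r (Suc k)) x - f (r k) x))\<^sup>2)"
  have "(\<integral>\<^sup>+x. ?h x \<partial>M) = (\<Sum>k. \<integral>\<^sup>+x. ennreal (4^k * (norm (f (r (Suc k)) x - f (r k) x))\<^sup>2) \<partial>M)"
    by (rule nn_integral_suminf) auto
  also have "... = (\<Sum>k. ennreal (4^k) * sqnorm M (\<lambda>x. f (r (Suc k)) x - f (r k) x))"
    by (simp add: sqnorm_def ennreal_mult nn_integral_cmult)
  also have "... <= (\<Sum>k. ennreal ((1/2)^k))"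
  proof (intro suminf_le)
    fix k :: nat
    have "ennreal (4^k) * sqnorm M (\<lambda>x. f (r (Suc k)) x - f (r k) x) <= ennreal (4^k) * ennreal ((1/8)^k)"
      by (intro mult_left_mono less_imp_le d) auto
    also have "... = ennreal ((1/2)^k)"
      by (subst ennreal_mult[symmetric]) (auto simp: power_mult_distrib[symmetric])
    finally show "ennreal (4^k) * sqnorm M (\<lambda>x. f (r (Suc k)) x - f (r k) x) <= ennreal ((1/2)^k)" .
  qed auto
  also have "... < \<infinity>"
    by (subst suminf_ennreal2) (auto intro: summable_geometric)
  finally have fin: "(\<integral>\<^sup>+x. ?h x \<partial>M) \<noteq> \<infinity>" by simp
  have "AE x in M. ?h x \<noteq> \<infinity>" by (rule nn_integral_noteq_infinite[OF _ fin]) auto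
  then have conv: "AE x in M. convergent (\<lambda>k. f (r k) x)"
  proof eventually_elim
    case (elim x)
    have sum: "summable (\<lambda>k. 4^k * (norm (f (r (Suc k)) x - f (r k) x))\<^sup>2)"
      by (rule summable_suminf_not_top) (use elim in auto)
    then have "(\<lambda>k. 4^k * (norm (f (r (Suc k)) x - f (r k) x))\<^sup>2) ---> 0" by (rule summable_LIMSEQ_zero)
    then have "Bseq (\<lambda>k. 4^k * (norm (f (r (Suc k)) x - f (r k) x))\<^sup>2)" using convergent_imp_Bseq convergent_def by blast
    then obtain K where K: "K > 0" "\<And>k. norm (4^k * (norm (f (r (Suc k)) x - f (r k) x))\<^sup>2) <= K" by (auto simp: Bseq_def)
    have bd: "norm (f (r (Suc k)) x - f (r k) x) <= sqrt K * (1/2)^k" for k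
    proof -
      have "(2^k * norm (f (r (Suc k)) x - f (r k) x))\<^sup>2 <= K"
        using K(2)[of k] by (simp add: power_mult_distrib power_mult[symmetric] mult.commute[of k]) (simp add: power_mult)
      then have "2^k * norm (f (r (Suc k)) x - f (r k) x) <= sqrt K" by (rule real_le_rsqrt)
      then show ?thesis by (simp add: field_simps power_one_over)
    qed
    have "summable (\<lambda>k. f (r (Suc k)) x - f (r k) x)"
    proof (rule summable_comparison_test'[where N = 0])
      show "summable (\<lambda>k. sqrt K * (1/2)^k :: real)" by (intro summable_mult summable_geometric) auto
    qed (use bd in auto)
    then have "convergent (\<lambda>n. \<Sum>k<n. (\<lambda>i. f (r i) x) (Suc k) - (\<lambda>i. f (r i) x) k)" by (simp add: summable_iff_convergent)
    then have "convergent (\<lambda>n. f (r n) x - f (r 0) x)"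
      by (simp only: sum_lessThan_telescope[where f = "\<lambda>i. f (r i) x"])
    then have "convergent (\<lambda>n. (f (r n) x - f (r 0) x) + f (r 0) x)" by (intro convergent_add convergent_const)
    then show ?case by simp
  qed
  define g where "g x = lim (\<lambda>k. f (r k) x)" for x
  have "g \<in> borel_measurable M" unfolding g_def by measurable
  moreover have "AE x in M. (\<lambda>n. f (r n) x) ---> g x"
    using conv by eventually_elim (simp add: g_def convergent_LIMSEQ_iff)
  ultimately show ?thesis using sm by blast
qed

text \<open>Fatou's lemma in the second index turns the Cauchy bound into a bound on the distance to
  the pointwise limit of the subsequence; hence the whole sequence converges in norm.\<close>

lemma sqnorm_AE_limit:
  fixes f :: "nat => 'a => 'b::{banach,second_countable_topology}"
  assumes [measurable]: "\<And>n. f n \<in> borel_measurable M" "g \<in> borel_measurable M"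
    and cauchy: "\<And>e. e > 0 ==> \<exists>N. \<forall>m\<ge>N. \<forall>n\<ge>N. sqnorm M (\<lambda>x. f m x - f n x) < ennreal e"
    and r: "strict_mono (r::nat=>nat)" and AE: "AE x in M. (\<lambda>n. f (r n) x) ---> g x"
  shows "(\<lambda>n. sqnorm M (\<lambda>x. f n x - g x)) ---> 0"
proof (rule tendsto_zero_ennreal)
  fix e :: real assume "e > 0"
  then obtain N where N: "\<And>m n. m >= N ==> n >= N ==> sqnorm M (\<lambda>x. f m x - f n x) < ennreal (e/2)"
    using cauchy[of "e/2"] by auto
  have "sqnorm M (\<lambda>x. f m x - g x) <= ennreal (e/2)" if "m >= N" for m
  proof (rule sqnorm_Fatou)
    show "AE x in M. (\<lambda>n. f m x - f (r n) x) ---> f m x - g x"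
      using AE by eventually_elim (intro tendsto_intros)
    show "\<forall>\<^sub>F n in sequentially. sqnorm M (\<lambda>x. f m x - f (r n) x) <= ennreal (e/2)"
      using eventually_ge_at_top[of N]
    proof eventually_elim
      case (elim n)
      then show ?case using N[OF that, of "r n"] seq_suble[OF r, of n] by (auto intro: less_imp_le)
    qed
  qed auto
  moreover have "ennreal (e/2) < ennreal e" using \<open>e > 0\<close> by (simp add: ennreal_lessI)
  ultimately have "\<forall>m\<ge>N. sqnorm M (\<lambda>x. f m x - g x) < ennreal e" by (meson le_less_trans)
  then show "\<forall>\<^sub>F n in sequentially. sqnorm M (\<lambda>x. f n x - g x) < ennreal e"
    by (auto simp: eventually_sequentially)
qed

subsection \<open>Smooth functions with compact support\<close>

text \<open>The definition of \<open>smooth_compact\<close> asks for a whole tower of derivatives. A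
  class that is closed under differentiation supplies it: a choice function for the derivative is
  iterated. Only the support of the bottom function has to be bounded.\<close>

lemma smooth_compactI:
  fixes f :: "real => 'h::real_normed_vector"
  assumes "f \<in> S" and closed: "\<And>g. g \<in> S ==> \<exists>g'\<in>S. \<forall>t. (g has_vector_derivative g' t) (at t)"
    and "bounded {t. f t \<noteq> 0}"
  shows "f \<in> smooth_compact"
proof -
  obtain D where D: "\<And>g. g \<in> S ==> D g \<in> S \<and> (\<forall>t. (g has_vector_derivative D g t) (at t))"
    using closed by metis
  define F where "F k = (D ^^ k) f" for k
  have FS: "F k \<in> S" for k by (induction k) (use assms(1) D in \<open>auto simp: F_def\<close>)
  have "(F k has_vector_derivative F (Suc k) t) (at t)" for k t
    using D[OF FS[of k]] by (simp add: F_def)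
  moreover have "F 0 = f" by (simp add: F_def)
  ultimately show ?thesis using assms(3) unfolding smooth_compact_def by (auto simp: compact_closure)
qed

lemma smooth_compact_bounded_support:
  fixes f :: "real => 'h::real_normed_vector"
  assumes "f \<in> smooth_compact"
  obtains R where "R > 0" "\<And>t. \<bar>t\<bar> > R ==> f t = 0"
proof -
  have "bounded {t. f t \<noteq> 0}" using assms by (auto simp: smooth_compact_def compact_closure)
  then obtain R where "\<And>t. f t \<noteq> 0 ==> norm t <= R" by (auto simp: bounded_iff)
  then show thesis by (intro that[of "max R 1"]) force+
qed

lemma has_vector_derivative_0_outside_support:
  fixes f :: "real => 'h::real_normed_vector"
  assumes f': "(f has_vector_derivative f') (at t)" and t: "t \<notin> closure {t. f t \<noteq> 0}"
  shows "f' = 0"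
proof -
  have "open (- closure {t. f t \<noteq> 0})" by auto
  then have "((\<lambda>x. 0) has_vector_derivative f') (at t)"
    by (rule has_vector_derivative_transform_within_open[OF f'])
       (use t closure_subset[of "{t. f t \<noteq> 0}"] in auto)
  moreover have "((\<lambda>x. 0::'h) has_vector_derivative 0) (at t)" by (rule has_vector_derivative_const)
  ultimately show ?thesis by (rule vector_derivative_unique_at)
qed

lemma smooth_compact_deriv:
  fixes f :: "real => 'h::real_normed_vector"
  assumes "f \<in> smooth_compact"
  obtains f' where "f' \<in> smooth_compact" "\<And>t. (f has_vector_derivative f' t) (at t)"
    "closure {t. f' t \<noteq> 0} \<subseteq> closure {t. f t \<noteq> 0}"
proof -
  obtain F where F: "F 0 = f" "\<And>k t. (F k has_vector_derivative F (Suc k) t) (at t)"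
    and c: "compact (closure {t. f t \<noteq> 0})"
    using assms by (auto simp: smooth_compact_def)
  have f': "(f has_vector_derivative F 1 t) (at t)" for t using F(1) F(2)[of 0] by simp
  have "{t. F 1 t \<noteq> 0} \<subseteq> closure {t. f t \<noteq> 0}"
    using has_vector_derivative_0_outside_support[OF f'] by blast
  then have sub: "closure {t. F 1 t \<noteq> 0} \<subseteq> closure {t. f t \<noteq> 0}" by (rule closure_minimal) simp
  have "compact (closure {t. F 1 t \<noteq> 0})"
    by (rule compact_closure[THEN iffD2], rule bounded_subset[OF compact_imp_bounded[OF c]])
       (use sub closure_subset in fast)
  then have "F 1 \<in> smooth_compact"
    unfolding smooth_compact_def using F(2) by (intro CollectI conjI exI[of _ "\<lambda>k. F (Suc k)"]) auto
  then show thesis using that f' sub by blast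
qed

lemma smooth_compact_continuous:
  fixes f :: "real => 'h::real_normed_vector"
  assumes "f \<in> smooth_compact"
  shows "continuous_on A f"
proof -
  obtain f' where "\<And>t. (f has_vector_derivative f' t) (at t)" using smooth_compact_deriv[OF assms] by metis
  then have "isCont f t" for t using has_vector_derivative_continuous by blast
  then show ?thesis by (simp add: continuous_at_imp_continuous_on)
qed

lemma smooth_compact_measurable:
  fixes f :: "real => 'h::real_normed_vector"
  assumes "f \<in> smooth_compact"
  shows "f \<in> borel_measurable borel"
  by (intro borel_measurable_continuous_onI smooth_compact_continuous assms)

lemma compactly_supported_bounded:
  fixes f :: "real => 'h::real_normed_vector"
  assumes "continuous_on UNIV f" "\<And>t. \<bar>t\<bar> > R ==> f t = 0"
  obtains B where "B > 0" "\<And>t. norm (f t) <= B"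
proof -
  have "compact (f ` {-R..R})" by (intro compact_continuous_image continuous_on_subset[OF assms(1)]) auto
  then obtain B where B: "B > 0" "\<And>t. t \<in> {-R..R} ==> norm (f t) <= B"
    by (auto dest!: compact_imp_bounded simp: bounded_pos)
  have "norm (f t) <= B" for t
  proof (cases "\<bar>t\<bar> > R")
    case False
    then have "t \<in> {-R..R}" by auto
    then show ?thesis by (rule B(2))
  qed (use B(1) assms(2)[of t] in auto)
  then show thesis using that B by blast
qed

lemma smooth_compact_bounded:
  fixes f :: "real => 'h::real_normed_vector"
  assumes "f \<in> smooth_compact"
  obtains B where "B > 0" "\<And>t. norm (f t) <= B"
  using smooth_compact_bounded_support[OF assms] compactly_supported_bounded[OF smooth_compact_continuous[OF assms]]
  by metis

lemma smooth_compact_add: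
  fixes f g :: "real => 'h::real_normed_vector"
  assumes f: "f \<in> smooth_compact" and g: "g \<in> smooth_compact"
  shows "(\<lambda>t. f t + g t) \<in> smooth_compact"
proof (rule smooth_compactI[where S = "{\<lambda>t. f t + g t | f g. f \<in> smooth_compact \<and> g \<in> smooth_compact}"])
  fix h :: "real => 'h" assume "h \<in> {\<lambda>t. f t + g t | f g. f \<in> smooth_compact \<and> g \<in> smooth_compact}"
  then obtain a b where h: "h = (\<lambda>t. a t + b t)" and ab: "a \<in> smooth_compact" "b \<in> smooth_compact" by auto
  obtain a' b' where "a' \<in> smooth_compact" "\<And>t. (a has_vector_derivative a' t) (at t)"
    "b' \<in> smooth_compact" "\<And>t. (b has_vector_derivative b' t) (at t)"
    using smooth_compact_deriv[OF ab(1)] smooth_compact_deriv[OF ab(2)] by metis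
  then show "\<exists>g'\<in>{\<lambda>t. f t + g t | f g. f \<in> smooth_compact \<and> g \<in> smooth_compact}. \<forall>t. (h has_vector_derivative g' t) (at t)"
    unfolding h by (intro bexI[of _ "\<lambda>t. a' t + b' t"]) (auto intro!: has_vector_derivative_add)
next
  have "bounded ({t. f t \<noteq> 0} \<union> {t. g t \<noteq> 0})"
    using f g by (auto simp: smooth_compact_def compact_closure)
  then show "bounded {t. f t + g t \<noteq> 0}" by (rule bounded_subset) auto
qed (use f g in auto)

lemma smooth_compact_linear_image:
  assumes L: "bounded_linear L" and f: "f \<in> smooth_compact"
  shows "(\<lambda>t. L (f t)) \<in> smooth_compact"
proof (rule smooth_compactI[where S = "{\<lambda>t. L (f t) | f. f \<in> smooth_compact}"])
  fix h assume "h \<in> {\<lambda>t. L (f t) | f. f \<in> smooth_compact}"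
  then obtain a where h: "h = (\<lambda>t. L (a t))" and a: "a \<in> smooth_compact" by auto
  obtain a' where "a' \<in> smooth_compact" "\<And>t. (a has_vector_derivative a' t) (at t)"
    using smooth_compact_deriv[OF a] by metis
  then show "\<exists>g'\<in>{\<lambda>t. L (f t) | f. f \<in> smooth_compact}. \<forall>t. (h has_vector_derivative g' t) (at t)"
    unfolding h by (intro bexI[of _ "\<lambda>t. L (a' t)"]) (auto intro!: bounded_linear.has_vector_derivative[OF L])
next
  have "bounded {t. f t \<noteq> 0}" using f by (auto simp: smooth_compact_def compact_closure)
  then show "bounded {t. L (f t) \<noteq> 0}"
    by (rule bounded_subset) (auto simp: linear_0[OF bounded_linear.linear[OF L]])
qed (use f in auto)

lemma smooth_compact_affine:
  fixes f :: "real => 'h::real_normed_vector"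
  assumes c: "c \<noteq> 0" and f: "f \<in> smooth_compact"
  shows "(\<lambda>t. f (c * t + b)) \<in> smooth_compact"
proof (rule smooth_compactI[where S = "{\<lambda>t. f (c * t + b) | f. f \<in> smooth_compact}"])
  fix h :: "real => 'h" assume "h \<in> {\<lambda>t. f (c * t + b) | f. f \<in> smooth_compact}"
  then obtain a where h: "h = (\<lambda>t. a (c * t + b))" and a: "a \<in> smooth_compact" by auto
  obtain a' where a': "a' \<in> smooth_compact" "\<And>t. (a has_vector_derivative a' t) (at t)"
    using smooth_compact_deriv[OF a] by metis
  have "(h has_vector_derivative c *\<^sub>R a' (c * t + b)) (at t)" for t
  proof -
    have "((\<lambda>t. c * t + b) has_vector_derivative c) (at t)"
      by (auto intro!: derivative_eq_intros simp: has_real_derivative_iff_has_vector_derivative[symmetric])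
    from vector_diff_chain_at[OF this a'(2)] show ?thesis by (simp add: h o_def)
  qed
  moreover have "(\<lambda>t. c *\<^sub>R a' (c * t + b)) \<in> {\<lambda>t. f (c * t + b) | f. f \<in> smooth_compact}"
    using smooth_compact_linear_image[OF bounded_linear_scaleR_right a'(1), of c] by (intro CollectI exI[of _ "\<lambda>t. c *\<^sub>R a' t"]) auto
  ultimately show "\<exists>g'\<in>{\<lambda>t. f (c * t + b) | f. f \<in> smooth_compact}. \<forall>t. (h has_vector_derivative g' t) (at t)"
    by (intro bexI[of _ "\<lambda>t. c *\<^sub>R a' (c * t + b)"]) auto
next
  obtain R where R: "R > 0" "\<And>t. \<bar>t\<bar> > R ==> f t = 0" using smooth_compact_bounded_support[OF f] by metis
  show "bounded {t. f (c * t + b) \<noteq> 0}"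
  proof (rule boundedI)
    fix t assume "t \<in> {t. f (c * t + b) \<noteq> 0}"
    then have "\<bar>c * t + b\<bar> <= R" using R(2)[of "c * t + b"] by force
    then have "\<bar>c\<bar> * \<bar>t\<bar> <= R + \<bar>b\<bar>" by (simp add: abs_mult[symmetric])
    then show "norm t <= (R + \<bar>b\<bar>) / \<bar>c\<bar>" using c by (simp add: field_simps)
  qed
qed (use f in auto)

text \<open>A nonempty compact support has a least point, which is positive if the support lies in
  the open half line. The resulting gap is easier to verify than an inclusion of closures.\<close>

lemma smooth_compact_0_iff:
  "f \<in> smooth_compact_0 \<longleftrightarrow> f \<in> smooth_compact \<and> (\<exists>d>0. \<forall>t<d. f t = 0)"
proof
  assume f: "f \<in> smooth_compact_0"
  then have c: "compact (closure {t. f t \<noteq> 0})" and sub: "closure {t. f t \<noteq> 0} \<subseteq> {0<..}"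
    by (auto simp: smooth_compact_0_def smooth_compact_def)
  have "\<exists>d>0. \<forall>t<d. f t = 0"
  proof (cases "{t. f t \<noteq> 0} = {}")
    case True then show ?thesis by (intro exI[of _ 1]) auto
  next
    case False
    then obtain m where m: "m \<in> closure {t. f t \<noteq> 0}" "\<And>t. t \<in> closure {t. f t \<noteq> 0} ==> m <= t"
      using compact_attains_inf[OF c] by (auto simp: closure_eq_empty)
    have "f t = 0" if "t < m" for t
      using m(2)[of t] that closure_subset[of "{t. f t \<noteq> 0}"] by force
    then show ?thesis using m(1) sub by auto
  qed
  then show "f \<in> smooth_compact \<and> (\<exists>d>0. \<forall>t<d. f t = 0)" using f by (auto simp: smooth_compact_0_def)
next
  assume "f \<in> smooth_compact \<and> (\<exists>d>0. \<forall>t<d. f t = 0)"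
  then obtain d where d: "d > 0" "\<And>t. t < d ==> f t = 0" and f: "f \<in> smooth_compact" by auto
  have "{t. f t \<noteq> 0} \<subseteq> {d..}" using d(2) by force
  then have "closure {t. f t \<noteq> 0} \<subseteq> {d..}" by (rule closure_minimal) simp
  then show "f \<in> smooth_compact_0" using d(1) f by (auto simp: smooth_compact_0_def)
qed

subsection \<open>Smooth mollifiers\<close>

text \<open>Differentiating \<open>exp (- 1 / t)\<close> produces powers of \<open>1 / t\<close>;
  including them makes the family closed under differentiation up to linear combinations. For k = 0
  it is the classical smooth function that is flat at 0.\<close>

definition flat_exp :: "nat => real => real" where
  "flat_exp k t = (if t > 0 then (1 / t) ^ k * exp (- (1 / t)) else 0)"

lemma flat_exp_tendsto_0: "(flat_exp k \<longlongrightarrow> 0) (at 0)"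
proof (rule filterlim_split_at)
  show "(flat_exp k \<longlongrightarrow> 0) (at_left 0)"
    by (rule Lim_transform_eventually[OF tendsto_const])
       (auto simp: flat_exp_def eventually_at_filter)
  have "((\<lambda>x::real. x ^ k / exp x) \<longlongrightarrow> 0) at_top" by (rule tendsto_power_div_exp_0)
  from filterlim_compose[OF this filterlim_inverse_at_top_right]
  have "((\<lambda>x::real. inverse x ^ k / exp (inverse x)) \<longlongrightarrow> 0) (at_right 0)" .
  then show "(flat_exp k \<longlongrightarrow> 0) (at_right 0)"
    by (rule Lim_transform_eventually)
       (auto simp: flat_exp_def eventually_at_filter exp_minus field_simps)
qed

lemma flat_exp_deriv: "(flat_exp k has_real_derivative flat_exp (k + 2) t - real k * flat_exp (Suc k) t) (at t)"
proof -
  consider "t < 0" | "t = 0" | "t > 0" by linarith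
  then show ?thesis
  proof cases
    case 1
    have "((\<lambda>x::real. 0::real) has_real_derivative 0) (at t)" by simp
    then have "(flat_exp k has_real_derivative 0) (at t)"
      by (rule has_field_derivative_transform_within_open[of _ _ _ "{..<0}"]) (use 1 in \<open>auto simp: flat_exp_def\<close>)
    then show ?thesis using 1 by (simp add: flat_exp_def)
  next
    case 2
    \<comment> \<open>Away from 0 the difference quotient at 0 is itself a member of the family,
      namely \<open>flat_exp (Suc k)\<close>, so that its limit is already known.\<close>
    have "((\<lambda>x. flat_exp k x / x) \<longlongrightarrow> 0) (at 0)"
      by (rule Lim_transform_eventually[OF flat_exp_tendsto_0[of "Suc k"]])
         (auto simp: flat_exp_def eventually_at_filter)
    then show ?thesis unfolding has_field_derivative_iff using 2 by (simp add: flat_exp_def)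
  next
    case 3
    have p: "((\<lambda>t. (1 / t) ^ k) has_real_derivative - real k * (1 / t) ^ Suc k) (at t)"
    proof (cases k)
      case (Suc m)
      have "((\<lambda>t. 1 / t) has_real_derivative (- 1 / (t * t))) (at t)"
        using 3 by (auto intro!: derivative_eq_intros)
      from DERIV_power[OF this, of k]
      have "((\<lambda>t. (1 / t) ^ k) has_real_derivative real k * ((1 / t) ^ m * (- 1 / (t * t)))) (at t)"
        unfolding Suc by (simp add: mult.commute)
      moreover have "real k * ((1 / t) ^ m * (- 1 / (t * t))) = - real k * (1 / t) ^ Suc k"
        unfolding Suc using 3 by (simp add: field_simps)
      ultimately show ?thesis by simp
    qed simp
    have e: "((\<lambda>t. exp (- (1 / t))) has_real_derivative (1 / t)\<^sup>2 * exp (- (1 / t))) (at t)"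
      using 3 by (auto intro!: derivative_eq_intros simp: power2_eq_square)
    have "((\<lambda>t. (1 / t) ^ k * exp (- (1 / t))) has_real_derivative
       (1 / t) ^ k * ((1 / t)\<^sup>2 * exp (- (1 / t))) + (- real k * (1 / t) ^ Suc k) * exp (- (1 / t))) (at t)"
      using DERIV_mult'[OF p e] .
    moreover have "(1 / t) ^ k * ((1 / t)\<^sup>2 * exp (- (1 / t))) + (- real k * (1 / t) ^ Suc k) * exp (- (1 / t))
        = flat_exp (k + 2) t - real k * flat_exp (Suc k) t"
      using 3 by (simp add: flat_exp_def power2_eq_square)
    ultimately have *: "((\<lambda>t. (1 / t) ^ k * exp (- (1 / t))) has_real_derivative
       (flat_exp (k + 2) t - real k * flat_exp (Suc k) t)) (at t)" by simp
    show ?thesis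
      by (rule has_field_derivative_transform_within_open[OF *, of "{0<..}"]) (use 3 in \<open>auto simp: flat_exp_def\<close>)
  qed
qed

text \<open>A family that is closed under differentiation, so that its members are smooth.\<close>

inductive_set bumps :: "real => (real => real) set" for d where
  base: "(\<lambda>t. flat_exp k (t / d - 1) * flat_exp l (2 - t / d)) \<in> bumps d"
| add: "f \<in> bumps d ==> g \<in> bumps d ==> (\<lambda>t. f t + g t) \<in> bumps d"
| scale: "f \<in> bumps d ==> (\<lambda>t. c * f t) \<in> bumps d"

lemma bumps_deriv:
  assumes "f \<in> bumps d" and d: "d > 0"
  shows "\<exists>g\<in>bumps d. \<forall>t. (f has_real_derivative g t) (at t)"
  using assms(1)
proof induction
  case (base k l)
  let ?f = "\<lambda>k l t. flat_exp k (t / d - 1) * flat_exp l (2 - t / d)"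
  let ?g = "\<lambda>t. (1 / d) * ?f (k + 2) l t + (- real k / d) * ?f (Suc k) l t
     + ((- 1 / d) * ?f k (l + 2) t + (real l / d) * ?f k (Suc l) t)"
  have "?g \<in> bumps d" by (intro bumps.intros)
  moreover have "(?f k l has_real_derivative ?g t) (at t)" for t
    using d by (auto intro!: derivative_eq_intros DERIV_chain'[OF _ flat_exp_deriv] simp: field_simps)
  ultimately show ?case by (intro bexI[of _ ?g]) auto
next
  case (add f g)
  then obtain f' g' where "f' \<in> bumps d" "g' \<in> bumps d"
    "\<forall>t. (f has_real_derivative f' t) (at t)" "\<forall>t. (g has_real_derivative g' t) (at t)" by auto
  then show ?case by (intro bexI[of _ "\<lambda>t. f' t + g' t"] bumps.add) (auto intro!: derivative_eq_intros)
next
  case (scale f c)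
  then obtain f' where "f' \<in> bumps d" "\<forall>t. (f has_real_derivative f' t) (at t)" by auto
  then show ?case by (intro bexI[of _ "\<lambda>t. c * f' t"] bumps.scale) (auto intro!: derivative_eq_intros)
qed

text \<open>The support lies strictly to the right of 0, which makes the mollifier one-sided:
  convolution with it carries a function vanishing for t <= 0 to one vanishing for t < d, and its
  reflection averages over later times only.\<close>

lemma mollifier_exists:
  assumes d: "d > (0::real)"
  obtains \<rho> :: "real => real" where "\<rho> \<in> smooth_compact" "\<And>t. 0 <= \<rho> t"
    "\<And>t. t \<notin> {d<..<2*d} ==> \<rho> t = 0" "integrable lborel \<rho>" "(LINT t|lborel. \<rho> t) = 1"
proof -
  let ?f = "\<lambda>t. flat_exp 0 (t / d - 1) * flat_exp 0 (2 - t / d)"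
  have nz: "?f t \<noteq> 0 \<longleftrightarrow> t \<in> {d<..<2*d}" for t using d by (auto simp: flat_exp_def field_simps)
  have nn: "?f t >= 0" for t by (auto simp: flat_exp_def)
  have f: "?f \<in> smooth_compact"
  proof (rule smooth_compactI[where S = "bumps d"])
    show "?f \<in> bumps d" by (rule bumps.base)
    show "\<exists>g'\<in>bumps d. \<forall>t. (g has_vector_derivative g' t) (at t)" if "g \<in> bumps d" for g
      using bumps_deriv[OF that d] by (simp add: has_real_derivative_iff_has_vector_derivative)
    have "bounded {d<..<2*d}" by simp
    then show "bounded {t. ?f t \<noteq> 0}" by (rule bounded_subset) (use nz in blast)
  qed
  have int: "integrable lborel ?f"
  proof -
    obtain B where B: "B > 0" "\<And>t. norm (?f t) <= B" using smooth_compact_bounded[OF f] by metis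
    have [measurable]: "?f \<in> borel_measurable borel" by (rule smooth_compact_measurable[OF f])
    show ?thesis
    proof (rule Bochner_Integration.integrable_bound[of lborel "\<lambda>t. B * indicator {d..2*d} t"])
      show "AE t in lborel. norm (?f t) <= norm (B * indicator {d..2*d} t)"
      proof (intro AE_I2)
        fix t show "norm (?f t) <= norm (B * indicator {d..2*d} t)"
          using B(1) B(2)[of t] nz[of t] by (cases "?f t = 0") (auto simp: indicator_def)
      qed
      show "integrable lborel (\<lambda>t. B * indicator {d..2 * d} t)"
        by (intro integrable_mult_right integrable_real_indicator) (auto simp: emeasure_lborel_Icc_eq)
    qed auto
  qed
  let ?c = "LINT t|lborel. ?f t"
  \<comment> \<open>A nonnegative function with zero integral vanishes almost everywhere, but this
    one is nonzero on an interval of length d.\<close>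
  have "?c \<noteq> 0"
  proof
    assume "?c = 0"
    then have "AE t in lborel. ?f t = 0"
      by (subst (asm) integral_nonneg_eq_0_iff_AE[OF int]) (use nn in auto)
    then have "AE t in lborel. t \<notin> {d<..<2*d}" using nz by auto
    then have "emeasure lborel {d<..<2*d} = 0"
      by (subst (asm) AE_iff_measurable[of "{d<..<2*d}"]) auto
    then show False using d by (simp add: emeasure_lborel_Ioo)
  qed
  moreover have "?c >= 0" by (rule Bochner_Integration.integral_nonneg) (rule nn)
  ultimately have c: "?c > 0" by linarith
  show thesis
  proof (rule that[of "\<lambda>t. (1 / ?c) * ?f t"])
    show "(\<lambda>t. (1 / ?c) * ?f t) \<in> smooth_compact"
      by (rule smooth_compact_linear_image[OF bounded_linear_mult_right f])
    show "(LINT t|lborel. (1 / ?c) * ?f t) = 1" using c by (subst integral_mult_right_zero) simp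
  qed (use c int nz nn in \<open>auto intro!: integrable_mult_right simp: mult_nonneg_nonneg\<close>)
qed

subsection \<open>Convolution with a smooth function\<close>

text \<open>The mean value inequality is applied twice, first to \<open>f'\<close> and then to
  \<open>f y - y f'(x)\<close> on the ball about x. This gives \<open>B * h^2\<close> instead of the
  sharp half of it, which is enough for differentiating under the integral.\<close>

lemma second_order_remainder:
  fixes f f' f'' :: "real => 'h::real_normed_vector"
  assumes f': "\<And>t. (f has_vector_derivative f' t) (at t)"
    and f'': "\<And>t. (f' has_vector_derivative f'' t) (at t)"
    and B: "\<And>t. norm (f'' t) <= B"
  shows "norm (f (x + h) - f x - h *\<^sub>R f' x) <= B * h\<^sup>2"
proof -
  have L: "norm (f' y - f' x) <= B * norm (y - x)" for x y
  proof (rule differentiable_bound[of UNIV f' "\<lambda>x h. h *\<^sub>R f'' x"])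
    show "onorm (\<lambda>h. h *\<^sub>R f'' x) <= B" for x
      by (rule onorm_le) (use B[of x] in \<open>simp add: mult.commute[of B] mult_left_mono\<close>)
  qed (use f'' in \<open>auto simp: has_vector_derivative_def\<close>)
  have "B >= 0" using B[of 0] norm_ge_zero order_trans by blast
  let ?S = "cball x \<bar>h\<bar>"
  have *: "norm ((f (x + h) - (x + h) *\<^sub>R f' x) - (f x - x *\<^sub>R f' x)) <= (B * \<bar>h\<bar>) * norm ((x + h) - x)"
  proof (rule differentiable_bound[of ?S _ "\<lambda>y h. h *\<^sub>R (f' y - f' x)"])
    show "((\<lambda>y. f y - y *\<^sub>R f' x) has_derivative (\<lambda>h. h *\<^sub>R (f' y - f' x))) (at y within ?S)" for y
    proof -
      have "((\<lambda>y. f y - y *\<^sub>R f' x) has_vector_derivative f' y - 1 *\<^sub>R f' x) (at y within ?S)"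
        by (intro has_vector_derivative_diff has_vector_derivative_at_within[OF f']
            bounded_linear.has_vector_derivative[OF bounded_linear_scaleR_left] has_vector_derivative_id)
      then show ?thesis by (simp add: has_vector_derivative_def)
    qed
    show "onorm (\<lambda>h. h *\<^sub>R (f' y - f' x)) <= B * \<bar>h\<bar>" if "y \<in> ?S" for y
    proof (rule onorm_le)
      have "norm (f' y - f' x) <= B * \<bar>h\<bar>"
      proof -
        have "B * norm (y - x) <= B * \<bar>h\<bar>"
          using that \<open>B >= 0\<close> by (intro mult_left_mono) (auto simp: dist_real_def)
        with L[of y x] show ?thesis by linarith
      qed
      then have "\<bar>k\<bar> * norm (f' y - f' x) <= \<bar>k\<bar> * (B * \<bar>h\<bar>)" for k by (rule mult_left_mono) simp
      then show "norm (k *\<^sub>R (f' y - f' x)) <= B * \<bar>h\<bar> * norm k" for k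
        unfolding norm_scaleR real_norm_def by (metis mult.commute)
    qed
  qed (auto simp: dist_real_def)
  have eq: "(f (x + h) - (x + h) *\<^sub>R f' x) - (f x - x *\<^sub>R f' x) = f (x + h) - f x - h *\<^sub>R f' x"
    by (simp add: algebra_simps)
  show ?thesis using * unfolding eq by (simp add: power2_eq_square mult.assoc)
qed

lemma integrable_bilinear_compact_support:
  fixes P :: "'a::{real_normed_vector,second_countable_topology} => 'b::{banach,second_countable_topology} => 'c::{banach,second_countable_topology}"
  assumes P: "bounded_bilinear P" and K: "0 <= K" "\<And>x y. norm (P x y) <= norm x * norm y * K"
    and [measurable]: "f \<in> borel_measurable borel" "k \<in> borel_measurable borel"
    and k: "set_integrable lborel {a..b} k"
    and B: "\<And>t. norm (f t) <= B" and R: "\<And>t. t \<notin> {a..b} ==> f t = 0"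
  shows "integrable lborel (\<lambda>r. P (f r) (k r))"
    "norm (LINT r|lborel. P (f r) (k r)) <= K * B * (LINT r:{a..b}|lborel. norm (k r))"
proof -
  have [measurable]: "(\<lambda>r. P (f r) (k r)) \<in> borel_measurable borel"
    by (rule borel_measurable_continuous_Pair[where H = P])
       (auto intro!: bounded_bilinear.continuous_on[OF P] continuous_intros simp: split_beta)
  have ik: "integrable lborel (\<lambda>r. K * B * (indicator {a..b} r * norm (k r)))"
    using k[unfolded set_integrable_def, THEN integrable_norm] by (auto simp: abs_mult intro!: integrable_mult_right)
  have bd: "norm (P (f r) (k r)) <= K * B * (indicator {a..b} r * norm (k r))" for r
  proof (cases "r \<in> {a..b}")
    case True
    have "norm (f r) * norm (k r) * K <= B * norm (k r) * K" by (intro mult_right_mono B K) auto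
    then show ?thesis using K(2)[of "f r" "k r"] True by (simp add: ac_simps)
  next
    case False then show ?thesis using R bounded_bilinear.zero_left[OF P] by simp
  qed
  have "B >= 0" using B[of 0] norm_ge_zero order_trans by blast
  show i: "integrable lborel (\<lambda>r. P (f r) (k r))"
    by (rule Bochner_Integration.integrable_bound[OF ik]) (use bd K \<open>B >= 0\<close> in \<open>auto simp: abs_mult\<close>)
  have "norm (LINT r|lborel. P (f r) (k r)) <= (LINT r|lborel. norm (P (f r) (k r)))" by simp
  also have "... <= (LINT r|lborel. K * B * (indicator {a..b} r * norm (k r)))"
    by (intro integral_mono ik integrable_norm i bd)
  finally show "norm (LINT r|lborel. P (f r) (k r)) <= K * B * (LINT r:{a..b}|lborel. norm (k r))"
    by (simp add: set_lebesgue_integral_def)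
qed

text \<open>All derivatives fall on the smooth factor: its second order remainder is uniform on a
  fixed compact interval and can be integrated against a merely locally integrable k. The bilinear P
  allows either factor to be the vector-valued one.\<close>

lemma has_vector_derivative_convolution:
  fixes P :: "'a::{real_normed_vector,second_countable_topology} => 'b::{banach,second_countable_topology} => 'c::{banach,second_countable_topology}"
  assumes P: "bounded_bilinear P" and f: "f \<in> smooth_compact"
    and f': "\<And>t. (f has_vector_derivative f' t) (at t)"
    and k: "k \<in> borel_measurable borel" "\<And>a b. set_integrable lborel {a..b} k"
  shows "((\<lambda>t. LINT r|lborel. P (f (t + r)) (k r)) has_vector_derivative (LINT r|lborel. P (f' (t + r)) (k r))) (at t)"
    and "integrable lborel (\<lambda>r. P (f (t + r)) (k r))"
proof -
  obtain K where K: "K > 0" "\<And>x y. norm (P x y) <= norm x * norm y * K"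
    using bounded_bilinear.pos_bounded[OF P] by blast
  obtain g where g: "g \<in> smooth_compact" "\<And>t. (f has_vector_derivative g t) (at t)"
    using smooth_compact_deriv[OF f] by metis
  have "g = f'" using vector_derivative_unique_at[OF g(2) f'] by blast
  with g have f'S: "f' \<in> smooth_compact" by simp
  obtain f'' where f'': "f'' \<in> smooth_compact" "\<And>t. (f' has_vector_derivative f'' t) (at t)"
    using smooth_compact_deriv[OF f'S] by metis
  obtain R1 R2 where R1: "R1 > 0" "\<And>t. \<bar>t\<bar> > R1 ==> f t = 0" and R2: "R2 > 0" "\<And>t. \<bar>t\<bar> > R2 ==> f' t = 0"
    using smooth_compact_bounded_support[OF f] smooth_compact_bounded_support[OF f'S] by metis
  obtain B1 B2 B where B1: "B1 > 0" "\<And>t. norm (f t) <= B1" and B2: "B2 > 0" "\<And>t. norm (f' t) <= B2"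
     and B: "B > 0" "\<And>t. norm (f'' t) <= B"
    using smooth_compact_bounded[OF f] smooth_compact_bounded[OF f'S] smooth_compact_bounded[OF f''(1)] by metis
  have [measurable]: "f \<in> borel_measurable borel" "f' \<in> borel_measurable borel"
    using f f'S smooth_compact_measurable by auto
  note [measurable] = k(1)
  have i1: "integrable lborel (\<lambda>r. P (f (t + r)) (k r))" for t
    by (rule integrable_bilinear_compact_support(1)[OF P _ K(2), of "\<lambda>r. f (t + r)" k "-R1-t" "R1-t" B1])
       (use K R1 B1 k in auto)
  then show "integrable lborel (\<lambda>r. P (f (t + r)) (k r))" .
  have i2: "integrable lborel (\<lambda>r. P (f' (t + r)) (k r))" for t
    by (rule integrable_bilinear_compact_support(1)[OF P _ K(2), of "\<lambda>r. f' (t + r)" k "-R2-t" "R2-t" B2])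
       (use K R2 B2 k in auto)
  \<comment> \<open>For increments with |h| <= 1 the remainder vanishes for r outside this interval;
    the 1 in both endpoints absorbs the shift by h.\<close>
  define a b where "a = - (R1 + R2) - 1 - t" and "b = R1 + R2 + 1 - t"
  define C where "C = K * B * (LINT r:{a..b}|lborel. norm (k r))"
  let ?F = "\<lambda>t. LINT r|lborel. P (f (t + r)) (k r)" and ?F' = "\<lambda>t. LINT r|lborel. P (f' (t + r)) (k r)"
  have rem: "norm (?F (t + h) - ?F t - h *\<^sub>R ?F' t) <= C * h\<^sup>2" if h: "\<bar>h\<bar> <= 1" for h
  proof -
    let ?r = "\<lambda>r. f (t + h + r) - f (t + r) - h *\<^sub>R f' (t + r)"
    have "?F (t + h) - ?F t - h *\<^sub>R ?F' t = (LINT r|lborel. P (f (t + h + r)) (k r) - P (f (t + r)) (k r) - h *\<^sub>R P (f' (t + r)) (k r))"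
      using i1 i2 by simp
    also have "... = (LINT r|lborel. P (?r r) (k r))"
      by (simp add: bounded_bilinear.diff_left[OF P] bounded_bilinear.scaleR_left[OF P])
    also have "norm ... <= K * (B * h\<^sup>2) * (LINT r:{a..b}|lborel. norm (k r))"
    proof (rule integrable_bilinear_compact_support(2)[OF P _ K(2)])
      show "norm (?r r) <= B * h\<^sup>2" for r
        using second_order_remainder[OF f' f''(2) B(2), of "t + r" h] by (simp add: ac_simps)
      show "?r r = 0" if "r \<notin> {a..b}" for r
      proof -
        have "\<bar>t + r\<bar> > R1" "\<bar>t + h + r\<bar> > R1" "\<bar>t + r\<bar> > R2"
          using that h R1(1) R2(1) unfolding a_def b_def by auto
        then show ?thesis using R1(2) R2(2) by simp
      qed
    qed (use K k in auto)
    finally show ?thesis by (simp add: C_def ac_simps)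
  qed
  have "((\<lambda>h. (1 / \<bar>h\<bar>) *\<^sub>R (?F (t + h) - (?F t + h *\<^sub>R ?F' t))) \<longlongrightarrow> 0) (at 0)"
  proof (rule Lim_null_comparison)
    have "\<forall>\<^sub>F h in at (0::real). h \<noteq> 0 \<and> \<bar>h\<bar> <= 1"
      unfolding eventually_at by (intro exI[of _ 1]) auto
    then show "\<forall>\<^sub>F h in at 0. norm ((1 / \<bar>h\<bar>) *\<^sub>R (?F (t + h) - (?F t + h *\<^sub>R ?F' t))) <= C * \<bar>h\<bar>"
    proof eventually_elim
      case (elim h)
      have "norm (?F (t + h) - (?F t + h *\<^sub>R ?F' t)) <= C * h\<^sup>2" using rem[of h] elim by (simp add: algebra_simps)
      then have "(1 / \<bar>h\<bar>) * norm (?F (t + h) - (?F t + h *\<^sub>R ?F' t)) <= (1 / \<bar>h\<bar>) * (C * h\<^sup>2)"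
        by (rule mult_left_mono) auto
      also have "... = C * \<bar>h\<bar>"
        using elim by (simp add: power2_eq_square field_simps abs_if)
      finally show ?case by simp
    qed
    show "((\<lambda>h. C * \<bar>h\<bar>) \<longlongrightarrow> 0) (at 0)" by (auto intro!: tendsto_eq_intros)
  qed
  from tendsto_norm_zero[OF this] show "(?F has_vector_derivative ?F' t) (at t)"
    unfolding has_vector_derivative_def has_derivative_at by (simp add: bounded_linear_scaleR_left diff_diff_eq)
qed

subsection \<open>Continuity of translations in \<open>L\<^sup>2\<close>\<close>

lemma sqnorm_dominated_convergence:
  fixes f :: "nat => 'a => 'b::{real_normed_vector,second_countable_topology}"
    and w :: "'a => 'c::{real_normed_vector,second_countable_topology}"
  assumes [measurable]: "\<And>n. f n \<in> borel_measurable M" and w: "sq_integrable M w"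
    and bd: "\<And>n. AE x in M. norm (f n x) <= C * norm (w x)"
    and lim: "AE x in M. (\<lambda>n. f n x) ---> 0"
  shows "(\<lambda>n. sqnorm M (f n)) ---> 0"
proof -
  have [measurable]: "w \<in> borel_measurable M" using w by (simp add: sq_integrable_def)
  have "(\<lambda>n. \<integral>\<^sup>+x. ennreal ((norm (f n x))\<^sup>2) \<partial>M) ---> (\<integral>\<^sup>+x. 0 \<partial>M)"
  proof (rule nn_integral_dominated_convergence[where w = "\<lambda>x. ennreal (C\<^sup>2 * (norm (w x))\<^sup>2)"])
    show "AE x in M. ennreal ((norm (f n x))\<^sup>2) <= ennreal (C\<^sup>2 * (norm (w x))\<^sup>2)" for n
      using bd[of n]
    proof eventually_elim
      case (elim x)
      then have "(norm (f n x))\<^sup>2 <= (C * norm (w x))\<^sup>2" by (intro power_mono) auto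
      then show ?case by (simp add: power_mult_distrib)
    qed
    have "(\<integral>\<^sup>+x. ennreal (C\<^sup>2 * (norm (w x))\<^sup>2) \<partial>M) = ennreal (C\<^sup>2) * sqnorm M w"
      unfolding sqnorm_def by (subst nn_integral_cmult[symmetric]) (auto simp: ennreal_mult)
    then show "(\<integral>\<^sup>+x. ennreal (C\<^sup>2 * (norm (w x))\<^sup>2) \<partial>M) < \<infinity>"
      using w by (simp add: sq_integrable_def ennreal_mult_less_top)
    show "AE x in M. (\<lambda>n. ennreal ((norm (f n x))\<^sup>2)) ---> 0"
      using lim
    proof eventually_elim
      case (elim x)
      then have "(\<lambda>n. (norm (f n x))\<^sup>2) ---> 0" by (auto intro!: tendsto_eq_intros)
      then show ?case using tendsto_ennrealI by fastforce
    qed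
  qed auto
  then show ?thesis by (simp add: sqnorm_def)
qed

lemma nn_integral_lborel_translate:
  fixes c :: "'a::euclidean_space"
  assumes [measurable]: "f \<in> borel_measurable borel"
  shows "(\<integral>\<^sup>+x. f (x + c) \<partial>lborel) = (\<integral>\<^sup>+x. f x \<partial>lborel)"
proof -
  have "(\<integral>\<^sup>+x. f x \<partial>lborel) = (\<integral>\<^sup>+x. f x \<partial>distr lborel borel ((+) c))" by (simp add: lborel_distr_plus)
  also have "... = (\<integral>\<^sup>+x. f (c + x) \<partial>lborel)" by (rule nn_integral_distr) auto
  finally show ?thesis by (simp add: add.commute)
qed

lemma sqnorm_translate:
  fixes c :: "'a::euclidean_space" and f :: "'a => 'b::{real_normed_vector,second_countable_topology}"
  assumes [measurable]: "f \<in> borel_measurable borel"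
  shows "sqnorm lborel (\<lambda>x. f (x - c)) = sqnorm lborel f"
  unfolding sqnorm_def using nn_integral_lborel_translate[of "\<lambda>x. ennreal ((norm (f x))\<^sup>2)" "-c"] by simp

text \<open>Formulated along sequences because dominated convergence applies to them; the
  epsilon-delta form is recovered in \<open>sq_integrable_translation_small\<close>. The domain is a
  general Euclidean space since difference quotients are translated in the plane.\<close>

definition translation_continuous :: "('a::euclidean_space => 'b::real_normed_vector) => bool" where
  "translation_continuous f \<longleftrightarrow>
     (\<forall>h. h ---> 0 \<longrightarrow> (\<lambda>n::nat. sqnorm lborel (\<lambda>x. f (x - h n) - f x)) ---> 0)"

lemma translation_continuous_add:
  fixes f g :: "'a::euclidean_space => 'b::{real_normed_vector,second_countable_topology}"
  assumes [measurable]: "f \<in> borel_measurable borel" "g \<in> borel_measurable borel"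
    and f: "translation_continuous f" and g: "translation_continuous g"
  shows "translation_continuous (\<lambda>x. f x + g x)"
  unfolding translation_continuous_def
proof (intro allI impI)
  fix h :: "nat => 'a" assume h: "h ---> 0"
  let ?a = "\<lambda>n. sqnorm lborel (\<lambda>x. f (x - h n) - f x)" and ?b = "\<lambda>n. sqnorm lborel (\<lambda>x. g (x - h n) - g x)"
  have "?a ---> 0" "?b ---> 0" using f g h by (auto simp: translation_continuous_def)
  then have "(\<lambda>n. 2 * ?a n + 2 * ?b n) ---> 2 * 0 + 2 * 0" by (intro tendsto_intros) auto
  then have l: "(\<lambda>n. 2 * ?a n + 2 * ?b n) ---> 0" by simp
  show "(\<lambda>n. sqnorm lborel (\<lambda>x. f (x - h n) + g (x - h n) - (f x + g x))) ---> 0"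
  proof (rule tendsto_sandwich[OF _ _ tendsto_const l])
    show "\<forall>\<^sub>F n in sequentially. sqnorm lborel (\<lambda>x. f (x - h n) + g (x - h n) - (f x + g x)) <= 2 * ?a n + 2 * ?b n"
      using sqnorm_add[of "\<lambda>x. f (x - h n) - f x" lborel "\<lambda>x. g (x - h n) - g x" for n]
      by (intro always_eventually allI) (simp add: algebra_simps)
  qed auto
qed

lemma translation_continuous_sum:
  fixes f :: "'i => 'a::euclidean_space => 'b::{real_normed_vector,second_countable_topology}"
  assumes "finite I" "\<And>i. i \<in> I ==> f i \<in> borel_measurable borel" "\<And>i. i \<in> I ==> translation_continuous (f i)"
  shows "translation_continuous (\<lambda>x. \<Sum>i\<in>I. f i x)"
  using assms
proof (induction I rule: finite_induct)
  case empty
  then show ?case by (simp add: translation_continuous_def)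
next
  case (insert i I)
  then show ?case by (simp, intro translation_continuous_add borel_measurable_sum) auto
qed

text \<open>Translation invariance of Lebesgue measure makes the approximation error of the
  translate as small as that of the function, so the property survives limits in norm.\<close>

lemma translation_continuous_limit:
  fixes f :: "'a::euclidean_space => 'b::{real_normed_vector,second_countable_topology}"
  assumes [measurable]: "f \<in> borel_measurable borel"
    and approx: "\<And>e. e > 0 ==> \<exists>g. g \<in> borel_measurable borel \<and> translation_continuous g \<and> sqnorm lborel (\<lambda>x. f x - g x) <= ennreal e"
  shows "translation_continuous f"
  unfolding translation_continuous_def
proof (intro allI impI)
  fix h :: "nat => 'a" assume h: "h ---> 0"
  show "(\<lambda>n. sqnorm lborel (\<lambda>x. f (x - h n) - f x)) ---> 0"
  proof (rule tendsto_zero_ennreal)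
    fix e :: real assume e: "e > 0"
    \<comment> \<open>The doubling bound for squared norms is applied twice to the approximation
      error and once to the rest: 8 times \<open>e / 16\<close> plus 2 times \<open>e / 8\<close> is
      \<open>3 * e / 4\<close>.\<close>
    obtain g where [measurable]: "g \<in> borel_measurable borel" and g: "translation_continuous g"
      and fg: "sqnorm lborel (\<lambda>x. f x - g x) <= ennreal (e / 16)"
      using approx[of "e / 16"] e by auto
    have "(\<lambda>n. sqnorm lborel (\<lambda>x. g (x - h n) - g x)) ---> 0" using g h by (auto simp: translation_continuous_def)
    then have "\<forall>\<^sub>F n in sequentially. sqnorm lborel (\<lambda>x. g (x - h n) - g x) < ennreal (e / 8)"
      by (rule order_tendstoD) (use e in auto)
    then show "\<forall>\<^sub>F n in sequentially. sqnorm lborel (\<lambda>x. f (x - h n) - f x) < ennreal e"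
    proof eventually_elim
      case (elim n)
      let ?d = "\<lambda>x. f x - g x"
      have "sqnorm lborel (\<lambda>x. f (x - h n) - f x) = sqnorm lborel (\<lambda>x. (?d (x - h n) - ?d x) + (g (x - h n) - g x))"
        by (rule sqnorm_cong) (simp add: algebra_simps)
      also have "... <= 2 * sqnorm lborel (\<lambda>x. ?d (x - h n) - ?d x) + 2 * sqnorm lborel (\<lambda>x. g (x - h n) - g x)"
        by (rule sqnorm_add) auto
      also have "... <= 2 * (2 * sqnorm lborel (\<lambda>x. ?d (x - h n)) + 2 * sqnorm lborel ?d) + 2 * sqnorm lborel (\<lambda>x. g (x - h n) - g x)"
        by (intro add_mono mult_left_mono sqnorm_diff) auto
      also have "... = 2 * (2 * sqnorm lborel ?d + 2 * sqnorm lborel ?d) + 2 * sqnorm lborel (\<lambda>x. g (x - h n) - g x)"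
        using sqnorm_translate[of ?d "h n"] by simp
      also have "... <= 2 * (2 * ennreal (e / 16) + 2 * ennreal (e / 16)) + 2 * sqnorm lborel (\<lambda>x. g (x - h n) - g x)"
        by (intro add_mono mult_left_mono fg order_refl) auto
      also have "... < 2 * (2 * ennreal (e / 16) + 2 * ennreal (e / 16)) + 2 * ennreal (e / 8)"
      proof (subst ennreal_add_left_cancel_less, intro conjI)
        show "2 * sqnorm lborel (\<lambda>x. g (x - h n) - g x) < 2 * ennreal (e / 8)"
          using elim ennreal_mult_strict_left_mono[of "sqnorm lborel (\<lambda>x. g (x - h n) - g x)" "ennreal (e/8)" 2] by simp
      qed (auto simp: ennreal_mult_eq_top_iff)
      also have "... = ennreal (2 * (2 * (e / 16) + 2 * (e / 16)) + 2 * (e / 8))"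
        using e by (simp add: ennreal_mult'[symmetric] ennreal_plus[symmetric] flip: ennreal_numeral del: ennreal_numeral ennreal_plus)
      also have "... <= ennreal e" by (intro ennreal_leI) (use e in simp)
      finally show ?case .
    qed
  qed
qed

text \<open>A point of an open set stays in it under small shifts, so the part of U that is moved
  out tends to 0 pointwise and is dominated by the indicator of U. The symmetric difference with a
  translate consists of that part for the shift and, after a translation, of the one for the
  opposite shift.\<close>

lemma translation_continuous_open:
  fixes U :: "'a::euclidean_space set"
  assumes U: "open U" "emeasure lborel U < \<infinity>"
  shows "translation_continuous (indicator U :: 'a => real)"
  unfolding translation_continuous_def
proof (intro allI impI)
  fix h :: "nat => 'a" assume h: "h ---> 0"
  have [measurable]: "U \<in> sets borel" using U by simp
  let ?A = "\<lambda>h. sqnorm lborel (\<lambda>x. indicator U x * (1 - indicator U (x + h)) :: real)"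
  have A: "(\<lambda>n. ?A (k n)) ---> 0" if k: "k ---> 0" for k :: "nat => 'a"
  proof (rule sqnorm_dominated_convergence[where w = "indicator U :: 'a => real" and C = 1])
    have "sqnorm lborel (indicator U :: 'a => real) = (\<integral>\<^sup>+x. indicator U x \<partial>lborel)"
      unfolding sqnorm_def by (intro nn_integral_cong) (auto simp: indicator_def)
    then show "sq_integrable lborel (indicator U :: 'a => real)"
      using U by (simp add: sq_integrable_def)
    show "AE x in lborel. (\<lambda>n. indicator U x * (1 - indicator U (x + k n)) :: real) ---> 0"
    proof (intro AE_I2)
      fix x
      show "(\<lambda>n. indicator U x * (1 - indicator U (x + k n)) :: real) ---> 0"
      proof (cases "x \<in> U")
        case True
        have "(\<lambda>n. x + k n) ---> x" using tendsto_add[OF tendsto_const k, of x] by simp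
        then have "\<forall>\<^sub>F n in sequentially. x + k n \<in> U" using U(1) True by (rule topological_tendstoD)
        then have "\<forall>\<^sub>F n in sequentially. indicator U x * (1 - indicator U (x + k n)) = (0::real)"
          by eventually_elim simp
        then show ?thesis by (rule tendsto_eventually)
      qed simp
    qed
  qed (auto simp: indicator_def)
  have "(\<lambda>n. - h n) ---> 0" using h tendsto_minus by fastforce
  from tendsto_add[OF A[OF h] A[OF this]] have "(\<lambda>n. ?A (h n) + ?A (- h n)) ---> 0" by simp
  moreover have "sqnorm lborel (\<lambda>x. indicator U (x - k) - indicator U x :: real) = ?A k + ?A (- k)" for k
  proof -
    have "sqnorm lborel (\<lambda>x. indicator U (x - k) - indicator U x :: real) =
      (\<integral>\<^sup>+x. ennreal ((indicator U (x - k) * (1 - indicator U x))\<^sup>2) + ennreal ((indicator U x * (1 - indicator U (x - k)))\<^sup>2) \<partial>lborel)"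
      unfolding sqnorm_def by (intro nn_integral_cong) (auto simp: indicator_def)
    also have "... = (\<integral>\<^sup>+x. ennreal ((indicator U (x - k) * (1 - indicator U x))\<^sup>2) \<partial>lborel) + ?A (- k)"
      by (subst nn_integral_add) (auto simp: sqnorm_def)
    also have "(\<integral>\<^sup>+x. ennreal ((indicator U (x - k) * (1 - indicator U x))\<^sup>2) \<partial>lborel) = ?A k"
      using nn_integral_lborel_translate[of "\<lambda>x. ennreal ((indicator U x * (1 - indicator U (x + k)))\<^sup>2)" "- k"]
      by (simp add: sqnorm_def)
    finally show ?thesis .
  qed
  ultimately show "(\<lambda>n. sqnorm lborel (\<lambda>x. indicator U (x - h n) - indicator U x :: real)) ---> 0" by simp
qed

lemma translation_continuous_indicator:
  fixes E :: "'a::euclidean_space set"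
  assumes E: "E \<in> sets borel" "emeasure lborel E < \<infinity>"
  shows "translation_continuous (indicator E :: 'a => real)"
proof (rule translation_continuous_limit)
  fix e :: real assume e: "e > 0"
  obtain U where U: "open U" "E \<subseteq> U" "emeasure lborel (U - E) < ennreal e"
    using outer_regular_lborel[OF E(1) e] by metis
  have [measurable]: "U \<in> sets borel" using U by simp
  note [measurable] = E(1)
  have "emeasure lborel (E \<union> (U - E)) <= emeasure lborel E + emeasure lborel (U - E)"
    by (rule emeasure_subadditive) auto
  also have "E \<union> (U - E) = U" using U by auto
  also have "emeasure lborel E + emeasure lborel (U - E) < \<infinity>" using E U(3) less_trans[OF U(3)] by auto
  finally have "translation_continuous (indicator U :: 'a => real)" by (intro translation_continuous_open U)
  moreover have "sqnorm lborel (\<lambda>x. indicator E x - indicator U x :: real) = (\<integral>\<^sup>+x. indicator (U - E) x \<partial>lborel)"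
    unfolding sqnorm_def by (intro nn_integral_cong) (use U in \<open>auto simp: indicator_def\<close>)
  ultimately show "\<exists>g. g \<in> borel_measurable borel \<and> translation_continuous g \<and>
      sqnorm lborel (\<lambda>x. indicator E x - g x :: real) <= ennreal e"
    using U by (intro exI[of _ "indicator U"]) (auto intro: less_imp_le)
qed (use E in auto)

text \<open>Reduction through simple functions to indicators of Borel sets, and from there by outer
  regularity to open sets.\<close>

lemma sq_integrable_translation_continuous:
  fixes f :: "'a::euclidean_space => 'b::{banach,second_countable_topology}"
  assumes f: "sq_integrable lborel f"
  shows "translation_continuous f"
proof (rule translation_continuous_limit)
  show [measurable]: "f \<in> borel_measurable borel" using f by (simp add: sq_integrable_def)
  fix e :: real assume e: "e > 0"
  obtain s where s: "\<And>i. simple_function lborel (s i)" "\<And>x. (\<lambda>i. s i x) ---> f x"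
    "\<And>i x. norm (s i x) <= 2 * norm (f x)"
    using borel_measurable_implies_sequence_metric[of f lborel 0] by (auto simp: dist_norm)
  have [measurable]: "s i \<in> borel_measurable borel" for i
    using borel_measurable_simple_function[OF s(1)] by simp
  have "(\<lambda>i. sqnorm lborel (\<lambda>x. f x - s i x)) ---> 0"
  proof (rule sqnorm_dominated_convergence[OF _ f, where C = 3])
    show "AE x in lborel. norm (f x - s n x) <= 3 * norm (f x)" for n
    proof (intro AE_I2)
      fix x show "norm (f x - s n x) <= 3 * norm (f x)"
        using norm_triangle_ineq4[of "f x" "s n x"] s(3)[of n x] by linarith
    qed
    show "AE x in lborel. (\<lambda>n. f x - s n x) ---> 0"
    proof (intro AE_I2)
      fix x show "(\<lambda>n. f x - s n x) ---> 0"
        using tendsto_diff[OF tendsto_const[of "f x"] s(2)[of x]] by simp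
    qed
  qed auto
  then have "\<forall>\<^sub>F i in sequentially. sqnorm lborel (\<lambda>x. f x - s i x) < ennreal e"
    by (rule order_tendstoD) (use e in auto)
  then obtain i where i: "sqnorm lborel (\<lambda>x. f x - s i x) < ennreal e" by (auto simp: eventually_sequentially)
  have rep: "s i = (\<lambda>x. \<Sum>y\<in>range (s i) - {0}. indicator (s i -` {y}) x *\<^sub>R y)"
  proof
    fix x
    have "s i x = (\<Sum>y\<in>range (s i). indicator (s i -` {y}) x *\<^sub>R y)"
      by (rule trans[OF simple_function_indicator_representation_banach[OF s(1)[of i], of x]]) simp_all
    also have "... = (\<Sum>y\<in>range (s i) - {0}. indicator (s i -` {y}) x *\<^sub>R y)"
      by (intro sum.mono_neutral_right) (use simple_functionD(1)[OF s(1)] in auto)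
    finally show "s i x = (\<Sum>y\<in>range (s i) - {0}. indicator (s i -` {y}) x *\<^sub>R y)" .
  qed
  have "translation_continuous (\<lambda>x. \<Sum>y\<in>range (s i) - {0}. indicator (s i -` {y}) x *\<^sub>R y)"
  proof (rule translation_continuous_sum)
    show "finite (range (s i) - {0})" using simple_functionD(1)[OF s(1)[of i]] by auto
    fix y assume y: "y \<in> range (s i) - {0}"
    have [measurable]: "s i -` {y} \<in> sets borel" using measurable_sets[of "s i" borel borel "{y}"] by simp
    show "(\<lambda>x. indicator (s i -` {y}) x *\<^sub>R y) \<in> borel_measurable borel" by measurable
    \<comment> \<open>Chebyshev's inequality: on the level set
      \<open>norm y <= 2 * norm (f x)\<close>, so a nonzero value is taken on a set of finite
      measure.\<close>
    have "ennreal ((norm y)\<^sup>2) * emeasure lborel (s i -` {y}) = (\<integral>\<^sup>+x. ennreal ((norm y)\<^sup>2) * indicator (s i -` {y}) x \<partial>lborel)"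
      by (subst nn_integral_cmult) auto
    also have "... <= ennreal 4 * sqnorm lborel f"
      unfolding sqnorm_def
    proof (subst nn_integral_cmult[symmetric], measurable, intro nn_integral_mono)
      fix x
      have "(norm (s i x))\<^sup>2 <= (2 * norm (f x))\<^sup>2" by (intro power_mono s) auto
      then show "ennreal ((norm y)\<^sup>2) * indicator (s i -` {y}) x <= ennreal 4 * ennreal ((norm (f x))\<^sup>2)"
        by (auto simp: indicator_def power_mult_distrib ennreal_mult[symmetric] simp del: ennreal_numeral intro!: ennreal_leI)
    qed
    also have "... < \<infinity>" using f by (simp add: sq_integrable_def ennreal_mult_less_top)
    finally have "emeasure lborel (s i -` {y}) < \<infinity>" using y by (auto simp: ennreal_mult_less_top)
    then have tc: "translation_continuous (indicator (s i -` {y}) :: 'a => real)"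
      by (intro translation_continuous_indicator) auto
    show "translation_continuous (\<lambda>x. indicator (s i -` {y}) x *\<^sub>R y)"
      unfolding translation_continuous_def
    proof (intro allI impI)
      fix h :: "nat => 'a" assume h: "h ---> 0"
      let ?I = "indicator (s i -` {y}) :: 'a => real"
      have "sqnorm lborel (\<lambda>x. ?I (x - h n) *\<^sub>R y - ?I x *\<^sub>R y) = ennreal ((norm y)\<^sup>2) * sqnorm lborel (\<lambda>x. ?I (x - h n) - ?I x)" for n
        unfolding sqnorm_def
        by (subst nn_integral_cmult[symmetric])
           (auto simp: scaleR_left_diff_distrib[symmetric] power_mult_distrib ennreal_mult[symmetric] mult.commute)
      moreover have "(\<lambda>n. ennreal ((norm y)\<^sup>2) * sqnorm lborel (\<lambda>x. ?I (x - h n) - ?I x)) ---> ennreal ((norm y)\<^sup>2) * 0"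
        using tc h by (intro ennreal_tendsto_cmult) (auto simp: translation_continuous_def)
      ultimately show "(\<lambda>n. sqnorm lborel (\<lambda>x. ?I (x - h n) *\<^sub>R y - ?I x *\<^sub>R y)) ---> 0" by simp
    qed
  qed
  then show "\<exists>g. g \<in> borel_measurable borel \<and> translation_continuous g \<and> sqnorm lborel (\<lambda>x. f x - g x) <= ennreal e"
    using i rep by (intro exI[of _ "s i"]) auto
qed

lemma sq_integrable_translation_small:
  fixes f :: "'a::euclidean_space => 'b::{banach,second_countable_topology}"
  assumes f: "sq_integrable lborel f" and e: "e > 0"
  obtains d where "d > 0" "\<And>h. norm h < d ==> sqnorm lborel (\<lambda>x. f (x - h) - f x) <= ennreal e"
proof -
  let ?P = "\<lambda>h. sqnorm lborel (\<lambda>x. f (x - h) - f x) <= ennreal e"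
  have "eventually ?P (at 0)"
  proof (rule sequentially_imp_eventually_at, intro allI impI)
    fix h :: "nat => 'a" assume h: "(\<forall>n. h n \<noteq> 0) \<and> h ---> 0"
    then have "(\<lambda>n. sqnorm lborel (\<lambda>x. f (x - h n) - f x)) ---> 0"
      using sq_integrable_translation_continuous[OF f] by (auto simp: translation_continuous_def)
    then have "\<forall>\<^sub>F n in sequentially. sqnorm lborel (\<lambda>x. f (x - h n) - f x) < ennreal e"
      by (rule order_tendstoD) (use e in auto)
    then show "\<forall>\<^sub>F n in sequentially. ?P (h n)" by eventually_elim simp
  qed
  then obtain d where "d > 0" "\<And>h. h \<noteq> 0 ==> norm h < d ==> ?P h"
    by (auto simp: eventually_at)
  moreover have "?P 0" by simp
  ultimately show thesis using that by metis
qed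

section \<open>Mollification as an average of translations\<close>

lemma norm_weighted_integral_sq_le:
  fixes G :: "real => 'b::{banach,second_countable_topology}"
  assumes [measurable]: "G \<in> borel_measurable borel" and nn: "\<And>t. 0 <= \<rho> t"
    and \<rho>: "integrable lborel \<rho>" "(LINT t|lborel. \<rho> t) = 1"
  shows "ennreal ((norm (LINT h|lborel. \<rho> h *\<^sub>R G h))\<^sup>2) <= (\<integral>\<^sup>+h. ennreal (\<rho> h) * ennreal ((norm (G h))\<^sup>2) \<partial>lborel)"
proof -
  have [measurable]: "\<rho> \<in> borel_measurable borel" using \<rho>(1) by auto
  have "ennreal (norm (LINT h|lborel. \<rho> h *\<^sub>R G h)) <= (\<integral>\<^sup>+h. norm (\<rho> h *\<^sub>R G h) \<partial>lborel)"
  proof (cases "integrable lborel (\<lambda>h. \<rho> h *\<^sub>R G h)")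
    case True
    then show ?thesis by (rule integral_norm_bound_ennreal)
  qed (simp add: not_integrable_integral_eq)
  then have "(ennreal (norm (LINT h|lborel. \<rho> h *\<^sub>R G h)))\<^sup>2 <= (\<integral>\<^sup>+h. norm (\<rho> h *\<^sub>R G h) \<partial>lborel)\<^sup>2"
    by (rule power_mono) auto
  \<comment> \<open>Jensen's inequality for the probability density \<rho>, obtained from
    Cauchy-Schwarz by distributing one square root of \<rho> to each factor.\<close>
  also have "(\<integral>\<^sup>+h. norm (\<rho> h *\<^sub>R G h) \<partial>lborel) = (\<integral>\<^sup>+h. ennreal (sqrt (\<rho> h)) * ennreal (sqrt (\<rho> h) * norm (G h)) \<partial>lborel)"
    by (intro nn_integral_cong, subst ennreal_mult[symmetric]) (auto simp: nn mult.assoc[symmetric])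
  also have "...\<^sup>2 <= (\<integral>\<^sup>+h. (ennreal (sqrt (\<rho> h)))\<^sup>2 \<partial>lborel) * (\<integral>\<^sup>+h. (ennreal (sqrt (\<rho> h) * norm (G h)))\<^sup>2 \<partial>lborel)"
    by (rule Cauchy_Schwarz_nn_integral) auto
  also have "(\<integral>\<^sup>+h. (ennreal (sqrt (\<rho> h)))\<^sup>2 \<partial>lborel) = (\<integral>\<^sup>+h. ennreal (\<rho> h) \<partial>lborel)"
    by (intro nn_integral_cong) (simp add: ennreal_power nn)
  also have "... = 1" using nn_integral_eq_integral[OF \<rho>(1)] nn \<rho>(2) by simp
  also have "(\<integral>\<^sup>+h. (ennreal (sqrt (\<rho> h) * norm (G h)))\<^sup>2 \<partial>lborel) = (\<integral>\<^sup>+h. ennreal (\<rho> h) * ennreal ((norm (G h))\<^sup>2) \<partial>lborel)"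
    by (intro nn_integral_cong) (simp add: ennreal_power nn power_mult_distrib ennreal_mult)
  finally show ?thesis by (simp add: ennreal_power)
qed

text \<open>Jensen and Tonelli move the average outside the squared norm. The direction v is 1 for
  functions on the line, \<open>(1, 1)\<close> for difference quotients, which commute with diagonal
  translations, and -1 for averages over later times.\<close>

lemma sqnorm_mollify_diff:
  fixes F :: "'a::euclidean_space => 'b::{banach,second_countable_topology}"
  assumes [measurable]: "F \<in> borel_measurable borel" and nn: "\<And>t. 0 <= \<rho> t"
    and \<rho>: "integrable lborel \<rho>" "(LINT t|lborel. \<rho> t) = 1"
    and small: "\<And>h. \<rho> h \<noteq> 0 ==> sqnorm lborel (\<lambda>x. F (x - h *\<^sub>R v) - F x) <= \<eta>"
  shows "sqnorm lborel (\<lambda>x. LINT h|lborel. \<rho> h *\<^sub>R (F (x - h *\<^sub>R v) - F x)) <= \<eta>"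
proof -
  have [measurable]: "\<rho> \<in> borel_measurable borel" using \<rho>(1) by auto
  have "sqnorm lborel (\<lambda>x. LINT h|lborel. \<rho> h *\<^sub>R (F (x - h *\<^sub>R v) - F x))
     <= (\<integral>\<^sup>+x. \<integral>\<^sup>+h. ennreal (\<rho> h) * ennreal ((norm (F (x - h *\<^sub>R v) - F x))\<^sup>2) \<partial>lborel \<partial>lborel)"
    unfolding sqnorm_def by (intro nn_integral_mono norm_weighted_integral_sq_le nn \<rho>) auto
  also have "... = (\<integral>\<^sup>+h. \<integral>\<^sup>+x. ennreal (\<rho> h) * ennreal ((norm (F (x - h *\<^sub>R v) - F x))\<^sup>2) \<partial>lborel \<partial>lborel)"
    by (rule lborel_pair.Fubini') auto
  also have "... = (\<integral>\<^sup>+h. ennreal (\<rho> h) * sqnorm lborel (\<lambda>x. F (x - h *\<^sub>R v) - F x) \<partial>lborel)"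
    unfolding sqnorm_def by (intro nn_integral_cong nn_integral_cmult) auto
  also have "... <= (\<integral>\<^sup>+h. ennreal (\<rho> h) * \<eta> \<partial>lborel)"
    by (intro nn_integral_mono) (metis mult_left_mono mult_zero_left ennreal_0 order_refl small zero_le)
  also have "... = \<eta>"
    using nn_integral_eq_integral[OF \<rho>(1)] nn \<rho>(2) by (simp add: nn_integral_multc)
  finally show ?thesis .
qed

subsection \<open>The half-order Sobolev space on the real line\<close>

abbreviation plane :: "(real \<times> real) measure" where
  "plane \<equiv> lborel \<Otimes>\<^sub>M lborel"

text \<open>Writes the Gagliardo seminorm as the L2 norm of a linear image on the plane, so that
  translation continuity, inner products and completeness are inherited from L2. The value on the
  diagonal is 0.\<close>

definition dquot :: "(real => 'h::real_normed_vector) => real \<times> real => 'h" where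
  "dquot u = (\<lambda>(s, t). (1 / \<bar>s - t\<bar>) *\<^sub>R (u s - u t))"

lemma borel_measurable_dquot:
  fixes u :: "real => 'h::{real_normed_vector,second_countable_topology}"
  assumes [measurable]: "u \<in> borel_measurable M" and [measurable]: "(\<lambda>x. x) \<in> borel_measurable M"
  shows "dquot u \<in> borel_measurable (M \<Otimes>\<^sub>M M)"
  unfolding dquot_def by measurable

lemma borel_measurable_dquot_lborel[measurable]:
  fixes u :: "real => 'h::{real_normed_vector,second_countable_topology}"
  shows "u \<in> borel_measurable borel ==> dquot u \<in> borel_measurable plane"
  by (rule borel_measurable_dquot) auto

lemma dquot_add: "dquot (\<lambda>t. u t + v t) = (\<lambda>x. dquot u x + dquot v x)"
  by (auto simp: dquot_def algebra_simps)

lemma dquot_diff: "dquot (\<lambda>t. u t - v t) = (\<lambda>x. dquot u x - dquot v x)"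
  by (auto simp: dquot_def algebra_simps)

lemma dquot_scaleR: "dquot (\<lambda>t. c *\<^sub>R u t) = (\<lambda>x. c *\<^sub>R dquot u x)"
  by (auto simp: dquot_def algebra_simps)

lemma norm_dquot_sq: "(norm (dquot u (s, t)))\<^sup>2 = (norm (u s - u t))\<^sup>2 / \<bar>s - t\<bar>\<^sup>2"
  by (simp add: dquot_def power_mult_distrib power_divide)

definition half_sob :: "(real => 'h::real_normed_vector) => bool" where
  "half_sob u \<longleftrightarrow> sq_integrable lborel u \<and> sq_integrable plane (dquot u)"

lemma half_sob_add:
  fixes u v :: "real => 'h::{real_normed_vector,second_countable_topology}"
  assumes "half_sob u" "half_sob v"
  shows "half_sob (\<lambda>t. u t + v t)"
  using assms by (auto simp: half_sob_def dquot_add intro: sq_integrable_add)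

section \<open>The half line as a measure space\<close>

lemma space_half_line[simp]: "space half_line = {0<..}"
  by (simp add: space_restrict_space)

lemma measurable_ident_half_line: "(\<lambda>x. x) \<in> borel_measurable half_line"
  by (rule measurable_restrict_space1) simp

lemma sigma_finite_half_line: "sigma_finite_measure half_line"
  by (rule sigma_finite_measure_restrict_space) (auto intro: sigma_finite_lborel)

interpretation half_line: sigma_finite_measure half_line
  by (rule sigma_finite_half_line)

lemma measurable_half_lineI: "u \<in> borel_measurable borel ==> u \<in> borel_measurable half_line"
  by (rule measurable_restrict_space1) simp

lemma nn_integral_half_line: "(\<integral>\<^sup>+t. f t \<partial>half_line) = (\<integral>\<^sup>+t. f t * indicator {0<..} t \<partial>lborel)"
  by (rule nn_integral_restrict_space) auto

lemma integral_half_line: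
  fixes f :: "real => 'b::{banach,second_countable_topology}"
  shows "(LINT t|half_line. f t) = (LINT t|lborel. indicator {0<..} t *\<^sub>R f t)"
  by (rule integral_restrict_space) auto

lemma nn_integral_reflect_split:
  assumes [measurable]: "g \<in> borel_measurable borel"
  shows "(\<integral>\<^sup>+t. g t \<partial>lborel) = (\<integral>\<^sup>+t. g t + g (- t) \<partial>half_line)"
proof -
  have "AE t in lborel. t \<noteq> (0::real)" by (rule AE_lborel_singleton)
  then have "(\<integral>\<^sup>+t. g t \<partial>lborel) = (\<integral>\<^sup>+t. g t * indicator {0<..} t + g t * indicator {..<0} t \<partial>lborel)"
    by (intro nn_integral_cong_AE) (auto elim!: eventually_mono simp: indicator_def)
  also have "... = (\<integral>\<^sup>+t. g t * indicator {0<..} t \<partial>lborel) + (\<integral>\<^sup>+t. g t * indicator {..<0} t \<partial>lborel)"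
    by (rule nn_integral_add) auto
  also have "(\<integral>\<^sup>+t. g t * indicator {..<0} t \<partial>lborel) = (\<integral>\<^sup>+t. g (- t) * indicator {0<..} t \<partial>lborel)"
    by (subst nn_integral_real_affine[where c = "-1" and t = 0]) (auto simp: indicator_def intro!: nn_integral_cong)
  also have "(\<integral>\<^sup>+t. g t * indicator {0<..} t \<partial>lborel) + ... = (\<integral>\<^sup>+t. g t * indicator {0<..} t + g (- t) * indicator {0<..} t \<partial>lborel)"
    by (rule nn_integral_add[symmetric]) auto
  also have "... = (\<integral>\<^sup>+t. g t + g (- t) \<partial>half_line)"
    unfolding nn_integral_half_line by (intro nn_integral_cong) (auto simp: indicator_def)
  finally show ?thesis .
qed

text \<open>Up to normalisation this is the Poisson kernel. It also serves as the integrable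
  majorant for difference quotients of bounded functions and for the regularised kernels
  below.\<close>

lemma nn_integral_Poisson:
  assumes e: "e > 0"
  shows "(\<integral>\<^sup>+x. ennreal (1 / (x\<^sup>2 + e\<^sup>2)) \<partial>lborel) = ennreal (pi / e)"
proof -
  have pos: "x\<^sup>2 + e\<^sup>2 > 0" for x :: real using e by (intro add_nonneg_pos) auto
  let ?f = "\<lambda>x. 1 / (x\<^sup>2 + e\<^sup>2)"
  have "(\<integral>\<^sup>+x. ennreal (?f x) * indicator {0..} x \<partial>lborel) = ennreal (pi / 2 / e - arctan (0 / e) / e)"
  proof (rule nn_integral_FTC_atLeast[where F = "\<lambda>x. arctan (x / e) / e" and T = "pi / 2 / e"])
    show "((\<lambda>x. arctan (x / e) / e) has_real_derivative ?f x) (at x)" for x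
    proof -
      have "((\<lambda>x. arctan (x / e) / e) has_real_derivative inverse (1 + (x / e)\<^sup>2) * (1 / e) / e) (at x)"
        using e by (auto intro!: derivative_eq_intros)
      moreover have "1 + (x / e)\<^sup>2 = (x\<^sup>2 + e\<^sup>2) / e\<^sup>2" using e by (simp add: field_simps)
      ultimately show ?thesis using e by (simp add: power2_eq_square)
    qed
    have "filterlim (\<lambda>x. (1 / e) * x) at_top at_top"
      by (rule filterlim_tendsto_pos_mult_at_top[OF tendsto_const]) (use e in \<open>auto intro: filterlim_ident\<close>)
    then have "filterlim (\<lambda>x. x / e) at_top at_top" by simp
    from filterlim_compose[OF tendsto_arctan_at_top this]
    show "((\<lambda>x. arctan (x / e) / e) \<longlongrightarrow> pi / 2 / e) at_top"
      by (intro tendsto_divide tendsto_const) (use e in auto)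
  qed (use pos in \<open>auto intro: less_imp_le\<close>)
  also have "pi / 2 / e - arctan (0 / e) / e = pi / (2 * e)" by simp
  also have "(\<integral>\<^sup>+x. ennreal (?f x) * indicator {0..} x \<partial>lborel) = (\<integral>\<^sup>+x. ennreal (?f x) \<partial>half_line)"
    unfolding nn_integral_half_line
    by (intro nn_integral_cong_AE eventually_mono[OF AE_lborel_singleton[of 0]]) (auto simp: indicator_def)
  finally have *: "(\<integral>\<^sup>+x. ennreal (?f x) \<partial>half_line) = ennreal (pi / (2 * e))" .
  have "(\<integral>\<^sup>+x. ennreal (?f x) \<partial>lborel) = (\<integral>\<^sup>+x. ennreal (?f x) + ennreal (?f (- x)) \<partial>half_line)"
    by (rule nn_integral_reflect_split) auto
  also have "... = 2 * (\<integral>\<^sup>+x. ennreal (?f x) \<partial>half_line)"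
    by (subst nn_integral_cmult[symmetric]) (auto simp: mult_2 intro: measurable_half_lineI)
  also have "... = ennreal (2 * (pi / (2 * e)))"
    unfolding * using e by (subst ennreal_mult') auto
  finally show ?thesis by simp
qed

lemma sq_integrable_set_integrable:
  fixes f :: "real => 'b::{banach,second_countable_topology}"
  assumes f: "sq_integrable lborel f"
  shows "set_integrable lborel {a..b} f"
proof -
  have [measurable]: "f \<in> borel_measurable borel" using f by (simp add: sq_integrable_def)
  have i: "integrable lborel (\<lambda>x. indicator {a..b} x + (norm (f x))\<^sup>2 :: real)"
    using sq_integrable_integrable(1)[OF f]
    by (intro Bochner_Integration.integrable_add integrable_real_indicator) (auto simp: emeasure_lborel_Icc_eq)
  show ?thesis unfolding set_integrable_def
  proof (rule Bochner_Integration.integrable_bound[OF i])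
    show "AE x in lborel. norm (indicator {a..b} x *\<^sub>R f x) <= norm (indicator {a..b} x + (norm (f x))\<^sup>2 :: real)"
    proof (intro AE_I2)
      fix x
      have "norm (f x) <= 1 + (norm (f x))\<^sup>2" using sum_squares_bound[of 1 "norm (f x)"] norm_ge_zero[of "f x"] unfolding power_one by linarith
      then show "norm (indicator {a..b} x *\<^sub>R f x) <= norm (indicator {a..b} x + (norm (f x))\<^sup>2 :: real)"
        by (auto simp: indicator_def)
    qed
  qed auto
qed

subsection \<open>Density of smooth functions\<close>

text \<open>A cutoff equal to 1 for |t| <= n + 1 and to 0 beyond twice that. Piecewise linearity
  suffices, as smoothness is restored by mollification; the slope \<open>1 / (n + 1)\<close> stays
  below 1, which gives majorants uniform in n.\<close>

definition ramp :: "nat => real => real" where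
  "ramp n t = max 0 (min 1 (2 - \<bar>t\<bar> / (real n + 1)))"

lemma ramp_bounds: "0 <= ramp n t" "ramp n t <= 1" by (auto simp: ramp_def)

lemma ramp_eq_0: "\<bar>t\<bar> > 2 * (real n + 1) ==> ramp n t = 0"
  by (auto simp: ramp_def field_simps)

lemma ramp_Lipschitz: "\<bar>ramp n s - ramp n t\<bar> <= \<bar>s - t\<bar> / (real n + 1)"
proof -
  have "\<bar>ramp n s - ramp n t\<bar> <= \<bar>\<bar>s\<bar> / (real n + 1) - \<bar>t\<bar> / (real n + 1)\<bar>"
    unfolding ramp_def by linarith
  also have "... = \<bar>\<bar>s\<bar> - \<bar>t\<bar>\<bar> / (real n + 1)" by (simp add: diff_divide_distrib[symmetric])
  also have "... <= \<bar>s - t\<bar> / (real n + 1)" by (intro divide_right_mono) auto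
  finally show ?thesis .
qed

lemma ramp_tendsto_1: "(\<lambda>n. ramp n t) ---> 1"
proof (rule tendsto_eventually)
  obtain N :: nat where "\<bar>t\<bar> < real N" using reals_Archimedean2 by blast
  then have "ramp n t = 1" if "n >= N" for n
  proof -
    have "\<bar>t\<bar> / (real n + 1) <= 1" using that \<open>\<bar>t\<bar> < real N\<close> by (simp add: field_simps)
    then show ?thesis by (simp add: ramp_def)
  qed
  then show "\<forall>\<^sub>F n in sequentially. ramp n t = 1" by (auto simp: eventually_sequentially)
qed

lemma borel_measurable_ramp[measurable]: "ramp n \<in> borel_measurable borel"
  unfolding ramp_def by measurable

text \<open>A product rule for difference quotients: one term is the cutoff error times
  \<open>dquot U\<close>, the other is U times the difference quotient of the ramp. Both converge
  pointwise to 0 and have a fixed majorant.\<close>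

lemma ramp_approx:
  fixes U :: "real => 'h::{banach,second_countable_topology}"
  assumes U: "half_sob U"
  shows "(\<lambda>n. sqnorm lborel (\<lambda>t. ramp n t *\<^sub>R U t - U t)) ---> 0"
    and "(\<lambda>n. sqnorm plane (dquot (\<lambda>t. ramp n t *\<^sub>R U t - U t))) ---> 0"
proof -
  have U1: "sq_integrable lborel U" and U2: "sq_integrable plane (dquot U)"
    and [measurable]: "U \<in> borel_measurable borel"
    using U by (auto simp: half_sob_def sq_integrable_def)
  have eq: "ramp n t *\<^sub>R U t - U t = (ramp n t - 1) *\<^sub>R U t" for n t by (simp add: algebra_simps)
  have bd: "\<bar>ramp n t - 1\<bar> <= 1" for n t using ramp_bounds[of n t] by auto
  have l0: "(\<lambda>n. ramp n t - 1) ---> 0" for t using tendsto_diff[OF ramp_tendsto_1 tendsto_const, of t 1] by simp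
  have l0': "(\<lambda>n. (ramp n t - 1) *\<^sub>R x) ---> 0" for t and x :: 'h
    using tendsto_scaleR[OF l0 tendsto_const, of t x] by simp
  show "(\<lambda>n. sqnorm lborel (\<lambda>t. ramp n t *\<^sub>R U t - U t)) ---> 0"
    unfolding eq
    by (rule sqnorm_dominated_convergence[OF _ U1, where C = 1])
       (use bd l0' in \<open>auto intro!: mult_left_le_one_le\<close>)
  let ?M = plane
  \<comment> \<open>The difference quotient of a ramp is at most 1 because of its slope and at most
    \<open>1 / |s - t|\<close> because of its range. Adding the two squared bounds gives
    \<open>2 / ((s - t)^2 + 1)\<close>, which is integrable in s.\<close>
  define w where "w = (\<lambda>(s, t). sqrt (2 / ((s - t)\<^sup>2 + 1\<^sup>2)) *\<^sub>R U t)"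
  have wm[measurable]: "w \<in> borel_measurable ?M" unfolding w_def by measurable
  have "sqnorm ?M w = (\<integral>\<^sup>+t. (\<integral>\<^sup>+s. ennreal ((norm (w (s, t)))\<^sup>2) \<partial>lborel) \<partial>lborel)"
    unfolding sqnorm_def by (rule lborel_pair.nn_integral_snd[symmetric]) measurable
  also have "... = (\<integral>\<^sup>+t. ennreal (2 * (norm (U t))\<^sup>2) * ennreal pi \<partial>lborel)"
  proof (intro nn_integral_cong)
    fix t
    have "(\<integral>\<^sup>+s. ennreal ((norm (w (s, t)))\<^sup>2) \<partial>lborel) = (\<integral>\<^sup>+s. ennreal (2 * (norm (U t))\<^sup>2) * ennreal (1 / ((s - t)\<^sup>2 + 1\<^sup>2)) \<partial>lborel)"
      unfolding w_def by (intro nn_integral_cong, subst ennreal_mult'[symmetric]) (auto simp: power_mult_distrib)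
    also have "... = ennreal (2 * (norm (U t))\<^sup>2) * (\<integral>\<^sup>+s. ennreal (1 / ((s - t)\<^sup>2 + 1\<^sup>2)) \<partial>lborel)"
      by (rule nn_integral_cmult) auto
    also have "(\<integral>\<^sup>+s. ennreal (1 / ((s - t)\<^sup>2 + 1\<^sup>2)) \<partial>lborel) = ennreal pi"
      using nn_integral_lborel_translate[of "\<lambda>s. ennreal (1 / (s\<^sup>2 + 1\<^sup>2))" "-t"] nn_integral_Poisson[of 1] by simp
    finally show "(\<integral>\<^sup>+s. ennreal ((norm (w (s, t)))\<^sup>2) \<partial>lborel) = ennreal (2 * (norm (U t))\<^sup>2) * ennreal pi" .
  qed
  also have "... = ennreal 2 * sqnorm lborel U * ennreal pi"
    unfolding sqnorm_def by (simp add: nn_integral_multc nn_integral_cmult ennreal_mult)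
  also have "... < \<infinity>" using U1 by (auto simp: sq_integrable_def ennreal_mult_less_top)
  finally have w: "sq_integrable ?M w" by (simp add: sq_integrable_def)
  define A where "A n = (\<lambda>(s, t). (ramp n s - 1) *\<^sub>R dquot U (s, t))" for n
  define B where "B n = (\<lambda>(s, t). ((ramp n s - ramp n t) / \<bar>s - t\<bar>) *\<^sub>R U t)" for n
  have dU[measurable]: "dquot U \<in> borel_measurable ?M" by measurable
  have Am[measurable]: "A n \<in> borel_measurable ?M" for n unfolding A_def by measurable
  have Bm[measurable]: "B n \<in> borel_measurable ?M" for n unfolding B_def by measurable
  have A: "(\<lambda>n. sqnorm ?M (A n)) ---> 0"
    by (rule sqnorm_dominated_convergence[OF _ U2, where C = 1])
       (use bd l0' in \<open>auto simp: A_def intro!: mult_left_le_one_le AE_I2\<close>)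
  have B: "(\<lambda>n. sqnorm ?M (B n)) ---> 0"
  proof (rule sqnorm_dominated_convergence[OF _ w, where C = 1])
    show "AE x in ?M. norm (B n x) <= 1 * norm (w x)" for n
    proof (intro AE_I2, clarify)
      fix s t :: real
      let ?r = "\<bar>s - t\<bar>"
      let ?q = "\<bar>ramp n s - ramp n t\<bar> / ?r"
      have q1: "?q <= 1"
      proof (cases "s = t")
        case False
        have "\<bar>ramp n s - ramp n t\<bar> <= ?r / (real n + 1)" by (rule ramp_Lipschitz)
        also have "... <= ?r" by (simp add: field_simps)
        finally show ?thesis using False by (simp add: field_simps)
      qed simp
      have q2: "?q * ?r <= 1" using ramp_bounds[of n s] ramp_bounds[of n t] by auto
      have "?q\<^sup>2 <= 1\<^sup>2" using q1 by (intro power_mono) auto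
      moreover have "(?q * ?r)\<^sup>2 <= 1\<^sup>2" using q2 by (intro power_mono) auto
      moreover have "?q\<^sup>2 * ((s - t)\<^sup>2 + 1\<^sup>2) = (?q * ?r)\<^sup>2 + ?q\<^sup>2"
        unfolding power_mult_distrib power2_abs by (simp only: distrib_left power_one mult_1_right)
      ultimately have "?q\<^sup>2 * ((s - t)\<^sup>2 + 1\<^sup>2) <= 2" unfolding power_one by linarith
      then have "?q\<^sup>2 <= 2 / ((s - t)\<^sup>2 + 1\<^sup>2)"
        by (subst pos_le_divide_eq) (auto intro: add_nonneg_pos)
      then have "?q <= sqrt (2 / ((s - t)\<^sup>2 + 1\<^sup>2))" by (rule real_le_rsqrt)
      then have "?q * norm (U t) <= sqrt (2 / ((s - t)\<^sup>2 + 1\<^sup>2)) * norm (U t)" by (rule mult_right_mono) simp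
      then show "norm (B n (s, t)) <= 1 * norm (w (s, t))"
        by (simp add: B_def w_def)
    qed
    show "AE x in ?M. (\<lambda>n. B n x) ---> 0"
    proof (intro AE_I2, clarify)
      fix s t :: real
      have "(\<lambda>n. ((ramp n s - ramp n t) / \<bar>s - t\<bar>) *\<^sub>R U t) ---> ((1 - 1) / \<bar>s - t\<bar>) *\<^sub>R U t"
        unfolding divide_inverse by (intro tendsto_intros ramp_tendsto_1)
      then show "(\<lambda>n. B n (s, t)) ---> 0" by (simp add: B_def)
    qed
  qed auto
  have split: "dquot (\<lambda>t. ramp n t *\<^sub>R U t - U t) = (\<lambda>x. A n x + B n x)" for n
  proof -
    have "(1 / r) *\<^sub>R (a *\<^sub>R x - b *\<^sub>R y) = a *\<^sub>R ((1 / r) *\<^sub>R (x - y)) + ((a - b) / r) *\<^sub>R y"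
      for a b r and x y :: 'h
      by (simp add: scaleR_diff_right scaleR_diff_left diff_divide_distrib)
    from this[of "\<bar>s - t\<bar>" "ramp n s - 1" "U s" "ramp n t - 1" "U t" for s t] show ?thesis
      by (auto simp: dquot_def A_def B_def eq)
  qed
  have "(\<lambda>n. 2 * sqnorm ?M (A n) + 2 * sqnorm ?M (B n)) ---> 2 * 0 + 2 * 0"
    by (intro tendsto_add ennreal_tendsto_cmult A B) auto
  then have l: "(\<lambda>n. 2 * sqnorm ?M (A n) + 2 * sqnorm ?M (B n)) ---> 0" by simp
  show "(\<lambda>n. sqnorm ?M (dquot (\<lambda>t. ramp n t *\<^sub>R U t - U t))) ---> 0"
    unfolding split
    by (rule tendsto_sandwich[OF _ _ tendsto_const l]) (auto intro!: always_eventually sqnorm_add)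
qed

text \<open>After a substitution the variable t occurs in the kernel only, so the convolutions of
  the fixed function W with smooth compactly supported kernels form a class closed under
  differentiation.\<close>

lemma mollify_smooth_compact:
  fixes W :: "real => 'h::{banach,second_countable_topology}"
  assumes \<rho>: "\<rho> \<in> smooth_compact" and W: "sq_integrable lborel W" and R: "\<And>t. \<bar>t\<bar> > R ==> W t = 0"
  shows "(\<lambda>t. LINT h|lborel. \<rho> h *\<^sub>R W (t - h)) \<in> smooth_compact"
    and "integrable lborel (\<lambda>h. \<rho> h *\<^sub>R W (t - h))"
proof -
  have [measurable]: "W \<in> borel_measurable borel" using W by (simp add: sq_integrable_def)
  have "sq_integrable lborel (\<lambda>r. W (- r))"
    using W nn_integral_real_affine[of "\<lambda>t. ennreal ((norm (W t))\<^sup>2)" "-1" 0]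
    by (simp add: sq_integrable_def sqnorm_def)
  from sq_integrable_set_integrable[OF this]
  have k: "set_integrable lborel {a..b} (\<lambda>r. W (- r))" for a b .
  have eq: "(LINT h|lborel. \<rho> h *\<^sub>R W (t - h)) = (LINT r|lborel. \<rho> (t + r) *\<^sub>R W (- r))" for \<rho> t
    by (subst lborel_integral_real_affine[where c = 1 and t = t]) auto
  show "(\<lambda>t. LINT h|lborel. \<rho> h *\<^sub>R W (t - h)) \<in> smooth_compact"
  proof (rule smooth_compactI[where S = "{\<lambda>t. LINT r|lborel. \<rho> (t + r) *\<^sub>R W (- r) | \<rho>. \<rho> \<in> smooth_compact}"])
    show "(\<lambda>t. LINT h|lborel. \<rho> h *\<^sub>R W (t - h)) \<in> {\<lambda>t. LINT r|lborel. \<rho> (t + r) *\<^sub>R W (- r) | \<rho>. \<rho> \<in> smooth_compact}"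
      unfolding eq using \<rho> by blast
    fix g assume "g \<in> {\<lambda>t. LINT r|lborel. \<rho> (t + r) *\<^sub>R W (- r) | \<rho>. \<rho> \<in> smooth_compact}"
    then obtain \<sigma> where g: "g = (\<lambda>t. LINT r|lborel. \<sigma> (t + r) *\<^sub>R W (- r))" and \<sigma>: "\<sigma> \<in> smooth_compact" by auto
    obtain \<sigma>' where \<sigma>': "\<sigma>' \<in> smooth_compact" "\<And>t. (\<sigma> has_vector_derivative \<sigma>' t) (at t)"
      using smooth_compact_deriv[OF \<sigma>] by metis
    show "\<exists>g'\<in>{\<lambda>t. LINT r|lborel. \<rho> (t + r) *\<^sub>R W (- r) | \<rho>. \<rho> \<in> smooth_compact}. \<forall>t. (g has_vector_derivative g' t) (at t)"
      unfolding g
      by (intro bexI[of _ "\<lambda>t. LINT r|lborel. \<sigma>' (t + r) *\<^sub>R W (- r)"] allI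
           has_vector_derivative_convolution(1)[OF bounded_bilinear_scaleR \<sigma> \<sigma>'(2) _ k]) (use \<sigma>' in auto)
  next
    obtain Q where Q: "Q > 0" "\<And>t. \<bar>t\<bar> > Q ==> \<rho> t = 0" using smooth_compact_bounded_support[OF \<rho>] by metis
    show "bounded {t. (LINT h|lborel. \<rho> h *\<^sub>R W (t - h)) \<noteq> 0}"
    proof (rule boundedI)
      fix t assume t: "t \<in> {t. (LINT h|lborel. \<rho> h *\<^sub>R W (t - h)) \<noteq> 0}"
      show "norm t <= Q + R"
      proof (rule ccontr)
        assume "\<not> norm t <= Q + R"
        then have "\<rho> h = 0 \<or> W (t - h) = 0" for h using Q(2)[of h] R[of "t - h"] by (cases "\<bar>h\<bar> > Q") auto
        then have "(\<lambda>h. \<rho> h *\<^sub>R W (t - h)) = (\<lambda>h. 0)" by (intro ext) auto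
        then have "(LINT h|lborel. \<rho> h *\<^sub>R W (t - h)) = 0" by (simp only: integral_zero)
        then show False using t by simp
      qed
    qed
  qed
  obtain \<rho>' where "\<And>t. (\<rho> has_vector_derivative \<rho>' t) (at t)" using smooth_compact_deriv[OF \<rho>] by metis
  from has_vector_derivative_convolution(2)[OF bounded_bilinear_scaleR \<rho> this _ k, of t]
  have "integrable lborel (\<lambda>r. \<rho> (t + 1 * r) *\<^sub>R W (t - (t + 1 * r)))" by simp
  then show "integrable lborel (\<lambda>h. \<rho> h *\<^sub>R W (t - h))"
    by (subst (asm) lborel_integrable_real_affine_iff[where f = "\<lambda>h. \<rho> h *\<^sub>R W (t - h)"]) auto
qed

text \<open>Cut off first, then mollify. Mollification commutes with \<open>dquot\<close> as an
  average of diagonal translations, so continuity of translations in L2 of the plane gives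
  convergence in the seminorm. The one-sided mollifier turns vanishing on the negative axis into a
  gap to the right of 0.\<close>

lemma half_sob_smooth_approx:
  fixes U :: "real => 'h::{banach,second_countable_topology}"
  assumes U: "half_sob U" and e: "e > 0"
  obtains \<phi> where "\<phi> \<in> smooth_compact" "sqnorm lborel (\<lambda>t. \<phi> t - U t) <= ennreal e"
    "sqnorm plane (dquot (\<lambda>t. \<phi> t - U t)) <= ennreal e"
    "(\<forall>t\<le>0. U t = 0) \<longrightarrow> \<phi> \<in> smooth_compact_0"
proof -
  let ?M = plane
  have [measurable]: "U \<in> borel_measurable borel" using U by (auto simp: half_sob_def sq_integrable_def)
  have "\<forall>\<^sub>F n in sequentially. sqnorm lborel (\<lambda>t. ramp n t *\<^sub>R U t - U t) < ennreal (e/4) \<and>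
     sqnorm ?M (dquot (\<lambda>t. ramp n t *\<^sub>R U t - U t)) < ennreal (e/4)"
    by (intro eventually_conj order_tendstoD(2)[OF ramp_approx(1)[OF U]] order_tendstoD(2)[OF ramp_approx(2)[OF U]])
       (use e in auto)
  then obtain n where n: "sqnorm lborel (\<lambda>t. ramp n t *\<^sub>R U t - U t) < ennreal (e/4)"
    "sqnorm ?M (dquot (\<lambda>t. ramp n t *\<^sub>R U t - U t)) < ennreal (e/4)"
    by (auto simp: eventually_sequentially)
  define W where "W t = ramp n t *\<^sub>R U t" for t
  have Wm[measurable]: "W \<in> borel_measurable borel" unfolding W_def by measurable
  have "half_sob (\<lambda>t. W t - U t)"
    using n by (auto simp: half_sob_def sq_integrable_def W_def simp del: dquot_diff intro: less_trans intro!: borel_measurable_dquot_lborel)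
  from half_sob_add[OF this U] have W: "half_sob W" by simp
  then have W1: "sq_integrable lborel W" and W2: "sq_integrable (lborel :: (real\<times>real) measure) (dquot W)"
    by (auto simp: half_sob_def lborel_prod)
  obtain d1 where d1: "d1 > 0" "\<And>h. norm h < d1 ==> sqnorm lborel (\<lambda>x. W (x - h) - W x) <= ennreal (e/4)"
    using sq_integrable_translation_small[OF W1, of "e/4"] e by auto
  obtain d2 where d2: "d2 > 0" "\<And>h. norm h < d2 ==> sqnorm lborel (\<lambda>x. dquot W (x - h) - dquot W x) <= ennreal (e/4)"
    using sq_integrable_translation_small[OF W2, of "e/4"] e by auto
  \<comment> \<open>The mollifier lives in (d, 2d) and the diagonal shift by h has norm at most
    2|h|, so all shifts that occur are shorter than 4d.\<close>
  define d where "d = min d1 d2 / 4"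
  have d: "d > 0" using d1 d2 by (simp add: d_def)
  obtain \<rho> :: "real => real" where \<rho>: "\<rho> \<in> smooth_compact" "\<And>t. 0 <= \<rho> t" "\<And>t. t \<notin> {d<..<2*d} ==> \<rho> t = 0"
      "integrable lborel \<rho>" "(LINT t|lborel. \<rho> t) = 1"
    using mollifier_exists[OF d] by metis
  define \<phi> where "\<phi> t = (LINT h|lborel. \<rho> h *\<^sub>R W (t - h))" for t
  have W0: "\<And>t. \<bar>t\<bar> > 2 * (real n + 1) ==> W t = 0" by (simp add: W_def ramp_eq_0)
  have \<phi>: "\<phi> \<in> smooth_compact" unfolding \<phi>_def by (rule mollify_smooth_compact(1)[OF \<rho>(1) W1 W0])
  have [measurable]: "\<phi> \<in> borel_measurable borel" by (rule smooth_compact_measurable[OF \<phi>])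
  have int: "integrable lborel (\<lambda>h. \<rho> h *\<^sub>R W (t - h))" for t by (rule mollify_smooth_compact(2)[OF \<rho>(1) W1 W0])
  have int': "integrable lborel (\<lambda>h. \<rho> h *\<^sub>R W t)" for t using \<rho>(4) by (rule integrable_scaleR_left)
  have diff: "\<phi> t - W t = (LINT h|lborel. \<rho> h *\<^sub>R (W (t - h) - W t))" for t
  proof -
    have "(LINT h|lborel. \<rho> h *\<^sub>R (W (t - h) - W t)) = (LINT h|lborel. \<rho> h *\<^sub>R W (t - h) - \<rho> h *\<^sub>R W t)"
      by (simp add: scaleR_diff_right)
    also have "... = \<phi> t - (LINT h|lborel. \<rho> h *\<^sub>R W t)" unfolding \<phi>_def by (rule Bochner_Integration.integral_diff[OF int int'])
    also have "(LINT h|lborel. \<rho> h *\<^sub>R W t) = W t" using \<rho>(4,5) by (subst integral_scaleR_left) auto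
    finally show ?thesis by simp
  qed
  have i3: "integrable lborel (\<lambda>h. \<rho> h *\<^sub>R (W (t - h) - W t))" for t
    using Bochner_Integration.integrable_diff[OF int[of t] int'[of t]] by (simp add: scaleR_diff_right)
  have qdiff: "dquot (\<lambda>t. \<phi> t - W t) x = (LINT h|lborel. \<rho> h *\<^sub>R (dquot W (x - h *\<^sub>R (1, 1)) - dquot W x))" for x
  proof -
    obtain s t where x: "x = (s, t)" by (cases x)
    have "dquot (\<lambda>t. \<phi> t - W t) x = (1 / \<bar>s - t\<bar>) *\<^sub>R ((LINT h|lborel. \<rho> h *\<^sub>R (W (s - h) - W s)) - (LINT h|lborel. \<rho> h *\<^sub>R (W (t - h) - W t)))"
      unfolding dquot_def x by (simp add: diff)
    also have "... = (LINT h|lborel. (1 / \<bar>s - t\<bar>) *\<^sub>R (\<rho> h *\<^sub>R (W (s - h) - W s) - \<rho> h *\<^sub>R (W (t - h) - W t)))"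
      using i3[of s] i3[of t] by simp
    also have "... = (LINT h|lborel. \<rho> h *\<^sub>R (dquot W (x - h *\<^sub>R (1, 1)) - dquot W x))"
      by (intro Bochner_Integration.integral_cong refl) (simp add: x dquot_def algebra_simps)
    finally show ?thesis .
  qed
  have s1: "sqnorm lborel (\<lambda>t. \<phi> t - W t) <= ennreal (e/4)"
    unfolding diff
  proof (rule sqnorm_mollify_diff[where v = "1::real", simplified, OF Wm \<rho>(2) \<rho>(4) \<rho>(5)])
    fix h assume "\<rho> h \<noteq> 0"
    then have "h \<in> {d<..<2*d}" using \<rho>(3) by blast
    then show "sqnorm lborel (\<lambda>x. W (x - h) - W x) <= ennreal (e/4)"
      using d by (intro d1(2)) (auto simp: d_def)
  qed
  have [measurable]: "dquot W \<in> borel_measurable borel" using W2 by (simp add: sq_integrable_def)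
  have s2: "sqnorm ?M (dquot (\<lambda>t. \<phi> t - W t)) <= ennreal (e/4)"
    unfolding qdiff lborel_prod
  proof (rule sqnorm_mollify_diff[OF _ \<rho>(2) \<rho>(4) \<rho>(5)])
    fix h assume "\<rho> h \<noteq> 0"
    then have h: "h \<in> {d<..<2*d}" using \<rho>(3) by blast
    have "norm (h *\<^sub>R (1::real, 1::real)) <= 2 * \<bar>h\<bar>"
    proof -
      have "norm (1::real, 1::real) <= 2" by (simp add: norm_prod_def real_le_lsqrt)
      then have "\<bar>h\<bar> * norm (1::real, 1::real) <= \<bar>h\<bar> * 2" by (intro mult_left_mono) auto
      then show ?thesis by (simp only: norm_scaleR real_norm_def mult.commute)
    qed
    also have "... < d2" using h d by (auto simp: d_def)
    finally show "sqnorm lborel (\<lambda>x. dquot W (x - h *\<^sub>R (1, 1)) - dquot W x) <= ennreal (e/4)"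
      by (rule d2(2))
  qed auto
  have comb: "2 * ennreal (e/4) + 2 * ennreal (e/4) = ennreal e"
    using e by (simp add: ennreal_mult'[symmetric] ennreal_plus[symmetric] flip: ennreal_numeral del: ennreal_numeral ennreal_plus)
  have "sqnorm lborel (\<lambda>t. \<phi> t - U t) = sqnorm lborel (\<lambda>t. (\<phi> t - W t) + (W t - U t))" by simp
  also have "... <= 2 * sqnorm lborel (\<lambda>t. \<phi> t - W t) + 2 * sqnorm lborel (\<lambda>t. W t - U t)"
    by (rule sqnorm_add) auto
  also have "... <= 2 * ennreal (e/4) + 2 * ennreal (e/4)"
    using s1 n(1) by (intro add_mono mult_left_mono) (auto simp: W_def)
  finally have r1: "sqnorm lborel (\<lambda>t. \<phi> t - U t) <= ennreal e" using comb by simp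
  have "sqnorm ?M (dquot (\<lambda>t. \<phi> t - U t)) = sqnorm ?M (\<lambda>x. dquot (\<lambda>t. \<phi> t - W t) x + dquot (\<lambda>t. W t - U t) x)"
    by (simp add: dquot_diff)
  also have "... <= 2 * sqnorm ?M (dquot (\<lambda>t. \<phi> t - W t)) + 2 * sqnorm ?M (dquot (\<lambda>t. W t - U t))"
    by (rule sqnorm_add) measurable
  also have "... <= 2 * ennreal (e/4) + 2 * ennreal (e/4)"
    using s2 n(2) by (intro add_mono mult_left_mono) (auto simp: W_def)
  finally have r2: "sqnorm ?M (dquot (\<lambda>t. \<phi> t - U t)) <= ennreal e" using comb by simp
  have r3: "\<phi> \<in> smooth_compact_0" if U0: "\<forall>t\<le>0. U t = 0"
    unfolding smooth_compact_0_iff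
  proof (intro conjI \<phi> exI[of _ d] allI impI d)
    fix t assume t: "t < d"
    have "\<rho> h *\<^sub>R W (t - h) = 0" for h
      using \<rho>(3)[of h] t U0 by (cases "h \<in> {d<..<2*d}") (auto simp: W_def)
    then have "(\<lambda>h. \<rho> h *\<^sub>R W (t - h)) = (\<lambda>h. 0)" by (intro ext)
    then show "\<phi> t = 0" unfolding \<phi>_def by (simp only: integral_zero)
  qed
  show thesis using that[OF \<phi> r1 r2] r3 by blast
qed

subsection \<open>The regularised logarithmic kernel\<close>

text \<open>Each of the next three kernels is the derivative of the one before.\<close>

definition log_kernel :: "real => real => real" where
  "log_kernel eps r = - ln (r\<^sup>2 + eps\<^sup>2) / 2"

definition conj_kernel :: "real => real => real" where
  "conj_kernel eps r = - r / (r\<^sup>2 + eps\<^sup>2)"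

definition energy_kernel :: "real => real => real" where
  "energy_kernel eps r = (r\<^sup>2 - eps\<^sup>2) / (r\<^sup>2 + eps\<^sup>2)\<^sup>2"

lemma sq_plus_sq_pos: "(eps::real) > 0 ==> r\<^sup>2 + eps\<^sup>2 > 0"
  by (intro add_nonneg_pos) auto

lemma borel_measurable_kernels[measurable]:
  "log_kernel eps \<in> borel_measurable borel" "conj_kernel eps \<in> borel_measurable borel"
  "energy_kernel eps \<in> borel_measurable borel"
  unfolding log_kernel_def conj_kernel_def energy_kernel_def by measurable

lemma log_kernel_deriv: "eps > 0 ==> (log_kernel eps has_real_derivative conj_kernel eps r) (at r)"
proof -
  assume "eps > 0"
  then have p: "r\<^sup>2 + eps\<^sup>2 > 0" by (rule sq_plus_sq_pos)
  have "((\<lambda>r. r\<^sup>2 + eps\<^sup>2) has_real_derivative 2 * r) (at r)" by (auto intro!: derivative_eq_intros)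
  from DERIV_cdivide[OF DERIV_minus[OF DERIV_chain2[OF DERIV_ln_divide[OF p] this]], of 2]
  have "((\<lambda>r. - ln (r\<^sup>2 + eps\<^sup>2) / 2) has_real_derivative - (1 / (r\<^sup>2 + eps\<^sup>2) * (2 * r)) / 2) (at r)" .
  moreover have "- (1 / (r\<^sup>2 + eps\<^sup>2) * (2 * r)) / 2 = conj_kernel eps r"
  proof -
    have "- (1 / P * (2 * r)) / 2 = - r / P" for P :: real by simp
    then show ?thesis by (simp only: conj_kernel_def)
  qed
  ultimately show ?thesis unfolding log_kernel_def by simp
qed

lemma conj_kernel_deriv:
  assumes "eps > 0"
  shows "(conj_kernel eps has_real_derivative energy_kernel eps r) (at r)"
proof -
  have p: "r\<^sup>2 + eps\<^sup>2 \<noteq> 0" using sq_plus_sq_pos[OF assms, of r] by (rule less_imp_neq[symmetric])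
  have "(conj_kernel eps has_real_derivative ((-1) * (r\<^sup>2 + eps\<^sup>2) - (- r) * (2 * r)) / ((r\<^sup>2 + eps\<^sup>2) * (r\<^sup>2 + eps\<^sup>2))) (at r)"
    unfolding conj_kernel_def
    by (intro DERIV_divide p) (auto intro!: derivative_eq_intros)
  moreover have "((-1) * (r\<^sup>2 + eps\<^sup>2) - (- r) * (2 * r)) / ((r\<^sup>2 + eps\<^sup>2) * (r\<^sup>2 + eps\<^sup>2)) = energy_kernel eps r"
    unfolding energy_kernel_def by (simp add: power2_eq_square algebra_simps)
  ultimately show ?thesis by simp
qed

lemma conj_kernel_odd: "conj_kernel eps (- r) = - conj_kernel eps r"
  by (simp add: conj_kernel_def)

lemma energy_kernel_abs_le:
  assumes "eps > 0"
  shows "\<bar>energy_kernel eps r\<bar> <= 1 / (r\<^sup>2 + eps\<^sup>2)"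
proof -
  have p: "r\<^sup>2 + eps\<^sup>2 > 0" by (rule sq_plus_sq_pos[OF assms])
  have "\<bar>r\<^sup>2 - eps\<^sup>2\<bar> <= r\<^sup>2 + eps\<^sup>2" by (simp add: abs_le_iff)
  then have "\<bar>energy_kernel eps r\<bar> <= (r\<^sup>2 + eps\<^sup>2) / (r\<^sup>2 + eps\<^sup>2)\<^sup>2"
    unfolding energy_kernel_def by (simp add: divide_right_mono)
  also have "... = 1 / (r\<^sup>2 + eps\<^sup>2)" using p by (simp add: power2_eq_square)
  finally show ?thesis .
qed

lemma energy_kernel_continuous: "eps > 0 ==> isCont (energy_kernel eps) r"
  unfolding energy_kernel_def[abs_def] using sq_plus_sq_pos[of eps r] by (intro continuous_intros) auto

lemma conj_kernel_continuous: "eps > 0 ==> isCont (conj_kernel eps) r"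
  using conj_kernel_deriv DERIV_isCont by blast

lemma integrable_Poisson: "eps > 0 ==> integrable lborel (\<lambda>r. 1 / (r\<^sup>2 + eps\<^sup>2) :: real)"
  by (rule integrableI_nonneg) (auto simp: nn_integral_Poisson sq_plus_sq_pos less_imp_le)

lemma integrable_energy_kernel: "eps > 0 ==> integrable lborel (energy_kernel eps)"
  by (rule Bochner_Integration.integrable_bound[OF integrable_Poisson[of eps]])
     (auto simp: energy_kernel_abs_le abs_of_nonneg sq_plus_sq_pos less_imp_le intro!: AE_I2)

text \<open>The antiderivative \<open>conj_kernel\<close> vanishes at both ends. This zero mean is
  what turns the quadratic form of the kernel into one in differences, that is, into a Gagliardo
  seminorm.\<close>

lemma integral_energy_kernel:
  assumes e: "eps > 0"
  shows "(LINT r|lborel. energy_kernel eps r) = 0"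
proof -
  have c0: "((\<lambda>r. conj_kernel eps r) \<longlongrightarrow> 0) at_top"
  proof (rule Lim_null_comparison)
    show "\<forall>\<^sub>F r in at_top. norm (conj_kernel eps r) <= inverse r"
      using eventually_gt_at_top[of 0]
    proof eventually_elim
      case (elim r)
      have "r / (r\<^sup>2 + eps\<^sup>2) <= r / r\<^sup>2" using elim sq_plus_sq_pos[OF e, of r] by (intro divide_left_mono mult_pos_pos) auto
      then show ?case using elim sq_plus_sq_pos[OF e, of r]
        by (simp add: conj_kernel_def abs_div power2_eq_square inverse_eq_divide)
    qed
    show "(inverse \<longlongrightarrow> (0::real)) at_top" by (rule tendsto_inverse_0_at_top) (rule filterlim_ident)
  qed
  have "(LBINT x=-\<infinity>..\<infinity>. energy_kernel eps x) = 0 - 0"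
  proof (rule interval_integral_FTC_integrable[where F = "conj_kernel eps"])
    show "(conj_kernel eps has_vector_derivative energy_kernel eps x) (at x)" for x
      using conj_kernel_deriv[OF e] by (simp add: has_real_derivative_iff_has_vector_derivative)
    show "set_integrable lborel (einterval (- \<infinity>) \<infinity>) (energy_kernel eps)"
      unfolding set_integrable_def using integrable_energy_kernel[OF e] by simp
    show "((conj_kernel eps \<circ> real_of_ereal) \<longlongrightarrow> 0) (at_left \<infinity>)"
      unfolding ereal_tendsto_simps using c0 .
    have "((\<lambda>r. - conj_kernel eps r) \<longlongrightarrow> - 0) at_top" by (intro tendsto_minus c0)
    then have "(conj_kernel eps \<longlongrightarrow> 0) at_bot"
      by (simp add: filterlim_at_bot_mirror conj_kernel_odd)
    then show "((conj_kernel eps \<circ> real_of_ereal) \<longlongrightarrow> 0) (at_right (-\<infinity>))"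
      unfolding ereal_tendsto_simps .
  qed (use energy_kernel_continuous[OF e] in auto)
  then show ?thesis by (simp add: interval_lebesgue_integral_def set_lebesgue_integral_def)
qed

subsection \<open>Integral forms of compactly supported functions\<close>

lemma bounded_compact_integrable:
  fixes f :: "real => 'h::{banach,second_countable_topology}" and k :: "real => real"
  assumes [measurable]: "f \<in> borel_measurable borel" and B: "\<And>t. norm (f t) <= B"
    and R: "\<And>t. \<bar>t\<bar> > R ==> f t = 0"
    and [measurable]: "k \<in> borel_measurable borel" and k: "set_integrable lborel {-R..R} k"
  shows "integrable lborel (\<lambda>t. k t *\<^sub>R f t)"
proof (rule Bochner_Integration.integrable_bound)
  show "integrable lborel (\<lambda>t. B * norm (indicator {-R..R} t *\<^sub>R k t))"
    using k unfolding set_integrable_def by (intro integrable_mult_right integrable_norm)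
  show "AE t in lborel. norm (k t *\<^sub>R f t) <= norm (B * norm (indicator {-R..R} t *\<^sub>R k t))"
  proof (intro AE_I2)
    fix t
    have "B >= 0" using B[of 0] norm_ge_zero order_trans by blast
    show "norm (k t *\<^sub>R f t) <= norm (B * norm (indicator {-R..R} t *\<^sub>R k t))"
    proof (cases "\<bar>t\<bar> > R")
      case False
      then have "t \<in> {-R..R}" by auto
      then show ?thesis using mult_right_mono[OF B[of t], of "\<bar>k t\<bar>"] \<open>B >= 0\<close> by (simp add: abs_mult mult.commute)
    qed (simp add: R)
  qed
qed auto

lemma set_integrable_continuous:
  fixes k :: "real => real"
  assumes "\<And>t. isCont k t"
  shows "set_integrable lborel {a..b} k"
  by (rule borel_integrable_atLeastAtMost'[OF continuous_at_imp_continuous_on]) (use assms in auto)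

lemma integral_inner_product:
  fixes u v :: "real => 'h::{real_inner,banach,second_countable_topology}"
  assumes u: "integrable lborel u" and v: "integrable lborel v"
  shows "integrable plane (\<lambda>(s, t). u s \<bullet> v t)"
    and "(LINT x|plane. (\<lambda>(s, t). u s \<bullet> v t) x) = (LINT s|lborel. u s) \<bullet> (LINT t|lborel. v t)"
proof -
  have [measurable]: "u \<in> borel_measurable borel" "v \<in> borel_measurable borel" using u v by auto
  have "(\<integral>\<^sup>+x. ennreal (norm ((\<lambda>(s, t). u s \<bullet> v t) x)) \<partial>plane) <= (\<integral>\<^sup>+x. (\<lambda>(s, t). ennreal (norm (u s)) * ennreal (norm (v t))) x \<partial>plane)"
    by (intro nn_integral_mono) (auto simp: ennreal_mult[symmetric] Cauchy_Schwarz_ineq2 intro!: ennreal_leI)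
  also have "... = (\<integral>\<^sup>+s. \<integral>\<^sup>+t. ennreal (norm (u s)) * ennreal (norm (v t)) \<partial>lborel \<partial>lborel)"
    by (subst lborel.nn_integral_fst[symmetric]) auto
  also have "... = (\<integral>\<^sup>+s. ennreal (norm (u s)) \<partial>lborel) * (\<integral>\<^sup>+t. ennreal (norm (v t)) \<partial>lborel)"
    by (simp add: nn_integral_cmult nn_integral_multc)
  also have "... < \<infinity>" using u v by (simp add: integrable_iff_bounded ennreal_mult_less_top)
  finally show i: "integrable plane (\<lambda>(s, t). u s \<bullet> v t)"
    by (intro integrableI_bounded) auto
  have "(LINT x|plane. (\<lambda>(s, t). u s \<bullet> v t) x) = (LINT s|lborel. LINT t|lborel. u s \<bullet> v t)"
    using lborel_pair.integral_fst'[OF i] by simp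
  also have "... = (LINT s|lborel. u s) \<bullet> (LINT t|lborel. v t)"
    using u v by simp
  finally show "(LINT x|plane. (\<lambda>(s, t). u s \<bullet> v t) x) = (LINT s|lborel. u s) \<bullet> (LINT t|lborel. v t)" .
qed

text \<open>Compact supports confine s - t to \<open>{-2*R..2*R}\<close>, on which a continuous
  kernel is bounded; Fubini then identifies both iterated forms with the double integral.\<close>

lemma kernel_form:
  fixes f g :: "real => 'h::{real_inner,banach,second_countable_topology}" and J :: "real => real"
  assumes [measurable]: "f \<in> borel_measurable borel" "g \<in> borel_measurable borel"
    and f: "\<And>t. norm (f t) <= B" "\<And>t. \<bar>t\<bar> > R ==> f t = 0"
    and g: "\<And>t. norm (g t) <= B" "\<And>t. \<bar>t\<bar> > R ==> g t = 0"
    and J: "\<And>r. isCont J r"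
  shows "integrable plane (\<lambda>(s, t). J (s - t) * (f s \<bullet> g t))"
    and "(LINT t|lborel. (LINT s|lborel. J (s - t) *\<^sub>R f s) \<bullet> g t) = (LINT x|plane. (\<lambda>(s, t). J (s - t) * (f s \<bullet> g t)) x)"
    and "(LINT s|lborel. f s \<bullet> (LINT t|lborel. J (s - t) *\<^sub>R g t)) = (LINT x|plane. (\<lambda>(s, t). J (s - t) * (f s \<bullet> g t)) x)"
    and "integrable lborel (\<lambda>s. J (s - t) *\<^sub>R f s)"
proof -
  let ?M = plane and ?F = "\<lambda>(s, t). J (s - t) * (f s \<bullet> g t)"
  have Jm[measurable]: "J \<in> borel_measurable borel"
    by (rule borel_measurable_continuous_onI) (use J continuous_at_imp_continuous_on in blast)
  have fi: "integrable lborel f" and gi: "integrable lborel g"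
    using bounded_compact_integrable[of f B R "\<lambda>_. 1"] bounded_compact_integrable[of g B R "\<lambda>_. 1"] f g
    by (auto simp: set_integrable_continuous)
  have "compact (J ` {-2*R..2*R})" by (intro compact_continuous_image continuous_at_imp_continuous_on) (use J in auto)
  then obtain C where C: "C > 0" "\<And>r. r \<in> {-2*R..2*R} ==> norm (J r) <= C"
    by (auto dest!: compact_imp_bounded simp: bounded_pos)
  have "integrable lborel (\<lambda>t. norm (f t))" "integrable lborel (\<lambda>t. norm (g t))" using fi gi by auto
  from integral_inner_product(1)[OF this]
  have i: "integrable ?M (\<lambda>(s, t). norm (f s) * norm (g t))" by simp
  show I: "integrable ?M ?F"
  proof (rule Bochner_Integration.integrable_bound[of _ "\<lambda>x. C * (\<lambda>(s, t). norm (f s) * norm (g t)) x"])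
    show "AE x in ?M. norm (?F x) <= norm (C * (\<lambda>(s, t). norm (f s) * norm (g t)) x)"
    proof (intro AE_I2)
      fix x :: "real \<times> real"
      obtain s t where x: "x = (s, t)" by (cases x)
      show "norm (?F x) <= norm (C * (\<lambda>(s, t). norm (f s) * norm (g t)) x)"
      proof (cases "\<bar>s\<bar> > R \<or> \<bar>t\<bar> > R")
        case False
        then have "norm (J (s - t)) <= C" by (intro C) auto
        then have "\<bar>J (s - t)\<bar> * \<bar>f s \<bullet> g t\<bar> <= C * (norm (f s) * norm (g t))"
          by (intro mult_mono Cauchy_Schwarz_ineq2) (use C in auto)
        then show ?thesis using C by (simp add: abs_mult x)
      qed (use f g x in auto)
    qed
  qed (use i in auto)
  have kf: "integrable lborel (\<lambda>s. J (s - t) *\<^sub>R f s)" for t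
    by (rule bounded_compact_integrable[OF _ f]) (auto intro!: set_integrable_continuous isCont_o2[OF _ J])
  then show "integrable lborel (\<lambda>s. J (s - t) *\<^sub>R f s)" .
  have kg: "integrable lborel (\<lambda>t. J (s - t) *\<^sub>R g t)" for s
    by (rule bounded_compact_integrable[OF _ g]) (auto intro!: set_integrable_continuous isCont_o2[OF _ J])
  have "(LINT t|lborel. (LINT s|lborel. J (s - t) *\<^sub>R f s) \<bullet> g t) = (LINT t|lborel. LINT s|lborel. J (s - t) * (f s \<bullet> g t))"
    by (intro Bochner_Integration.integral_cong refl) (use kf in \<open>simp flip: integral_inner_left\<close>)
  also have "... = (LINT x|?M. ?F x)"
    using lborel_pair.integral_snd[of "\<lambda>s t. J (s - t) * (f s \<bullet> g t)"] I by simp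
  finally show "(LINT t|lborel. (LINT s|lborel. J (s - t) *\<^sub>R f s) \<bullet> g t) = (LINT x|?M. ?F x)" .
  have "(LINT s|lborel. f s \<bullet> (LINT t|lborel. J (s - t) *\<^sub>R g t)) = (LINT s|lborel. LINT t|lborel. J (s - t) * (f s \<bullet> g t))"
    by (intro Bochner_Integration.integral_cong refl) (use kg in \<open>simp flip: integral_inner_right\<close>)
  also have "... = (LINT x|?M. ?F x)"
    using lborel_pair.integral_fst'[OF I] by simp
  finally show "(LINT s|lborel. f s \<bullet> (LINT t|lborel. J (s - t) *\<^sub>R g t)) = (LINT x|?M. ?F x)" .
qed

text \<open>The exceptional set admits the even reflection of a smooth function, whose derivative jumps at \<open>0\<close>.\<close>

locale compact_primitive =
  fixes \<Phi> \<psi> :: "real => 'h::{real_inner,banach,second_countable_topology}" and S :: "real set" and R B :: real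
  assumes fin: "finite S" and cont: "continuous_on UNIV \<Phi>" and meas[measurable]: "\<psi> \<in> borel_measurable borel"
    and bound: "\<And>t. norm (\<Phi> t) <= B" "\<And>t. norm (\<psi> t) <= B"
    and supp: "\<And>t. \<bar>t\<bar> > R ==> \<Phi> t = 0" "\<And>t. \<bar>t\<bar> > R ==> \<psi> t = 0"
    and deriv: "\<And>t. t \<notin> S ==> (\<Phi> has_vector_derivative \<psi> t) (at t)"
    and R: "R > 0"
begin

lemma meas\<Phi>[measurable]: "\<Phi> \<in> borel_measurable borel"
  by (rule borel_measurable_continuous_onI) (rule cont)

lemma integrable_mult_continuous:
  assumes "\<And>r. isCont (J::real=>real) r"
  shows "integrable lborel (\<lambda>s. J s *\<^sub>R \<psi> s)" "integrable lborel (\<lambda>s. J s *\<^sub>R \<Phi> s)"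
proof -
  have [measurable]: "J \<in> borel_measurable borel"
    by (rule borel_measurable_continuous_onI) (use assms continuous_at_imp_continuous_on in blast)
  show "integrable lborel (\<lambda>s. J s *\<^sub>R \<psi> s)" "integrable lborel (\<lambda>s. J s *\<^sub>R \<Phi> s)"
    by (rule bounded_compact_integrable[OF _ bound(2) supp(2)], use assms in \<open>auto intro: set_integrable_continuous\<close>)
       (rule bounded_compact_integrable[OF _ bound(1) supp(1)], use assms in \<open>auto intro: set_integrable_continuous\<close>)
qed

text \<open>Testing against every vector y reduces the claim to the scalar fundamental theorem, in
  the version that tolerates a finite exceptional set. The interval exceeds the support by 1, so the
  boundary terms vanish.\<close>

lemma integral_by_parts:
  assumes J: "\<And>r. (J has_real_derivative J' r) (at r)" and J': "\<And>r. isCont J' r"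
  shows "(LINT s|lborel. J s *\<^sub>R \<psi> s) = - (LINT s|lborel. J' s *\<^sub>R \<Phi> s)"
proof -
  have Jc: "isCont J r" for r using J DERIV_isCont by blast
  note i = integrable_mult_continuous(1)[OF Jc] integrable_mult_continuous(2)[OF J']
  have "y \<bullet> ((LINT s|lborel. J s *\<^sub>R \<psi> s) + (LINT s|lborel. J' s *\<^sub>R \<Phi> s)) = 0" for y
  proof -
    let ?f = "\<lambda>s. J s * (\<Phi> s \<bullet> y)" and ?f' = "\<lambda>s. J s * (\<psi> s \<bullet> y) + J' s * (\<Phi> s \<bullet> y)"
    have "(?f' has_integral (?f (R + 1) - ?f (- (R + 1)))) {- (R + 1)..R + 1}"
    proof (rule fundamental_theorem_of_calculus_interior_strong[OF fin])
      fix x assume "x \<in> {- (R + 1)<..<R + 1} - S"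
      then have "(\<Phi> has_vector_derivative \<psi> x) (at x)" using deriv by auto
      then have "((\<lambda>s. \<Phi> s \<bullet> y) has_real_derivative \<psi> x \<bullet> y) (at x)"
        unfolding has_real_derivative_iff_has_vector_derivative
        by (rule bounded_linear.has_vector_derivative[OF bounded_linear_inner_left])
      from DERIV_mult'[OF J this]
      show "(?f has_vector_derivative ?f' x) (at x)"
        by (simp add: has_real_derivative_iff_has_vector_derivative)
    next
      show "continuous_on {- (R + 1)..R + 1} ?f"
        by (intro continuous_intros continuous_on_subset[OF cont] continuous_at_imp_continuous_on) (use Jc in auto)
    qed (use R in auto)
    then have "(?f' has_integral 0) {- (R + 1)..R + 1}" using supp by simp
    then have "((\<lambda>x. if x \<in> {- (R + 1)..R + 1} then ?f' x else 0) has_integral 0) UNIV"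
      by (simp only: has_integral_restrict_UNIV)
    moreover have "(\<lambda>x. if x \<in> {- (R + 1)..R + 1} then ?f' x else 0) = ?f'"
      using supp by (auto simp: fun_eq_iff)
    ultimately have 1: "(?f' has_integral 0) UNIV" by simp
    have eq: "?f' = (\<lambda>s. (J s *\<^sub>R \<psi> s) \<bullet> y + (J' s *\<^sub>R \<Phi> s) \<bullet> y)" by auto
    have "integrable lborel ?f'" unfolding eq using i by (intro Bochner_Integration.integrable_add integrable_inner_left) auto
    from has_integral_integral_lborel[OF this] 1 have "(LINT s|lborel. ?f' s) = 0"
      by (rule has_integral_unique)
    moreover have "(LINT s|lborel. ?f' s) = (LINT s|lborel. J s *\<^sub>R \<psi> s) \<bullet> y + (LINT s|lborel. J' s *\<^sub>R \<Phi> s) \<bullet> y"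
      unfolding eq using i by (subst Bochner_Integration.integral_add) (auto simp del: inner_scaleR_left)
    ultimately show ?thesis by (simp only: inner_add_right inner_commute[of y])
  qed
  then have "(LINT s|lborel. J s *\<^sub>R \<psi> s) + (LINT s|lborel. J' s *\<^sub>R \<Phi> s) = 0"
    using inner_eq_zero_iff by blast
  then show ?thesis by (simp add: eq_neg_iff_add_eq_0)
qed

lemma integral_tail: "(LINT s|lborel. indicator {t<..} s *\<^sub>R \<psi> s) = - \<Phi> t"
proof -
  have i: "integrable lborel (\<lambda>s. indicator {t<..} s *\<^sub>R \<psi> s)"
    using integrable_mult_continuous(1)[of "\<lambda>_. 1"] integrable_mult_indicator[of "{t<..}" lborel \<psi>] by simp
  have "y \<bullet> ((LINT s|lborel. indicator {t<..} s *\<^sub>R \<psi> s) + \<Phi> t) = 0" for y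
  proof -
    define b where "b = max t R + 1"
    have b: "t <= b" "\<bar>b\<bar> > R" using R by (auto simp: b_def)
    have "((\<lambda>s. \<psi> s \<bullet> y) has_integral (\<Phi> b \<bullet> y - \<Phi> t \<bullet> y)) {t..b}"
    proof (rule fundamental_theorem_of_calculus_interior_strong[OF fin b(1)])
      fix x assume "x \<in> {t<..<b} - S"
      then have "(\<Phi> has_vector_derivative \<psi> x) (at x)" using deriv by auto
      then show "((\<lambda>s. \<Phi> s \<bullet> y) has_vector_derivative \<psi> x \<bullet> y) (at x)"
        by (rule bounded_linear.has_vector_derivative[OF bounded_linear_inner_left])
    qed (intro continuous_intros continuous_on_subset[OF cont], auto)
    then have "((\<lambda>s. if s \<in> {t..b} then \<psi> s \<bullet> y else 0) has_integral (- (\<Phi> t \<bullet> y))) UNIV"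
      using supp(1)[OF b(2)] by (simp only: has_integral_restrict_UNIV) simp
    then have "((\<lambda>s. (indicator {t<..} s *\<^sub>R \<psi> s) \<bullet> y) has_integral (- (\<Phi> t \<bullet> y))) UNIV"
    proof (rule has_integral_spike_finite[of "{t}", rotated 2])
      fix x assume x: "x \<in> UNIV - {t}"
      show "(indicator {t<..} x *\<^sub>R \<psi> x) \<bullet> y = (if x \<in> {t..b} then \<psi> x \<bullet> y else 0)"
      proof (cases "x > b")
        case True
        then have "\<bar>x\<bar> > R" by (auto simp: b_def)
        then show ?thesis using True by (simp add: supp)
      qed (use x in \<open>auto simp: indicator_def\<close>)
    qed auto
    moreover have "((\<lambda>s. (indicator {t<..} s *\<^sub>R \<psi> s) \<bullet> y) has_integral (LINT s|lborel. indicator {t<..} s *\<^sub>R \<psi> s) \<bullet> y) UNIV"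
      using has_integral_integral_lborel[OF integrable_inner_left[OF i, of y]] i by (simp del: inner_scaleR_left)
    ultimately have "(LINT s|lborel. indicator {t<..} s *\<^sub>R \<psi> s) \<bullet> y = - (\<Phi> t \<bullet> y)"
      using has_integral_unique by blast
    then show ?thesis by (simp add: inner_add_right inner_commute)
  qed
  then have "(LINT s|lborel. indicator {t<..} s *\<^sub>R \<psi> s) + \<Phi> t = 0"
    using inner_eq_zero_iff by blast
  then show ?thesis by (simp add: eq_neg_iff_add_eq_0)
qed

text \<open>Integration by parts against the constant 1. This mean value zero later annihilates the
  divergent constant in the truncated half-order kernel.\<close>

lemma integral_deriv_0: "(LINT s|lborel. \<psi> s) = 0"
  using integral_by_parts[of "\<lambda>_. 1" "\<lambda>_. 0"] by simp

text \<open>Polarisation replaces twice the inner product by two squares minus the squared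
  difference. The two square terms drop out as the kernel has zero mean. The remaining weight, the
  kernel times \<open>(s - t)^2\<close>, is at most 1 and tends to 1 off the diagonal as eps tends
  to 0.\<close>

lemma energy_kernel_form:
  assumes e: "eps > 0"
  shows "- (LINT x|plane. (\<lambda>(s, t). energy_kernel eps (s - t) * (\<Phi> s \<bullet> \<Phi> t)) x) =
     (LINT x|plane. energy_kernel eps (fst x - snd x) * (fst x - snd x)\<^sup>2 * (norm (dquot \<Phi> x))\<^sup>2) / 2"
    (is "- (LINT x|?M. ?F x) = (LINT x|?M. ?G x) / 2")
proof -
  let ?K = "energy_kernel eps"
  have i\<Phi>: "integrable lborel (\<lambda>t. (norm (\<Phi> t))\<^sup>2)"
  proof -
    have "integrable lborel (\<lambda>t. (1::real) *\<^sub>R ((norm (\<Phi> t))\<^sup>2))"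
      by (rule bounded_compact_integrable[where B = "B\<^sup>2" and R = R])
         (use bound supp in \<open>auto intro!: power_mono set_integrable_continuous\<close>)
    then show ?thesis by simp
  qed
  have Kf0: "(LINT s|lborel. ?K (s - t)) = 0" for t
    using lborel_integral_real_affine[of 1 ?K "-t"] integral_energy_kernel[OF e] by simp
  have Keven: "?K (- r) = ?K r" for r by (simp add: energy_kernel_def)
  have i1: "integrable ?M (\<lambda>(s, t). ?K (s - t) * (norm (\<Phi> t))\<^sup>2)"
  proof (rule integrableI_bounded)
    have "(\<integral>\<^sup>+x. ennreal (norm ((\<lambda>(s, t). ?K (s - t) * (norm (\<Phi> t))\<^sup>2) x)) \<partial>?M)
      = (\<integral>\<^sup>+t. \<integral>\<^sup>+s. ennreal (norm (?K (s - t) * (norm (\<Phi> t))\<^sup>2)) \<partial>lborel \<partial>lborel)"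
      by (subst lborel_pair.nn_integral_snd[symmetric]) auto
    also have "... = (\<integral>\<^sup>+t. ennreal ((norm (\<Phi> t))\<^sup>2) * (\<integral>\<^sup>+s. ennreal \<bar>?K s\<bar> \<partial>lborel) \<partial>lborel)"
    proof (intro nn_integral_cong)
      fix t
      have "(\<integral>\<^sup>+s. ennreal (norm (?K (s - t) * (norm (\<Phi> t))\<^sup>2)) \<partial>lborel) = (\<integral>\<^sup>+s. ennreal ((norm (\<Phi> t))\<^sup>2) * ennreal \<bar>?K (s - t)\<bar> \<partial>lborel)"
        by (intro nn_integral_cong) (simp add: abs_mult ennreal_mult[symmetric] mult.commute)
      also have "... = ennreal ((norm (\<Phi> t))\<^sup>2) * (\<integral>\<^sup>+s. ennreal \<bar>?K (s - t)\<bar> \<partial>lborel)"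
        by (rule nn_integral_cmult) auto
      also have "(\<integral>\<^sup>+s. ennreal \<bar>?K (s - t)\<bar> \<partial>lborel) = (\<integral>\<^sup>+s. ennreal \<bar>?K s\<bar> \<partial>lborel)"
        using nn_integral_lborel_translate[of "\<lambda>s. ennreal \<bar>?K s\<bar>" "-t"] by simp
      finally show "(\<integral>\<^sup>+s. ennreal (norm (?K (s - t) * (norm (\<Phi> t))\<^sup>2)) \<partial>lborel) = ennreal ((norm (\<Phi> t))\<^sup>2) * (\<integral>\<^sup>+s. ennreal \<bar>?K s\<bar> \<partial>lborel)" .
    qed
    also have "... = (\<integral>\<^sup>+t. ennreal ((norm (\<Phi> t))\<^sup>2) \<partial>lborel) * (\<integral>\<^sup>+s. ennreal \<bar>?K s\<bar> \<partial>lborel)"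
      by (rule nn_integral_multc) auto
    also have "... < \<infinity>"
      using i\<Phi> integrable_energy_kernel[OF e] by (simp add: integrable_iff_bounded ennreal_mult_less_top)
    finally show "(\<integral>\<^sup>+x. ennreal (norm ((\<lambda>(s, t). ?K (s - t) * (norm (\<Phi> t))\<^sup>2) x)) \<partial>?M) < \<infinity>" .
  qed auto
  have z1: "(LINT x|?M. (\<lambda>(s, t). ?K (s - t) * (norm (\<Phi> t))\<^sup>2) x) = 0"
  proof -
    have "(LINT x|?M. (\<lambda>(s, t). ?K (s - t) * (norm (\<Phi> t))\<^sup>2) x) = (LINT t|lborel. LINT s|lborel. ?K (s - t) * (norm (\<Phi> t))\<^sup>2)"
      using lborel_pair.integral_snd[of "\<lambda>s t. ?K (s - t) * (norm (\<Phi> t))\<^sup>2"] i1 by simp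
    also have "... = 0" by (simp add: Kf0)
    finally show ?thesis .
  qed
  have i2: "integrable ?M (\<lambda>(s, t). ?K (s - t) * (norm (\<Phi> s))\<^sup>2)"
    using lborel_pair.integrable_product_swap[OF i1] Keven[of "s - t" for s t] by simp
  have z2: "(LINT x|?M. (\<lambda>(s, t). ?K (s - t) * (norm (\<Phi> s))\<^sup>2) x) = 0"
  proof -
    have "(LINT x|?M. (\<lambda>(s, t). ?K (s - t) * (norm (\<Phi> s))\<^sup>2) x) = (LINT s|lborel. LINT t|lborel. ?K (s - t) * (norm (\<Phi> s))\<^sup>2)"
      using lborel_pair.integral_fst'[OF i2] by simp
    also have "... = (LINT s|lborel. LINT t|lborel. ?K (t - s) * (norm (\<Phi> s))\<^sup>2)"
      using Keven[of "s - t" for s t] by simp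
    also have "... = 0" by (simp add: Kf0)
    finally show ?thesis .
  qed
  have i3: "integrable ?M ?F"
    by (rule kernel_form(1)[OF _ _ bound(1) supp(1) bound(1) supp(1)]) (use energy_kernel_continuous[OF e] in auto)
  have eq: "?G x = (\<lambda>(s, t). ?K (s - t) * (norm (\<Phi> t))\<^sup>2) x + (\<lambda>(s, t). ?K (s - t) * (norm (\<Phi> s))\<^sup>2) x - 2 * ?F x" for x
  proof -
    obtain s t where x: "x = (s, t)" by (cases x)
    have "(s - t)\<^sup>2 * (norm (dquot \<Phi> x))\<^sup>2 = (norm (\<Phi> s - \<Phi> t))\<^sup>2"
      unfolding x norm_dquot_sq by simp
    also have "... = (norm (\<Phi> t))\<^sup>2 + (norm (\<Phi> s))\<^sup>2 - 2 * (\<Phi> s \<bullet> \<Phi> t)"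
      by (simp add: power2_norm_eq_inner inner_diff_left inner_diff_right inner_commute)
    finally have *: "(s - t)\<^sup>2 * (norm (dquot \<Phi> x))\<^sup>2 = ..." .
    have "?G x = ?K (s - t) * ((s - t)\<^sup>2 * (norm (dquot \<Phi> x))\<^sup>2)" by (simp add: x)
    then show ?thesis unfolding * by (simp add: x algebra_simps)
  qed
  show ?thesis unfolding eq using i1 i2 i3 z1 z2 by simp
qed

text \<open>Each integration by parts moves one derivative from \<psi> to the kernel and passes to
  the next kernel in the chain. Between the two, the oddness of \<open>conj_kernel\<close> exchanges
  the variables and supplies the sign.\<close>

lemma log_kernel_form:
  assumes e: "eps > 0"
  shows "(LINT x|plane. (\<lambda>(s, t). log_kernel eps (s - t) * (\<psi> s \<bullet> \<psi> t)) x) =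
     - (LINT x|plane. (\<lambda>(s, t). energy_kernel eps (s - t) * (\<Phi> s \<bullet> \<Phi> t)) x)"
    and conj_kernel_form: "(LINT s|lborel. \<psi> s \<bullet> (LINT t|lborel. conj_kernel eps (s - t) *\<^sub>R \<Phi> t)) =
     - (LINT x|plane. (\<lambda>(s, t). energy_kernel eps (s - t) * (\<Phi> s \<bullet> \<Phi> t)) x)"
proof -
  have Lc: "isCont (log_kernel eps) r" for r using log_kernel_deriv[OF e] DERIV_isCont by blast
  note Cc = conj_kernel_continuous[OF e] and Ec = energy_kernel_continuous[OF e]
  have bp1: "(LINT s|lborel. log_kernel eps (s - t) *\<^sub>R \<psi> s) = - (LINT s|lborel. conj_kernel eps (s - t) *\<^sub>R \<Phi> s)" for t
  proof (rule integral_by_parts)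
    show "((\<lambda>s. log_kernel eps (s - t)) has_real_derivative conj_kernel eps (r - t)) (at r)" for r
    proof -
      have "((\<lambda>s. s - t) has_real_derivative 1) (at r)" by (auto intro!: derivative_eq_intros)
      from DERIV_chain2[OF log_kernel_deriv[OF e] this] show ?thesis by simp
    qed
    show "isCont (\<lambda>s. conj_kernel eps (s - t)) r" for r by (rule isCont_o2[OF _ Cc]) auto
  qed
  have bp2: "(LINT s|lborel. conj_kernel eps (s - t) *\<^sub>R \<psi> s) = - (LINT s|lborel. energy_kernel eps (s - t) *\<^sub>R \<Phi> s)" for t
  proof (rule integral_by_parts)
    show "((\<lambda>s. conj_kernel eps (s - t)) has_real_derivative energy_kernel eps (r - t)) (at r)" for r
    proof -
      have "((\<lambda>s. s - t) has_real_derivative 1) (at r)" by (auto intro!: derivative_eq_intros)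
      from DERIV_chain2[OF conj_kernel_deriv[OF e] this] show ?thesis by simp
    qed
    show "isCont (\<lambda>s. energy_kernel eps (s - t)) r" for r by (rule isCont_o2[OF _ Ec]) auto
  qed
  show conj: "(LINT s|lborel. \<psi> s \<bullet> (LINT t|lborel. conj_kernel eps (s - t) *\<^sub>R \<Phi> t)) =
     - (LINT x|plane. (\<lambda>(s, t). energy_kernel eps (s - t) * (\<Phi> s \<bullet> \<Phi> t)) x)"
  proof -
    have "(LINT s|lborel. \<psi> s \<bullet> (LINT t|lborel. conj_kernel eps (s - t) *\<^sub>R \<Phi> t)) =
       (LINT t|lborel. (LINT s|lborel. conj_kernel eps (s - t) *\<^sub>R \<psi> s) \<bullet> \<Phi> t)"
      using kernel_form(2,3)[OF _ _ bound(2) supp(2) bound(1) supp(1) Cc] by simp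
    also have "... = - (LINT t|lborel. (LINT s|lborel. energy_kernel eps (s - t) *\<^sub>R \<Phi> s) \<bullet> \<Phi> t)"
      by (simp add: bp2)
    also have "... = - (LINT x|plane. (\<lambda>(s, t). energy_kernel eps (s - t) * (\<Phi> s \<bullet> \<Phi> t)) x)"
      using kernel_form(2)[OF _ _ bound(1) supp(1) bound(1) supp(1) Ec] by simp
    finally show ?thesis .
  qed
  have "(LINT x|plane. (\<lambda>(s, t). log_kernel eps (s - t) * (\<psi> s \<bullet> \<psi> t)) x)
     = (LINT t|lborel. (LINT s|lborel. log_kernel eps (s - t) *\<^sub>R \<psi> s) \<bullet> \<psi> t)"
    using kernel_form(2)[OF _ _ bound(2) supp(2) bound(2) supp(2) Lc] by simp
  also have "... = (LINT t|lborel. \<psi> t \<bullet> (LINT s|lborel. conj_kernel eps (t - s) *\<^sub>R \<Phi> s))"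
  proof -
    have odd: "conj_kernel eps (s - t) = - conj_kernel eps (t - s)" for s t
      using conj_kernel_odd[of eps "t - s"] by simp
    have "(LINT s|lborel. log_kernel eps (s - t) *\<^sub>R \<psi> s) = (LINT s|lborel. conj_kernel eps (t - s) *\<^sub>R \<Phi> s)" for t
      unfolding bp1 odd[of _ t] by simp
    then show ?thesis by (simp add: inner_commute)
  qed
  also note conj
  finally show "(LINT x|plane. (\<lambda>(s, t). log_kernel eps (s - t) * (\<psi> s \<bullet> \<psi> t)) x) =
     - (LINT x|plane. (\<lambda>(s, t). energy_kernel eps (s - t) * (\<Phi> s \<bullet> \<Phi> t)) x)" .
qed

lemma log_kernel_form_le:
  assumes e: "eps > 0" and q: "sq_integrable plane (dquot \<Phi>)"
  shows "(LINT x|plane. (\<lambda>(s, t). log_kernel eps (s - t) * (\<psi> s \<bullet> \<psi> t)) x) \<le>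
     (l2norm plane (dquot \<Phi>))\<^sup>2 / 2"
proof -
  let ?M = plane
  have "energy_kernel eps r * r\<^sup>2 <= 1" for r
  proof -
    have "energy_kernel eps r * r\<^sup>2 <= (1 / (r\<^sup>2 + eps\<^sup>2)) * r\<^sup>2"
      using energy_kernel_abs_le[OF e, of r] by (intro mult_right_mono) auto
    also have "... <= 1" using sq_plus_sq_pos[OF e, of r] by (simp add: divide_le_eq)
    finally show ?thesis .
  qed
  then have "energy_kernel eps (fst x - snd x) * (fst x - snd x)\<^sup>2 * (norm (dquot \<Phi> x))\<^sup>2 <= 1 * (norm (dquot \<Phi> x))\<^sup>2" for x
    by (intro mult_right_mono) auto
  then have "(LINT x|?M. energy_kernel eps (fst x - snd x) * (fst x - snd x)\<^sup>2 * (norm (dquot \<Phi> x))\<^sup>2) <= (LINT x|?M. (norm (dquot \<Phi> x))\<^sup>2)"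
    using sq_integrable_integrable(1)[OF q] by (intro integral_mono') auto
  also have "... = (l2norm ?M (dquot \<Phi>))\<^sup>2" by (rule sq_integrable_integrable(2)[OF q])
  finally show ?thesis
    unfolding log_kernel_form[OF e] energy_kernel_form[OF e] by simp
qed

lemma energy_form_tendsto:
  assumes q: "sq_integrable plane (dquot \<Phi>)" and \<delta>: "\<And>n. \<delta> n > 0" "\<delta> ---> 0"
  shows "(\<lambda>n::nat. - (LINT x|plane. (\<lambda>(s, t). energy_kernel (\<delta> n) (s - t) * (\<Phi> s \<bullet> \<Phi> t)) x))
     ---> (l2norm plane (dquot \<Phi>))\<^sup>2 / 2"
proof -
  let ?M = plane
  have [measurable]: "dquot \<Phi> \<in> borel_measurable ?M" by measurable
  have "(\<lambda>n. LINT x|?M. energy_kernel (\<delta> n) (fst x - snd x) * (fst x - snd x)\<^sup>2 * (norm (dquot \<Phi> x))\<^sup>2)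
     ---> (LINT x|?M. (norm (dquot \<Phi> x))\<^sup>2)"
  proof (rule integral_dominated_convergence[where w = "\<lambda>x. (norm (dquot \<Phi> x))\<^sup>2"])
    show "integrable ?M (\<lambda>x. (norm (dquot \<Phi> x))\<^sup>2)" by (rule sq_integrable_integrable(1)[OF q])
    show "AE x in ?M. norm (energy_kernel (\<delta> n) (fst x - snd x) * (fst x - snd x)\<^sup>2 * (norm (dquot \<Phi> x))\<^sup>2) <= (norm (dquot \<Phi> x))\<^sup>2" for n
    proof (intro AE_I2)
      fix x :: "real \<times> real"
      have "\<bar>energy_kernel (\<delta> n) (fst x - snd x)\<bar> * (fst x - snd x)\<^sup>2 <= (1 / ((fst x - snd x)\<^sup>2 + (\<delta> n)\<^sup>2)) * (fst x - snd x)\<^sup>2"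
        using energy_kernel_abs_le[OF \<delta>(1)] by (intro mult_right_mono) auto
      also have "... <= 1" using sq_plus_sq_pos[OF \<delta>(1), of "fst x - snd x" n] by (simp add: divide_le_eq)
      finally have "(\<bar>energy_kernel (\<delta> n) (fst x - snd x)\<bar> * (fst x - snd x)\<^sup>2) * (norm (dquot \<Phi> x))\<^sup>2 <= 1 * (norm (dquot \<Phi> x))\<^sup>2"
        by (rule mult_right_mono) auto
      then show "norm (energy_kernel (\<delta> n) (fst x - snd x) * (fst x - snd x)\<^sup>2 * (norm (dquot \<Phi> x))\<^sup>2) <= (norm (dquot \<Phi> x))\<^sup>2"
        by (simp add: abs_mult)
    qed
    show "AE x in ?M. (\<lambda>n. energy_kernel (\<delta> n) (fst x - snd x) * (fst x - snd x)\<^sup>2 * (norm (dquot \<Phi> x))\<^sup>2) ---> (norm (dquot \<Phi> x))\<^sup>2"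
    proof (intro AE_I2)
      fix x :: "real \<times> real"
      obtain s t where x: "x = (s, t)" by (cases x)
      show "(\<lambda>n. energy_kernel (\<delta> n) (fst x - snd x) * (fst x - snd x)\<^sup>2 * (norm (dquot \<Phi> x))\<^sup>2) ---> (norm (dquot \<Phi> x))\<^sup>2"
      proof (cases "s = t")
        case True then show ?thesis by (simp add: x dquot_def)
      next
        case False
        let ?r = "s - t"
        have "(\<lambda>n. ((?r\<^sup>2 - (\<delta> n)\<^sup>2) / (?r\<^sup>2 + (\<delta> n)\<^sup>2)\<^sup>2) * ?r\<^sup>2 * (norm (dquot \<Phi> x))\<^sup>2) --->
          ((?r\<^sup>2 - 0\<^sup>2) / (?r\<^sup>2 + 0\<^sup>2)\<^sup>2) * ?r\<^sup>2 * (norm (dquot \<Phi> x))\<^sup>2"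
          by (intro tendsto_intros \<delta>) (use False in auto)
        moreover have "((?r\<^sup>2 - 0\<^sup>2) / (?r\<^sup>2 + 0\<^sup>2)\<^sup>2) * ?r\<^sup>2 = 1" using False by (simp add: power2_eq_square)
        ultimately show ?thesis by (simp add: x energy_kernel_def)
      qed
    qed
  qed auto
  from tendsto_divide[OF this tendsto_const[of 2]] show ?thesis
    unfolding energy_kernel_form[OF \<delta>(1)] sq_integrable_integrable(2)[OF q] by simp
qed

end

subsection \<open>The half-order integral\<close>

text \<open>The inverse square root, set to 0 on the left axis. Both one-sided integrals of order
  one half thereby become convolutions over the whole line.\<close>

definition frac_kernel :: "real => real" where
  "frac_kernel r = (if r > 0 then r powr (-1/2) else 0)"

text \<open>The right-sided fractional integral of order one half (Weyl), without its normalising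
  factor \<open>1 / Gamma (1/2)\<close>.\<close>

definition half_int :: "(real => 'h::{banach,second_countable_topology}) => real => 'h" where
  "half_int \<psi> t = (LINT s|lborel. frac_kernel (s - t) *\<^sub>R \<psi> s)"

lemma frac_kernel_nonneg[simp]: "0 <= frac_kernel r"
  by (simp add: frac_kernel_def)

lemma frac_kernel_measurable[measurable]: "frac_kernel \<in> borel_measurable borel"
  unfolding frac_kernel_def by measurable

lemma frac_kernel_eq: "r > 0 ==> frac_kernel r = 1 / sqrt r"
  by (simp add: frac_kernel_def powr_minus_divide powr_half_sqrt)

lemma nn_integral_frac_kernel:
  assumes b: "b >= 0"
  shows "(\<integral>\<^sup>+r. ennreal (frac_kernel r) * indicator {0..b} r \<partial>lborel) = ennreal (2 * sqrt b)"
proof -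
  have "(frac_kernel has_integral (2 * sqrt b - 2 * sqrt 0)) {0..b}"
  proof (rule fundamental_theorem_of_calculus_interior)
    show "((\<lambda>r. 2 * sqrt r) has_vector_derivative frac_kernel r) (at r)" if "r \<in> {0<..<b}" for r
      unfolding has_real_derivative_iff_has_vector_derivative[symmetric] using that
      by (auto intro!: derivative_eq_intros simp: frac_kernel_eq field_simps)
  qed (use b in \<open>auto intro!: continuous_intros\<close>)
  then have "(frac_kernel has_integral (2 * sqrt b)) {0..b}" by simp
  then show ?thesis by (intro nn_integral_has_integral_lebesgue') auto
qed

lemma frac_kernel_set_integrable: "set_integrable lborel {a..b} frac_kernel"
  unfolding set_integrable_def
proof (rule integrableI_bounded)
  have "(\<integral>\<^sup>+r. ennreal (norm (indicator {a..b} r *\<^sub>R frac_kernel r)) \<partial>lborel)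
     <= (\<integral>\<^sup>+r. ennreal (frac_kernel r) * indicator {0..max b 0} r \<partial>lborel)"
    by (intro nn_integral_mono) (auto simp: indicator_def frac_kernel_def)
  also have "... < \<infinity>" by (subst nn_integral_frac_kernel) auto
  finally show "(\<integral>\<^sup>+r. ennreal (norm (indicator {a..b} r *\<^sub>R frac_kernel r)) \<partial>lborel) < \<infinity>" .
qed auto

lemma nn_integral_lborel_reflect:
  fixes f :: "real => ennreal"
  assumes [measurable]: "f \<in> borel_measurable borel"
  shows "(\<integral>\<^sup>+x. f (c - x) \<partial>lborel) = (\<integral>\<^sup>+x. f x \<partial>lborel)"
  using nn_integral_real_affine[of f "-1" c] by simp

lemma frac_kernel_set_integrable_shift:
  "set_integrable lborel {a..b} (\<lambda>s. frac_kernel (s - t))" "set_integrable lborel {a..b} (\<lambda>s. frac_kernel (t - s))"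
proof -
  have *: "(\<lambda>s. indicator {a..b} (t + 1 * s) *\<^sub>R frac_kernel (t + 1 * s - t)) = (\<lambda>s. indicator {a-t..b-t} s *\<^sub>R frac_kernel s)"
    by (auto simp: fun_eq_iff split: split_indicator)
  show "set_integrable lborel {a..b} (\<lambda>s. frac_kernel (s - t))"
    unfolding set_integrable_def
    by (subst lborel_integrable_real_affine_iff[symmetric, where c = 1 and t = t])
       (use frac_kernel_set_integrable[of "a-t" "b-t", unfolded set_integrable_def] * in auto)
  have *: "(\<lambda>s. indicator {a..b} (t + (-1) * s) *\<^sub>R frac_kernel (t - (t + (-1) * s))) = (\<lambda>s. indicator {t-b..t-a} s *\<^sub>R frac_kernel s)"
    by (auto simp: fun_eq_iff split: split_indicator)
  show "set_integrable lborel {a..b} (\<lambda>s. frac_kernel (t - s))"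
    unfolding set_integrable_def
    by (subst lborel_integrable_real_affine_iff[symmetric, where c = "-1" and t = t])
       (use frac_kernel_set_integrable[of "t-b" "t-a", unfolded set_integrable_def] * in auto)
qed

text \<open>An antiderivative is minus twice the logarithm of
  \<open>sqrt (s - t) + sqrt (s' - t)\<close>. The cut at -T is essential: as T grows the value
  behaves like \<open>ln (4 * T) - ln |s - s'|\<close>, whose divergent part does not depend on s
  and s'.\<close>

lemma nn_integral_frac_kernel_product:
  assumes s: "s > - T" "s' > - T" "s \<noteq> s'"
  shows "(\<integral>\<^sup>+t. ennreal (indicator {- T<..} t * frac_kernel (s - t)) * ennreal (frac_kernel (s' - t)) \<partial>lborel)
    = ennreal (2 * ln (sqrt (s + T) + sqrt (s' + T)) - ln \<bar>s - s'\<bar>)"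
proof -
  define m where "m = min s s'"
  let ?F = "\<lambda>t. - 2 * ln (sqrt (s - t) + sqrt (s' - t))"
  let ?f = "\<lambda>t. frac_kernel (s - t) * frac_kernel (s' - t)"
  have pos: "sqrt (s - t) + sqrt (s' - t) > 0" if "t <= m" for t
  proof (cases "t < s")
    case True
    then show ?thesis using that by (intro add_pos_nonneg) (auto simp: m_def)
  next
    case False
    then show ?thesis using that s(3) by (intro add_nonneg_pos) (auto simp: m_def)
  qed
  have "(?f has_integral (?F m - ?F (- T))) {- T..m}"
  proof (rule fundamental_theorem_of_calculus_interior)
    fix t assume t: "t \<in> {- T<..<m}"
    then have p: "s - t > 0" "s' - t > 0" by (auto simp: m_def)
    let ?p = "sqrt (s - t)" and ?q = "sqrt (s' - t)"
    have pq: "?p > 0" "?q > 0" using p by auto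
    have d1: "((\<lambda>t. sqrt (s - t)) has_real_derivative - 1 / (2 * ?p)) (at t)"
      using p by (auto intro!: derivative_eq_intros simp: field_simps)
    have d2: "((\<lambda>t. sqrt (s' - t)) has_real_derivative - 1 / (2 * ?q)) (at t)"
      using p by (auto intro!: derivative_eq_intros simp: field_simps)
    have "?p + ?q > 0" using pq by (rule add_pos_pos)
    from DERIV_cmult[OF DERIV_chain2[OF DERIV_ln_divide[OF this] DERIV_add[OF d1 d2]], of "-2"]
    have "(?F has_real_derivative - 2 * (1 / (?p + ?q) * (- 1 / (2 * ?p) + - 1 / (2 * ?q)))) (at t)" .
    moreover have "- 2 * (1 / (P + Q) * (- 1 / (2 * P) + - 1 / (2 * Q))) = (1 / P) * (1 / Q)" if "P > 0" "Q > 0" for P Q :: real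
      using that by (simp add: divide_simps)
    ultimately have "(?F has_real_derivative ?f t) (at t)"
      using pq p by (simp add: frac_kernel_eq)
    then show "(?F has_vector_derivative ?f t) (at t)" by (simp add: has_real_derivative_iff_has_vector_derivative)
  next
    show "continuous_on {- T..m} ?F"
      by (intro continuous_intros) (use pos in force)
  qed (use s in \<open>auto simp: m_def\<close>)
  moreover have "?F m = - ln \<bar>s - s'\<bar>"
  proof -
    have "sqrt (s - m) + sqrt (s' - m) = sqrt \<bar>s - s'\<bar>" by (auto simp: m_def min_def)
    then have "?F m = - 2 * ln (sqrt \<bar>s - s'\<bar>)" by (simp only:)
    also have "... = - ln \<bar>s - s'\<bar>" using s by (simp add: ln_sqrt)
    finally show ?thesis .
  qed
  ultimately have "(?f has_integral (2 * ln (sqrt (s + T) + sqrt (s' + T)) - ln \<bar>s - s'\<bar>)) {- T..m}" by simp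
  then have "(\<integral>\<^sup>+t. ennreal (?f t) * indicator {- T..m} t \<partial>lborel) = ennreal (2 * ln (sqrt (s + T) + sqrt (s' + T)) - ln \<bar>s - s'\<bar>)"
    by (intro nn_integral_has_integral_lebesgue') auto
  moreover have "(\<integral>\<^sup>+t. ennreal (?f t) * indicator {- T..m} t \<partial>lborel) =
     (\<integral>\<^sup>+t. ennreal (indicator {- T<..} t * frac_kernel (s - t)) * ennreal (frac_kernel (s' - t)) \<partial>lborel)"
    by (intro nn_integral_cong_AE eventually_mono[OF AE_lborel_singleton[of "- T"]])
       (auto simp: indicator_def m_def frac_kernel_def ennreal_mult)
  ultimately show ?thesis by simp
qed

text \<open>The Beta integral B(1/2, 1/2), with an arcsine as antiderivative. That the value does
  not depend on the end points expresses that two half-order integrations compose to one full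
  integration.\<close>

lemma nn_integral_Beta_half:
  assumes s: "s < s'"
  shows "(\<integral>\<^sup>+t. ennreal (frac_kernel (t - s)) * ennreal (frac_kernel (s' - t)) \<partial>lborel) = ennreal pi"
proof -
  let ?F = "\<lambda>t. arcsin ((2 * t - s - s') / (s' - s))"
  let ?f = "\<lambda>t. frac_kernel (t - s) * frac_kernel (s' - t)"
  have "(?f has_integral (?F s' - ?F s)) {s..s'}"
  proof (rule fundamental_theorem_of_calculus_interior)
    fix t assume t: "t \<in> {s<..<s'}"
    let ?x = "(2 * t - s - s') / (s' - s)"
    have x: "- 1 < ?x" "?x < 1" using t by (auto simp: field_simps)
    have "((\<lambda>t. (2 * t - s - s') / (s' - s)) has_real_derivative 2 / (s' - s)) (at t)"
      by (intro DERIV_cdivide) (auto intro!: derivative_eq_intros)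
    from DERIV_chain2[OF DERIV_arcsin[OF x] this]
    have d: "(?F has_real_derivative inverse (sqrt (1 - ?x\<^sup>2)) * (2 / (s' - s))) (at t)" .
    have "1 - ?x\<^sup>2 = 4 * ((t - s) * (s' - t)) / (s' - s)\<^sup>2"
      using s by (simp add: field_simps) (simp add: power2_eq_square algebra_simps)
    then have "sqrt (1 - ?x\<^sup>2) = 2 * (sqrt (t - s) * sqrt (s' - t)) / (s' - s)"
      using s by (simp add: real_sqrt_divide real_sqrt_mult)
    then have "inverse (sqrt (1 - ?x\<^sup>2)) * (2 / (s' - s)) = ?f t"
      using s t by (simp add: frac_kernel_eq field_simps)
    then show "(?F has_vector_derivative ?f t) (at t)"
      using d by (simp add: has_real_derivative_iff_has_vector_derivative)
  next
    show "continuous_on {s..s'} ?F"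
      using s by (intro continuous_on_arcsin continuous_intros) (auto simp: field_simps)
  qed (use s in auto)
  moreover have "?F s' - ?F s = pi"
  proof -
    have "(2 * s' - s - s') / (s' - s) = 1" "(2 * s - s - s') / (s' - s) = - 1" using s by (auto simp: field_simps)
    then show ?thesis by (simp only: arcsin_1 arcsin_minus_1)
  qed
  ultimately have "(?f has_integral pi) {s..s'}" by simp
  then have "(\<integral>\<^sup>+t. ennreal (?f t) * indicator {s..s'} t \<partial>lborel) = ennreal pi"
    by (intro nn_integral_has_integral_lebesgue') auto
  moreover have "(\<integral>\<^sup>+t. ennreal (?f t) * indicator {s..s'} t \<partial>lborel) =
     (\<integral>\<^sup>+t. ennreal (frac_kernel (t - s)) * ennreal (frac_kernel (s' - t)) \<partial>lborel)"
    by (intro nn_integral_cong) (auto simp: indicator_def frac_kernel_def ennreal_mult)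
  ultimately show ?thesis by simp
qed

text \<open>Fubini in three variables: the pairing of two integral transforms is a double integral
  against the composed kernel. The finiteness assumption is the Tonelli condition for the absolute
  values.\<close>

lemma integral_kernel_product:
  fixes f g :: "real => 'h::{real_inner,banach,second_countable_topology}" and a b :: "real => real => real"
  assumes [measurable]: "(\<lambda>x. a (fst x) (snd x)) \<in> borel_measurable (borel \<Otimes>\<^sub>M borel)"
      "(\<lambda>x. b (fst x) (snd x)) \<in> borel_measurable (borel \<Otimes>\<^sub>M borel)"
      "f \<in> borel_measurable borel" "g \<in> borel_measurable borel"
    and fin: "(\<integral>\<^sup>+x. (\<integral>\<^sup>+t. ennreal \<bar>a t (fst x)\<bar> * ennreal \<bar>b t (snd x)\<bar> \<partial>lborel) * ennreal (norm (f (fst x)) * norm (g (snd x))) \<partial>plane) < \<infinity>"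
    and ia: "\<And>t. integrable lborel (\<lambda>s. a t s *\<^sub>R f s)" and ib: "\<And>t. integrable lborel (\<lambda>s. b t s *\<^sub>R g s)"
  shows "integrable lborel (\<lambda>t. (LINT s|lborel. a t s *\<^sub>R f s) \<bullet> (LINT s|lborel. b t s *\<^sub>R g s))"
    and "(LINT t|lborel. (LINT s|lborel. a t s *\<^sub>R f s) \<bullet> (LINT s|lborel. b t s *\<^sub>R g s)) =
      (LINT x|plane. (LINT t|lborel. a t (fst x) * b t (snd x)) * (f (fst x) \<bullet> g (snd x)))"
proof -
  let ?M = plane
  interpret M: sigma_finite_measure ?M by (simp add: lborel_prod sigma_finite_lborel)
  interpret P: pair_sigma_finite "lborel :: real measure" ?M ..
  have [measurable]: "(\<lambda>x. a (p x) (q x)) \<in> borel_measurable N" "(\<lambda>x. b (p x) (q x)) \<in> borel_measurable N"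
    if [measurable]: "p \<in> borel_measurable N" "q \<in> borel_measurable N" for p q and N :: "'z measure"
    using measurable_compose[of "\<lambda>x. (p x, q x)" N "borel \<Otimes>\<^sub>M borel" "\<lambda>x. a (fst x) (snd x)"]
      measurable_compose[of "\<lambda>x. (p x, q x)" N "borel \<Otimes>\<^sub>M borel" "\<lambda>x. b (fst x) (snd x)"] by auto
  define h where "h = (\<lambda>(t, x). (a t (fst x) * b t (snd x)) * (f (fst x) \<bullet> g (snd x)))"
  have [measurable]: "h \<in> borel_measurable (lborel \<Otimes>\<^sub>M ?M)" unfolding h_def by measurable
  have ih: "integrable (lborel \<Otimes>\<^sub>M ?M) h"
  proof (rule integrableI_bounded)
    have "(\<integral>\<^sup>+z. ennreal (norm (h z)) \<partial>(lborel \<Otimes>\<^sub>M ?M)) = (\<integral>\<^sup>+x. \<integral>\<^sup>+t. ennreal (norm (h (t, x))) \<partial>lborel \<partial>?M)"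
      by (rule P.nn_integral_snd[symmetric]) measurable
    also have "... <= (\<integral>\<^sup>+x. (\<integral>\<^sup>+t. ennreal \<bar>a t (fst x)\<bar> * ennreal \<bar>b t (snd x)\<bar> \<partial>lborel) * ennreal (norm (f (fst x)) * norm (g (snd x))) \<partial>?M)"
    proof (intro nn_integral_mono)
      fix x :: "real \<times> real"
      have "(\<integral>\<^sup>+t. ennreal (norm (h (t, x))) \<partial>lborel) <= (\<integral>\<^sup>+t. (ennreal \<bar>a t (fst x)\<bar> * ennreal \<bar>b t (snd x)\<bar>) * ennreal (norm (f (fst x)) * norm (g (snd x))) \<partial>lborel)"
      proof (intro nn_integral_mono)
        fix t
        have "norm (h (t, x)) <= \<bar>a t (fst x)\<bar> * \<bar>b t (snd x)\<bar> * (norm (f (fst x)) * norm (g (snd x)))"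
          unfolding h_def by (simp add: abs_mult mult_left_mono Cauchy_Schwarz_ineq2)
        then show "ennreal (norm (h (t, x))) <= (ennreal \<bar>a t (fst x)\<bar> * ennreal \<bar>b t (snd x)\<bar>) * ennreal (norm (f (fst x)) * norm (g (snd x)))"
          by (simp add: ennreal_mult[symmetric] ennreal_leI)
      qed
      also have "... = (\<integral>\<^sup>+t. ennreal \<bar>a t (fst x)\<bar> * ennreal \<bar>b t (snd x)\<bar> \<partial>lborel) * ennreal (norm (f (fst x)) * norm (g (snd x)))"
        by (rule nn_integral_multc) measurable
      finally show "(\<integral>\<^sup>+t. ennreal (norm (h (t, x))) \<partial>lborel) <= ..." .
    qed
    also note fin
    finally show "(\<integral>\<^sup>+z. ennreal (norm (h z)) \<partial>(lborel \<Otimes>\<^sub>M ?M)) < \<infinity>" .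
  qed measurable
  have 1: "(LINT x|?M. h (t, x)) = (LINT s|lborel. a t s *\<^sub>R f s) \<bullet> (LINT s|lborel. b t s *\<^sub>R g s)" for t
  proof -
    have "(\<lambda>x. h (t, x)) = (\<lambda>(s, s'). (a t s *\<^sub>R f s) \<bullet> (b t s' *\<^sub>R g s'))" by (auto simp: h_def)
    then show ?thesis using integral_inner_product(2)[OF ia ib, of t t] by simp
  qed
  have 2: "(LINT t|lborel. h (t, x)) = (LINT t|lborel. a t (fst x) * b t (snd x)) * (f (fst x) \<bullet> g (snd x))" for x
    by (simp add: h_def)
  show "integrable lborel (\<lambda>t. (LINT s|lborel. a t s *\<^sub>R f s) \<bullet> (LINT s|lborel. b t s *\<^sub>R g s))"
    using P.integrable_fst'[OF ih] by (simp only: 1)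
  have "(LINT t|lborel. (LINT x|?M. h (t, x))) = (LINT x|?M. LINT t|lborel. h (t, x))"
    using P.integral_fst'[OF ih] P.integral_snd[of "\<lambda>t x. h (t, x)"] ih by simp
  then show "(LINT t|lborel. (LINT s|lborel. a t s *\<^sub>R f s) \<bullet> (LINT s|lborel. b t s *\<^sub>R g s)) =
      (LINT x|?M. (LINT t|lborel. a t (fst x) * b t (snd x)) * (f (fst x) \<bullet> g (snd x)))"
    by (simp only: 1 2)
qed

text \<open>For nonnegative kernels the composed kernel is kept as a nonnegative integral, so that
  the explicit logarithmic and Beta evaluations can be substituted directly.\<close>

lemma integral_nonneg_kernel_product:
  fixes f g :: "real => 'h::{real_inner,banach,second_countable_topology}" and a b :: "real => real => real"
  assumes a: "(\<lambda>x. a (fst x) (snd x)) \<in> borel_measurable (borel \<Otimes>\<^sub>M borel)"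
    and b: "(\<lambda>x. b (fst x) (snd x)) \<in> borel_measurable (borel \<Otimes>\<^sub>M borel)"
    and f: "f \<in> borel_measurable borel" and g: "g \<in> borel_measurable borel"
    and nn: "\<And>t s. 0 <= a t s" "\<And>t s. 0 <= b t s"
    and fin: "(\<integral>\<^sup>+x. (\<integral>\<^sup>+t. ennreal (a t (fst x)) * ennreal (b t (snd x)) \<partial>lborel) * ennreal (norm (f (fst x)) * norm (g (snd x))) \<partial>plane) < \<infinity>"
    and ia: "\<And>t. integrable lborel (\<lambda>s. a t s *\<^sub>R f s)" and ib: "\<And>t. integrable lborel (\<lambda>s. b t s *\<^sub>R g s)"
  shows "integrable lborel (\<lambda>t. (LINT s|lborel. a t s *\<^sub>R f s) \<bullet> (LINT s|lborel. b t s *\<^sub>R g s))"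
    and "(LINT t|lborel. (LINT s|lborel. a t s *\<^sub>R f s) \<bullet> (LINT s|lborel. b t s *\<^sub>R g s)) =
      (LINT x|plane. enn2real (\<integral>\<^sup>+t. ennreal (a t (fst x)) * ennreal (b t (snd x)) \<partial>lborel) * (f (fst x) \<bullet> g (snd x)))"
proof -
  have fin': "(\<integral>\<^sup>+x. (\<integral>\<^sup>+t. ennreal \<bar>a t (fst x)\<bar> * ennreal \<bar>b t (snd x)\<bar> \<partial>lborel) * ennreal (norm (f (fst x)) * norm (g (snd x))) \<partial>plane) < \<infinity>"
    using fin nn by (simp add: abs_of_nonneg)
  note kp = integral_kernel_product[OF a b f g fin' ia ib]
  show "integrable lborel (\<lambda>t. (LINT s|lborel. a t s *\<^sub>R f s) \<bullet> (LINT s|lborel. b t s *\<^sub>R g s))" by (rule kp(1))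
  have "(LINT t|lborel. a t s * b t s') = enn2real (\<integral>\<^sup>+t. ennreal (a t s) * ennreal (b t s') \<partial>lborel)" for s s'
  proof -
    have "(\<lambda>t. a t s) \<in> borel_measurable borel" "(\<lambda>t. b t s') \<in> borel_measurable borel"
      using measurable_compose[OF measurable_Pair a, of "\<lambda>t. t" borel "\<lambda>_. s"]
        measurable_compose[OF measurable_Pair b, of "\<lambda>t. t" borel "\<lambda>_. s'"] by auto
    then have "(LINT t|lborel. a t s * b t s') = enn2real (\<integral>\<^sup>+t. ennreal (a t s * b t s') \<partial>lborel)"
      by (intro integral_eq_nn_integral) (use nn in auto)
    then show ?thesis using nn by (simp add: ennreal_mult)
  qed
  then show "(LINT t|lborel. (LINT s|lborel. a t s *\<^sub>R f s) \<bullet> (LINT s|lborel. b t s *\<^sub>R g s)) =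
      (LINT x|plane. enn2real (\<integral>\<^sup>+t. ennreal (a t (fst x)) * ennreal (b t (snd x)) \<partial>lborel) * (f (fst x) \<bullet> g (snd x)))"
    using kp(2) by simp
qed

text \<open>The bound \<open>ln x <= x\<close>, used at |r| and at \<open>1 / sqrt |r|\<close>,
  trades the logarithmic singularity for an inverse square root, whose integrability is already
  available.\<close>

lemma abs_ln_le_frac_kernel:
  assumes "r \<noteq> 0"
  shows "\<bar>ln \<bar>r\<bar>\<bar> <= 2 * frac_kernel r + 2 * frac_kernel (- r) + \<bar>r\<bar>"
proof -
  let ?x = "\<bar>r\<bar>"
  have x: "?x > 0" using assms by simp
  have k: "frac_kernel r + frac_kernel (- r) = 1 / sqrt ?x"
    using assms by (cases "r > 0") (auto simp: frac_kernel_eq, auto simp: frac_kernel_def)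
  have "ln ?x <= ?x" using ln_bound[OF x] by simp
  moreover have "- ln ?x <= 2 * (1 / sqrt ?x)"
  proof -
    have "- ln ?x = 2 * ln (1 / sqrt ?x)" using x by (simp add: ln_div ln_sqrt)
    also have "... <= 2 * (1 / sqrt ?x)" using x ln_bound[of "1 / sqrt ?x"] by simp
    finally show ?thesis .
  qed
  moreover have "1 / sqrt ?x >= 0" by simp
  ultimately show ?thesis using k x by linarith
qed

lemma AE_pair_neq: "AE x in plane. fst x \<noteq> snd x"
proof -
  have 1: "{x \<in> space plane. fst x \<noteq> snd x} \<in> sets plane"
    by measurable
  have 2: "AE x in (lborel :: real measure). AE y in (lborel :: real measure). fst (x, y) \<noteq> snd (x, y)"
  proof (rule AE_I2)
    fix x :: real
    show "AE y in lborel. fst (x, y) \<noteq> snd (x, y)"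
      using AE_lborel_singleton[of x] by eventually_elim simp
  qed
  show ?thesis by (rule lborel_pair.AE_pair_measure[OF 1 2])
qed

section \<open>The half-order integral is bounded by the Gagliardo seminorm\<close>

context compact_primitive
begin

lemma integrable_frac_kernel_mult: "integrable lborel (\<lambda>s. frac_kernel (s - t) *\<^sub>R \<psi> s)"
  "integrable lborel (\<lambda>s. frac_kernel (t - s) *\<^sub>R \<psi> s)"
  by (rule bounded_compact_integrable[OF _ bound(2) supp(2)]; simp add: frac_kernel_set_integrable_shift)+

lemma norm_deriv_integrable: "integrable lborel \<psi>" "integrable lborel (\<lambda>s. norm (\<psi> s))"
  using integrable_mult_continuous(1)[of "\<lambda>_. 1"] integrable_norm[of lborel \<psi>] by auto

text \<open>A single family of majorants, with a free constant C, for all dominated convergence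
  arguments that involve logarithmic kernels.\<close>

lemma dominating_integrable:
  "integrable plane (\<lambda>x. (2 * frac_kernel (fst x - snd x) + 2 * frac_kernel (snd x - fst x) + C) * (norm (\<psi> (fst x)) * norm (\<psi> (snd x))))"
proof -
  let ?M = plane
  have i1: "integrable ?M (\<lambda>(s, t). norm (\<psi> s) * norm (\<psi> t))"
    using integral_inner_product(1)[OF norm_deriv_integrable(2) norm_deriv_integrable(2)] by simp
  have i2: "integrable ?M (\<lambda>(s, t). frac_kernel (s - t) * (norm (\<psi> s) * norm (\<psi> t)))"
  proof (rule integrableI_bounded)
    have B0: "B >= 0" using bound(2)[of 0] norm_ge_zero order_trans by blast
    have "(\<integral>\<^sup>+x. ennreal (norm ((\<lambda>(s, t). frac_kernel (s - t) * (norm (\<psi> s) * norm (\<psi> t))) x)) \<partial>?M)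
      = (\<integral>\<^sup>+s. \<integral>\<^sup>+t. ennreal (frac_kernel (s - t) * (norm (\<psi> s) * norm (\<psi> t))) \<partial>lborel \<partial>lborel)"
      by (subst lborel.nn_integral_fst[symmetric]) (auto simp: abs_mult)
    also have "... <= (\<integral>\<^sup>+s. ennreal (B * norm (\<psi> s)) * ennreal (2 * sqrt (2 * R)) \<partial>lborel)"
    proof (intro nn_integral_mono)
      fix s :: real
      have "(\<integral>\<^sup>+t. ennreal (frac_kernel (s - t) * (norm (\<psi> s) * norm (\<psi> t))) \<partial>lborel)
        <= (\<integral>\<^sup>+t. ennreal (B * norm (\<psi> s)) * (ennreal (frac_kernel (s - t)) * indicator {0..2*R} (s - t)) \<partial>lborel)"
      proof (intro nn_integral_mono)
        fix t
        show "ennreal (frac_kernel (s - t) * (norm (\<psi> s) * norm (\<psi> t))) <= ennreal (B * norm (\<psi> s)) * (ennreal (frac_kernel (s - t)) * indicator {0..2*R} (s - t))"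
        proof (cases "\<bar>s\<bar> > R \<or> \<bar>t\<bar> > R \<or> s <= t")
          case True
          then show ?thesis using supp by (auto simp: frac_kernel_def)
        next
          case False
          have "frac_kernel (s - t) * (norm (\<psi> s) * norm (\<psi> t)) <= frac_kernel (s - t) * (norm (\<psi> s) * B)"
            by (intro mult_left_mono bound) auto
          then show ?thesis using False B0
            by (auto simp: ennreal_mult[symmetric] indicator_def mult_ac intro!: ennreal_leI)
        qed
      qed
      also have "... = ennreal (B * norm (\<psi> s)) * (\<integral>\<^sup>+t. ennreal (frac_kernel (s - t)) * indicator {0..2*R} (s - t) \<partial>lborel)"
        by (rule nn_integral_cmult) auto
      also have "(\<integral>\<^sup>+t. ennreal (frac_kernel (s - t)) * indicator {0..2*R} (s - t) \<partial>lborel) = ennreal (2 * sqrt (2 * R))"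
        using nn_integral_lborel_reflect[of "\<lambda>r. ennreal (frac_kernel r) * indicator {0..2*R} r" s] nn_integral_frac_kernel[of "2 * R"] R by simp
      finally show "(\<integral>\<^sup>+t. ennreal (frac_kernel (s - t) * (norm (\<psi> s) * norm (\<psi> t))) \<partial>lborel) <= ennreal (B * norm (\<psi> s)) * ennreal (2 * sqrt (2 * R))" .
    qed
    also have "... = ennreal B * (\<integral>\<^sup>+s. ennreal (norm (\<psi> s)) \<partial>lborel) * ennreal (2 * sqrt (2 * R))"
      using B0 by (simp add: nn_integral_multc nn_integral_cmult ennreal_mult)
    also have "... < \<infinity>" using norm_deriv_integrable(1) by (simp add: integrable_iff_bounded ennreal_mult_less_top)
    finally show "(\<integral>\<^sup>+x. ennreal (norm ((\<lambda>(s, t). frac_kernel (s - t) * (norm (\<psi> s) * norm (\<psi> t))) x)) \<partial>?M) < \<infinity>" .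
  qed auto
  have i3: "integrable ?M (\<lambda>(s, t). frac_kernel (t - s) * (norm (\<psi> s) * norm (\<psi> t)))"
    using lborel_pair.integrable_product_swap[OF i2] by (simp add: mult_ac)
  have "(\<lambda>x. (2 * frac_kernel (fst x - snd x) + 2 * frac_kernel (snd x - fst x) + C) * (norm (\<psi> (fst x)) * norm (\<psi> (snd x))))
     = (\<lambda>x. 2 * (\<lambda>(s, t). frac_kernel (s - t) * (norm (\<psi> s) * norm (\<psi> t))) x
        + 2 * (\<lambda>(s, t). frac_kernel (t - s) * (norm (\<psi> s) * norm (\<psi> t))) x + C * (\<lambda>(s, t). norm (\<psi> s) * norm (\<psi> t)) x)"
    by (auto simp: algebra_simps)
  then show ?thesis using i1 i2 i3 by simp
qed

text \<open>The truncated kernel product equals \<open>ln (4 * n) - ln |s - s'|\<close> up to a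
  bounded error that vanishes in the limit. The mean value zero of \<psi> permits subtracting
  \<open>ln (4 * n)\<close>, after which the integrand has a majorant independent of n.\<close>

lemma half_int_truncated:
  fixes n :: nat
  assumes n: "real n >= 2 * R + 1"
  defines "D \<equiv> \<lambda>x. (2 * ln (sqrt (fst x + real n) + sqrt (snd x + real n)) - ln (4 * real n) - ln \<bar>fst x - snd x\<bar>) * (\<psi> (fst x) \<bullet> \<psi> (snd x))"
  shows "sqnorm lborel (\<lambda>t. indicator {- real n<..} t *\<^sub>R half_int \<psi> t) = ennreal (LINT x|plane. D x)"
    and "AE x in plane. norm (D x) <= (2 * frac_kernel (fst x - snd x) + 2 * frac_kernel (snd x - fst x) + (2 * R + 1)) * (norm (\<psi> (fst x)) * norm (\<psi> (snd x)))"
proof -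
  let ?M = plane
  let ?T = "real n"
  let ?c = "\<lambda>x. \<integral>\<^sup>+t. ennreal (indicator {- ?T<..} t * frac_kernel (fst x - t)) * ennreal (frac_kernel (snd x - t)) \<partial>lborel"
  let ?l = "\<lambda>x. 2 * ln (sqrt (fst x + ?T) + sqrt (snd x + ?T)) - ln \<bar>fst x - snd x\<bar>"
  let ?w = "\<lambda>C x. (2 * frac_kernel (fst x - snd x) + 2 * frac_kernel (snd x - fst x) + C) * (norm (\<psi> (fst x)) * norm (\<psi> (snd x)))"
  have T: "?T > 0" using n R by linarith
  \<comment> \<open>Since n >= 2R + 1, both s + n and s' + n lie between n/2 and 3n/2. Hence the
    square of the sum of their roots, divided by 4n, lies between 1/2 and 3/2.\<close>
  have lnA: "\<bar>2 * ln (sqrt (s + ?T) + sqrt (s' + ?T)) - ln (4 * ?T)\<bar> <= 1" if s: "\<bar>s\<bar> <= R" "\<bar>s'\<bar> <= R" for s s'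
  proof -
    have h: "?T / 2 <= s + ?T" "s + ?T <= 3 * ?T / 2" "?T / 2 <= s' + ?T" "s' + ?T <= 3 * ?T / 2" using s n by auto
    let ?A = "sqrt (s + ?T) + sqrt (s' + ?T)"
    have "sqrt (?T / 2) <= sqrt (s + ?T)" "sqrt (?T / 2) <= sqrt (s' + ?T)" using h by (auto intro: real_sqrt_le_mono)
    then have "2 * sqrt (?T / 2) <= ?A" by linarith
    then have "(2 * sqrt (?T / 2))\<^sup>2 <= ?A\<^sup>2" by (rule power_mono) simp
    then have lo: "2 * ?T <= ?A\<^sup>2" by (simp add: power_mult_distrib)
    have "sqrt (s + ?T) <= sqrt (3 * ?T / 2)" "sqrt (s' + ?T) <= sqrt (3 * ?T / 2)" using h by (auto intro: real_sqrt_le_mono)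
    then have "?A <= 2 * sqrt (3 * ?T / 2)" by linarith
    then have "?A\<^sup>2 <= (2 * sqrt (3 * ?T / 2))\<^sup>2" by (rule power_mono) (use h T in auto)
    then have up: "?A\<^sup>2 <= 6 * ?T" by (simp add: power_mult_distrib)
    have "0 < sqrt (?T / 2)" using T by simp
    then have A: "?A > 0" using \<open>2 * sqrt (?T / 2) <= ?A\<close> by linarith
    have eq: "2 * ln ?A - ln (4 * ?T) = ln (?A\<^sup>2 / (4 * ?T))"
      using A T by (simp add: ln_div ln_realpow)
    have "1 / 2 <= ?A\<^sup>2 / (4 * ?T)" "?A\<^sup>2 / (4 * ?T) <= 3 / 2" using lo up T by (auto simp: field_simps)
    then have "ln (1 / 2) <= ln (?A\<^sup>2 / (4 * ?T))" "ln (?A\<^sup>2 / (4 * ?T)) <= ln (3 / 2)" by (auto intro: ln_mono)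
    moreover have "ln (3 / 2 :: real) <= 1" using ln_bound[of "3/2"] ln_add_one_self_le_self[of "1/2"] by simp
    moreover have "ln (1 / 2 :: real) >= - 1" using ln_add_one_self_le_self[of 1] by (simp add: ln_div)
    ultimately show ?thesis unfolding eq by linarith
  qed
  show dom: "AE x in ?M. norm (D x) <= ?w (2 * R + 1) x"
    using AE_pair_neq
  proof eventually_elim
    case (elim x)
    show ?case
    proof (cases "\<bar>fst x\<bar> > R \<or> \<bar>snd x\<bar> > R")
      case True then show ?thesis by (auto simp: D_def supp)
    next
      case False
      let ?d = "2 * ln (sqrt (fst x + ?T) + sqrt (snd x + ?T)) - ln (4 * ?T) - ln \<bar>fst x - snd x\<bar>"
      have "\<bar>fst x - snd x\<bar> <= 2 * R" using False by linarith
      then have d: "\<bar>?d\<bar> <= 2 * frac_kernel (fst x - snd x) + 2 * frac_kernel (snd x - fst x) + (2 * R + 1)"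
        using abs_ln_le_frac_kernel[of "fst x - snd x"] lnA[of "fst x" "snd x"] elim False by auto
      have "norm (D x) = \<bar>?d\<bar> * \<bar>\<psi> (fst x) \<bullet> \<psi> (snd x)\<bar>" by (simp add: D_def abs_mult)
      also have "... <= ?w (2 * R + 1) x"
        by (intro mult_mono d Cauchy_Schwarz_ineq2) (use R in auto)
      finally show ?thesis .
    qed
  qed
  have Dm[measurable]: "D \<in> borel_measurable ?M" unfolding D_def by measurable
  have iD: "integrable ?M D"
    by (rule Bochner_Integration.integrable_bound[OF dominating_integrable[of "2 * R + 1"] Dm])
       (use dom in \<open>auto elim!: eventually_mono intro: order_trans\<close>)
  have c: "?c x = ennreal (?l x)" if "fst x \<noteq> snd x" "\<not> (\<bar>fst x\<bar> > R \<or> \<bar>snd x\<bar> > R)" for x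
    by (rule nn_integral_frac_kernel_product) (use that n R in auto)
  let ?C = "2 * R + 1 + \<bar>ln (4 * ?T)\<bar>"
  have l: "\<bar>?l x\<bar> <= 2 * frac_kernel (fst x - snd x) + 2 * frac_kernel (snd x - fst x) + ?C"
    if "fst x \<noteq> snd x" "\<not> (\<bar>fst x\<bar> > R \<or> \<bar>snd x\<bar> > R)" for x
  proof -
    have "\<bar>fst x - snd x\<bar> <= 2 * R" using that by linarith
    then show ?thesis
      using abs_ln_le_frac_kernel[of "fst x - snd x"] lnA[of "fst x" "snd x"] that by auto
  qed
  have fin: "(\<integral>\<^sup>+x. ?c x * ennreal (norm (\<psi> (fst x)) * norm (\<psi> (snd x))) \<partial>?M) < \<infinity>"
  proof -
    have "(\<integral>\<^sup>+x. ?c x * ennreal (norm (\<psi> (fst x)) * norm (\<psi> (snd x))) \<partial>?M) <= (\<integral>\<^sup>+x. ennreal (norm (?w ?C x)) \<partial>?M)"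
    proof (rule nn_integral_mono_AE, use AE_pair_neq in eventually_elim)
      case (elim x)
      show ?case
      proof (cases "\<bar>fst x\<bar> > R \<or> \<bar>snd x\<bar> > R")
        case True then show ?thesis by (auto simp: supp)
      next
        case False
        have "?c x * ennreal (norm (\<psi> (fst x)) * norm (\<psi> (snd x))) <= ennreal (\<bar>?l x\<bar> * (norm (\<psi> (fst x)) * norm (\<psi> (snd x))))"
          unfolding c[OF elim False] by (subst ennreal_mult) (auto intro!: mult_right_mono ennreal_leI)
        also have "... <= ennreal (norm (?w ?C x))"
          by (intro ennreal_leI order_trans[OF mult_right_mono[OF l[OF elim False]]]) auto
        finally show ?thesis .
      qed
    qed
    also have "... < \<infinity>" using dominating_integrable[of ?C] by (simp only: integrable_iff_bounded)
    finally show ?thesis .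
  qed
  have am: "(\<lambda>x. indicator {- ?T<..} (fst x) * frac_kernel (snd x - fst x)) \<in> borel_measurable (borel \<Otimes>\<^sub>M borel)"
    "(\<lambda>x. frac_kernel (snd x - fst x)) \<in> borel_measurable (borel \<Otimes>\<^sub>M borel)" by measurable
  have ia: "integrable lborel (\<lambda>s. (indicator {- ?T<..} t * frac_kernel (s - t)) *\<^sub>R \<psi> s)" for t
    using integrable_scaleR_right[OF integrable_frac_kernel_mult(1)[of t], of "indicator {- ?T<..} t"] by simp
  note kp = integral_nonneg_kernel_product[OF am meas meas _ _ fin ia integrable_frac_kernel_mult(1)]
  have h1: "(LINT s|lborel. (indicator {- ?T<..} t * frac_kernel (s - t)) *\<^sub>R \<psi> s) = indicator {- ?T<..} t *\<^sub>R half_int \<psi> t" for t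
    unfolding half_int_def by (simp flip: scaleR_scaleR)
  have sq: "indicator {- ?T<..} t *\<^sub>R half_int \<psi> t \<bullet> half_int \<psi> t = (norm (indicator {- ?T<..} t *\<^sub>R half_int \<psi> t))\<^sup>2" for t
    by (auto simp: indicator_def power2_norm_eq_inner)
  have I: "integrable lborel (\<lambda>t. (norm (indicator {- ?T<..} t *\<^sub>R half_int \<psi> t))\<^sup>2)"
    using kp(1) unfolding h1 half_int_def[symmetric] sq by simp
  have "(LINT t|lborel. (norm (indicator {- ?T<..} t *\<^sub>R half_int \<psi> t))\<^sup>2) = (LINT x|?M. enn2real (?c x) * (\<psi> (fst x) \<bullet> \<psi> (snd x)))"
    using kp(2) unfolding h1 half_int_def[symmetric] sq by simp
  also have "... = (LINT x|?M. D x + ln (4 * ?T) * (\<psi> (fst x) \<bullet> \<psi> (snd x)))"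
  proof (rule integral_cong_AE)
    show "AE x in ?M. enn2real (?c x) * (\<psi> (fst x) \<bullet> \<psi> (snd x)) = D x + ln (4 * ?T) * (\<psi> (fst x) \<bullet> \<psi> (snd x))"
      using AE_pair_neq
    proof eventually_elim
      case (elim x)
      show ?case
      proof (cases "\<bar>fst x\<bar> > R \<or> \<bar>snd x\<bar> > R")
        case True then show ?thesis by (auto simp: supp D_def)
      next
        case False
        \<comment> \<open>Needed to read off the real value: \<open>ennreal\<close> would cut a
          negative number off to 0.\<close>
        have "?l x >= 0"
        proof -
          have fs: "- R <= fst x" "- R <= snd x" using False by auto
          have p: "fst x + ?T > 0" "snd x + ?T > 0" using fs n R by linarith+
          have "\<bar>fst x - snd x\<bar> <= (sqrt (fst x + ?T) + sqrt (snd x + ?T))\<^sup>2"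
            using p by (simp add: power2_sum) (smt (verit) mult_nonneg_nonneg real_sqrt_ge_zero)
          then have "ln \<bar>fst x - snd x\<bar> <= ln ((sqrt (fst x + ?T) + sqrt (snd x + ?T))\<^sup>2)"
            using elim by (intro ln_mono) auto
          also have "... = 2 * ln (sqrt (fst x + ?T) + sqrt (snd x + ?T))"
            using p by (subst ln_realpow) (auto intro: add_pos_pos)
          finally show ?thesis by simp
        qed
        then show ?thesis unfolding c[OF elim False] by (simp add: D_def algebra_simps)
      qed
    qed
  qed measurable
  \<comment> \<open>The constant \<open>ln (4 * n)\<close> multiplies the inner product of the
    integral of \<psi> with itself, which is 0.\<close>
  also have "... = (LINT x|?M. D x)"
  proof -
    have "integrable ?M (\<lambda>x. \<psi> (fst x) \<bullet> \<psi> (snd x))" "(LINT x|?M. \<psi> (fst x) \<bullet> \<psi> (snd x)) = 0"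
      using integral_inner_product[OF norm_deriv_integrable(1) norm_deriv_integrable(1)] integral_deriv_0 by (auto simp: case_prod_beta')
    then show ?thesis using iD by simp
  qed
  finally have "(LINT t|lborel. (norm (indicator {- ?T<..} t *\<^sub>R half_int \<psi> t))\<^sup>2) = (LINT x|?M. D x)" .
  then show "sqnorm lborel (\<lambda>t. indicator {- ?T<..} t *\<^sub>R half_int \<psi> t) = ennreal (LINT x|?M. D x)"
    unfolding sqnorm_def by (subst nn_integral_eq_integral[OF I]) auto
qed

end

context compact_primitive
begin

lemma half_int_measurable[measurable]: "half_int \<psi> \<in> borel_measurable borel"
  unfolding half_int_def by measurable

text \<open>The logarithmic form is the common limit of two approximations: the regularised kernels,
  which bound it by half the squared seminorm, and the truncated norms, which it controls. Fatou's
  lemma then removes the truncation. The factor 1/2 is given away at the end.\<close>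

lemma half_int_bound: "sqnorm lborel (half_int \<psi>) <= sqnorm plane (dquot \<Phi>)"
proof (cases "sqnorm plane (dquot \<Phi>) = \<infinity>")
  case False
  let ?M = plane
  have q: "sq_integrable ?M (dquot \<Phi>)" using False by (simp add: sq_integrable_def less_top[symmetric] borel_measurable_dquot_lborel)
  define E where "E = (l2norm ?M (dquot \<Phi>))\<^sup>2"
  let ?w = "\<lambda>C x. (2 * frac_kernel (fst x - snd x) + 2 * frac_kernel (snd x - fst x) + C) * (norm (\<psi> (fst x)) * norm (\<psi> (snd x)))"
  let ?L = "\<lambda>x. - ln \<bar>fst x - snd x\<bar> * (\<psi> (fst x) \<bullet> \<psi> (snd x))"
  define \<delta> where "\<delta> n = 1 / (real n + 1)" for n :: nat
  have \<delta>: "\<delta> n > 0" "\<delta> n <= 1" "\<delta> ---> 0" for n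
    using LIMSEQ_inverse_real_of_nat by (auto simp: \<delta>_def[abs_def] inverse_eq_divide add.commute)
  \<comment> \<open>For regularisation parameters at most 1 and |r| <= 2R, the regularised logarithm
    differs from \<open>ln |r|\<close> in absolute value by at most the term
    \<open>ln (4 * R^2 + 1)\<close>; the term 2R bounds the linear part in
    \<open>abs_ln_le_frac_kernel\<close>.\<close>
  let ?C = "2 * R + ln (4 * R\<^sup>2 + 1)"
  have lim1: "(\<lambda>n. LINT x|?M. log_kernel (\<delta> n) (fst x - snd x) * (\<psi> (fst x) \<bullet> \<psi> (snd x))) ---> (LINT x|?M. ?L x)"
  proof (rule integral_dominated_convergence[where w = "?w ?C"])
    show "integrable ?M (?w ?C)" by (rule dominating_integrable)
    show "AE x in ?M. norm (log_kernel (\<delta> n) (fst x - snd x) * (\<psi> (fst x) \<bullet> \<psi> (snd x))) <= ?w ?C x" for n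
      using AE_pair_neq
    proof eventually_elim
      case (elim x)
      show ?case
      proof (cases "\<bar>fst x\<bar> > R \<or> \<bar>snd x\<bar> > R")
        case True then show ?thesis by (auto simp: supp)
      next
        case False
        let ?r = "fst x - snd x"
        have r: "\<bar>?r\<bar> <= 2 * R" "?r \<noteq> 0" using False elim by auto
        have r2: "?r\<^sup>2 <= (2 * R)\<^sup>2" using power_mono[OF r(1), of 2] by simp
        have "(\<delta> n)\<^sup>2 <= 1\<^sup>2" using \<delta>(1,2)[of n] by (intro power_mono) auto
        then have up: "?r\<^sup>2 + (\<delta> n)\<^sup>2 <= 4 * R\<^sup>2 + 1" using r2 by (simp add: power_mult_distrib)
        have pos: "?r\<^sup>2 > 0" using r by simp
        have "ln (?r\<^sup>2) <= ln (?r\<^sup>2 + (\<delta> n)\<^sup>2)" using pos by (intro ln_mono) auto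
        moreover have "ln (?r\<^sup>2 + (\<delta> n)\<^sup>2) <= ln (4 * R\<^sup>2 + 1)" using pos up by (intro ln_mono) (auto intro: add_pos_nonneg)
        moreover have "ln (?r\<^sup>2) = 2 * ln \<bar>?r\<bar>" using r ln_realpow[of "\<bar>?r\<bar>" 2] by simp
        moreover have "ln (4 * R\<^sup>2 + 1) >= 0" by simp
        ultimately have "\<bar>log_kernel (\<delta> n) ?r\<bar> <= \<bar>ln \<bar>?r\<bar>\<bar> + ln (4 * R\<^sup>2 + 1)"
          unfolding log_kernel_def by linarith
        then have "\<bar>log_kernel (\<delta> n) ?r\<bar> <= 2 * frac_kernel (fst x - snd x) + 2 * frac_kernel (snd x - fst x) + ?C"
          using abs_ln_le_frac_kernel[OF r(2)] r(1) by simp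
        then show ?thesis
          unfolding real_norm_def abs_mult by (intro mult_mono Cauchy_Schwarz_ineq2) (use R in auto)
      qed
    qed
    show "AE x in ?M. (\<lambda>n. log_kernel (\<delta> n) (fst x - snd x) * (\<psi> (fst x) \<bullet> \<psi> (snd x))) ---> ?L x"
      using AE_pair_neq
    proof eventually_elim
      case (elim x)
      let ?r = "fst x - snd x"
      have "(\<lambda>n. - ln (?r\<^sup>2 + (\<delta> n)\<^sup>2) / 2) ---> - ln (?r\<^sup>2 + 0\<^sup>2) / 2"
        by (intro tendsto_intros \<delta>) (use elim in auto)
      moreover have "- ln (?r\<^sup>2 + 0\<^sup>2) / 2 = - ln \<bar>?r\<bar>" using elim ln_realpow[of "\<bar>?r\<bar>" 2] by simp
      ultimately show ?case unfolding log_kernel_def by (intro tendsto_mult tendsto_const) simp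
    qed
  qed measurable
  have "(LINT x|?M. log_kernel (\<delta> n) (fst x - snd x) * (\<psi> (fst x) \<bullet> \<psi> (snd x))) <= E / 2" for n
    using log_kernel_form_le[OF \<delta>(1)[of n] q] by (simp add: E_def case_prod_beta')
  then have LE: "(LINT x|?M. ?L x) <= E / 2" using LIMSEQ_le_const2[OF lim1] by blast
  define D where "D n x = (2 * ln (sqrt (fst x + real n) + sqrt (snd x + real n)) - ln (4 * real n) - ln \<bar>fst x - snd x\<bar>) * (\<psi> (fst x) \<bullet> \<psi> (snd x))" for n and x :: "real \<times> real"
  obtain N :: nat where N: "real N >= 2 * R + 1" using real_arch_simple by blast
  have lim2: "(\<lambda>n. LINT x|?M. D (n + N) x) ---> (LINT x|?M. ?L x)"
  proof (rule integral_dominated_convergence[where w = "?w (2 * R + 1)"])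
    show "integrable ?M (?w (2 * R + 1))" by (rule dominating_integrable)
    show "AE x in ?M. norm (D (n + N) x) <= ?w (2 * R + 1) x" for n
      using half_int_truncated(2)[of "n + N"] N by (simp add: D_def)
    show "AE x in ?M. (\<lambda>n. D (n + N) x) ---> ?L x"
    proof (rule AE_I2, rule LIMSEQ_ignore_initial_segment)
      fix x :: "real \<times> real"
      have q: "(\<lambda>n. (s + real n) / real n) ---> 1" for s
      proof -
        have "(\<lambda>n. s / real n + 1) ---> 0 + 1" by (intro tendsto_intros lim_const_over_n)
        then have "(\<lambda>n. s / real n + 1) ---> 1" by simp
        then show ?thesis
          by (rule Lim_transform_eventually)
             (use eventually_gt_at_top[of 0] in \<open>auto elim!: eventually_mono simp: add_divide_distrib\<close>)
      qed
      \<comment> \<open>Distributing \<open>ln (4 * n)\<close> under the roots turns the difference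
        into twice the logarithm of a mean of two roots that tend to 1.\<close>
      have "(\<lambda>n. 2 * ln ((sqrt ((fst x + real n) / real n) + sqrt ((snd x + real n) / real n)) / 2)) ---> 2 * ln ((sqrt 1 + sqrt 1) / 2)"
        by (intro tendsto_intros q) auto
      then have l0: "(\<lambda>n. 2 * ln ((sqrt ((fst x + real n) / real n) + sqrt ((snd x + real n) / real n)) / 2)) ---> 0" by simp
      have "(\<lambda>n. 2 * ln (sqrt (fst x + real n) + sqrt (snd x + real n)) - ln (4 * real n)) ---> 0"
      proof (rule Lim_transform_eventually[OF l0])
        obtain K :: nat where K: "real K > \<bar>fst x\<bar> + \<bar>snd x\<bar> + 1" using reals_Archimedean2 by blast
        show "\<forall>\<^sub>F n in sequentially. 2 * ln ((sqrt ((fst x + real n) / real n) + sqrt ((snd x + real n) / real n)) / 2)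
           = 2 * ln (sqrt (fst x + real n) + sqrt (snd x + real n)) - ln (4 * real n)"
          using eventually_ge_at_top[of K]
        proof eventually_elim
          case (elim n)
          have n: "real n > \<bar>fst x\<bar> + \<bar>snd x\<bar> + 1" using elim K by (meson less_le_trans of_nat_le_iff)
          have p: "fst x + real n > 0" "snd x + real n > 0" "real n > 0" using n by linarith+
          let ?A = "sqrt (fst x + real n) + sqrt (snd x + real n)"
          have A: "?A > 0" using p by (intro add_pos_pos) auto
          have "(sqrt ((fst x + real n) / real n) + sqrt ((snd x + real n) / real n)) / 2 = ?A / sqrt (4 * real n)"
            unfolding real_sqrt_divide real_sqrt_mult real_sqrt_four by (simp add: add_divide_distrib)
          then have "2 * ln ((sqrt ((fst x + real n) / real n) + sqrt ((snd x + real n) / real n)) / 2) = 2 * ln (?A / sqrt (4 * real n))"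
            by (simp only:)
          also have "... = 2 * (ln ?A - ln (sqrt (4 * real n)))"
            using A p by (subst ln_div) auto
          also have "... = 2 * ln ?A - ln (4 * real n)" using p by (simp add: ln_sqrt)
          finally show ?case .
        qed
      qed
      then have "(\<lambda>n. ((2 * ln (sqrt (fst x + real n) + sqrt (snd x + real n)) - ln (4 * real n)) - ln \<bar>fst x - snd x\<bar>) * (\<psi> (fst x) \<bullet> \<psi> (snd x)))
         ---> (0 - ln \<bar>fst x - snd x\<bar>) * (\<psi> (fst x) \<bullet> \<psi> (snd x))"
        by (intro tendsto_intros)
      then show "(\<lambda>n. D n x) ---> ?L x" by (simp add: D_def)
    qed
  qed (auto simp: D_def)
  have "sqnorm lborel (half_int \<psi>) <= ennreal (E / 2) + ennreal \<eta>" if \<eta>: "\<eta> > 0" for \<eta>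
  proof -
    have E0: "E >= 0" by (simp add: E_def)
    have "\<forall>\<^sub>F n in sequentially. (LINT x|?M. D (n + N) x) < E / 2 + \<eta>"
      using LE \<eta> by (intro order_tendstoD(2)[OF lim2]) auto
    then have ev: "\<forall>\<^sub>F n in sequentially. sqnorm lborel (\<lambda>t. indicator {- real (n + N)<..} t *\<^sub>R half_int \<psi> t) <= ennreal (E / 2 + \<eta>)"
    proof eventually_elim
      case (elim n)
      have n: "2 * R + 1 <= real (n + N)" using N by simp
      show ?case
        unfolding half_int_truncated(1)[OF n] D_def[symmetric] using elim by (intro ennreal_leI) simp
    qed
    have "sqnorm lborel (half_int \<psi>) <= ennreal (E / 2 + \<eta>)"
    proof (rule sqnorm_Fatou[OF _ _ ev])
      show "AE t in lborel. (\<lambda>n. indicator {- real (n + N)<..} t *\<^sub>R half_int \<psi> t) ---> half_int \<psi> t"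
      proof (rule AE_I2)
        fix t :: real
        obtain K :: nat where K: "real K > - t" using reals_Archimedean2 by blast
        have "\<forall>\<^sub>F n in sequentially. indicator {- real (n + N)<..} t *\<^sub>R half_int \<psi> t = half_int \<psi> t"
          using eventually_ge_at_top[of K]
        proof eventually_elim
          case (elim n)
          then have "- real (n + N) < t" using K by (smt (verit) of_nat_add of_nat_le_iff of_nat_0_le_iff)
          then show ?case by simp
        qed
        then show "(\<lambda>n. indicator {- real (n + N)<..} t *\<^sub>R half_int \<psi> t) ---> half_int \<psi> t"
          by (rule tendsto_eventually)
      qed
    qed measurable
    then show ?thesis using E0 \<eta> by (simp add: ennreal_plus)
  qed
  then have "sqnorm lborel (half_int \<psi>) <= ennreal (E / 2)" by (rule ennreal_le_epsilon)
  also have "... <= ennreal E" by (intro ennreal_leI) (simp add: E_def)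
  also have "... = sqnorm ?M (dquot \<Phi>)" unfolding E_def by (rule sqnorm_eq_l2norm[OF q, symmetric])
  finally show ?thesis .
qed simp

end

subsection \<open>Half derivatives of smooth functions\<close>

lemma smooth_compact_primitive:
  fixes f :: "real => 'h::{real_inner,banach,second_countable_topology}"
  assumes f: "f \<in> smooth_compact" and f': "\<And>t. (f has_vector_derivative f' t) (at t)"
  obtains R B where "compact_primitive f f' {} R B" "f' \<in> smooth_compact"
proof -
  obtain g where g: "g \<in> smooth_compact" "\<And>t. (f has_vector_derivative g t) (at t)"
    using smooth_compact_deriv[OF f] by metis
  have "g = f'" using vector_derivative_unique_at[OF g(2) f'] by blast
  with g have f'S: "f' \<in> smooth_compact" by simp
  obtain R1 R2 where R1: "R1 > 0" "\<And>t. \<bar>t\<bar> > R1 ==> f t = 0" and R2: "R2 > 0" "\<And>t. \<bar>t\<bar> > R2 ==> f' t = 0"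
    using smooth_compact_bounded_support[OF f] smooth_compact_bounded_support[OF f'S] by metis
  obtain B1 B2 where B1: "B1 > 0" "\<And>t. norm (f t) <= B1" and B2: "B2 > 0" "\<And>t. norm (f' t) <= B2"
    using smooth_compact_bounded[OF f] smooth_compact_bounded[OF f'S] by metis
  have "compact_primitive f f' {} (max R1 R2) (max B1 B2)"
    using R1 R2 B1 B2 f' smooth_compact_continuous[OF f] smooth_compact_measurable[OF f'S]
    by unfold_locales (auto simp: le_max_iff_disj)
  then show thesis using that f'S by blast
qed

text \<open>Continuous at 0, with a jump of the derivative there; this reflection allows an estimate
  of \<open>D_minus\<close> by values on the half line alone.\<close>

lemma compact_primitive_even:
  assumes "compact_primitive f f' {} R B"
  shows "compact_primitive (\<lambda>t. f \<bar>t\<bar>) (\<lambda>t. sgn t *\<^sub>R f' \<bar>t\<bar>) {0} R B"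
proof -
  interpret compact_primitive f f' "{}" R B by fact
  show ?thesis
  proof
    show "continuous_on UNIV (\<lambda>t. f \<bar>t\<bar>)"
      by (rule continuous_on_compose2[OF cont]) (auto intro!: continuous_intros)
    show "norm (sgn t *\<^sub>R f' \<bar>t\<bar>) <= B" for t
    proof (cases "t = 0")
      case True
      then show ?thesis using order_trans[OF norm_ge_zero bound(2)[of 0]] by simp
    qed (use bound(2)[of "\<bar>t\<bar>"] in \<open>auto simp: sgn_if\<close>)
    show "((\<lambda>t. f \<bar>t\<bar>) has_vector_derivative sgn t *\<^sub>R f' \<bar>t\<bar>) (at t)" if "t \<notin> {0}" for t
    proof -
      have "(abs has_vector_derivative sgn t) (at t)"
      proof (cases "t > 0")
        case True
        show ?thesis
          by (rule has_vector_derivative_transform_within_open[of "\<lambda>x. x" _ _ "{0<..}"])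
             (use True in \<open>auto intro: has_vector_derivative_id\<close>)
      next
        case False
        show ?thesis
          by (rule has_vector_derivative_transform_within_open[of "\<lambda>x. - x" _ _ "{..<0}"])
             (use False that in \<open>auto intro!: derivative_eq_intros simp: has_real_derivative_iff_has_vector_derivative[symmetric]\<close>)
      qed
      from vector_diff_chain_at[OF this deriv[of "\<bar>t\<bar>"]] show ?thesis by (simp add: o_def)
    qed
  qed (use R bound supp in auto)
qed

lemma compact_primitive_reflect:
  assumes "compact_primitive f f' {} R B"
  shows "compact_primitive (\<lambda>t. f (- t)) (\<lambda>t. - f' (- t)) {} R B"
proof -
  interpret compact_primitive f f' "{}" R B by fact
  show ?thesis
  proof
    show "continuous_on UNIV (\<lambda>t. f (- t))"
      by (rule continuous_on_compose2[OF cont]) (auto intro!: continuous_intros)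
    show "((\<lambda>t. f (- t)) has_vector_derivative - f' (- t)) (at t)" for t
    proof -
      have "(uminus has_vector_derivative - 1) (at t)"
        by (auto intro!: derivative_eq_intros simp: has_real_derivative_iff_has_vector_derivative[symmetric])
      from vector_diff_chain_at[OF this deriv[of "- t"]] show ?thesis by (simp add: o_def)
    qed
  qed (use R bound supp in auto)
qed

lemma half_int_deriv:
  fixes f :: "real => 'h::{real_inner,banach,second_countable_topology}"
  assumes f: "f \<in> smooth_compact" and f': "\<And>t. (f has_vector_derivative f' t) (at t)"
  shows "((\<lambda>t. half_int f t) has_vector_derivative half_int f' t) (at t)"
proof -
  have eq: "half_int g t = (LINT r|lborel. frac_kernel r *\<^sub>R g (t + r))" for g :: "real => 'h" and t
    unfolding half_int_def by (subst lborel_integral_real_affine[where c = 1 and t = t]) auto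
  show ?thesis unfolding eq
    by (rule has_vector_derivative_convolution(1)[OF bounded_bilinear.flip[OF bounded_bilinear_scaleR] f f'])
       (auto intro: frac_kernel_set_integrable)
qed

lemma smooth_D_minus_eq:
  fixes f :: "real => 'h::{real_inner,banach,second_countable_topology}"
  assumes f: "f \<in> smooth_compact" and f': "\<And>t. (f has_vector_derivative f' t) (at t)"
  shows "smooth_D_minus f t = - (1 / sqrt pi) *\<^sub>R half_int f' t"
proof -
  have "(\<lambda>\<tau>. LINT s:{\<tau><..}|lborel. ((s - \<tau>) powr (-1/2)) *\<^sub>R f s) = half_int f"
    unfolding half_int_def set_lebesgue_integral_def
    by (intro ext Bochner_Integration.integral_cong) (auto simp: frac_kernel_def indicator_def)
  then show ?thesis
    unfolding smooth_D_minus_def Gamma_one_half_real using vector_derivative_at[OF half_int_deriv[OF f f']] by simp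
qed

text \<open>Time reversal turns the left-sided integral into \<open>half_int\<close>; the lower
  limit 0 may be dropped because f vanishes on the negative axis. The reflected form serves the norm
  bound, the explicit one the pairing with \<open>D_minus\<close>.\<close>

lemma smooth_D_plus_eq:
  fixes f :: "real => 'h::{real_inner,banach,second_countable_topology}"
  assumes f: "f \<in> smooth_compact_0" and f': "\<And>t. (f has_vector_derivative f' t) (at t)"
  shows "smooth_D_plus f t = - (1 / sqrt pi) *\<^sub>R half_int (\<lambda>s. - f' (- s)) (- t)"
    and "smooth_D_plus f t = (1 / sqrt pi) *\<^sub>R (LINT s|lborel. frac_kernel (t - s) *\<^sub>R f' s)"
proof -
  have fS: "f \<in> smooth_compact" and f0: "\<And>t. t <= 0 ==> f t = 0" using f by (auto simp: smooth_compact_0_iff)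
  have g: "(\<lambda>s. f (- s)) \<in> smooth_compact" using smooth_compact_affine[of "-1" f 0] fS by simp
  obtain R B where "compact_primitive f f' {} R B" using smooth_compact_primitive[OF fS f'] by metis
  then interpret compact_primitive "\<lambda>t. f (- t)" "\<lambda>t. - f' (- t)" "{}" R B by (rule compact_primitive_reflect)
  have eq: "half_int (\<lambda>s. h (- s)) (- \<tau>) = (LINT s|lborel. frac_kernel (\<tau> - s) *\<^sub>R h s)" for \<tau> and h :: "real => 'h"
    unfolding half_int_def by (subst lborel_integral_real_affine[where c = "-1" and t = 0]) auto
  have 1: "(\<lambda>\<tau>. LINT s:{0<..<\<tau>}|lborel. ((\<tau> - s) powr (-1/2)) *\<^sub>R f s) = (\<lambda>\<tau>. half_int (\<lambda>s. f (- s)) (- \<tau>))"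
    unfolding eq set_lebesgue_integral_def
  proof (intro ext Bochner_Integration.integral_cong refl)
    fix \<tau> s :: real
    show "indicator {0<..<\<tau>} s *\<^sub>R (\<tau> - s) powr (-1/2) *\<^sub>R f s = frac_kernel (\<tau> - s) *\<^sub>R f s"
      using f0[of s] by (cases "s <= 0") (auto simp: frac_kernel_def indicator_def)
  qed
  have "(uminus has_vector_derivative - 1) (at t)"
    by (auto intro!: derivative_eq_intros simp: has_real_derivative_iff_has_vector_derivative[symmetric])
  from vector_diff_chain_at[OF this half_int_deriv[OF g deriv], of]
  have "((\<lambda>\<tau>. half_int (\<lambda>s. f (- s)) (- \<tau>)) has_vector_derivative - half_int (\<lambda>s. - f' (- s)) (- t)) (at t)"
    by (simp add: o_def)
  from vector_derivative_at[OF this] show *: "smooth_D_plus f t = - (1 / sqrt pi) *\<^sub>R half_int (\<lambda>s. - f' (- s)) (- t)"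
    unfolding smooth_D_plus_def Gamma_one_half_real 1 by simp
  show "smooth_D_plus f t = (1 / sqrt pi) *\<^sub>R (LINT s|lborel. frac_kernel (t - s) *\<^sub>R f' s)"
    unfolding * using eq[of "\<lambda>s. - f' s" t] by simp
qed

lemma half_int_cong_pos:
  "(\<And>s. s > t ==> f s = g s) ==> half_int f t = half_int g t"
  unfolding half_int_def by (intro Bochner_Integration.integral_cong) (auto simp: frac_kernel_def)

text \<open>At positive times the operator sees only later values, so f may be replaced by its even
  reflection. The seminorm of f itself over the line would involve its values at negative times,
  which the half-line norm does not control. The factor \<open>1 / sqrt pi\<close> is below 1 and is
  dropped.\<close>

lemma smooth_D_minus_bound:
  fixes f :: "real => 'h::{real_inner,banach,second_countable_topology}"
  assumes f: "f \<in> smooth_compact"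
  shows "sqnorm half_line (smooth_D_minus f) <= sqnorm plane (dquot (\<lambda>t. f \<bar>t\<bar>))"
    and "smooth_D_minus f \<in> borel_measurable borel"
proof -
  obtain f' where f': "\<And>t. (f has_vector_derivative f' t) (at t)" using smooth_compact_deriv[OF f] by metis
  obtain R B where cp: "compact_primitive f f' {} R B" using smooth_compact_primitive[OF f f'] by metis
  then interpret A: compact_primitive f f' "{}" R B .
  interpret compact_primitive "\<lambda>t. f \<bar>t\<bar>" "\<lambda>t. sgn t *\<^sub>R f' \<bar>t\<bar>" "{0}" R B by (rule compact_primitive_even[OF cp])
  have "smooth_D_minus f = (\<lambda>t. - (1 / sqrt pi) *\<^sub>R half_int f' t)" using smooth_D_minus_eq[OF f f'] by auto
  then show "smooth_D_minus f \<in> borel_measurable borel" by simp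
  have "sqnorm half_line (smooth_D_minus f) <= sqnorm half_line (half_int (\<lambda>t. sgn t *\<^sub>R f' \<bar>t\<bar>))"
  proof (rule sqnorm_mono, rule AE_I2)
    fix t assume "t \<in> space half_line"
    then have "half_int f' t = half_int (\<lambda>t. sgn t *\<^sub>R f' \<bar>t\<bar>) t" by (intro half_int_cong_pos) auto
    then have "norm (smooth_D_minus f t) = norm (half_int (\<lambda>t. sgn t *\<^sub>R f' \<bar>t\<bar>) t) / sqrt pi"
      unfolding smooth_D_minus_eq[OF f f'] by simp
    also have "... <= norm (half_int (\<lambda>t. sgn t *\<^sub>R f' \<bar>t\<bar>) t) / 1"
      using pi_gt3 by (intro divide_left_mono) (auto simp: real_le_rsqrt)
    finally show "norm (smooth_D_minus f t) <= norm (half_int (\<lambda>t. sgn t *\<^sub>R f' \<bar>t\<bar>) t)" by simp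
  qed
  also have "... <= sqnorm lborel (half_int (\<lambda>t. sgn t *\<^sub>R f' \<bar>t\<bar>))"
    unfolding sqnorm_def nn_integral_half_line by (intro nn_integral_mono) (auto simp: indicator_def)
  also have "... <= sqnorm plane (dquot (\<lambda>t. f \<bar>t\<bar>))" by (rule half_int_bound)
  finally show "sqnorm half_line (smooth_D_minus f) <= sqnorm plane (dquot (\<lambda>t. f \<bar>t\<bar>))" .
qed

lemma smooth_D_plus_bound:
  fixes f :: "real => 'h::{real_inner,banach,second_countable_topology}"
  assumes f: "f \<in> smooth_compact_0"
  shows "sqnorm half_line (smooth_D_plus f) <= sqnorm plane (dquot f)"
    and "smooth_D_plus f \<in> borel_measurable borel"
proof -
  have fS: "f \<in> smooth_compact" using f by (auto simp: smooth_compact_0_def)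
  obtain f' where f': "\<And>t. (f has_vector_derivative f' t) (at t)" using smooth_compact_deriv[OF fS] by metis
  obtain R B where cp: "compact_primitive f f' {} R B" using smooth_compact_primitive[OF fS f'] by metis
  then interpret A: compact_primitive f f' "{}" R B .
  interpret compact_primitive "\<lambda>t. f (- t)" "\<lambda>t. - f' (- t)" "{}" R B by (rule compact_primitive_reflect[OF cp])
  have eq: "smooth_D_plus f = (\<lambda>t. - (1 / sqrt pi) *\<^sub>R half_int (\<lambda>s. - f' (- s)) (- t))" using smooth_D_plus_eq(1)[OF f f'] by auto
  then show "smooth_D_plus f \<in> borel_measurable borel" by simp
  have "sqnorm half_line (smooth_D_plus f) <= sqnorm lborel (smooth_D_plus f)"
    unfolding sqnorm_def nn_integral_half_line by (intro nn_integral_mono) (auto simp: indicator_def)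
  also have "... <= sqnorm lborel (\<lambda>t. half_int (\<lambda>s. - f' (- s)) (- t))"
  proof (rule sqnorm_mono, rule AE_I2)
    fix t :: real
    have "norm (smooth_D_plus f t) = norm (half_int (\<lambda>s. - f' (- s)) (- t)) / sqrt pi" unfolding eq by simp
    also have "... <= norm (half_int (\<lambda>s. - f' (- s)) (- t)) / 1"
      using pi_gt3 by (intro divide_left_mono) (auto simp: real_le_rsqrt)
    finally show "norm (smooth_D_plus f t) <= norm (half_int (\<lambda>s. - f' (- s)) (- t))" by simp
  qed
  also have "... = sqnorm lborel (half_int (\<lambda>s. - f' (- s)))"
    unfolding sqnorm_def using nn_integral_lborel_reflect[of "\<lambda>t. ennreal ((norm (half_int (\<lambda>s. - f' (- s)) t))\<^sup>2)" 0] by simp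
  also have "... <= sqnorm plane (dquot (\<lambda>t. f (- t)))" by (rule half_int_bound)
  also have "... = sqnorm plane (dquot f)"
  proof -
    have "sqnorm plane (dquot (\<lambda>t. f (- t))) = (\<integral>\<^sup>+s. \<integral>\<^sup>+t. ennreal ((norm (dquot f (0 - s, 0 - t)))\<^sup>2) \<partial>lborel \<partial>lborel)"
      unfolding sqnorm_def by (subst lborel.nn_integral_fst[symmetric]) (auto simp: dquot_def abs_minus_commute)
    also have "... = (\<integral>\<^sup>+s. \<integral>\<^sup>+t. ennreal ((norm (dquot f (0 - s, t)))\<^sup>2) \<partial>lborel \<partial>lborel)"
      using nn_integral_lborel_reflect[of "\<lambda>t. ennreal ((norm (dquot f (0 - s, t)))\<^sup>2)" 0 for s] by (simp add: dquot_def)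
    also have "... = (\<integral>\<^sup>+s. \<integral>\<^sup>+t. ennreal ((norm (dquot f (s, t)))\<^sup>2) \<partial>lborel \<partial>lborel)"
      using nn_integral_lborel_reflect[of "\<lambda>s. \<integral>\<^sup>+t. ennreal ((norm (dquot f (s, t)))\<^sup>2) \<partial>lborel" 0] by (simp add: dquot_def)
    also have "... = sqnorm plane (dquot f)"
      unfolding sqnorm_def by (rule lborel.nn_integral_fst) measurable
    finally show ?thesis .
  qed
  finally show "sqnorm half_line (smooth_D_plus f) <= sqnorm plane (dquot f)" .
qed

text \<open>Composing the two half-order kernels gives the constant pi on the triangle s < t by the
  Beta integral, and it cancels the two factors \<open>1 / sqrt pi\<close>. Integrating
  \<open>g'\<close> over t > s leaves \<open>- g s\<close>, which also settles the sign. As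
  \<open>f'\<close> vanishes for s <= 0, so does the left factor for t <= 0, and the half line may
  be replaced by the line.\<close>

lemma smooth_D_pairing:
  fixes f g :: "real => 'h::{real_inner,banach,second_countable_topology}"
  assumes f: "f \<in> smooth_compact_0" and f': "\<And>t. (f has_vector_derivative f' t) (at t)"
    and g: "g \<in> smooth_compact"
  shows "(LINT t|half_line. smooth_D_plus f t \<bullet> smooth_D_minus g t) = (LINT t|lborel. f' t \<bullet> g t)"
proof -
  let ?M = plane
  have fS: "f \<in> smooth_compact" using f by (auto simp: smooth_compact_0_def)
  obtain g' where g': "\<And>t. (g has_vector_derivative g' t) (at t)" using smooth_compact_deriv[OF g] by metis
  obtain R B where "compact_primitive f f' {} R B" using smooth_compact_primitive[OF fS f'] by metis
  then interpret F: compact_primitive f f' "{}" R B .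
  obtain R2 B2 where "compact_primitive g g' {} R2 B2" using smooth_compact_primitive[OF g g'] by metis
  then interpret G: compact_primitive g g' "{}" R2 B2 .
  obtain d where d: "d > 0" "\<And>t. t < d ==> f t = 0" using f by (auto simp: smooth_compact_0_iff)
  have f'0: "f' s = 0" if "s <= 0" for s
  proof (rule has_vector_derivative_0_outside_support[OF f'])
    have "closure {t. f t \<noteq> 0} \<subseteq> {0<..}" using f by (auto simp: smooth_compact_0_def)
    then show "s \<notin> closure {t. f t \<noteq> 0}" using that by auto
  qed
  let ?p = "\<lambda>t. LINT s|lborel. frac_kernel (t - s) *\<^sub>R f' s" and ?m = "\<lambda>t. LINT s|lborel. frac_kernel (s - t) *\<^sub>R g' s"
  have p0: "?p t = 0" if "t <= 0" for t
  proof -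
    have "frac_kernel (t - s) *\<^sub>R f' s = 0" for s using f'0[of s] that by (cases "s <= 0") (auto simp: frac_kernel_def)
    then have "(\<lambda>s. frac_kernel (t - s) *\<^sub>R f' s) = (\<lambda>s. 0)" by (intro ext)
    then show ?thesis by (simp only: integral_zero)
  qed
  let ?c = "\<lambda>x. \<integral>\<^sup>+t. ennreal (frac_kernel (t - fst x)) * ennreal (frac_kernel (snd x - t)) \<partial>lborel"
  have c1: "?c x = ennreal pi" if "fst x < snd x" for x using nn_integral_Beta_half[OF that] .
  have c2: "?c x = 0" if "\<not> fst x < snd x" for x
  proof -
    have "(\<lambda>t. ennreal (frac_kernel (t - fst x)) * ennreal (frac_kernel (snd x - t))) = (\<lambda>t. 0)"
      using that by (auto simp: frac_kernel_def fun_eq_iff)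
    then show ?thesis by (simp only: nn_integral_0_iff_AE) simp
  qed
  have iN: "integrable ?M (\<lambda>(s, t). norm (f' s) * norm (g' t))"
    using integral_inner_product(1)[OF F.norm_deriv_integrable(2) G.norm_deriv_integrable(2)] by simp
  have "(\<integral>\<^sup>+x. ?c x * ennreal (norm (f' (fst x)) * norm (g' (snd x))) \<partial>?M) <= (\<integral>\<^sup>+x. ennreal pi * ennreal (norm ((\<lambda>(s, t). norm (f' s) * norm (g' t)) x)) \<partial>?M)"
  proof (intro nn_integral_mono)
    fix x :: "real \<times> real"
    have "?c x <= ennreal pi" using c1 c2 by (cases "fst x < snd x") auto
    then show "?c x * ennreal (norm (f' (fst x)) * norm (g' (snd x))) <= ennreal pi * ennreal (norm ((\<lambda>(s, t). norm (f' s) * norm (g' t)) x))"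
      by (intro mult_mono) (auto simp: case_prod_beta)
  qed
  also have "... = ennreal pi * (\<integral>\<^sup>+x. ennreal (norm ((\<lambda>(s, t). norm (f' s) * norm (g' t)) x)) \<partial>?M)"
    by (rule nn_integral_cmult) auto
  also have "... < \<infinity>" using iN by (simp add: integrable_iff_bounded ennreal_mult_less_top)
  finally have fin: "(\<integral>\<^sup>+x. ?c x * ennreal (norm (f' (fst x)) * norm (g' (snd x))) \<partial>?M) < \<infinity>" .
  have am: "(\<lambda>x. frac_kernel (fst x - snd x)) \<in> borel_measurable (borel \<Otimes>\<^sub>M borel)"
    "(\<lambda>x. frac_kernel (snd x - fst x)) \<in> borel_measurable (borel \<Otimes>\<^sub>M borel)" by measurable
  note kp = integral_nonneg_kernel_product(2)[OF am F.meas G.meas _ _ fin F.integrable_frac_kernel_mult(2) G.integrable_frac_kernel_mult(1)]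
  have "(LINT t|half_line. smooth_D_plus f t \<bullet> smooth_D_minus g t) = (LINT t|lborel. - (1 / pi) * (?p t \<bullet> ?m t))"
    unfolding integral_half_line
  proof (intro Bochner_Integration.integral_cong refl)
    fix t :: real
    have "smooth_D_plus f t \<bullet> smooth_D_minus g t = - (1 / pi) * (?p t \<bullet> ?m t)"
      unfolding smooth_D_plus_eq(2)[OF f f'] smooth_D_minus_eq[OF g g'] half_int_def
      by (simp add: divide_simps)
    then show "indicator {0<..} t *\<^sub>R (smooth_D_plus f t \<bullet> smooth_D_minus g t) = - (1 / pi) * (?p t \<bullet> ?m t)"
      using p0[of t] by (cases "t > 0") auto
  qed
  also have "... = - (1 / pi) * (LINT t|lborel. ?p t \<bullet> ?m t)" by simp
  also have "(LINT t|lborel. ?p t \<bullet> ?m t) = (LINT x|?M. enn2real (?c x) * (f' (fst x) \<bullet> g' (snd x)))"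
    using kp by simp
  also have "... = (LINT x|?M. pi * (\<lambda>(s, t). f' s \<bullet> (indicator {s<..} t *\<^sub>R g' t)) x)"
  proof (intro Bochner_Integration.integral_cong refl)
    fix x :: "real \<times> real"
    show "enn2real (?c x) * (f' (fst x) \<bullet> g' (snd x)) = pi * (\<lambda>(s, t). f' s \<bullet> (indicator {s<..} t *\<^sub>R g' t)) x"
      using c1 c2 by (cases "fst x < snd x") (auto simp: case_prod_beta)
  qed
  also have "... = pi * (LINT x|?M. (\<lambda>(s, t). f' s \<bullet> (indicator {s<..} t *\<^sub>R g' t)) x)" by simp
  also have "(LINT x|?M. (\<lambda>(s, t). f' s \<bullet> (indicator {s<..} t *\<^sub>R g' t)) x) = (LINT s|lborel. LINT t|lborel. f' s \<bullet> (indicator {s<..} t *\<^sub>R g' t))"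
  proof -
    have m: "(\<lambda>(s, t). f' s \<bullet> (indicator {s<..} t *\<^sub>R g' t)) \<in> borel_measurable ?M"
      unfolding indicator_def of_bool_def greaterThan_iff by measurable
    have "integrable ?M (\<lambda>(s, t). f' s \<bullet> (indicator {s<..} t *\<^sub>R g' t))"
      by (rule Bochner_Integration.integrable_bound[OF iN m])
         (auto simp: indicator_def Cauchy_Schwarz_ineq2 intro!: AE_I2)
    from lborel_pair.integral_fst'[OF this] show ?thesis by simp
  qed
  also have "... = (LINT s|lborel. f' s \<bullet> (- g s))"
  proof (intro Bochner_Integration.integral_cong refl)
    fix s
    have "integrable lborel (\<lambda>t. indicator {s<..} t *\<^sub>R g' t)"
      using integrable_mult_indicator[of "{s<..}" lborel g'] G.norm_deriv_integrable(1) by simp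
    then have "(LINT t|lborel. f' s \<bullet> (indicator {s<..} t *\<^sub>R g' t)) = f' s \<bullet> (LINT t|lborel. indicator {s<..} t *\<^sub>R g' t)"
      by (intro integral_inner_right) auto
    then show "(LINT t|lborel. f' s \<bullet> (indicator {s<..} t *\<^sub>R g' t)) = f' s \<bullet> (- g s)"
      unfolding G.integral_tail .
  qed
  finally show ?thesis by simp
qed

subsection \<open>Extension from the half line\<close>

abbreviation half_plane :: "(real \<times> real) measure" where
  "half_plane \<equiv> half_line \<Otimes>\<^sub>M half_line"

lemma borel_measurable_dquot_half_line:
  fixes u :: "real => 'h::{real_normed_vector,second_countable_topology}"
  shows "u \<in> borel_measurable half_line ==> dquot u \<in> borel_measurable half_plane"
  by (rule borel_measurable_dquot) (auto intro: measurable_ident_half_line)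

lemma H12_normsq_eq:
  fixes u :: "real => 'h::{real_normed_vector,second_countable_topology}"
  assumes "u \<in> borel_measurable half_line"
  shows "H12_normsq u = sqnorm half_line u + sqnorm half_plane (dquot u)"
proof -
  have [measurable]: "dquot u \<in> borel_measurable half_plane" by (rule borel_measurable_dquot_half_line) fact
  have "sqnorm half_plane (dquot u) = (\<integral>\<^sup>+s. \<integral>\<^sup>+t. ennreal ((norm (dquot u (s, t)))\<^sup>2) \<partial>half_line \<partial>half_line)"
    unfolding sqnorm_def by (rule half_line.nn_integral_fst[symmetric]) measurable
  then show ?thesis by (simp add: H12_normsq_def L2_normsq_eq norm_dquot_sq)
qed

lemma nn_integral_plane_reflect_split:
  assumes [measurable]: "q \<in> borel_measurable (borel \<Otimes>\<^sub>M borel)"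
  shows "(\<integral>\<^sup>+x. q x \<partial>plane) =
    (\<integral>\<^sup>+s. \<integral>\<^sup>+t. q (s, t) + q (s, - t) + (q (- s, t) + q (- s, - t)) \<partial>half_line \<partial>half_line)"
proof -
  have m: "(\<lambda>t. q (f s, g t)) \<in> borel_measurable half_line" if [measurable]: "g \<in> borel_measurable borel" for f g and s :: real
    by (rule measurable_half_lineI) measurable
  have "(\<integral>\<^sup>+x. q x \<partial>plane) = (\<integral>\<^sup>+s. \<integral>\<^sup>+t. q (s, t) \<partial>lborel \<partial>lborel)"
    by (rule lborel.nn_integral_fst[symmetric]) measurable
  also have "... = (\<integral>\<^sup>+s. (\<integral>\<^sup>+t. q (s, t) + q (s, - t) \<partial>half_line) + (\<integral>\<^sup>+t. q (- s, t) + q (- s, - t) \<partial>half_line) \<partial>half_line)"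
    by (subst nn_integral_reflect_split[of "\<lambda>s. \<integral>\<^sup>+t. q (s, t) \<partial>lborel"])
       (auto intro!: nn_integral_cong arg_cong2[where f = "(+)"] nn_integral_reflect_split)
  also have "... = (\<integral>\<^sup>+s. \<integral>\<^sup>+t. q (s, t) + q (s, - t) + (q (- s, t) + q (- s, - t)) \<partial>half_line \<partial>half_line)"
    by (intro nn_integral_cong nn_integral_add[symmetric] borel_measurable_add m) auto
  finally show ?thesis .
qed

text \<open>The interaction of a point s > 0 with the whole negative axis in the Gagliardo integral;
  this is where the weight \<open>1 / s\<close> originates.\<close>

lemma nn_integral_inverse_square_tail:
  assumes s: "s > 0"
  shows "(\<integral>\<^sup>+t. ennreal (1 / (s + t)\<^sup>2) \<partial>half_line) = ennreal (1 / s)"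
proof -
  have "(\<integral>\<^sup>+t. ennreal (1 / (s + t)\<^sup>2) * indicator {0..} t \<partial>lborel) = ennreal (0 - (- 1 / (s + 0)))"
  proof (rule nn_integral_FTC_atLeast[where F = "\<lambda>t. - 1 / (s + t)" and T = 0])
    show "((\<lambda>t. - 1 / (s + t)) has_real_derivative 1 / (s + t)\<^sup>2) (at t)" if "0 <= t" for t
      using s that by (auto intro!: derivative_eq_intros simp: power2_eq_square)
    have "filterlim (\<lambda>t. s + t) at_top at_top"
      by (rule filterlim_tendsto_add_at_top[OF tendsto_const filterlim_ident])
    from tendsto_minus[OF tendsto_inverse_0_at_top[OF this]]
    show "((\<lambda>t. - 1 / (s + t)) \<longlongrightarrow> 0) at_top" by (simp add: inverse_eq_divide)
  qed auto
  moreover have "(\<integral>\<^sup>+t. ennreal (1 / (s + t)\<^sup>2) * indicator {0..} t \<partial>lborel) = (\<integral>\<^sup>+t. ennreal (1 / (s + t)\<^sup>2) \<partial>half_line)"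
    unfolding nn_integral_half_line
    by (intro nn_integral_cong_AE eventually_mono[OF AE_lborel_singleton[of 0]]) (auto simp: indicator_def)
  ultimately show ?thesis by simp
qed

lemma sqnorm_half_line_le: "sqnorm half_line U <= sqnorm lborel U"
  unfolding sqnorm_def nn_integral_half_line by (intro nn_integral_mono) (auto simp: indicator_def)

lemma sqnorm_half_plane_le:
  fixes U :: "real => 'h::{real_normed_vector,second_countable_topology}"
  assumes [measurable]: "U \<in> borel_measurable borel"
  shows "sqnorm half_plane (dquot U) <= sqnorm plane (dquot U)"
proof -
  have [measurable]: "dquot U \<in> borel_measurable half_plane"
    by (intro borel_measurable_dquot_half_line measurable_half_lineI) fact
  have [measurable]: "dquot U \<in> borel_measurable (borel \<Otimes>\<^sub>M borel)" by (rule borel_measurable_dquot) auto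
  have "sqnorm half_plane (dquot U) = (\<integral>\<^sup>+s. \<integral>\<^sup>+t. ennreal ((norm (dquot U (s, t)))\<^sup>2) \<partial>half_line \<partial>half_line)"
    unfolding sqnorm_def by (rule half_line.nn_integral_fst[symmetric]) measurable
  also have "... <= sqnorm plane (dquot U)"
    unfolding sqnorm_def
    by (subst nn_integral_plane_reflect_split) (auto intro!: nn_integral_mono add_increasing2)
  finally show ?thesis .
qed

text \<open>The plane splits into quadrants: the positive one gives the half-line seminorm, the
  negative one nothing, and each mixed one a copy of the weighted term.\<close>

lemma sqnorm_dquot_zero_extension:
  fixes U :: "real => 'h::{real_normed_vector,second_countable_topology}"
  assumes [measurable]: "U \<in> borel_measurable borel" and U0: "\<And>t. t <= 0 ==> U t = 0"
  shows "sqnorm plane (dquot U) = sqnorm half_plane (dquot U) + 2 * (\<integral>\<^sup>+s. ennreal (1 / s * (norm (U s))\<^sup>2) \<partial>half_line)"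
proof -
  note mh = measurable_half_lineI
  have [measurable]: "U \<in> borel_measurable half_line" by (rule mh) fact
  have [measurable]: "(\<lambda>x. x) \<in> borel_measurable half_line" by (rule measurable_ident_half_line)
  have dm[measurable]: "dquot U \<in> borel_measurable half_plane" by (rule borel_measurable_dquot_half_line) measurable
  have [measurable]: "dquot U \<in> borel_measurable (borel \<Otimes>\<^sub>M borel)" by (rule borel_measurable_dquot) auto
  have dm1[measurable]: "(\<lambda>t. dquot U (s, t)) \<in> borel_measurable half_line" for s by (rule mh) measurable
  interpret H: pair_sigma_finite half_line half_line ..
  let ?q = "\<lambda>s t. ennreal ((norm (dquot U (s, t)))\<^sup>2)"
  let ?g = "\<lambda>s t. ennreal ((norm (U s))\<^sup>2) * ennreal (1 / (s + t)\<^sup>2)"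
  have gm[measurable]: "(\<lambda>(s, t). ?g s t) \<in> borel_measurable half_plane" by measurable
  have g: "(\<integral>\<^sup>+s. \<integral>\<^sup>+t. ?g s t \<partial>half_line \<partial>half_line) = (\<integral>\<^sup>+s. ennreal (1 / s * (norm (U s))\<^sup>2) \<partial>half_line)"
  proof (intro nn_integral_cong)
    fix s assume "s \<in> space half_line"
    then have s: "s > 0" by simp
    have "(\<integral>\<^sup>+t. ?g s t \<partial>half_line) = ennreal ((norm (U s))\<^sup>2) * (\<integral>\<^sup>+t. ennreal (1 / (s + t)\<^sup>2) \<partial>half_line)"
      by (rule nn_integral_cmult) (rule mh, measurable)
    then show "(\<integral>\<^sup>+t. ?g s t \<partial>half_line) = ennreal (1 / s * (norm (U s))\<^sup>2)"
      unfolding nn_integral_inverse_square_tail[OF s] using s by (simp add: ennreal_mult[symmetric] mult.commute)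
  qed
  have "sqnorm plane (dquot U) = (\<integral>\<^sup>+s. \<integral>\<^sup>+t. ?q s t + ?q s (- t) + (?q (- s) t + ?q (- s) (- t)) \<partial>half_line \<partial>half_line)"
    unfolding sqnorm_def by (rule nn_integral_plane_reflect_split) measurable
  also have "... = (\<integral>\<^sup>+s. \<integral>\<^sup>+t. ?q s t + (?g s t + ?g t s) \<partial>half_line \<partial>half_line)"
  proof (intro nn_integral_cong)
    fix s t assume "s \<in> space half_line" "t \<in> space half_line"
    then have st: "s > 0" "t > 0" by auto
    have "?q s (- t) = ?g s t" "?q (- s) t = ?g t s" "?q (- s) (- t) = 0"
      using st U0[of "- s"] U0[of "- t"]
      by (auto simp: norm_dquot_sq ennreal_mult[symmetric] power2_commute add.commute)
    then show "?q s t + ?q s (- t) + (?q (- s) t + ?q (- s) (- t)) = ?q s t + (?g s t + ?g t s)"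
      by (simp add: add.assoc)
  qed
  also have "... = (\<integral>\<^sup>+s. (\<integral>\<^sup>+t. ?q s t \<partial>half_line) + ((\<integral>\<^sup>+t. ?g s t \<partial>half_line) + (\<integral>\<^sup>+t. ?g t s \<partial>half_line)) \<partial>half_line)"
    by (intro nn_integral_cong, subst nn_integral_add, simp, rule mh, measurable, subst nn_integral_add) (auto intro!: mh)
  also have "... = (\<integral>\<^sup>+s. (\<integral>\<^sup>+t. ?q s t \<partial>half_line) \<partial>half_line) + ((\<integral>\<^sup>+s. \<integral>\<^sup>+t. ?g s t \<partial>half_line \<partial>half_line) + (\<integral>\<^sup>+s. \<integral>\<^sup>+t. ?g t s \<partial>half_line \<partial>half_line))"
    by (subst nn_integral_add, measurable, subst nn_integral_add) measurable
  also have "(\<integral>\<^sup>+s. \<integral>\<^sup>+t. ?g t s \<partial>half_line \<partial>half_line) = (\<integral>\<^sup>+s. \<integral>\<^sup>+t. ?g s t \<partial>half_line \<partial>half_line)"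
    by (rule H.Fubini') measurable
  also have "(\<integral>\<^sup>+s. (\<integral>\<^sup>+t. ?q s t \<partial>half_line) \<partial>half_line) = sqnorm half_plane (dquot U)"
    unfolding sqnorm_def by (rule half_line.nn_integral_fst) measurable
  finally show ?thesis unfolding g by (simp add: mult_2)
qed

text \<open>Since |s - t| <= s + t for positive times, each of the four quadrants contributes at
  most the half-line seminorm.\<close>

lemma sqnorm_dquot_even:
  fixes u :: "real => 'h::{real_normed_vector,second_countable_topology}"
  assumes [measurable]: "(\<lambda>t. u \<bar>t\<bar>) \<in> borel_measurable borel" "u \<in> borel_measurable half_line"
  shows "sqnorm lborel (\<lambda>t. u \<bar>t\<bar>) = 2 * sqnorm half_line u"
    and "sqnorm plane (dquot (\<lambda>t. u \<bar>t\<bar>)) <= 4 * sqnorm half_plane (dquot u)"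
proof -
  have "sqnorm lborel (\<lambda>t. u \<bar>t\<bar>) = (\<integral>\<^sup>+t. ennreal ((norm (u \<bar>t\<bar>))\<^sup>2) + ennreal ((norm (u \<bar>- t\<bar>))\<^sup>2) \<partial>half_line)"
    unfolding sqnorm_def by (rule nn_integral_reflect_split) measurable
  also have "... = (\<integral>\<^sup>+t. 2 * ennreal ((norm (u t))\<^sup>2) \<partial>half_line)"
    by (intro nn_integral_cong) (auto simp: mult_2)
  also have "... = 2 * sqnorm half_line u" unfolding sqnorm_def by (rule nn_integral_cmult) measurable
  finally show "sqnorm lborel (\<lambda>t. u \<bar>t\<bar>) = 2 * sqnorm half_line u" .
  have [measurable]: "dquot u \<in> borel_measurable half_plane" by (rule borel_measurable_dquot_half_line) measurable
  have [measurable]: "dquot (\<lambda>t. u \<bar>t\<bar>) \<in> borel_measurable (borel \<Otimes>\<^sub>M borel)" by (rule borel_measurable_dquot) auto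
  let ?q = "\<lambda>s t. ennreal ((norm (dquot (\<lambda>t. u \<bar>t\<bar>) (s, t)))\<^sup>2)"
  have "sqnorm plane (dquot (\<lambda>t. u \<bar>t\<bar>)) = (\<integral>\<^sup>+s. \<integral>\<^sup>+t. ?q s t + ?q s (- t) + (?q (- s) t + ?q (- s) (- t)) \<partial>half_line \<partial>half_line)"
    unfolding sqnorm_def by (rule nn_integral_plane_reflect_split) measurable
  also have "... <= (\<integral>\<^sup>+s. \<integral>\<^sup>+t. 4 * ennreal ((norm (dquot u (s, t)))\<^sup>2) \<partial>half_line \<partial>half_line)"
  proof (intro nn_integral_mono)
    fix s t assume "s \<in> space half_line" "t \<in> space half_line"
    then have st: "s > 0" "t > 0" by auto
    let ?d = "ennreal ((norm (dquot u (s, t)))\<^sup>2)"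
    have e: "?q s t = ?d" "?q (- s) (- t) = ?d" using st by (auto simp: norm_dquot_sq power2_commute)
    have le: "(norm (u s - u t))\<^sup>2 / (s + t)\<^sup>2 <= (norm (u s - u t))\<^sup>2 / (s - t)\<^sup>2"
    proof (cases "s = t")
      case False
      have "(s - t)\<^sup>2 <= (s + t)\<^sup>2" using st by (simp add: power2_eq_square algebra_simps)
      then show ?thesis using False st by (intro divide_left_mono mult_pos_pos) auto
    qed simp
    have "?q s (- t) <= ?d" "?q (- s) t <= ?d"
      using st le by (auto simp: norm_dquot_sq power2_commute intro!: ennreal_leI)
        (simp add: power2_commute[of "- s" t] add.commute)
    then have "?q s t + ?q s (- t) + (?q (- s) t + ?q (- s) (- t)) <= ?d + ?d + (?d + ?d)"
      unfolding e by (intro add_mono) auto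
    also have "... = 4 * ?d" by (simp add: mult_2[symmetric] mult.assoc[symmetric] distrib_right[symmetric])
    finally show "?q s t + ?q s (- t) + (?q (- s) t + ?q (- s) (- t)) <= 4 * ?d" .
  qed
  also have "... = (\<integral>\<^sup>+x. 4 * ennreal ((norm (dquot u x))\<^sup>2) \<partial>half_plane)"
    using half_line.nn_integral_fst[of "\<lambda>x. 4 * ennreal ((norm (dquot u x))\<^sup>2)" half_line] by simp
  also have "... = 4 * sqnorm half_plane (dquot u)"
    unfolding sqnorm_def by (rule nn_integral_cmult) measurable
  finally show "sqnorm plane (dquot (\<lambda>t. u \<bar>t\<bar>)) <= 4 * sqnorm half_plane (dquot u)" .
qed

text \<open>Also discards whatever values a representative has at nonpositive times, so that
  measurability on the half line becomes Borel measurability on the line.\<close>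

definition zero_ext :: "(real => 'b::real_normed_vector) => real => 'b" where
  "zero_ext u t = indicator {0<..} t *\<^sub>R u t"

lemma zero_ext_simps: "t > 0 ==> zero_ext u t = u t" "t <= 0 ==> zero_ext u t = 0"
  by (auto simp: zero_ext_def)

lemma zero_ext_measurable:
  fixes u :: "real => 'b::real_normed_vector"
  shows "u \<in> borel_measurable half_line ==> zero_ext u \<in> borel_measurable borel"
  unfolding zero_ext_def[abs_def] by (subst (asm) borel_measurable_restrict_space_iff) auto

lemma sqnorm_zero_ext: "sqnorm lborel (zero_ext u) = sqnorm half_line u"
  unfolding sqnorm_def nn_integral_half_line
  by (intro nn_integral_cong) (auto simp: zero_ext_def indicator_def)

lemma H12_00_normsq_eq:
  fixes u :: "real => 'h::{real_normed_vector,second_countable_topology}"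
  assumes "u \<in> borel_measurable half_line"
  shows "H12_00_normsq u = sqnorm half_line u + sqnorm half_plane (dquot u) + sqnorm half_line (\<lambda>s. (1 / sqrt s) *\<^sub>R u s)"
proof -
  have "sqnorm half_line (\<lambda>s. (1 / sqrt s) *\<^sub>R u s) = (\<integral>\<^sup>+s. ennreal (1 / s * (norm (u s))\<^sup>2) \<partial>half_line)"
    unfolding sqnorm_def by (intro nn_integral_cong) (auto simp: power_mult_distrib power_divide)
  then show ?thesis by (simp add: H12_00_normsq_def H12_normsq_eq[OF assms])
qed

lemma sqnorm_dquot_zero_ext:
  fixes u :: "real => 'h::{real_normed_vector,second_countable_topology}"
  assumes u: "u \<in> borel_measurable half_line"
  shows "sqnorm plane (dquot (zero_ext u)) = sqnorm half_plane (dquot u) + 2 * sqnorm half_line (\<lambda>s. (1 / sqrt s) *\<^sub>R u s)"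
proof -
  have "sqnorm half_plane (dquot (zero_ext u)) = sqnorm half_plane (dquot u)"
    by (rule sqnorm_cong) (auto simp: space_pair_measure dquot_def zero_ext_simps)
  moreover have "(\<integral>\<^sup>+s. ennreal (1 / s * (norm (zero_ext u s))\<^sup>2) \<partial>half_line) = sqnorm half_line (\<lambda>s. (1 / sqrt s) *\<^sub>R u s)"
    unfolding sqnorm_def by (intro nn_integral_cong) (auto simp: power_mult_distrib power_divide zero_ext_simps)
  ultimately show ?thesis
    using sqnorm_dquot_zero_extension[OF zero_ext_measurable[OF u]] by (simp add: zero_ext_simps)
qed

lemma H12_00_zero_ext:
  fixes u :: "real => 'h::{real_normed_vector,second_countable_topology}"
  assumes u: "u \<in> borel_measurable half_line"
  shows "H12_00_normsq u <= sqnorm lborel (zero_ext u) + sqnorm plane (dquot (zero_ext u))"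
    and "sqnorm plane (dquot (zero_ext u)) <= 2 * H12_00_normsq u"
    and "H12_normsq u <= H12_00_normsq u"
proof -
  let ?a = "sqnorm half_line u" and ?b = "sqnorm half_plane (dquot u)" and ?c = "sqnorm half_line (\<lambda>s. (1 / sqrt s) *\<^sub>R u s)"
  show "H12_00_normsq u <= sqnorm lborel (zero_ext u) + sqnorm plane (dquot (zero_ext u))"
    unfolding H12_00_normsq_eq[OF u] sqnorm_dquot_zero_ext[OF u] sqnorm_zero_ext
    by (simp add: mult_2 add.assoc add_left_mono add_increasing2)
  have "?b + 2 * ?c <= 2 * ?a + (2 * ?b + 2 * ?c)"
    by (intro add_increasing add_mono) (auto simp: mult_2 add_increasing2)
  then show "sqnorm plane (dquot (zero_ext u)) <= 2 * H12_00_normsq u"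
    unfolding H12_00_normsq_eq[OF u] sqnorm_dquot_zero_ext[OF u] by (simp add: distrib_left add.assoc)
  show "H12_normsq u <= H12_00_normsq u" unfolding H12_00_normsq_def by (simp add: add_increasing2)
qed

lemma H12_restrict:
  fixes U :: "real => 'h::{real_normed_vector,second_countable_topology}"
  assumes U: "U \<in> borel_measurable borel"
  shows "H12_normsq U <= sqnorm lborel U + sqnorm plane (dquot U)"
  unfolding H12_normsq_eq[OF measurable_half_lineI[OF U]]
  by (intro add_mono sqnorm_half_line_le sqnorm_half_plane_le U)

lemma even_ext_measurable:
  fixes u :: "real => 'h::{real_normed_vector,second_countable_topology}"
  assumes u: "u \<in> borel_measurable half_line"
  shows "(\<lambda>t. zero_ext u \<bar>t\<bar>) \<in> borel_measurable borel"
  using measurable_compose[of abs borel borel, OF _ zero_ext_measurable[OF u]] by simp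

text \<open>The Lipschitz bound near the diagonal and the range bound \<open>2 * B\<close> away from
  it combine to a squared difference quotient of at most \<open>5 * B^2 / (r^2 + 1)\<close> with r =
  s - t, where 5 = 1 + 4. It is nonzero only if one of the two points lies in the support interval,
  so the Poisson integral in the other variable finishes.\<close>

lemma smooth_compact_half_sob:
  fixes f :: "real => 'h::{real_inner,banach,second_countable_topology}"
  assumes f: "f \<in> smooth_compact"
  shows "half_sob f"
proof -
  obtain f' where f': "\<And>t. (f has_vector_derivative f' t) (at t)" using smooth_compact_deriv[OF f] by metis
  obtain R B where "compact_primitive f f' {} R B" using smooth_compact_primitive[OF f f'] by metis
  then interpret compact_primitive f f' "{}" R B .
  let ?I = "indicator {-R..R} :: real => real"
  let ?P = "\<lambda>r. 1 / (r\<^sup>2 + 1\<^sup>2) :: real"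
  have I: "(\<integral>\<^sup>+t. ennreal (?I t) \<partial>lborel) < \<infinity>"
    by (subst ennreal_indicator) (auto simp: emeasure_lborel_Icc_eq)
  have "sqnorm lborel f <= (\<integral>\<^sup>+t. ennreal (B\<^sup>2) * ennreal (?I t) \<partial>lborel)"
    unfolding sqnorm_def
  proof (intro nn_integral_mono)
    fix t
    show "ennreal ((norm (f t))\<^sup>2) <= ennreal (B\<^sup>2) * ennreal (?I t)"
      using power_mono[OF bound(1)[of t] norm_ge_zero, of 2] supp(1)[of t]
      by (cases "\<bar>t\<bar> > R") (auto simp: indicator_def intro!: ennreal_leI)
  qed
  also have "... < \<infinity>" using I by (simp add: nn_integral_cmult ennreal_mult_less_top)
  finally have 1: "sq_integrable lborel f" by (simp add: sq_integrable_def)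
  have lip: "norm (f s - f t) <= B * \<bar>s - t\<bar>" for s t
  proof -
    have "norm (f s - f t) <= B * norm (s - t)"
    proof (rule differentiable_bound[of UNIV f "\<lambda>x h. h *\<^sub>R f' x"])
      show "onorm (\<lambda>h. h *\<^sub>R f' x) <= B" for x
        by (rule onorm_le) (use bound(2)[of x] in \<open>simp add: mult.commute[of B] mult_left_mono\<close>)
    qed (use f' in \<open>auto simp: has_vector_derivative_def\<close>)
    then show ?thesis by simp
  qed
  have pt: "(norm (dquot f (s, t)))\<^sup>2 <= 5 * B\<^sup>2 * (?P (s - t) * ?I s + ?P (s - t) * ?I t)" for s t
  proof (cases "(\<bar>s\<bar> > R \<and> \<bar>t\<bar> > R) \<or> s = t")
    case True
    have "0 <= 5 * B\<^sup>2 * (?P (s - t) * ?I s + ?P (s - t) * ?I t)" by (intro mult_nonneg_nonneg add_nonneg_nonneg) auto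
    then show ?thesis using True supp by (auto simp: norm_dquot_sq)
  next
    case False
    let ?n = "(norm (dquot f (s, t)))\<^sup>2"
    have n1: "?n <= B\<^sup>2"
      unfolding norm_dquot_sq using False power_mono[OF lip[of s t] norm_ge_zero, of 2]
      by (simp add: divide_le_eq power_mult_distrib)
    have n2: "?n * (s - t)\<^sup>2 <= 4 * B\<^sup>2"
    proof -
      have "norm (f s - f t) <= 2 * B" using norm_triangle_ineq4[of "f s" "f t"] bound(1)[of s] bound(1)[of t] by linarith
      then have "(norm (f s - f t))\<^sup>2 <= (2 * B)\<^sup>2" by (rule power_mono) simp
      then show ?thesis unfolding norm_dquot_sq using False by (simp add: power_mult_distrib)
    qed
    have "?n * ((s - t)\<^sup>2 + 1\<^sup>2) <= 5 * B\<^sup>2" using n1 n2 by (simp add: algebra_simps)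
    moreover have "(s - t)\<^sup>2 + 1\<^sup>2 > 0" by (intro add_nonneg_pos) auto
    ultimately have "?n <= 5 * B\<^sup>2 / ((s - t)\<^sup>2 + 1\<^sup>2)" by (simp only: pos_le_divide_eq)
    then have n3: "?n <= 5 * B\<^sup>2 * ?P (s - t)" by simp
    have "?P (s - t) >= 0" by simp
    moreover have "?I s + ?I t >= 1" using False by (auto simp: indicator_def)
    ultimately have "?P (s - t) <= ?P (s - t) * ?I s + ?P (s - t) * ?I t"
      using mult_left_mono[of 1 "?I s + ?I t" "?P (s - t)"] by (simp add: distrib_left)
    then have "5 * B\<^sup>2 * ?P (s - t) <= 5 * B\<^sup>2 * (?P (s - t) * ?I s + ?P (s - t) * ?I t)" by (intro mult_left_mono) auto
    with n3 show ?thesis by linarith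
  qed
  let ?M = plane
  let ?J = "(\<integral>\<^sup>+t. ennreal (?I t) \<partial>lborel)"
  have J1: "(\<integral>\<^sup>+x. ennreal (?P (fst x - snd x) * ?I (fst x)) \<partial>?M) = ennreal pi * ?J"
  proof -
    have "(\<integral>\<^sup>+x. ennreal (?P (fst x - snd x) * ?I (fst x)) \<partial>?M) = (\<integral>\<^sup>+s. \<integral>\<^sup>+t. ennreal (?P (s - t)) * ennreal (?I s) \<partial>lborel \<partial>lborel)"
      by (subst lborel.nn_integral_fst[symmetric]) (auto intro!: nn_integral_cong simp: ennreal_mult''[symmetric])
    also have "... = (\<integral>\<^sup>+s. ennreal pi * ennreal (?I s) \<partial>lborel)"
      using nn_integral_lborel_reflect[of "\<lambda>r. ennreal (?P r)"] nn_integral_Poisson[of 1]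
      by (simp add: nn_integral_multc)
    finally show ?thesis by (simp add: nn_integral_cmult)
  qed
  have J2: "(\<integral>\<^sup>+x. ennreal (?P (fst x - snd x) * ?I (snd x)) \<partial>?M) = ennreal pi * ?J"
  proof -
    have "(\<integral>\<^sup>+x. ennreal (?P (fst x - snd x) * ?I (snd x)) \<partial>?M) = (\<integral>\<^sup>+t. \<integral>\<^sup>+s. ennreal (?P (s - t)) * ennreal (?I t) \<partial>lborel \<partial>lborel)"
      by (subst lborel_pair.nn_integral_snd[symmetric]) (auto intro!: nn_integral_cong simp: ennreal_mult''[symmetric])
    also have "... = (\<integral>\<^sup>+s. ennreal pi * ennreal (?I s) \<partial>lborel)"
      using nn_integral_lborel_translate[of "\<lambda>r. ennreal (?P r)" "- t" for t] nn_integral_Poisson[of 1]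
      by (simp add: nn_integral_multc)
    finally show ?thesis by (simp add: nn_integral_cmult)
  qed
  have "sqnorm ?M (dquot f) <= (\<integral>\<^sup>+x. ennreal (5 * B\<^sup>2) * (ennreal (?P (fst x - snd x) * ?I (fst x)) + ennreal (?P (fst x - snd x) * ?I (snd x))) \<partial>?M)"
    unfolding sqnorm_def
  proof (intro nn_integral_mono)
    fix x :: "real \<times> real"
    show "ennreal ((norm (dquot f x))\<^sup>2) <= ennreal (5 * B\<^sup>2) * (ennreal (?P (fst x - snd x) * ?I (fst x)) + ennreal (?P (fst x - snd x) * ?I (snd x)))"
      using ennreal_leI[OF pt[of "fst x" "snd x"]]
      by (subst ennreal_plus[symmetric], simp, simp, subst ennreal_mult[symmetric]) auto
  qed
  also have "... = ennreal (5 * B\<^sup>2) * (\<integral>\<^sup>+x. ennreal (?P (fst x - snd x) * ?I (fst x)) + ennreal (?P (fst x - snd x) * ?I (snd x)) \<partial>?M)"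
    by (rule nn_integral_cmult) measurable
  also have "(\<integral>\<^sup>+x. ennreal (?P (fst x - snd x) * ?I (fst x)) + ennreal (?P (fst x - snd x) * ?I (snd x)) \<partial>?M)
     = (\<integral>\<^sup>+x. ennreal (?P (fst x - snd x) * ?I (fst x)) \<partial>?M) + (\<integral>\<^sup>+x. ennreal (?P (fst x - snd x) * ?I (snd x)) \<partial>?M)"
    by (rule nn_integral_add) measurable
  also have "... = ennreal pi * ?J + ennreal pi * ?J" by (simp only: J1 J2)
  also have "ennreal (5 * B\<^sup>2) * (ennreal pi * ?J + ennreal pi * ?J) < \<infinity>" using I by (simp add: ennreal_mult_less_top)
  finally show ?thesis using 1 by (simp add: half_sob_def sq_integrable_def borel_measurable_dquot_lborel)
qed

subsection \<open>The conjugate Poisson operator\<close>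

lemma filterlim_inverse_0:
  "((inverse :: real => real) \<longlongrightarrow> 0) at_top" "((inverse :: real => real) \<longlongrightarrow> 0) at_bot"
  by (auto intro!: tendsto_inverse_0_at_top filterlim_ident tendsto_mono[OF at_bot_le_at_infinity tendsto_inverse_0])

text \<open>Two conjugate Poisson kernels compose to a Poisson kernel of twice the width. Its
  positivity and fixed mass are what make \<open>conj_op\<close> a contraction with a bound uniform
  in eps.\<close>

lemma integral_conj_kernel_product:
  assumes e: "eps > 0" and r: "r \<noteq> 0"
  shows "(LINT x|lborel. conj_kernel eps x * conj_kernel eps (x - r)) = 2 * pi * eps / (r\<^sup>2 + (2 * eps)\<^sup>2)"
    and "integrable lborel (\<lambda>x. conj_kernel eps x * conj_kernel eps (x - r))"
proof -
  define Q where "Q = r\<^sup>2 + (2 * eps)\<^sup>2"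
  have Q: "Q > 0" unfolding Q_def using e by (intro add_nonneg_pos) auto
  \<comment> \<open>\<alpha> and \<beta> solve the partial fraction problem for x(r - x) over the
    product of the two denominators, in a form symmetric under the exchange of x and r - x. The
    logarithms cancel at both ends; only the arctangents contribute, hence only \<beta>.\<close>
  define \<beta> where "\<beta> = - eps\<^sup>2 / Q"
  define \<alpha> where "\<alpha> = (1 + 2 * \<beta>) / r"
  let ?A = "\<lambda>x. x\<^sup>2 + eps\<^sup>2" and ?B = "\<lambda>x. (x - r)\<^sup>2 + eps\<^sup>2"
  let ?f = "\<lambda>x. conj_kernel eps x * conj_kernel eps (x - r)"
  have A: "?A x > 0" and B: "?B x > 0" for x using sq_plus_sq_pos[OF e] by auto
  have key: "- ((\<alpha> * x + \<beta>) / ?A x + (\<alpha> * (r - x) + \<beta>) / ?B x) = ?f x" for x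
  proof -
    have ar: "\<alpha> * r = 1 + 2 * \<beta>" using r by (simp add: \<alpha>_def)
    have bQ: "\<beta> * (r\<^sup>2 + 4 * eps\<^sup>2) = - eps\<^sup>2" using Q by (simp add: \<beta>_def Q_def power_mult_distrib)
    have "(\<alpha> * x + \<beta>) * ?B x + (\<alpha> * (r - x) + \<beta>) * ?A x
       = (\<alpha> * r) * (x * (r - x)) + (\<alpha> * r) * eps\<^sup>2 + \<beta> * (r\<^sup>2 - 2 * (x * (r - x)) + 2 * eps\<^sup>2)"
      by (simp add: power2_eq_square algebra_simps)
    also have "... = x * (r - x) + (eps\<^sup>2 + \<beta> * (r\<^sup>2 + 4 * eps\<^sup>2))"
      unfolding ar by (simp add: algebra_simps)
    also have "... = x * (r - x)" unfolding bQ by simp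
    finally have num: "(\<alpha> * x + \<beta>) * ?B x + (\<alpha> * (r - x) + \<beta>) * ?A x = x * (r - x)" .
    have "a / P + b / S = (a * S + b * P) / (P * S)" if "P > 0" "S > 0" for a b P S :: real
      using that by (simp add: add_frac_eq)
    from this[OF A B] have "(\<alpha> * x + \<beta>) / ?A x + (\<alpha> * (r - x) + \<beta>) / ?B x = ((\<alpha> * x + \<beta>) * ?B x + (\<alpha> * (r - x) + \<beta>) * ?A x) / (?A x * ?B x)" .
    then have "- ((\<alpha> * x + \<beta>) / ?A x + (\<alpha> * (r - x) + \<beta>) / ?B x) = - (x * (r - x) / (?A x * ?B x))"
      unfolding num by (rule arg_cong)
    moreover have "- (x * (r - x) / (P * S)) = (- x / P) * (- (x - r) / S)" for P S
      unfolding times_divide_times_eq minus_divide_left by (rule arg_cong2[where f = "(/)"]) (auto simp: algebra_simps)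
    ultimately show ?thesis unfolding conj_kernel_def by (simp only:)
  qed
  let ?F = "\<lambda>x. - (\<alpha> / 2 * ln (?A x / ?B x) + \<beta> / eps * (arctan (x / eps) + arctan ((x - r) / eps)))"
  have deriv: "(?F has_real_derivative ?f x) (at x)" for x
  proof -
    have dl: "((\<lambda>x. ln (?A x) - ln (?B x)) has_real_derivative 1 / ?A x * (2 * x) - 1 / ?B x * (2 * (x - r))) (at x)"
    proof (intro DERIV_diff DERIV_chain2[OF DERIV_ln_divide])
      show "((\<lambda>x. ?A x) has_real_derivative 2 * x) (at x)" "((\<lambda>x. ?B x) has_real_derivative 2 * (x - r)) (at x)"
        by (auto intro!: derivative_eq_intros)
    qed (use A B in auto)
    have eql: "ln (?A x / ?B x) = ln (?A x) - ln (?B x)" for x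
    proof -
      have "ln (P / S) = ln P - ln S" if "P > 0" "S > 0" for P S :: real using that by (simp add: ln_div)
      from this[OF A B] show ?thesis .
    qed
    have at: "((\<lambda>x. arctan ((x - c) / eps)) has_real_derivative eps / ((x - c)\<^sup>2 + eps\<^sup>2)) (at x)" for c
    proof -
      have "((\<lambda>x. arctan ((x - c) / eps)) has_real_derivative inverse (1 + ((x - c) / eps)\<^sup>2) * (1 / eps)) (at x)"
        using e by (auto intro!: derivative_eq_intros)
      moreover have "1 + ((x - c) / eps)\<^sup>2 = ((x - c)\<^sup>2 + eps\<^sup>2) / eps\<^sup>2" using e by (simp add: field_simps)
      ultimately show ?thesis using e by (simp add: power2_eq_square)
    qed
    have "(?F has_real_derivative - (\<alpha> / 2 * (1 / ?A x * (2 * x) - 1 / ?B x * (2 * (x - r))) + \<beta> / eps * (eps / ?A x + eps / ?B x))) (at x)"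
      unfolding eql using at[of 0] by (intro DERIV_minus DERIV_add DERIV_cmult dl at) simp
    moreover have "- (\<alpha> / 2 * (1 / P * (2 * x) - 1 / S * (2 * (x - r))) + \<beta> / eps * (eps / P + eps / S))
       = - ((\<alpha> * x + \<beta>) / P + (\<alpha> * (r - x) + \<beta>) / S)" for P S
      using e by (simp add: diff_divide_distrib add_divide_distrib algebra_simps)
    ultimately show ?thesis using key[of x] by simp
  qed
  have lnlim: "((\<lambda>x. ln (?A x / ?B x)) \<longlongrightarrow> 0) F" if F: "((inverse :: real => real) \<longlongrightarrow> 0) F" "\<forall>\<^sub>F x in F. x \<noteq> 0" for F
  proof -
    have "((\<lambda>x. ln ((1 + eps\<^sup>2 * (inverse x)\<^sup>2) / ((1 - r * inverse x)\<^sup>2 + eps\<^sup>2 * (inverse x)\<^sup>2))) \<longlongrightarrow>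
       ln ((1 + eps\<^sup>2 * 0\<^sup>2) / ((1 - r * 0)\<^sup>2 + eps\<^sup>2 * 0\<^sup>2))) F"
      by (intro tendsto_intros F) auto
    then have l: "((\<lambda>x. ln ((1 + eps\<^sup>2 * (inverse x)\<^sup>2) / ((1 - r * inverse x)\<^sup>2 + eps\<^sup>2 * (inverse x)\<^sup>2))) \<longlongrightarrow> 0) F" by simp
    show ?thesis
    proof (rule Lim_transform_eventually[OF l], use F(2) in eventually_elim)
      case (elim x)
      have 1: "1 + eps\<^sup>2 * (inverse x)\<^sup>2 = ?A x / x\<^sup>2" using elim by (simp add: field_simps)
      have 2: "(1 - r * inverse x)\<^sup>2 + eps\<^sup>2 * (inverse x)\<^sup>2 = ?B x / x\<^sup>2"
        using elim by (simp add: field_simps power2_eq_square)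
      show ?case unfolding 1 2 using elim by simp
    qed
  qed
  have filt1: "filterlim (\<lambda>x. (x - c) / eps) at_top at_top" for c
  proof -
    have "filterlim (\<lambda>x. (1 / eps) * (- c + x)) at_top at_top"
      by (intro filterlim_tendsto_pos_mult_at_top[OF tendsto_const] filterlim_tendsto_add_at_top[OF tendsto_const] filterlim_ident)
         (use e in auto)
    then show ?thesis by (simp add: algebra_simps)
  qed
  have filt2: "filterlim (\<lambda>x. (x - c) / eps) at_bot at_bot" for c
  proof -
    have "- ((- x - c) / eps) = (x - (- c)) / eps" for x by (simp add: divide_simps)
    then show ?thesis
      unfolding filterlim_at_bot_mirror filterlim_uminus_at_bot using filt1[of "- c"] by (simp only:)
  qed
  have lim_top: "(?F \<longlongrightarrow> - (\<alpha> / 2 * 0 + \<beta> / eps * (pi / 2 + pi / 2))) at_top"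
    using filterlim_compose[OF tendsto_arctan_at_top filt1[of 0]]
    by (intro tendsto_intros lnlim filterlim_inverse_0 eventually_at_top_not_equal filterlim_compose[OF tendsto_arctan_at_top filt1]) simp
  have lim_bot: "(?F \<longlongrightarrow> - (\<alpha> / 2 * 0 + \<beta> / eps * (- (pi / 2) + - (pi / 2)))) at_bot"
    using filterlim_compose[OF tendsto_arctan_at_bot filt2[of 0]]
    by (intro tendsto_intros lnlim filterlim_inverse_0 eventually_at_bot_not_equal filterlim_compose[OF tendsto_arctan_at_bot filt2]) simp
  have sqk: "(conj_kernel eps x)\<^sup>2 <= 1 / ?A x" for x
  proof -
    have "(conj_kernel eps x)\<^sup>2 = x\<^sup>2 / (?A x * ?A x)" by (simp add: conj_kernel_def power2_eq_square)
    also have "... <= ?A x / (?A x * ?A x)" using A[of x] by (intro divide_right_mono) auto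
    also have "... = 1 / ?A x" using A[of x] by simp
    finally show ?thesis .
  qed
  show int: "integrable lborel ?f"
  proof (rule Bochner_Integration.integrable_bound)
    have "integrable lborel (\<lambda>x. 1 / ((- r + 1 * x)\<^sup>2 + eps\<^sup>2))"
      by (rule lborel_integrable_real_affine[OF integrable_Poisson[OF e]]) simp
    then show "integrable lborel (\<lambda>x. 1 / ?A x + 1 / ?B x)" using integrable_Poisson[OF e] by simp
    show "AE x in lborel. norm (?f x) <= norm (1 / ?A x + 1 / ?B x)"
    proof (rule AE_I2)
      fix x
      have "2 * (\<bar>conj_kernel eps x\<bar> * \<bar>conj_kernel eps (x - r)\<bar>) <= (conj_kernel eps x)\<^sup>2 + (conj_kernel eps (x - r))\<^sup>2"
        using sum_squares_bound[of "\<bar>conj_kernel eps x\<bar>" "\<bar>conj_kernel eps (x - r)\<bar>"] by simp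
      also have "... <= 1 / ?A x + 1 / ?B x" by (intro add_mono sqk)
      finally have "2 * (\<bar>conj_kernel eps x\<bar> * \<bar>conj_kernel eps (x - r)\<bar>) <= 1 / ?A x + 1 / ?B x" .
      moreover have "0 <= \<bar>conj_kernel eps x\<bar> * \<bar>conj_kernel eps (x - r)\<bar>" by simp
      ultimately show "norm (?f x) <= norm (1 / ?A x + 1 / ?B x)"
        unfolding real_norm_def abs_mult by linarith
    qed
  qed measurable
  have "(LBINT x=-\<infinity>..\<infinity>. ?f x) = - (\<alpha> / 2 * 0 + \<beta> / eps * (pi / 2 + pi / 2)) - (- (\<alpha> / 2 * 0 + \<beta> / eps * (- (pi / 2) + - (pi / 2))))"
  proof (rule interval_integral_FTC_integrable[where F = ?F])
    show "(?F has_vector_derivative ?f x) (at x)" for x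
      using deriv by (simp add: has_real_derivative_iff_has_vector_derivative)
    show "isCont ?f x" for x
      using conj_kernel_continuous[OF e] by (intro continuous_mult isCont_o2[OF _ conj_kernel_continuous[OF e]]) auto
    show "set_integrable lborel (einterval (- \<infinity>) \<infinity>) ?f"
      unfolding set_integrable_def using int by simp
  qed (use lim_top lim_bot in \<open>auto simp: ereal_tendsto_simps\<close>)
  also have "... = - 2 * pi * \<beta> / eps" by (simp add: algebra_simps)
  also have "... = 2 * pi * eps / Q" using e by (simp add: \<beta>_def power2_eq_square)
  finally show "(LINT x|lborel. ?f x) = 2 * pi * eps / (r\<^sup>2 + (2 * eps)\<^sup>2)"
    by (simp add: interval_lebesgue_integral_def set_lebesgue_integral_def Q_def)
qed

text \<open>Convolution with the conjugate Poisson kernel regularises the Hilbert transform (up to sign).\<close>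

definition conj_op :: "real => (real => 'b::{banach,second_countable_topology}) => real => 'b" where
  "conj_op eps f t = (1 / pi) *\<^sub>R (LINT s|lborel. conj_kernel eps (t - s) *\<^sub>R f s)"

lemma conj_kernel_sq_le:
  assumes e: "eps > 0"
  shows "(conj_kernel eps x)\<^sup>2 <= 1 / (x\<^sup>2 + eps\<^sup>2)"
proof -
  have A: "x\<^sup>2 + eps\<^sup>2 > 0" by (rule sq_plus_sq_pos[OF e])
  have "(conj_kernel eps x)\<^sup>2 = x\<^sup>2 / ((x\<^sup>2 + eps\<^sup>2) * (x\<^sup>2 + eps\<^sup>2))" by (simp add: conj_kernel_def power2_eq_square)
  also have "... <= (x\<^sup>2 + eps\<^sup>2) / ((x\<^sup>2 + eps\<^sup>2) * (x\<^sup>2 + eps\<^sup>2))" using A by (intro divide_right_mono) auto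
  also have "... = 1 / (x\<^sup>2 + eps\<^sup>2)" using A by simp
  finally show ?thesis .
qed

lemma conj_kernel_shift_sq_integrable:
  assumes e: "eps > 0"
  shows "sq_integrable lborel (\<lambda>s. conj_kernel eps (t - s))"
proof -
  have "sqnorm lborel (\<lambda>s. conj_kernel eps (t - s)) <= (\<integral>\<^sup>+s. ennreal (1 / ((t - s)\<^sup>2 + eps\<^sup>2)) \<partial>lborel)"
    unfolding sqnorm_def using conj_kernel_sq_le[OF e] by (intro nn_integral_mono ennreal_leI) simp
  also have "... = ennreal (pi / eps)"
    using nn_integral_lborel_reflect[of "\<lambda>r. ennreal (1 / (r\<^sup>2 + eps\<^sup>2))" t] nn_integral_Poisson[OF e] by simp
  also have "... < \<infinity>" by simp
  finally show ?thesis by (simp add: sq_integrable_def)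
qed

lemma conj_op_integrable:
  fixes f :: "real => 'b::{banach,second_countable_topology}"
  assumes e: "eps > 0" and f: "sq_integrable lborel f"
  shows "integrable lborel (\<lambda>s. conj_kernel eps (t - s) *\<^sub>R f s)"
proof (rule Bochner_Integration.integrable_bound)
  have [measurable]: "f \<in> borel_measurable borel" using f by (simp add: sq_integrable_def)
  show "integrable lborel (\<lambda>s. norm (conj_kernel eps (t - s)) * norm (f s))"
    by (rule integrable_norm_mult(1)[OF conj_kernel_shift_sq_integrable[OF e] f])
  show "(\<lambda>s. conj_kernel eps (t - s) *\<^sub>R f s) \<in> borel_measurable lborel" by measurable
qed auto

lemma conj_op_measurable:
  fixes f :: "real => 'b::{banach,second_countable_topology}"
  assumes [measurable]: "f \<in> borel_measurable borel"
  shows "conj_op eps f \<in> borel_measurable borel"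
  unfolding conj_op_def[abs_def] by measurable

lemma conj_op_diff:
  fixes f g :: "real => 'b::{banach,second_countable_topology}"
  assumes e: "eps > 0" and f: "sq_integrable lborel f" and g: "sq_integrable lborel g"
  shows "conj_op eps (\<lambda>s. f s - g s) t = conj_op eps f t - conj_op eps g t"
  unfolding conj_op_def using conj_op_integrable[OF e f] conj_op_integrable[OF e g]
  by (simp add: scaleR_diff_right)

lemma conj_op_translate:
  fixes f :: "real => 'b::{banach,second_countable_topology}"
  shows "conj_op eps (\<lambda>s. f (s - h)) t = conj_op eps f (t - h)"
  unfolding conj_op_def
  by (subst lborel_integral_real_affine[where c = 1 and t = h]) (auto simp: algebra_simps)

lemma conj_op_linear_image:
  fixes f :: "real => 'b::{banach,second_countable_topology}" and L :: "'b => 'c::{banach,second_countable_topology}"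
  assumes L: "bounded_linear L" and e: "eps > 0" and f: "sq_integrable lborel f"
  shows "conj_op eps (\<lambda>s. L (f s)) t = L (conj_op eps f t)"
proof -
  interpret L: bounded_linear L by fact
  show ?thesis
    unfolding conj_op_def L.scaleR using integral_bounded_linear[OF L conj_op_integrable[OF e f, of t]] by (simp add: L.scaleR)
qed

text \<open>A Schur test on the composed kernel: the Poisson kernel of width \<open>2 * eps\<close>
  has total mass \<open>pi^2\<close> with its factor, and splitting the inner product into half the
  sum of squares uses exactly that mass. Dividing by pi in \<open>conj_op\<close> gives constant 1.
  Bounded functions of compact support are integrable, which justifies Fubini.\<close>

lemma conj_op_bound_bounded:
  fixes f :: "real => 'h::{real_inner,banach,second_countable_topology}"
  assumes e: "eps > 0" and [measurable]: "f \<in> borel_measurable borel"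
    and B: "\<And>t. norm (f t) <= B" and R: "\<And>t. \<bar>t\<bar> > R ==> f t = 0"
  shows "sqnorm lborel (conj_op eps f) <= sqnorm lborel f"
proof -
  let ?M = plane
  let ?P = "\<lambda>r. 1 / (r\<^sup>2 + (2 * eps)\<^sup>2) :: real"
  have if1: "integrable lborel f"
    using bounded_compact_integrable[of f B R "\<lambda>_. 1"] B R by (simp add: set_integrable_continuous)
  have if2: "integrable lborel (\<lambda>t. (norm (f t))\<^sup>2)"
  proof -
    have "integrable lborel (\<lambda>t. (1::real) *\<^sub>R ((norm (f t))\<^sup>2))"
      by (rule bounded_compact_integrable[where B = "B\<^sup>2" and R = R])
         (use B R in \<open>auto intro!: power_mono set_integrable_continuous\<close>)
    then show ?thesis by simp
  qed
  have f: "sq_integrable lborel f"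
    using if2 by (simp add: sq_integrable_def sqnorm_def integrable_iff_bounded)
  have iN: "integrable ?M (\<lambda>(s, t). norm (f s) * norm (f t))"
    using integral_inner_product(1)[of "\<lambda>s. norm (f s)" "\<lambda>s. norm (f s)"] if1 by simp
  let ?k = "\<lambda>t s. conj_kernel eps (t - s)"
  have km: "(\<lambda>x. ?k (fst x) (snd x)) \<in> borel_measurable (borel \<Otimes>\<^sub>M borel)" by measurable
  \<comment> \<open>A crude bound for absolute values, where the cancellation is lost. It blows up
    as eps tends to 0 but is used only for the Tonelli condition.\<close>
  have cbd: "(\<integral>\<^sup>+t. ennreal \<bar>?k t s\<bar> * ennreal \<bar>?k t s'\<bar> \<partial>lborel) <= ennreal (2 * pi / eps)" for s s'
  proof -
    have "(\<integral>\<^sup>+t. ennreal \<bar>?k t s\<bar> * ennreal \<bar>?k t s'\<bar> \<partial>lborel) <= (\<integral>\<^sup>+t. ennreal (1 / ((t - s)\<^sup>2 + eps\<^sup>2)) + ennreal (1 / ((t - s')\<^sup>2 + eps\<^sup>2)) \<partial>lborel)"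
    proof (intro nn_integral_mono)
      fix t
      have "2 * (\<bar>?k t s\<bar> * \<bar>?k t s'\<bar>) <= (?k t s)\<^sup>2 + (?k t s')\<^sup>2"
        using sum_squares_bound[of "\<bar>?k t s\<bar>" "\<bar>?k t s'\<bar>"] by simp
      also have "... <= 1 / ((t - s)\<^sup>2 + eps\<^sup>2) + 1 / ((t - s')\<^sup>2 + eps\<^sup>2)" by (intro add_mono conj_kernel_sq_le e)
      finally have "2 * (\<bar>?k t s\<bar> * \<bar>?k t s'\<bar>) <= 1 / ((t - s)\<^sup>2 + eps\<^sup>2) + 1 / ((t - s')\<^sup>2 + eps\<^sup>2)" .
      moreover have "0 <= \<bar>?k t s\<bar> * \<bar>?k t s'\<bar>" by simp
      ultimately have "\<bar>?k t s\<bar> * \<bar>?k t s'\<bar> <= 1 / ((t - s)\<^sup>2 + eps\<^sup>2) + 1 / ((t - s')\<^sup>2 + eps\<^sup>2)" by linarith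
      then show "ennreal \<bar>?k t s\<bar> * ennreal \<bar>?k t s'\<bar> <= ennreal (1 / ((t - s)\<^sup>2 + eps\<^sup>2)) + ennreal (1 / ((t - s')\<^sup>2 + eps\<^sup>2))"
        by (subst ennreal_mult[symmetric], simp, simp, subst ennreal_plus[symmetric], simp, simp, intro ennreal_leI)
    qed
    also have "... = (\<integral>\<^sup>+t. ennreal (1 / ((t - s)\<^sup>2 + eps\<^sup>2)) \<partial>lborel) + (\<integral>\<^sup>+t. ennreal (1 / ((t - s')\<^sup>2 + eps\<^sup>2)) \<partial>lborel)"
      by (rule nn_integral_add) auto
    also have "... = ennreal (pi / eps) + ennreal (pi / eps)"
      using nn_integral_lborel_translate[of "\<lambda>r. ennreal (1 / (r\<^sup>2 + eps\<^sup>2))" "- s" for s] nn_integral_Poisson[OF e] by simp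
    also have "... = ennreal (2 * pi / eps)" using e by (subst ennreal_plus[symmetric]) (auto simp: divide_nonneg_pos)
    finally show ?thesis .
  qed
  have fin: "(\<integral>\<^sup>+x. (\<integral>\<^sup>+t. ennreal \<bar>?k t (fst x)\<bar> * ennreal \<bar>?k t (snd x)\<bar> \<partial>lborel) * ennreal (norm (f (fst x)) * norm (f (snd x))) \<partial>?M) < \<infinity>"
  proof -
    have "(\<integral>\<^sup>+x. (\<integral>\<^sup>+t. ennreal \<bar>?k t (fst x)\<bar> * ennreal \<bar>?k t (snd x)\<bar> \<partial>lborel) * ennreal (norm (f (fst x)) * norm (f (snd x))) \<partial>?M)
      <= (\<integral>\<^sup>+x. ennreal (2 * pi / eps) * ennreal (norm ((\<lambda>(s, t). norm (f s) * norm (f t)) x)) \<partial>?M)"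
      by (intro nn_integral_mono mult_mono cbd) (auto simp: case_prod_beta)
    also have "... = ennreal (2 * pi / eps) * (\<integral>\<^sup>+x. ennreal (norm ((\<lambda>(s, t). norm (f s) * norm (f t)) x)) \<partial>?M)"
      by (rule nn_integral_cmult) auto
    also have "... < \<infinity>" using iN by (simp add: integrable_iff_bounded ennreal_mult_less_top)
    finally show ?thesis .
  qed
  have fm: "f \<in> borel_measurable borel" by measurable
  note kp = integral_kernel_product[OF km km fm fm fin conj_op_integrable[OF e f] conj_op_integrable[OF e f]]
  let ?G = "\<lambda>t. LINT s|lborel. ?k t s *\<^sub>R f s"
  have iG: "integrable lborel (\<lambda>t. (norm (?G t))\<^sup>2)" using kp(1) by (simp add: power2_norm_eq_inner)
  have e2: "2 * eps > 0" using e by simp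
  have iP: "integrable ?M (\<lambda>x. ?P (fst x - snd x) * (norm (f (fst x)))\<^sup>2)" "(LINT x|?M. ?P (fst x - snd x) * (norm (f (fst x)))\<^sup>2) = pi / (2 * eps) * (l2norm lborel f)\<^sup>2"
    and iP': "integrable ?M (\<lambda>x. ?P (fst x - snd x) * (norm (f (snd x)))\<^sup>2)" "(LINT x|?M. ?P (fst x - snd x) * (norm (f (snd x)))\<^sup>2) = pi / (2 * eps) * (l2norm lborel f)\<^sup>2"
  proof -
    have "(\<integral>\<^sup>+x. ennreal (?P (fst x - snd x) * (norm (f (fst x)))\<^sup>2) \<partial>?M) = (\<integral>\<^sup>+s. \<integral>\<^sup>+t. ennreal (?P (s - t)) * ennreal ((norm (f s))\<^sup>2) \<partial>lborel \<partial>lborel)"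
      by (subst lborel.nn_integral_fst[symmetric]) (auto intro!: nn_integral_cong simp: ennreal_mult''[symmetric])
    also have "... = ennreal (pi / (2 * eps)) * sqnorm lborel f"
      using nn_integral_lborel_reflect[of "\<lambda>r. ennreal (?P r)"] nn_integral_Poisson[OF e2]
      by (simp add: nn_integral_multc nn_integral_cmult sqnorm_def)
    also have "... = ennreal (pi / (2 * eps) * (l2norm lborel f)\<^sup>2)"
      unfolding sqnorm_eq_l2norm[OF f] using e by (subst ennreal_mult) auto
    finally have 1: "(\<integral>\<^sup>+x. ennreal (?P (fst x - snd x) * (norm (f (fst x)))\<^sup>2) \<partial>?M) = ennreal (pi / (2 * eps) * (l2norm lborel f)\<^sup>2)" .
    show i: "integrable ?M (\<lambda>x. ?P (fst x - snd x) * (norm (f (fst x)))\<^sup>2)"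
      by (rule integrableI_nonneg) (use 1 in auto)
    show I: "(LINT x|?M. ?P (fst x - snd x) * (norm (f (fst x)))\<^sup>2) = pi / (2 * eps) * (l2norm lborel f)\<^sup>2"
      by (subst integral_eq_nn_integral) (use 1 e in auto)
    have sw: "(\<lambda>(x, y). ?P (fst (y, x) - snd (y, x)) * (norm (f (fst (y, x))))\<^sup>2) = (\<lambda>x. ?P (fst x - snd x) * (norm (f (snd x)))\<^sup>2)"
      by (auto simp: power2_commute)
    show "integrable ?M (\<lambda>x. ?P (fst x - snd x) * (norm (f (snd x)))\<^sup>2)"
      using lborel_pair.integrable_product_swap[OF i] unfolding sw .
    have "(\<lambda>x. ?P (fst x - snd x) * (norm (f (fst x)))\<^sup>2) \<in> borel_measurable ?M" by measurable
    from lborel_pair.integral_product_swap[OF this]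
    show "(LINT x|?M. ?P (fst x - snd x) * (norm (f (snd x)))\<^sup>2) = pi / (2 * eps) * (l2norm lborel f)\<^sup>2"
      unfolding sw I .
  qed
  have c: "(LINT t|lborel. ?k t s * ?k t s') = 2 * pi * eps * ?P (s - s')" if "s \<noteq> s'" for s s'
  proof -
    have "(LINT t|lborel. ?k t s * ?k t s') = (LINT x|lborel. conj_kernel eps x * conj_kernel eps (x - (s' - s)))"
      by (subst lborel_integral_real_affine[where c = 1 and t = s]) (auto simp: algebra_simps)
    also have "... = 2 * pi * eps / ((s' - s)\<^sup>2 + (2 * eps)\<^sup>2)"
      by (rule integral_conj_kernel_product[OF e]) (use that in simp)
    finally show ?thesis by (simp add: power2_commute)
  qed
  let ?H = "\<lambda>x. pi * eps * (?P (fst x - snd x) * (norm (f (fst x)))\<^sup>2 + ?P (fst x - snd x) * (norm (f (snd x)))\<^sup>2)"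
  have iH: "integrable ?M ?H" using iP(1) iP'(1) by (intro integrable_mult_right Bochner_Integration.integrable_add)
  have "(LINT t|lborel. (norm (?G t))\<^sup>2) = (LINT x|?M. (LINT t|lborel. ?k t (fst x) * ?k t (snd x)) * (f (fst x) \<bullet> f (snd x)))"
    using kp(2) by (simp add: power2_norm_eq_inner)
  also have "... <= (LINT x|?M. ?H x)"
  proof (rule integral_mono_AE')
    show "AE x in ?M. (LINT t|lborel. ?k t (fst x) * ?k t (snd x)) * (f (fst x) \<bullet> f (snd x)) <= ?H x"
      using AE_pair_neq
    proof eventually_elim
      case (elim x)
      have "f (fst x) \<bullet> f (snd x) <= norm (f (fst x)) * norm (f (snd x))" by (rule norm_cauchy_schwarz)
      also have "... <= ((norm (f (fst x)))\<^sup>2 + (norm (f (snd x)))\<^sup>2) / 2"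
        using sum_squares_bound[of "norm (f (fst x))" "norm (f (snd x))"] by simp
      finally have le: "f (fst x) \<bullet> f (snd x) <= ((norm (f (fst x)))\<^sup>2 + (norm (f (snd x)))\<^sup>2) / 2" .
      have "(LINT t|lborel. ?k t (fst x) * ?k t (snd x)) * (f (fst x) \<bullet> f (snd x)) <= (2 * pi * eps * ?P (fst x - snd x)) * (((norm (f (fst x)))\<^sup>2 + (norm (f (snd x)))\<^sup>2) / 2)"
        unfolding c[OF elim] using e by (intro mult_left_mono le) auto
      also have "... = ?H x"
      proof -
        have id: "(2 * pi * eps * P) * ((a + b) / 2) = pi * eps * (P * a + P * b)" for P a b
          by (simp add: algebra_simps add_divide_distrib)
        show ?thesis by (rule id)
      qed
      finally show ?case .
    qed
    show "AE x in ?M. 0 <= ?H x" using e by (intro AE_I2 mult_nonneg_nonneg add_nonneg_nonneg) auto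
  qed (rule iH)
  also have "... = pi * eps * (pi / (2 * eps) * (l2norm lborel f)\<^sup>2 + pi / (2 * eps) * (l2norm lborel f)\<^sup>2)"
    using iP iP' by simp
  also have "... = pi\<^sup>2 * (l2norm lborel f)\<^sup>2" using e by (simp add: power2_eq_square field_simps)
  finally have main: "(LINT t|lborel. (norm (?G t))\<^sup>2) <= pi\<^sup>2 * (l2norm lborel f)\<^sup>2" .
  have "sqnorm lborel (conj_op eps f) = ennreal ((1 / pi)\<^sup>2) * sqnorm lborel ?G"
    unfolding conj_op_def by (rule sqnorm_scale) measurable
  also have "sqnorm lborel ?G = ennreal (LINT t|lborel. (norm (?G t))\<^sup>2)"
    unfolding sqnorm_def by (rule nn_integral_eq_integral[OF iG]) auto
  also have "ennreal ((1 / pi)\<^sup>2) * ... <= ennreal ((1 / pi)\<^sup>2) * ennreal (pi\<^sup>2 * (l2norm lborel f)\<^sup>2)"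
    by (intro mult_left_mono ennreal_leI main) auto
  also have "... = sqnorm lborel f"
    unfolding sqnorm_eq_l2norm[OF f] by (subst ennreal_mult[symmetric]) (auto simp: power_divide)
  finally show ?thesis .
qed

text \<open>Truncation in both time and size reaches the bounded case. The integrals defining
  \<open>conj_op\<close> converge pointwise by dominated convergence, and Fatou's lemma keeps the
  bound.\<close>

lemma conj_op_bound:
  fixes f :: "real => 'h::{real_inner,banach,second_countable_topology}"
  assumes e: "eps > 0" and f: "sq_integrable lborel f"
  shows "sqnorm lborel (conj_op eps f) <= sqnorm lborel f"
proof -
  have [measurable]: "f \<in> borel_measurable borel" using f by (simp add: sq_integrable_def)
  define g where "g n t = (if \<bar>t\<bar> <= real n \<and> norm (f t) <= real n then f t else 0)" for n t
  have [measurable]: "g n \<in> borel_measurable borel" for n unfolding g_def[abs_def] by measurable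
  have gf: "norm (g n t) <= norm (f t)" for n t by (simp add: g_def)
  have le: "sqnorm lborel (conj_op eps (g n)) <= sqnorm lborel f" for n
  proof -
    have "sqnorm lborel (conj_op eps (g n)) <= sqnorm lborel (g n)"
      by (rule conj_op_bound_bounded[OF e, of _ "real n" "real n"]) (auto simp: g_def)
    also have "... <= sqnorm lborel f" by (intro sqnorm_mono) (auto simp: gf)
    finally show ?thesis .
  qed
  show ?thesis
  proof (rule sqnorm_Fatou[where f = "\<lambda>n. conj_op eps (g n)"])
    show "conj_op eps (g n) \<in> borel_measurable lborel" for n using conj_op_measurable[of "g n" eps] by simp
    show "AE t in lborel. (\<lambda>n. conj_op eps (g n) t) ---> conj_op eps f t"
    proof (rule AE_I2)
      fix t :: real
      have "(\<lambda>n. LINT s|lborel. conj_kernel eps (t - s) *\<^sub>R g n s) ---> (LINT s|lborel. conj_kernel eps (t - s) *\<^sub>R f s)"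
      proof (rule integral_dominated_convergence[where w = "\<lambda>s. norm (conj_kernel eps (t - s) *\<^sub>R f s)"])
        show "integrable lborel (\<lambda>s. norm (conj_kernel eps (t - s) *\<^sub>R f s))"
          by (rule integrable_norm[OF conj_op_integrable[OF e f]])
        show "AE s in lborel. (\<lambda>n. conj_kernel eps (t - s) *\<^sub>R g n s) ---> conj_kernel eps (t - s) *\<^sub>R f s"
        proof (rule AE_I2)
          fix s :: real
          obtain N :: nat where N: "real N >= max \<bar>s\<bar> (norm (f s))" using real_arch_simple by blast
          have "g n s = f s" if "n >= N" for n
          proof -
            have "real N <= real n" using that by simp
            then show ?thesis using N by (simp add: g_def)
          qed
          then have "\<forall>\<^sub>F n in sequentially. conj_kernel eps (t - s) *\<^sub>R g n s = conj_kernel eps (t - s) *\<^sub>R f s"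
            by (auto simp: eventually_sequentially)
          then show "(\<lambda>n. conj_kernel eps (t - s) *\<^sub>R g n s) ---> conj_kernel eps (t - s) *\<^sub>R f s"
            by (rule tendsto_eventually)
        qed
        show "AE s in lborel. norm (conj_kernel eps (t - s) *\<^sub>R g n s) <= norm (conj_kernel eps (t - s) *\<^sub>R f s)" for n
          by (auto simp: gf intro!: mult_left_mono)
      qed measurable
      then show "(\<lambda>n. conj_op eps (g n) t) ---> conj_op eps f t"
        unfolding conj_op_def by (intro tendsto_scaleR tendsto_const)
    qed
  qed (use le in auto)
qed

text \<open>Expresses the seminorm through L2 norms of translation differences, so that a linear L2
  contraction commuting with translations is a contraction for the seminorm as well.\<close>

lemma sqnorm_dquot_translation:
  fixes U :: "real => 'b::{real_normed_vector,second_countable_topology}"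
  assumes [measurable]: "U \<in> borel_measurable borel"
  shows "sqnorm plane (dquot U) = (\<integral>\<^sup>+h. ennreal (1 / h\<^sup>2) * sqnorm lborel (\<lambda>t. U (t - h) - U t) \<partial>lborel)"
proof -
  have [measurable]: "dquot U \<in> borel_measurable (borel \<Otimes>\<^sub>M borel)" by (rule borel_measurable_dquot) auto
  have "sqnorm plane (dquot U) = (\<integral>\<^sup>+t. \<integral>\<^sup>+s. ennreal ((norm (dquot U (s, t)))\<^sup>2) \<partial>lborel \<partial>lborel)"
    unfolding sqnorm_def by (rule lborel_pair.nn_integral_snd[symmetric]) measurable
  also have "... = (\<integral>\<^sup>+t. \<integral>\<^sup>+h. ennreal ((norm (dquot U (t - h, t)))\<^sup>2) \<partial>lborel \<partial>lborel)"
    using nn_integral_lborel_reflect[of "\<lambda>s. ennreal ((norm (dquot U (s, t)))\<^sup>2)" t for t] by simp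
  also have "... = (\<integral>\<^sup>+h. \<integral>\<^sup>+t. ennreal ((norm (dquot U (t - h, t)))\<^sup>2) \<partial>lborel \<partial>lborel)"
    by (rule lborel_pair.Fubini') measurable
  also have "... = (\<integral>\<^sup>+h. \<integral>\<^sup>+t. ennreal (1 / h\<^sup>2) * ennreal ((norm (U (t - h) - U t))\<^sup>2) \<partial>lborel \<partial>lborel)"
    by (intro nn_integral_cong) (simp add: norm_dquot_sq ennreal_mult''[symmetric])
  also have "... = (\<integral>\<^sup>+h. ennreal (1 / h\<^sup>2) * sqnorm lborel (\<lambda>t. U (t - h) - U t) \<partial>lborel)"
    unfolding sqnorm_def by (intro nn_integral_cong nn_integral_cmult) measurable
  finally show ?thesis .
qed

lemma sq_integrable_translate:
  fixes f :: "'a::euclidean_space => 'b::{real_normed_vector,second_countable_topology}"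
  assumes "sq_integrable lborel f"
  shows "sq_integrable lborel (\<lambda>x. f (x - c))"
  using assms sqnorm_translate[of f c] by (auto simp: sq_integrable_def)

lemma conj_op_half_sob:
  fixes U :: "real => 'h::{real_inner,banach,second_countable_topology}"
  assumes e: "eps > 0" and U: "half_sob U"
  shows "half_sob (conj_op eps U)"
    and "sqnorm plane (dquot (conj_op eps U)) <= sqnorm plane (dquot U)"
proof -
  have U1: "sq_integrable lborel U" and [measurable]: "U \<in> borel_measurable borel"
    using U by (auto simp: half_sob_def sq_integrable_def)
  have [measurable]: "conj_op eps U \<in> borel_measurable borel" by (rule conj_op_measurable) measurable
  have "sqnorm plane (dquot (conj_op eps U)) = (\<integral>\<^sup>+h. ennreal (1 / h\<^sup>2) * sqnorm lborel (\<lambda>t. conj_op eps U (t - h) - conj_op eps U t) \<partial>lborel)"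
    by (rule sqnorm_dquot_translation) measurable
  also have "... <= (\<integral>\<^sup>+h. ennreal (1 / h\<^sup>2) * sqnorm lborel (\<lambda>t. U (t - h) - U t) \<partial>lborel)"
  proof (intro nn_integral_mono mult_left_mono)
    fix h :: real
    have "(\<lambda>t. conj_op eps U (t - h) - conj_op eps U t) = conj_op eps (\<lambda>t. U (t - h) - U t)"
      using conj_op_diff[OF e sq_integrable_translate[OF U1] U1] by (auto simp: conj_op_translate)
    then show "sqnorm lborel (\<lambda>t. conj_op eps U (t - h) - conj_op eps U t) <= sqnorm lborel (\<lambda>t. U (t - h) - U t)"
      using conj_op_bound[OF e sq_integrable_diff[OF sq_integrable_translate[OF U1] U1]] by simp
  qed auto
  also have "... = sqnorm plane (dquot U)"
    by (rule sqnorm_dquot_translation[symmetric]) measurable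
  finally show le: "sqnorm plane (dquot (conj_op eps U)) <= sqnorm plane (dquot U)" .
  have "sq_integrable lborel (conj_op eps U)"
    using conj_op_bound[OF e U1] U1 by (auto simp: sq_integrable_def)
  then show "half_sob (conj_op eps U)"
    using le U by (auto simp: half_sob_def sq_integrable_def intro: borel_measurable_dquot_lborel)
qed

text \<open>The form of \<open>f'\<close> against the conjugate kernel is the energy form. The
  factor \<open>1 / pi\<close> is the normalisation of \<open>conj_op\<close>, and 2 in the
  denominator comes from polarisation.\<close>

lemma conj_op_energy:
  fixes f :: "real => 'h::{real_inner,banach,second_countable_topology}"
  assumes f: "f \<in> smooth_compact" and f': "\<And>t. (f has_vector_derivative f' t) (at t)"
    and \<delta>: "\<And>n. \<delta> n > 0" "\<delta> ---> 0"
  shows "(\<lambda>n::nat. LINT s|lborel. f' s \<bullet> conj_op (\<delta> n) f s) ---> (l2norm plane (dquot f))\<^sup>2 / (2 * pi)"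
proof -
  obtain R B where "compact_primitive f f' {} R B" using smooth_compact_primitive[OF f f'] by metis
  then interpret compact_primitive f f' "{}" R B .
  have q: "sq_integrable plane (dquot f)" using smooth_compact_half_sob[OF f] by (simp add: half_sob_def)
  have "(LINT s|lborel. f' s \<bullet> conj_op (\<delta> n) f s) = (1 / pi) * (LINT s|lborel. f' s \<bullet> (LINT t|lborel. conj_kernel (\<delta> n) (s - t) *\<^sub>R f t))" for n
    by (simp add: conj_op_def)
  then have eq: "(LINT s|lborel. f' s \<bullet> conj_op (\<delta> n) f s) = (1 / pi) * - (LINT x|plane. (\<lambda>(s, t). energy_kernel (\<delta> n) (s - t) * (f s \<bullet> f t)) x)" for n
    unfolding conj_kernel_form[OF \<delta>(1)] .
  from tendsto_mult[OF tendsto_const[of "1 / pi"] energy_form_tendsto[OF q \<delta>]]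
  show ?thesis unfolding eq by (simp add: mult.commute)
qed

subsection \<open>Extension of the half derivatives by continuity\<close>

lemma tendsto_0_le_ennreal:
  fixes f g :: "nat => ennreal"
  assumes "g ---> 0" "\<And>n. f n <= g n"
  shows "f ---> 0"
  by (rule tendsto_sandwich[OF _ _ tendsto_const assms(1)]) (use assms(2) in auto)

lemma tendsto_0_lincomb_ennreal:
  fixes f g :: "nat => ennreal"
  assumes "f ---> 0" "g ---> 0" "a < \<infinity>" "b < \<infinity>"
  shows "(\<lambda>n. a * f n + b * g n) ---> 0"
proof -
  have "(\<lambda>n. a * f n + b * g n) ---> a * 0 + b * 0"
    using assms by (intro tendsto_add ennreal_tendsto_cmult) auto
  then show ?thesis by simp
qed

lemma sqnorm_limit_unique:
  fixes f :: "nat => 'a => 'b::{real_normed_vector,second_countable_topology}"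
  assumes [measurable]: "\<And>n. f n \<in> borel_measurable M" "g \<in> borel_measurable M" "h \<in> borel_measurable M"
    and g: "(\<lambda>n. sqnorm M (\<lambda>x. f n x - g x)) ---> 0" and h: "(\<lambda>n. sqnorm M (\<lambda>x. f n x - h x)) ---> 0"
  shows "AE x in M. g x = h x"
proof -
  have "sqnorm M (\<lambda>x. g x - h x) <= 2 * sqnorm M (\<lambda>x. f n x - g x) + 2 * sqnorm M (\<lambda>x. f n x - h x)" for n
    using sqnorm_diff[of "\<lambda>x. f n x - h x" M "\<lambda>x. f n x - g x"] by (simp add: add.commute)
  moreover have "(\<lambda>n. 2 * sqnorm M (\<lambda>x. f n x - g x) + 2 * sqnorm M (\<lambda>x. f n x - h x)) ---> 0"
    by (rule tendsto_0_lincomb_ennreal[OF g h]) auto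
  ultimately have "sqnorm M (\<lambda>x. g x - h x) <= 0"
    by (intro LIMSEQ_le_const[where a = "sqnorm M (\<lambda>x. g x - h x)"]) auto
  then have "sqnorm M (\<lambda>x. g x - h x) = 0" by simp
  then have "AE x in M. g x - h x = 0" by (subst (asm) sqnorm_eq_0_iff) auto
  then show ?thesis by eventually_elim simp
qed

lemma sqnorm_lincomb:
  fixes f g :: "'a => 'b::{real_normed_vector,second_countable_topology}"
  assumes [measurable]: "f \<in> borel_measurable M" "g \<in> borel_measurable M"
  shows "sqnorm M (\<lambda>x. a *\<^sub>R f x + b *\<^sub>R g x) <= ennreal (2 * a\<^sup>2) * sqnorm M f + ennreal (2 * b\<^sup>2) * sqnorm M g"
  using sqnorm_add[of "\<lambda>x. a *\<^sub>R f x" M "\<lambda>x. b *\<^sub>R g x"]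
  by (simp add: sqnorm_scale ennreal_mult mult.assoc)

text \<open>Extension by continuity from a dense class S to a space K. Squared norms satisfy the
  triangle inequality only with a factor 2, hence the form of the assumption on N. Equations for T
  are required at positive times only, as the half-line norm sees nothing else.\<close>

locale L2_ext =
  fixes S K :: "(real => 'h::{real_inner,banach,second_countable_topology}) set"
    and N :: "(real => 'h) => ennreal" and T :: "(real => 'h) => real => 'h" and C :: real
  assumes S_meas: "\<And>f. f \<in> S ==> f \<in> borel_measurable half_line"
    and K_meas: "\<And>f. f \<in> K ==> f \<in> borel_measurable half_line"
    and S_lin: "\<And>f g a b. f \<in> S ==> g \<in> S ==> (\<lambda>t. a *\<^sub>R f t + b *\<^sub>R g t) \<in> S"
    and K_lin: "\<And>f g a b. f \<in> K ==> g \<in> K ==> (\<lambda>t. a *\<^sub>R f t + b *\<^sub>R g t) \<in> K"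
    and T_lin: "\<And>f g a b t. f \<in> S ==> g \<in> S ==> t > 0 ==> T (\<lambda>t. a *\<^sub>R f t + b *\<^sub>R g t) t = a *\<^sub>R T f t + b *\<^sub>R T g t"
    and T_meas: "\<And>f. f \<in> S ==> T f \<in> borel_measurable half_line"
    and N_lin: "\<And>f g a b. f \<in> borel_measurable half_line ==> g \<in> borel_measurable half_line ==>
        N (\<lambda>t. a *\<^sub>R f t + b *\<^sub>R g t) <= ennreal (2 * a\<^sup>2) * N f + ennreal (2 * b\<^sup>2) * N g"
    and S_fin: "\<And>f. f \<in> S ==> N f < \<infinity>"
    and T_bound: "\<And>f. f \<in> S ==> sqnorm half_line (T f) <= ennreal C * N f"
    and dense: "\<And>u. u \<in> K ==> \<exists>\<phi>. (\<forall>n::nat. \<phi> n \<in> S) \<and> (\<lambda>n. N (\<lambda>t. \<phi> n t - u t)) ---> 0"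
begin

abbreviation ext :: "(real => 'h) => real => 'h" where
  "ext \<equiv> L2_extension S N T"

lemma T_sq_integrable: "f \<in> S ==> sq_integrable half_line (T f)"
  using T_bound[of f] S_fin[of f] T_meas[of f]
  by (auto simp: sq_integrable_def ennreal_mult_less_top intro: le_less_trans)

lemma N_diff:
  "f \<in> borel_measurable half_line ==> g \<in> borel_measurable half_line ==> N (\<lambda>t. f t - g t) <= 2 * N f + 2 * N g"
  using N_lin[of f g 1 "-1"] by simp

lemma T_diff_bound:
  assumes f: "f \<in> S" and g: "g \<in> S" and u: "u \<in> borel_measurable half_line"
  shows "sqnorm half_line (\<lambda>t. T f t - T g t) <= ennreal (2 * C) * N (\<lambda>t. f t - u t) + ennreal (2 * C) * N (\<lambda>t. g t - u t)"
proof -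
  have [measurable]: "f \<in> borel_measurable half_line" "g \<in> borel_measurable half_line" "u \<in> borel_measurable half_line"
    using f g u S_meas by auto
  have "sqnorm half_line (\<lambda>t. T f t - T g t) = sqnorm half_line (T (\<lambda>t. f t - g t))"
    by (rule sqnorm_cong) (use T_lin[OF f g, of _ 1 "-1"] in simp)
  also have "... <= ennreal C * N (\<lambda>t. f t - g t)"
    using S_lin[OF f g, of 1 "-1"] by (intro T_bound) simp
  also have "... <= ennreal C * (2 * N (\<lambda>t. f t - u t) + 2 * N (\<lambda>t. g t - u t))"
    using N_diff[of "\<lambda>t. f t - u t" "\<lambda>t. g t - u t"] by (intro mult_left_mono) simp_all
  also have "... = ennreal (2 * C) * N (\<lambda>t. f t - u t) + ennreal (2 * C) * N (\<lambda>t. g t - u t)"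
  proof -
    have "ennreal (2 * C) = 2 * ennreal C" by (subst ennreal_mult') auto
    then show ?thesis by (simp add: distrib_left mult_ac)
  qed
  finally show ?thesis .
qed

lemma T_Cauchy:
  assumes \<phi>: "\<And>n. \<phi> n \<in> S" and u: "u \<in> borel_measurable half_line" and lim: "(\<lambda>n. N (\<lambda>t. \<phi> n t - u t)) ---> 0" and e: "e > 0"
  shows "\<exists>M. \<forall>m\<ge>M. \<forall>n\<ge>M. sqnorm half_line (\<lambda>t. T (\<phi> m) t - T (\<phi> n) t) < ennreal e"
proof -
  let ?a = "\<lambda>n. ennreal (2 * C) * N (\<lambda>t. \<phi> n t - u t)"
  have "(\<lambda>n. ?a n + 0 * ?a n) ---> 0" using tendsto_0_lincomb_ennreal[OF lim lim, of "ennreal (2 * C)" 0] by simp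
  then have "\<forall>\<^sub>F n in sequentially. ?a n < ennreal (e / 4)"
    by (intro order_tendstoD(2)) (use e in auto)
  then obtain M where M: "\<And>n. n >= M ==> ?a n < ennreal (e / 4)" by (auto simp: eventually_sequentially)
  have "sqnorm half_line (\<lambda>t. T (\<phi> m) t - T (\<phi> n) t) < ennreal e" if "m >= M" "n >= M" for m n
  proof -
    have "sqnorm half_line (\<lambda>t. T (\<phi> m) t - T (\<phi> n) t) <= ?a m + ?a n" by (rule T_diff_bound[OF \<phi> \<phi> u])
    also have "... <= ennreal (e / 4) + ennreal (e / 4)" by (intro add_mono less_imp_le M that)
    also have "... = ennreal (e / 2)" using e by (subst ennreal_plus[symmetric]) auto
    also have "... < ennreal e" using e by (intro ennreal_lessI) auto
    finally show ?thesis .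
  qed
  then show ?thesis by blast
qed

text \<open>The choice in \<open>L2_extension\<close> has a witness: images of an approximating
  sequence form a Cauchy sequence, and L2 is complete.\<close>

lemma ext_spec:
  assumes u: "u \<in> K"
  shows "sq_integrable half_line (ext u)"
    and "\<exists>\<phi>. (\<forall>n::nat. \<phi> n \<in> S) \<and> (\<lambda>n. N (\<lambda>t. \<phi> n t - u t)) ---> 0 \<and> (\<lambda>n. sqnorm half_line (\<lambda>t. T (\<phi> n) t - ext u t)) ---> 0"
proof -
  note um = K_meas[OF u]
  obtain \<phi> where \<phi>: "\<And>n::nat. \<phi> n \<in> S" and lim: "(\<lambda>n. N (\<lambda>t. \<phi> n t - u t)) ---> 0"
    using dense[OF u] by auto
  note cauchy = T_Cauchy[OF \<phi> um lim]
  obtain r g where r: "strict_mono (r::nat=>nat)" and g: "g \<in> borel_measurable half_line" "AE t in half_line. (\<lambda>n. T (\<phi> (r n)) t) ---> g t"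
    using sqnorm_Cauchy_AE_convergent[OF T_meas[OF \<phi>] cauchy] by auto
  have conv: "(\<lambda>n. sqnorm half_line (\<lambda>t. T (\<phi> n) t - g t)) ---> 0"
    by (rule sqnorm_AE_limit[OF T_meas[OF \<phi>] g(1) cauchy r g(2)])
  have "sq_integrable half_line g" by (rule sq_integrable_limit[OF T_sq_integrable[OF \<phi>] g(1) conv])
  then have "\<exists>g. g \<in> L2_space \<and> (\<exists>\<phi>. (\<forall>n::nat. \<phi> n \<in> S) \<and> (\<lambda>n. N (\<lambda>t. \<phi> n t - u t)) ---> 0 \<and>
      (\<lambda>n. L2_normsq (\<lambda>t. T (\<phi> n) t - g t)) ---> 0)"
    using \<phi> lim conv by (auto simp: sq_integrable_def L2_space_def L2_normsq_eq)
  from someI_ex[OF this]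
  have "ext u \<in> L2_space \<and> (\<exists>\<phi>. (\<forall>n::nat. \<phi> n \<in> S) \<and> (\<lambda>n. N (\<lambda>t. \<phi> n t - u t)) ---> 0 \<and>
      (\<lambda>n. L2_normsq (\<lambda>t. T (\<phi> n) t - ext u t)) ---> 0)"
    unfolding L2_extension_def .
  then show "sq_integrable half_line (ext u)"
    and "\<exists>\<phi>. (\<forall>n::nat. \<phi> n \<in> S) \<and> (\<lambda>n. N (\<lambda>t. \<phi> n t - u t)) ---> 0 \<and> (\<lambda>n. sqnorm half_line (\<lambda>t. T (\<phi> n) t - ext u t)) ---> 0"
    by (auto simp: sq_integrable_def L2_space_def L2_normsq_eq)
qed

lemma ext_measurable: "u \<in> K ==> ext u \<in> borel_measurable half_line"
  using ext_spec(1) by (simp add: sq_integrable_def)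

text \<open>The choice fixes one approximating sequence; boundedness of T forces the images of every
  other one to approach the same limit.\<close>

lemma ext_limit:
  assumes u: "u \<in> K" and \<phi>: "\<And>n::nat. \<phi> n \<in> S" and lim: "(\<lambda>n. N (\<lambda>t. \<phi> n t - u t)) ---> 0"
  shows "(\<lambda>n. sqnorm half_line (\<lambda>t. T (\<phi> n) t - ext u t)) ---> 0"
proof -
  obtain \<psi> where \<psi>: "\<And>n::nat. \<psi> n \<in> S" and lim': "(\<lambda>n. N (\<lambda>t. \<psi> n t - u t)) ---> 0"
    and ext: "(\<lambda>n. sqnorm half_line (\<lambda>t. T (\<psi> n) t - ext u t)) ---> 0"
    using ext_spec(2)[OF u] by auto
  note [measurable] = T_meas[OF \<phi>] T_meas[OF \<psi>] ext_measurable[OF u]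
  have 1: "(\<lambda>n. sqnorm half_line (\<lambda>t. T (\<phi> n) t - T (\<psi> n) t)) ---> 0"
    by (rule tendsto_0_le_ennreal[OF tendsto_0_lincomb_ennreal[OF lim lim'] T_diff_bound[OF \<phi> \<psi> K_meas[OF u]]]) auto
  show ?thesis
  proof (rule tendsto_0_le_ennreal[OF tendsto_0_lincomb_ennreal[OF 1 ext, of 2 2]])
    show "sqnorm half_line (\<lambda>t. T (\<phi> n) t - ext u t) <= 2 * sqnorm half_line (\<lambda>t. T (\<phi> n) t - T (\<psi> n) t) + 2 * sqnorm half_line (\<lambda>t. T (\<psi> n) t - ext u t)" for n
      using sqnorm_add[of "\<lambda>t. T (\<phi> n) t - T (\<psi> n) t" half_line "\<lambda>t. T (\<psi> n) t - ext u t"] by simp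
  qed auto
qed

text \<open>Holds almost everywhere only, since the three extensions are chosen independently; both
  sides are norm limits of the same sequence.\<close>

lemma ext_lin:
  assumes u: "u \<in> K" and v: "v \<in> K"
  shows "AE t in half_line. ext (\<lambda>t. a *\<^sub>R u t + b *\<^sub>R v t) t = a *\<^sub>R ext u t + b *\<^sub>R ext v t"
proof -
  obtain \<phi> where \<phi>: "\<And>n::nat. \<phi> n \<in> S" and lim: "(\<lambda>n. N (\<lambda>t. \<phi> n t - u t)) ---> 0" using dense[OF u] by auto
  obtain \<psi> where \<psi>: "\<And>n::nat. \<psi> n \<in> S" and lim': "(\<lambda>n. N (\<lambda>t. \<psi> n t - v t)) ---> 0" using dense[OF v] by auto
  have w: "(\<lambda>t. a *\<^sub>R u t + b *\<^sub>R v t) \<in> K" by (rule K_lin[OF u v])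
  note [measurable] = S_meas[OF \<phi>] S_meas[OF \<psi>] K_meas[OF u] K_meas[OF v] T_meas[OF \<phi>] T_meas[OF \<psi>]
    ext_measurable[OF u] ext_measurable[OF v] ext_measurable[OF w]
  let ?f = "\<lambda>n t. a *\<^sub>R \<phi> n t + b *\<^sub>R \<psi> n t"
  have f: "?f n \<in> S" for n by (rule S_lin[OF \<phi> \<psi>])
  have "(\<lambda>n. N (\<lambda>t. ?f n t - (a *\<^sub>R u t + b *\<^sub>R v t))) ---> 0"
  proof (rule tendsto_0_le_ennreal[OF tendsto_0_lincomb_ennreal[OF lim lim']])
    show "N (\<lambda>t. ?f n t - (a *\<^sub>R u t + b *\<^sub>R v t)) <= ennreal (2 * a\<^sup>2) * N (\<lambda>t. \<phi> n t - u t) + ennreal (2 * b\<^sup>2) * N (\<lambda>t. \<psi> n t - v t)" for n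
      using N_lin[of "\<lambda>t. \<phi> n t - u t" "\<lambda>t. \<psi> n t - v t" a b] by (simp add: algebra_simps)
  qed auto
  from ext_limit[OF w f this]
  have 1: "(\<lambda>n. sqnorm half_line (\<lambda>t. (a *\<^sub>R T (\<phi> n) t + b *\<^sub>R T (\<psi> n) t) - ext (\<lambda>t. a *\<^sub>R u t + b *\<^sub>R v t) t)) ---> 0"
    by (rule filterlim_cong[THEN iffD1, rotated -1])
       (auto intro!: always_eventually sqnorm_cong simp: T_lin[OF \<phi> \<psi>])
  have 2: "(\<lambda>n. sqnorm half_line (\<lambda>t. (a *\<^sub>R T (\<phi> n) t + b *\<^sub>R T (\<psi> n) t) - (a *\<^sub>R ext u t + b *\<^sub>R ext v t))) ---> 0"
  proof (rule tendsto_0_le_ennreal[OF tendsto_0_lincomb_ennreal[OF ext_limit[OF u \<phi> lim] ext_limit[OF v \<psi> lim']]])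
    show "sqnorm half_line (\<lambda>t. (a *\<^sub>R T (\<phi> n) t + b *\<^sub>R T (\<psi> n) t) - (a *\<^sub>R ext u t + b *\<^sub>R ext v t))
      <= ennreal (2 * a\<^sup>2) * sqnorm half_line (\<lambda>t. T (\<phi> n) t - ext u t) + ennreal (2 * b\<^sup>2) * sqnorm half_line (\<lambda>t. T (\<psi> n) t - ext v t)" for n
      using sqnorm_lincomb[of "\<lambda>t. T (\<phi> n) t - ext u t" half_line "\<lambda>t. T (\<psi> n) t - ext v t" a b] by (simp add: algebra_simps)
  qed auto
  show ?thesis
    by (rule sqnorm_limit_unique[OF _ _ _ 1 2]) measurable
qed

text \<open>The constant grows from C to 4C because the doubling bound for squared norms is used
  once on the way to an approximant and once on the way back.\<close>

lemma ext_bound: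
  assumes u: "u \<in> K" and C: "C >= 0"
  shows "sqnorm half_line (ext u) <= ennreal (4 * C) * N u"
proof -
  obtain \<phi> where \<phi>: "\<And>n::nat. \<phi> n \<in> S" and lim: "(\<lambda>n. N (\<lambda>t. \<phi> n t - u t)) ---> 0" using dense[OF u] by auto
  note ext = ext_limit[OF u \<phi> lim]
  note [measurable] = S_meas[OF \<phi>] K_meas[OF u] T_meas[OF \<phi>] ext_measurable[OF u]
  let ?r = "\<lambda>n. 2 * sqnorm half_line (\<lambda>t. T (\<phi> n) t - ext u t) + ennreal (4 * C) * N (\<lambda>t. \<phi> n t - u t)"
  have le: "sqnorm half_line (ext u) <= ?r n + ennreal (4 * C) * N u" for n
  proof -
    have "sqnorm half_line (ext u) <= 2 * sqnorm half_line (\<lambda>t. T (\<phi> n) t - ext u t) + 2 * sqnorm half_line (T (\<phi> n))"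
      using sqnorm_diff[of "T (\<phi> n)" half_line "\<lambda>t. T (\<phi> n) t - ext u t"] by (simp add: add.commute)
    also have "... <= 2 * sqnorm half_line (\<lambda>t. T (\<phi> n) t - ext u t) + 2 * (ennreal C * (2 * N (\<lambda>t. \<phi> n t - u t) + 2 * N u))"
    proof (intro add_left_mono mult_left_mono)
      have "N (\<phi> n) <= 2 * N (\<lambda>t. \<phi> n t - u t) + 2 * N u"
        using N_lin[of "\<lambda>t. \<phi> n t - u t" u 1 1] by simp
      then show "sqnorm half_line (T (\<phi> n)) <= ennreal C * (2 * N (\<lambda>t. \<phi> n t - u t) + 2 * N u)"
        using T_bound[OF \<phi>, of n] by (meson mult_left_mono order_trans zero_le)
    qed simp
    also have "... = ?r n + ennreal (4 * C) * N u"
    proof -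
      have "ennreal (4 * C) = 4 * ennreal C" by (subst ennreal_mult') auto
      then show ?thesis by (simp add: distrib_left mult_ac add.assoc)
    qed
    finally show ?thesis .
  qed
  have "(\<lambda>n. ?r n + ennreal (4 * C) * N u) ---> 0 + ennreal (4 * C) * N u"
    by (intro tendsto_add tendsto_const tendsto_0_lincomb_ennreal ext lim) auto
  then show ?thesis
    using le by (intro LIMSEQ_le_const[where a = "sqnorm half_line (ext u)"]) auto
qed

end

section \<open>The two half derivatives as instances of the extension scheme\<close>

lemma dquot_lincomb: "dquot (\<lambda>t. a *\<^sub>R u t + b *\<^sub>R v t) = (\<lambda>x. a *\<^sub>R dquot u x + b *\<^sub>R dquot v x)"
  by (simp add: dquot_add dquot_scaleR)

lemma H12_normsq_lincomb:
  fixes f g :: "real => 'h::{real_normed_vector,second_countable_topology}"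
  assumes f: "f \<in> borel_measurable half_line" and g: "g \<in> borel_measurable half_line"
  shows "H12_normsq (\<lambda>t. a *\<^sub>R f t + b *\<^sub>R g t) <= ennreal (2 * a\<^sup>2) * H12_normsq f + ennreal (2 * b\<^sup>2) * H12_normsq g"
proof -
  have fg: "(\<lambda>t. a *\<^sub>R f t + b *\<^sub>R g t) \<in> borel_measurable half_line" using f g by measurable
  have "H12_normsq (\<lambda>t. a *\<^sub>R f t + b *\<^sub>R g t) <= (ennreal (2 * a\<^sup>2) * sqnorm half_line f + ennreal (2 * b\<^sup>2) * sqnorm half_line g)
     + (ennreal (2 * a\<^sup>2) * sqnorm half_plane (dquot f) + ennreal (2 * b\<^sup>2) * sqnorm half_plane (dquot g))"
    unfolding H12_normsq_eq[OF fg] dquot_lincomb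
    by (intro add_mono sqnorm_lincomb f g borel_measurable_dquot_half_line)
  then show ?thesis unfolding H12_normsq_eq[OF f] H12_normsq_eq[OF g] by (simp add: distrib_left add_ac)
qed

lemma H12_00_normsq_lincomb:
  fixes f g :: "real => 'h::{real_normed_vector,second_countable_topology}"
  assumes [measurable]: "f \<in> borel_measurable half_line" "g \<in> borel_measurable half_line"
  shows "H12_00_normsq (\<lambda>t. a *\<^sub>R f t + b *\<^sub>R g t) <= ennreal (2 * a\<^sup>2) * H12_00_normsq f + ennreal (2 * b\<^sup>2) * H12_00_normsq g"
proof -
  have [measurable]: "(\<lambda>x. x) \<in> borel_measurable half_line" by (rule measurable_ident_half_line)
  have eq: "H12_00_normsq u = H12_normsq u + sqnorm half_line (\<lambda>s. (1 / sqrt s) *\<^sub>R u s)"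
    if "u \<in> borel_measurable half_line" for u :: "real => 'h"
    using H12_00_normsq_eq[OF that] H12_normsq_eq[OF that] by simp
  have "H12_00_normsq (\<lambda>t. a *\<^sub>R f t + b *\<^sub>R g t) = H12_normsq (\<lambda>t. a *\<^sub>R f t + b *\<^sub>R g t)
     + sqnorm half_line (\<lambda>s. a *\<^sub>R ((1 / sqrt s) *\<^sub>R f s) + b *\<^sub>R ((1 / sqrt s) *\<^sub>R g s))"
    by (subst eq) (auto simp: algebra_simps)
  also have "... <= (ennreal (2 * a\<^sup>2) * H12_normsq f + ennreal (2 * b\<^sup>2) * H12_normsq g)
     + (ennreal (2 * a\<^sup>2) * sqnorm half_line (\<lambda>s. (1 / sqrt s) *\<^sub>R f s) + ennreal (2 * b\<^sup>2) * sqnorm half_line (\<lambda>s. (1 / sqrt s) *\<^sub>R g s))"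
    by (intro add_mono sqnorm_lincomb H12_normsq_lincomb) measurable
  also have "... = ennreal (2 * a\<^sup>2) * H12_00_normsq f + ennreal (2 * b\<^sup>2) * H12_00_normsq g"
    by (subst (1 2) eq) (auto simp: distrib_left add_ac)
  finally show ?thesis .
qed

lemma smooth_compact_lincomb:
  fixes f g :: "real => 'h::real_normed_vector"
  assumes f: "f \<in> smooth_compact" and g: "g \<in> smooth_compact"
  shows "(\<lambda>t. a *\<^sub>R f t + b *\<^sub>R g t) \<in> smooth_compact"
  by (intro smooth_compact_add smooth_compact_linear_image[OF bounded_linear_scaleR_right] f g)

lemma smooth_compact_0_lincomb:
  fixes f g :: "real => 'h::real_normed_vector"
  assumes f: "f \<in> smooth_compact_0" and g: "g \<in> smooth_compact_0"
  shows "(\<lambda>t. a *\<^sub>R f t + b *\<^sub>R g t) \<in> smooth_compact_0"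
proof -
  obtain d1 d2 where "d1 > 0" "\<And>t. t < d1 ==> f t = 0" "d2 > 0" "\<And>t. t < d2 ==> g t = 0"
    using f g by (auto simp: smooth_compact_0_iff)
  then show ?thesis
    using smooth_compact_lincomb[of f g a b] f g unfolding smooth_compact_0_iff
    by (intro conjI exI[of _ "min d1 d2"]) auto
qed

lemma lincomb_deriv:
  fixes f g :: "real => 'h::real_normed_vector"
  assumes "(f has_vector_derivative f') (at t)" "(g has_vector_derivative g') (at t)"
  shows "((\<lambda>t. a *\<^sub>R f t + b *\<^sub>R g t) has_vector_derivative (a *\<^sub>R f' + b *\<^sub>R g')) (at t)"
  by (intro has_vector_derivative_add bounded_linear.has_vector_derivative[OF bounded_linear_scaleR_right] assms)

lemma integral_lincomb:
  fixes f g :: "'a => 'b::{banach,second_countable_topology}"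
  assumes "integrable M f" "integrable M g"
  shows "(LINT x|M. a *\<^sub>R f x + b *\<^sub>R g x) = a *\<^sub>R (LINT x|M. f x) + b *\<^sub>R (LINT x|M. g x)"
  using assms by simp

lemma smooth_D_minus_lincomb:
  fixes f g :: "real => 'h::{real_inner,banach,second_countable_topology}"
  assumes f: "f \<in> smooth_compact" and g: "g \<in> smooth_compact"
  shows "smooth_D_minus (\<lambda>t. a *\<^sub>R f t + b *\<^sub>R g t) t = a *\<^sub>R smooth_D_minus f t + b *\<^sub>R smooth_D_minus g t"
proof -
  obtain f' where f': "\<And>t. (f has_vector_derivative f' t) (at t)" using smooth_compact_deriv[OF f] by metis
  obtain g' where g': "\<And>t. (g has_vector_derivative g' t) (at t)" using smooth_compact_deriv[OF g] by metis
  obtain R B where "compact_primitive f f' {} R B" using smooth_compact_primitive[OF f f'] by metis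
  then interpret F: compact_primitive f f' "{}" R B .
  obtain R2 B2 where "compact_primitive g g' {} R2 B2" using smooth_compact_primitive[OF g g'] by metis
  then interpret G: compact_primitive g g' "{}" R2 B2 .
  have "half_int (\<lambda>t. a *\<^sub>R f' t + b *\<^sub>R g' t) t = (LINT s|lborel. a *\<^sub>R (frac_kernel (s - t) *\<^sub>R f' s) + b *\<^sub>R (frac_kernel (s - t) *\<^sub>R g' s))"
    unfolding half_int_def by (simp add: algebra_simps)
  also have "... = a *\<^sub>R half_int f' t + b *\<^sub>R half_int g' t"
    unfolding half_int_def by (rule integral_lincomb[OF F.integrable_frac_kernel_mult(1) G.integrable_frac_kernel_mult(1)])
  finally show ?thesis
    unfolding smooth_D_minus_eq[OF smooth_compact_lincomb[OF f g] lincomb_deriv[OF f' g']] smooth_D_minus_eq[OF f f'] smooth_D_minus_eq[OF g g']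
    by (simp add: algebra_simps)
qed

lemma smooth_D_plus_lincomb:
  fixes f g :: "real => 'h::{real_inner,banach,second_countable_topology}"
  assumes f: "f \<in> smooth_compact_0" and g: "g \<in> smooth_compact_0"
  shows "smooth_D_plus (\<lambda>t. a *\<^sub>R f t + b *\<^sub>R g t) t = a *\<^sub>R smooth_D_plus f t + b *\<^sub>R smooth_D_plus g t"
proof -
  have fS: "f \<in> smooth_compact" and gS: "g \<in> smooth_compact" using f g by (auto simp: smooth_compact_0_def)
  obtain f' where f': "\<And>t. (f has_vector_derivative f' t) (at t)" using smooth_compact_deriv[OF fS] by metis
  obtain g' where g': "\<And>t. (g has_vector_derivative g' t) (at t)" using smooth_compact_deriv[OF gS] by metis
  obtain R B where "compact_primitive f f' {} R B" using smooth_compact_primitive[OF fS f'] by metis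
  then interpret F: compact_primitive f f' "{}" R B .
  obtain R2 B2 where "compact_primitive g g' {} R2 B2" using smooth_compact_primitive[OF gS g'] by metis
  then interpret G: compact_primitive g g' "{}" R2 B2 .
  have "(LINT s|lborel. frac_kernel (t - s) *\<^sub>R (a *\<^sub>R f' s + b *\<^sub>R g' s)) = (LINT s|lborel. a *\<^sub>R (frac_kernel (t - s) *\<^sub>R f' s) + b *\<^sub>R (frac_kernel (t - s) *\<^sub>R g' s))"
    by (simp add: algebra_simps)
  also have "... = a *\<^sub>R (LINT s|lborel. frac_kernel (t - s) *\<^sub>R f' s) + b *\<^sub>R (LINT s|lborel. frac_kernel (t - s) *\<^sub>R g' s)"
    by (rule integral_lincomb[OF F.integrable_frac_kernel_mult(2) G.integrable_frac_kernel_mult(2)])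
  finally show ?thesis
    unfolding smooth_D_plus_eq(2)[OF smooth_compact_0_lincomb[OF f g] lincomb_deriv[OF f' g']] smooth_D_plus_eq(2)[OF f f'] smooth_D_plus_eq(2)[OF g g']
    by (simp add: algebra_simps)
qed

lemma zero_ext_smooth_compact_0: "f \<in> smooth_compact_0 ==> zero_ext f = f"
  by (auto simp: smooth_compact_0_iff zero_ext_def indicator_def fun_eq_iff)

lemma smooth_compact_measurable_half_line:
  fixes f :: "real => 'h::real_normed_vector"
  shows "f \<in> smooth_compact ==> f \<in> borel_measurable half_line"
  by (intro measurable_half_lineI smooth_compact_measurable)

lemma zero_ext_half_sob:
  fixes u :: "real => 'h::{real_normed_vector,second_countable_topology}"
  assumes u: "u \<in> H12_00_space"
  shows "half_sob (zero_ext u)"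
proof -
  have um: "u \<in> borel_measurable half_line" and fin: "H12_00_normsq u < \<infinity>" using u by (auto simp: H12_00_space_def)
  have "sqnorm plane (dquot (zero_ext u)) < \<infinity>"
    using H12_00_zero_ext(2)[OF um] fin by (auto simp: ennreal_mult_less_top intro: le_less_trans)
  moreover have "sqnorm lborel (zero_ext u) <= H12_00_normsq u"
    unfolding sqnorm_zero_ext H12_00_normsq_eq[OF um] by (simp add: add.assoc add_increasing2)
  ultimately show ?thesis
    using fin zero_ext_measurable[OF um] by (auto simp: half_sob_def sq_integrable_def intro: borel_measurable_dquot_lborel)
qed

text \<open>Everything goes through the zero extension, whose one-sided mollification stays in the
  open half line. The constant 2 arises as the weighted term counts twice in the seminorm on the
  plane but once in the norm.\<close>

interpretation Dp: L2_ext "smooth_compact_0 :: (real => 'h::{real_inner,banach,second_countable_topology}) set" H12_00_space H12_00_normsq smooth_D_plus 2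
proof
  fix f g :: "real => 'h" and a b t :: real
  show "f \<in> borel_measurable half_line" if "f \<in> smooth_compact_0"
    using that by (auto simp: smooth_compact_0_def intro: smooth_compact_measurable_half_line)
  show "f \<in> borel_measurable half_line" if "f \<in> H12_00_space" using that by (simp add: H12_00_space_def)
  show "(\<lambda>t. a *\<^sub>R f t + b *\<^sub>R g t) \<in> smooth_compact_0" if "f \<in> smooth_compact_0" "g \<in> smooth_compact_0"
    using that by (rule smooth_compact_0_lincomb)
  show "(\<lambda>t. a *\<^sub>R f t + b *\<^sub>R g t) \<in> H12_00_space" if "f \<in> H12_00_space" "g \<in> H12_00_space"
    using H12_00_normsq_lincomb[of f g a b] that
    by (auto simp: H12_00_space_def ennreal_mult_less_top intro: le_less_trans)
  show "smooth_D_plus (\<lambda>t. a *\<^sub>R f t + b *\<^sub>R g t) t = a *\<^sub>R smooth_D_plus f t + b *\<^sub>R smooth_D_plus g t"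
    if "f \<in> smooth_compact_0" "g \<in> smooth_compact_0" using that by (rule smooth_D_plus_lincomb)
  show "smooth_D_plus f \<in> borel_measurable half_line" if "f \<in> smooth_compact_0"
    by (intro measurable_half_lineI smooth_D_plus_bound that)
  show "H12_00_normsq (\<lambda>t. a *\<^sub>R f t + b *\<^sub>R g t) <= ennreal (2 * a\<^sup>2) * H12_00_normsq f + ennreal (2 * b\<^sup>2) * H12_00_normsq g"
    if "f \<in> borel_measurable half_line" "g \<in> borel_measurable half_line" using that by (rule H12_00_normsq_lincomb)
  show "H12_00_normsq f < \<infinity>" if f: "f \<in> smooth_compact_0"
  proof -
    have fS: "f \<in> smooth_compact" using f by (simp add: smooth_compact_0_def)
    have "H12_00_normsq f <= sqnorm lborel f + sqnorm plane (dquot f)"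
      using H12_00_zero_ext(1)[OF smooth_compact_measurable_half_line[OF fS]] by (simp add: zero_ext_smooth_compact_0[OF f])
    also have "... < \<infinity>" using smooth_compact_half_sob[OF fS] by (simp add: half_sob_def sq_integrable_def)
    finally show ?thesis .
  qed
  show "sqnorm half_line (smooth_D_plus f) <= ennreal 2 * H12_00_normsq f" if f: "f \<in> smooth_compact_0"
  proof -
    have fS: "f \<in> smooth_compact" using f by (simp add: smooth_compact_0_def)
    show ?thesis
      using order_trans[OF smooth_D_plus_bound(1)[OF f]] H12_00_zero_ext(2)[OF smooth_compact_measurable_half_line[OF fS]]
      by (simp add: zero_ext_smooth_compact_0[OF f])
  qed
  show "\<exists>\<phi>. (\<forall>n::nat. \<phi> n \<in> smooth_compact_0) \<and> (\<lambda>n. H12_00_normsq (\<lambda>t. \<phi> n t - f t)) ---> 0" if f: "f \<in> H12_00_space"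
  proof -
    have fm: "f \<in> borel_measurable half_line" using f by (auto simp: H12_00_space_def)
    have "\<exists>\<phi>. \<phi> \<in> smooth_compact_0 \<and> H12_00_normsq (\<lambda>t. \<phi> t - f t) <= ennreal (2 * (1 / real (Suc n)))" for n
    proof -
      have n: "1 / real (Suc n) > 0" by simp
      obtain \<phi> where \<phi>: "\<phi> \<in> smooth_compact" "sqnorm lborel (\<lambda>t. \<phi> t - zero_ext f t) <= ennreal (1 / real (Suc n))"
        "sqnorm plane (dquot (\<lambda>t. \<phi> t - zero_ext f t)) <= ennreal (1 / real (Suc n))"
        "(\<forall>t\<le>0. zero_ext f t = 0) \<longrightarrow> \<phi> \<in> smooth_compact_0"
        by (rule half_sob_smooth_approx[OF zero_ext_half_sob[OF f] n])
      have \<phi>0: "\<phi> \<in> smooth_compact_0" using \<phi>(4) by (simp add: zero_ext_simps)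
      have m: "(\<lambda>t. \<phi> t - f t) \<in> borel_measurable half_line"
        using smooth_compact_measurable_half_line[OF \<phi>(1)] fm by measurable
      have z: "zero_ext (\<lambda>t. \<phi> t - f t) = (\<lambda>t. \<phi> t - zero_ext f t)"
      proof
        fix t show "zero_ext (\<lambda>t. \<phi> t - f t) t = \<phi> t - zero_ext f t"
          using fun_cong[OF zero_ext_smooth_compact_0[OF \<phi>0], of t] by (simp add: zero_ext_def scaleR_diff_right)
      qed
      have "H12_00_normsq (\<lambda>t. \<phi> t - f t) <= ennreal (1 / real (Suc n)) + ennreal (1 / real (Suc n))"
        using H12_00_zero_ext(1)[OF m] \<phi>(2,3) unfolding z by (meson add_mono order_trans)
      also have "... = ennreal (2 * (1 / real (Suc n)))" by (subst ennreal_plus[symmetric]) auto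
      finally show ?thesis using \<phi>0 by blast
    qed
    then obtain \<phi> where \<phi>: "\<And>n. \<phi> n \<in> smooth_compact_0" "\<And>n. H12_00_normsq (\<lambda>t. \<phi> n t - f t) <= ennreal (2 * (1 / real (Suc n)))" by metis
    have "(\<lambda>n. 2 * (1 / real (Suc n))) ---> 2 * 0"
      using LIMSEQ_inverse_real_of_nat by (intro tendsto_mult tendsto_const) (simp add: inverse_eq_divide)
    then have "(\<lambda>n. ennreal (2 * (1 / real (Suc n)))) ---> 0" using tendsto_ennrealI by fastforce
    from tendsto_0_le_ennreal[OF this \<phi>(2)] \<phi>(1) show ?thesis by blast
  qed
qed

text \<open>Density uses the even extension, which creates no jump at 0 and so keeps the seminorm
  finite. The constant 4 counts the quadrants.\<close>

interpretation Dm: L2_ext "smooth_compact :: (real => 'h::{real_inner,banach,second_countable_topology}) set" H12_space H12_normsq smooth_D_minus 4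
proof
  fix f g :: "real => 'h" and a b t :: real
  show "f \<in> borel_measurable half_line" if "f \<in> smooth_compact"
    using that by (rule smooth_compact_measurable_half_line)
  show "f \<in> borel_measurable half_line" if "f \<in> H12_space" using that by (simp add: H12_space_def)
  show "(\<lambda>t. a *\<^sub>R f t + b *\<^sub>R g t) \<in> smooth_compact" if "f \<in> smooth_compact" "g \<in> smooth_compact"
    using that by (rule smooth_compact_lincomb)
  show "(\<lambda>t. a *\<^sub>R f t + b *\<^sub>R g t) \<in> H12_space" if "f \<in> H12_space" "g \<in> H12_space"
    using H12_normsq_lincomb[of f g a b] that
    by (auto simp: H12_space_def ennreal_mult_less_top intro: le_less_trans)
  show "smooth_D_minus (\<lambda>t. a *\<^sub>R f t + b *\<^sub>R g t) t = a *\<^sub>R smooth_D_minus f t + b *\<^sub>R smooth_D_minus g t"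
    if "f \<in> smooth_compact" "g \<in> smooth_compact" using that by (rule smooth_D_minus_lincomb)
  show "smooth_D_minus f \<in> borel_measurable half_line" if "f \<in> smooth_compact"
    by (intro measurable_half_lineI smooth_D_minus_bound that)
  show "H12_normsq (\<lambda>t. a *\<^sub>R f t + b *\<^sub>R g t) <= ennreal (2 * a\<^sup>2) * H12_normsq f + ennreal (2 * b\<^sup>2) * H12_normsq g"
    if "f \<in> borel_measurable half_line" "g \<in> borel_measurable half_line" using that by (rule H12_normsq_lincomb)
  show "H12_normsq f < \<infinity>" if f: "f \<in> smooth_compact"
  proof -
    have "H12_normsq f <= sqnorm lborel f + sqnorm plane (dquot f)"
      by (rule H12_restrict[OF smooth_compact_measurable[OF f]])
    also have "... < \<infinity>" using smooth_compact_half_sob[OF f] by (simp add: half_sob_def sq_integrable_def)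
    finally show ?thesis .
  qed
  show "sqnorm half_line (smooth_D_minus f) <= ennreal 4 * H12_normsq f" if f: "f \<in> smooth_compact"
  proof -
    have fm: "f \<in> borel_measurable half_line" by (rule smooth_compact_measurable_half_line[OF f])
    have am: "(\<lambda>t. f \<bar>t\<bar>) \<in> borel_measurable borel" using smooth_compact_measurable[OF f] by measurable
    have "sqnorm half_line (smooth_D_minus f) <= 4 * sqnorm half_plane (dquot f)"
      by (rule order_trans[OF smooth_D_minus_bound(1)[OF f] sqnorm_dquot_even(2)[OF am fm]])
    also have "... <= 4 * H12_normsq f"
      unfolding H12_normsq_eq[OF fm] by (intro mult_left_mono) (auto simp: add_increasing)
    finally show ?thesis by simp
  qed
  show "\<exists>\<phi>. (\<forall>n::nat. \<phi> n \<in> smooth_compact) \<and> (\<lambda>n. H12_normsq (\<lambda>t. \<phi> n t - f t)) ---> 0" if f: "f \<in> H12_space"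
  proof -
    have fm: "f \<in> borel_measurable half_line" and fin: "H12_normsq f < \<infinity>" using f by (auto simp: H12_space_def)
    let ?U = "\<lambda>t. zero_ext f \<bar>t\<bar>"
    have Um: "?U \<in> borel_measurable borel" by (rule even_ext_measurable[OF fm])
    have zm: "zero_ext f \<in> borel_measurable half_line" by (intro measurable_half_lineI zero_ext_measurable fm)
    have s1: "sqnorm half_line (zero_ext f) = sqnorm half_line f" by (rule sqnorm_cong) (simp add: zero_ext_simps)
    have s2: "sqnorm half_plane (dquot (zero_ext f)) = sqnorm half_plane (dquot f)"
      by (rule sqnorm_cong) (auto simp: space_pair_measure dquot_def zero_ext_simps)
    have U: "half_sob ?U"
      using sqnorm_dquot_even[OF Um zm] fin Um unfolding s1 s2 H12_normsq_eq[OF fm]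
      by (auto simp: half_sob_def sq_integrable_def ennreal_mult_less_top intro: borel_measurable_dquot_lborel le_less_trans)
    have "\<exists>\<phi>. \<phi> \<in> smooth_compact \<and> H12_normsq (\<lambda>t. \<phi> t - f t) <= ennreal (2 * (1 / real (Suc n)))" for n
    proof -
      have n: "1 / real (Suc n) > 0" by simp
      obtain \<phi> where \<phi>: "\<phi> \<in> smooth_compact" "sqnorm lborel (\<lambda>t. \<phi> t - ?U t) <= ennreal (1 / real (Suc n))"
        "sqnorm plane (dquot (\<lambda>t. \<phi> t - ?U t)) <= ennreal (1 / real (Suc n))"
        by (rule half_sob_smooth_approx[OF U n])
      have m: "(\<lambda>t. \<phi> t - ?U t) \<in> borel_measurable borel" using smooth_compact_measurable[OF \<phi>(1)] Um by measurable
      have m': "(\<lambda>t. \<phi> t - f t) \<in> borel_measurable half_line"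
        using smooth_compact_measurable_half_line[OF \<phi>(1)] fm by measurable
      have "H12_normsq (\<lambda>t. \<phi> t - f t) = H12_normsq (\<lambda>t. \<phi> t - ?U t)"
        unfolding H12_normsq_eq[OF m'] H12_normsq_eq[OF measurable_half_lineI[OF m]]
        by (intro arg_cong2[where f = "(+)"] sqnorm_cong) (auto simp: space_pair_measure dquot_def zero_ext_simps)
      also have "... <= ennreal (1 / real (Suc n)) + ennreal (1 / real (Suc n))"
        using H12_restrict[OF m] \<phi>(2,3) by (meson add_mono order_trans)
      also have "... = ennreal (2 * (1 / real (Suc n)))" by (subst ennreal_plus[symmetric]) auto
      finally show ?thesis using \<phi>(1) by blast
    qed
    then obtain \<phi> where \<phi>: "\<And>n. \<phi> n \<in> smooth_compact" "\<And>n. H12_normsq (\<lambda>t. \<phi> n t - f t) <= ennreal (2 * (1 / real (Suc n)))" by metis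
    have "(\<lambda>n. 2 * (1 / real (Suc n))) ---> 2 * 0"
      using LIMSEQ_inverse_real_of_nat by (intro tendsto_mult tendsto_const) (simp add: inverse_eq_divide)
    then have "(\<lambda>n. ennreal (2 * (1 / real (Suc n)))) ---> 0" using tendsto_ennrealI by fastforce
    from tendsto_0_le_ennreal[OF this \<phi>(2)] \<phi>(1) show ?thesis by blast
  qed
qed

subsection \<open>The time form\<close>

definition time_form :: "(real => 'h::{real_inner,banach,second_countable_topology}) => (real => 'h) => real" where
  "time_form u v = (LINT t|half_line. D_plus u t \<bullet> D_minus v t)"

lemma H12_00_normsq_norm: "u \<in> H12_00_space ==> H12_00_normsq u = ennreal ((H12_00_norm u)\<^sup>2)"
  by (simp add: H12_00_space_def H12_00_norm_def)

lemma H12_normsq_norm: "u \<in> H12_space ==> H12_normsq u = ennreal ((H12_norm u)\<^sup>2)"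
  by (simp add: H12_space_def H12_norm_def)

lemma H12_00_subset:
  fixes u :: "real => 'h::{real_normed_vector,second_countable_topology}"
  shows "u \<in> H12_00_space ==> u \<in> H12_space"
  using H12_00_zero_ext(3)[of u] by (auto simp: H12_00_space_def H12_space_def intro: le_less_trans)

lemma l2norm_leI:
  assumes "sqnorm M f <= ennreal (c\<^sup>2)" "c >= 0"
  shows "l2norm M f <= c"
proof -
  have "enn2real (sqnorm M f) <= c\<^sup>2" using enn2real_mono[OF assms(1)] by simp
  then show ?thesis unfolding l2norm_def using assms(2) real_le_lsqrt by fastforce
qed

lemma D_plus_l2norm:
  fixes u :: "real => 'h::{real_inner,banach,second_countable_topology}"
  assumes u: "u \<in> H12_00_space"
  shows "sq_integrable half_line (D_plus u)" "l2norm half_line (D_plus u) <= 3 * H12_00_norm u"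
proof -
  show "sq_integrable half_line (D_plus u)" using Dp.ext_spec(1)[OF u] by (simp add: D_plus_def)
  have "sqnorm half_line (D_plus u) <= ennreal 8 * ennreal ((H12_00_norm u)\<^sup>2)"
    using Dp.ext_bound[OF u] by (simp add: D_plus_def H12_00_normsq_norm[OF u])
  \<comment> \<open>The bound 8, four times the constant 2 of the smooth case, is rounded up to the
    square 9.\<close>
  also have "... <= ennreal ((3 * H12_00_norm u)\<^sup>2)"
    by (subst ennreal_mult[symmetric]) (auto simp: power_mult_distrib intro!: ennreal_leI mult_right_mono)
  finally show "l2norm half_line (D_plus u) <= 3 * H12_00_norm u"
    by (rule l2norm_leI) (simp add: H12_00_norm_def)
qed

lemma D_minus_l2norm:
  fixes u :: "real => 'h::{real_inner,banach,second_countable_topology}"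
  assumes u: "u \<in> H12_space"
  shows "sq_integrable half_line (D_minus u)" "l2norm half_line (D_minus u) <= 4 * H12_norm u"
proof -
  show "sq_integrable half_line (D_minus u)" using Dm.ext_spec(1)[OF u] by (simp add: D_minus_def)
  have "sqnorm half_line (D_minus u) <= ennreal 16 * ennreal ((H12_norm u)\<^sup>2)"
    using Dm.ext_bound[OF u] by (simp add: D_minus_def H12_normsq_norm[OF u])
  also have "... = ennreal ((4 * H12_norm u)\<^sup>2)"
    by (subst ennreal_mult[symmetric]) (auto simp: power_mult_distrib)
  finally show "l2norm half_line (D_minus u) <= 4 * H12_norm u"
    by (rule l2norm_leI) (simp add: H12_norm_def)
qed

lemma time_form_bound:
  fixes u v :: "real => 'h::{real_inner,banach,second_countable_topology}"
  assumes u: "u \<in> H12_00_space" and v: "v \<in> H12_space"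
  shows "integrable half_line (\<lambda>t. D_plus u t \<bullet> D_minus v t)"
    and "\<bar>time_form u v\<bar> <= 12 * H12_00_norm u * H12_norm v"
proof -
  note p = D_plus_l2norm[OF u] and m = D_minus_l2norm[OF v]
  show "integrable half_line (\<lambda>t. D_plus u t \<bullet> D_minus v t)" by (rule integrable_inner(1)[OF p(1) m(1)])
  have "\<bar>time_form u v\<bar> <= l2norm half_line (D_plus u) * l2norm half_line (D_minus v)"
    unfolding time_form_def by (rule integrable_inner(2)[OF p(1) m(1)])
  also have "... <= (3 * H12_00_norm u) * (4 * H12_norm v)"
    by (intro mult_mono p m) (auto simp: H12_00_norm_def)
  finally show "\<bar>time_form u v\<bar> <= 12 * H12_00_norm u * H12_norm v" by simp
qed

lemma time_form_lincomb_left: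
  fixes u u' v :: "real => 'h::{real_inner,banach,second_countable_topology}"
  assumes u: "u \<in> H12_00_space" and u': "u' \<in> H12_00_space" and v: "v \<in> H12_space"
  shows "time_form (\<lambda>t. a *\<^sub>R u t + b *\<^sub>R u' t) v = a * time_form u v + b * time_form u' v"
proof -
  note [measurable] = Dp.ext_measurable[OF u] Dp.ext_measurable[OF u'] Dp.ext_measurable[OF Dp.K_lin[OF u u', of a b]] Dm.ext_measurable[OF v]
  have "time_form (\<lambda>t. a *\<^sub>R u t + b *\<^sub>R u' t) v = (LINT t|half_line. a * (D_plus u t \<bullet> D_minus v t) + b * (D_plus u' t \<bullet> D_minus v t))"
    unfolding time_form_def D_plus_def D_minus_def
  proof (rule integral_cong_AE)
    show "AE t in half_line. Dp.ext (\<lambda>t. a *\<^sub>R u t + b *\<^sub>R u' t) t \<bullet> Dm.ext v t = a * (Dp.ext u t \<bullet> Dm.ext v t) + b * (Dp.ext u' t \<bullet> Dm.ext v t)"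
      using Dp.ext_lin[OF u u', of a b] by eventually_elim (simp add: inner_add_left)
  qed measurable
  then show ?thesis
    using time_form_bound(1)[OF u v] time_form_bound(1)[OF u' v] by (simp add: time_form_def)
qed

lemma time_form_lincomb_right:
  fixes u v v' :: "real => 'h::{real_inner,banach,second_countable_topology}"
  assumes u: "u \<in> H12_00_space" and v: "v \<in> H12_space" and v': "v' \<in> H12_space"
  shows "time_form u (\<lambda>t. a *\<^sub>R v t + b *\<^sub>R v' t) = a * time_form u v + b * time_form u v'"
proof -
  note [measurable] = Dp.ext_measurable[OF u] Dm.ext_measurable[OF v] Dm.ext_measurable[OF v'] Dm.ext_measurable[OF Dm.K_lin[OF v v', of a b]]
  have "time_form u (\<lambda>t. a *\<^sub>R v t + b *\<^sub>R v' t) = (LINT t|half_line. a * (D_plus u t \<bullet> D_minus v t) + b * (D_plus u t \<bullet> D_minus v' t))"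
    unfolding time_form_def D_plus_def D_minus_def
  proof (rule integral_cong_AE)
    show "AE t in half_line. Dp.ext u t \<bullet> Dm.ext (\<lambda>t. a *\<^sub>R v t + b *\<^sub>R v' t) t = a * (Dp.ext u t \<bullet> Dm.ext v t) + b * (Dp.ext u t \<bullet> Dm.ext v' t)"
      using Dm.ext_lin[OF v v', of a b] by eventually_elim (simp add: inner_add_right)
  qed measurable
  then show ?thesis
    using time_form_bound(1)[OF u v] time_form_bound(1)[OF u v'] by (simp add: time_form_def)
qed

lemma smooth_compact_0_H12_00:
  fixes f :: "real => 'h::{real_inner,banach,second_countable_topology}"
  assumes "f \<in> smooth_compact_0"
  shows "f \<in> H12_00_space"
  using Dp.S_fin[OF assms] Dp.S_meas[OF assms] by (simp add: H12_00_space_def)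

lemma time_form_limit:
  fixes u v :: "real => 'h::{real_inner,banach,second_countable_topology}"
  assumes u: "u \<in> H12_00_space" and v: "v \<in> H12_space"
    and \<phi>: "\<And>n::nat. \<phi> n \<in> smooth_compact_0" "(\<lambda>n. H12_00_normsq (\<lambda>t. \<phi> n t - u t)) ---> 0"
    and \<psi>: "\<And>n::nat. \<psi> n \<in> smooth_compact" "(\<lambda>n. H12_normsq (\<lambda>t. \<psi> n t - v t)) ---> 0"
    and \<phi>': "\<And>n t. (\<phi> n has_vector_derivative \<phi>' n t) (at t)"
  shows "(\<lambda>n. LINT t|lborel. \<phi>' n t \<bullet> \<psi> n t) ---> time_form u v"
proof -
  have "(\<lambda>n. LINT t|half_line. smooth_D_plus (\<phi> n) t \<bullet> smooth_D_minus (\<psi> n) t) ---> time_form u v"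
    unfolding time_form_def
    by (rule inner_integral_tendsto)
       (use \<phi> \<psi> u v Dp.T_sq_integrable Dm.T_sq_integrable D_plus_l2norm(1) D_minus_l2norm(1)
         Dp.ext_limit[OF u \<phi>] Dm.ext_limit[OF v \<psi>] in \<open>auto simp: D_plus_def D_minus_def\<close>)
  then show ?thesis unfolding smooth_D_pairing[OF \<phi>(1) \<phi>' \<psi>(1)] .
qed

lemma smooth_compact_0_deriv_0:
  fixes f :: "real => 'h::real_normed_vector"
  assumes "f \<in> smooth_compact_0" "\<And>t. (f has_vector_derivative f' t) (at t)" "t <= 0"
  shows "f' t = 0"
  by (rule has_vector_derivative_0_outside_support[OF assms(2)])
     (use assms(1,3) in \<open>auto simp: smooth_compact_0_def\<close>)

text \<open>With a smooth first argument the constant sequence approximates it, and the full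
  derivative lands on it. Both uses of the form rely on this: the energy of the conjugate function
  and the equation satisfied by an annihilating v.\<close>

lemma time_form_smooth:
  fixes v :: "real => 'h::{real_inner,banach,second_countable_topology}"
  assumes f: "f \<in> smooth_compact_0" and f': "\<And>t. (f has_vector_derivative f' t) (at t)" and v: "v \<in> H12_space"
  shows "time_form f v = (LINT t|half_line. f' t \<bullet> v t)"
proof -
  have fS: "f \<in> smooth_compact" using f by (simp add: smooth_compact_0_def)
  obtain R B where "compact_primitive f f' {} R B" and f'S: "f' \<in> smooth_compact" using smooth_compact_primitive[OF fS f'] by metis
  obtain \<psi> where \<psi>: "\<And>n::nat. \<psi> n \<in> smooth_compact" "(\<lambda>n. H12_normsq (\<lambda>t. \<psi> n t - v t)) ---> 0"
    using Dm.dense[OF v] by auto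
  have vm: "v \<in> borel_measurable half_line" by (rule Dm.K_meas[OF v])
  have "(\<lambda>n. H12_00_normsq (\<lambda>t. f t - f t)) ---> 0"
    using Dp.N_lin[of f f 0 0] Dp.S_meas[OF f] by simp
  then have l1: "(\<lambda>n. LINT t|lborel. f' t \<bullet> \<psi> n t) ---> time_form f v"
    using time_form_limit[OF smooth_compact_0_H12_00[OF f] v f _ \<psi> f'] by blast
  have eq: "(LINT t|lborel. f' t \<bullet> g t) = (LINT t|half_line. f' t \<bullet> g t)" for g
    unfolding integral_half_line
    by (intro Bochner_Integration.integral_cong) (auto simp: indicator_def smooth_compact_0_deriv_0[OF f f'])
  have sq: "sq_integrable half_line f'" "sq_integrable half_line (\<psi> n)" for n
  proof -
    have *: "sq_integrable half_line g" if "g \<in> smooth_compact" for g :: "real => 'h"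
      using smooth_compact_half_sob[OF that] sqnorm_half_line_le[of g] smooth_compact_measurable_half_line[OF that]
      by (auto simp: half_sob_def sq_integrable_def intro: le_less_trans)
    show "sq_integrable half_line f'" "sq_integrable half_line (\<psi> n)" using * f'S \<psi>(1) by auto
  qed
  have sqv: "sq_integrable half_line v"
    using v vm H12_normsq_eq[OF vm] by (auto simp: H12_space_def sq_integrable_def)
  have "(\<lambda>n. sqnorm half_line (\<lambda>t. \<psi> n t - v t)) ---> 0"
  proof (rule tendsto_0_le_ennreal[OF \<psi>(2)])
    fix n
    have "(\<lambda>t. \<psi> n t - v t) \<in> borel_measurable half_line" using Dm.S_meas[OF \<psi>(1)] vm by measurable
    then show "sqnorm half_line (\<lambda>t. \<psi> n t - v t) <= H12_normsq (\<lambda>t. \<psi> n t - v t)"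
      by (simp add: H12_normsq_eq add_increasing2)
  qed
  then have "(\<lambda>n. LINT t|half_line. f' t \<bullet> \<psi> n t) ---> (LINT t|half_line. f' t \<bullet> v t)"
    by (intro inner_integral_tendsto sq sqv) auto
  with l1 show ?thesis unfolding eq using LIMSEQ_unique by blast
qed

text \<open>The squared norm is itself a compactly supported primitive, of twice the integrand, so
  its derivative has mean zero.\<close>

lemma smooth_compact_inner_deriv:
  fixes f :: "real => 'h::{real_inner,banach,second_countable_topology}"
  assumes f: "f \<in> smooth_compact" and f': "\<And>t. (f has_vector_derivative f' t) (at t)"
  shows "(LINT t|lborel. f' t \<bullet> f t) = 0"
proof -
  obtain R B where "compact_primitive f f' {} R B" using smooth_compact_primitive[OF f f'] by metis
  then interpret compact_primitive f f' "{}" R B .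
  have B0: "B >= 0" using order_trans[OF norm_ge_zero bound(1)[of 0]] .
  have bb: "\<bar>x \<bullet> y\<bar> <= B * B" if "norm x <= B" "norm y <= B" for x y :: 'h
    using Cauchy_Schwarz_ineq2[of x y] mult_mono[OF that B0 norm_ge_zero] by linarith
  interpret N: compact_primitive "\<lambda>t. f t \<bullet> f t" "\<lambda>t. 2 * (f' t \<bullet> f t)" "{}" R "2 * (B * B)"
  proof
    show "continuous_on UNIV (\<lambda>t. f t \<bullet> f t)" by (intro continuous_intros cont)
    show "((\<lambda>t. f t \<bullet> f t) has_vector_derivative 2 * (f' t \<bullet> f t)) (at t)" for t
      using bounded_bilinear.has_vector_derivative[OF bounded_bilinear_inner f' f', of t] by (simp add: inner_commute)
    show "norm (f t \<bullet> f t) <= 2 * (B * B)" "norm (2 * (f' t \<bullet> f t)) <= 2 * (B * B)" for t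
      using bb[OF bound(1) bound(1), of t t] bb[OF bound(2) bound(1), of t t] B0 by (auto simp: abs_mult)
  qed (use supp R in auto)
  show ?thesis using N.integral_deriv_0 by simp
qed

text \<open>One sequence can be used in both slots, because convergence in the stronger norm implies
  convergence in the weaker one; for each member the form is the integral of an exact
  derivative.\<close>

lemma time_form_self:
  fixes u :: "real => 'h::{real_inner,banach,second_countable_topology}"
  assumes u: "u \<in> H12_00_space"
  shows "time_form u u = 0"
proof -
  obtain \<phi> where \<phi>: "\<And>n::nat. \<phi> n \<in> smooth_compact_0" "(\<lambda>n. H12_00_normsq (\<lambda>t. \<phi> n t - u t)) ---> 0"
    using Dp.dense[OF u] by auto
  have \<phi>S: "\<phi> n \<in> smooth_compact" for n using \<phi>(1) by (simp add: smooth_compact_0_def)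
  have "\<forall>n. \<exists>f'. \<forall>t. (\<phi> n has_vector_derivative f' t) (at t)"
  proof
    fix n show "\<exists>f'. \<forall>t. (\<phi> n has_vector_derivative f' t) (at t)"
      by (rule smooth_compact_deriv[OF \<phi>S[of n]]) blast
  qed
  then obtain \<phi>' where \<phi>': "\<And>n t. (\<phi> n has_vector_derivative \<phi>' n t) (at t)" by metis
  have um: "u \<in> borel_measurable half_line" by (rule Dp.K_meas[OF u])
  have l: "(\<lambda>n. H12_normsq (\<lambda>t. \<phi> n t - u t)) ---> 0"
    by (rule tendsto_0_le_ennreal[OF \<phi>(2) H12_00_zero_ext(3)])
       (use Dp.S_meas[OF \<phi>(1)] um in measurable)
  from time_form_limit[OF u H12_00_subset[OF u] \<phi> \<phi>S l \<phi>']
  have "(\<lambda>n. 0) ---> time_form u u" unfolding smooth_compact_inner_deriv[OF \<phi>S \<phi>'] .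
  then show ?thesis using LIMSEQ_const_iff by metis
qed

lemma H12_00_norm_le_I:
  assumes "H12_00_normsq u <= ennreal (c\<^sup>2)" "c >= 0"
  shows "H12_00_norm u <= c"
proof -
  have "enn2real (H12_00_normsq u) <= c\<^sup>2" using enn2real_mono[OF assms(1)] by simp
  then show ?thesis unfolding H12_00_norm_def using assms(2) real_le_lsqrt by fastforce
qed

lemma H12_norm_le_I:
  assumes "H12_normsq u <= ennreal (c\<^sup>2)" "c >= 0"
  shows "H12_norm u <= c"
proof -
  have "enn2real (H12_normsq u) <= c\<^sup>2" using enn2real_mono[OF assms(1)] by simp
  then show ?thesis unfolding H12_norm_def using assms(2) real_le_lsqrt by fastforce
qed

lemma H12_norms_nonneg[simp]: "0 <= H12_norm u" "0 <= H12_00_norm u"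
  by (auto simp: H12_norm_def H12_00_norm_def)

text \<open>The L2 part costs one and the seminorm of the zero extension two copies of the squared
  norm; 3 is rounded up to the square of 2. Independence of eps allows eps to be chosen at the
  end.\<close>

lemma conj_op_H12:
  fixes u :: "real => 'h::{real_inner,banach,second_countable_topology}"
  assumes u: "u \<in> H12_00_space" and e: "eps > 0"
  shows "conj_op eps (zero_ext u) \<in> H12_space" "H12_norm (conj_op eps (zero_ext u)) <= 2 * H12_00_norm u"
proof -
  have um: "u \<in> borel_measurable half_line" using u by (simp add: H12_00_space_def)
  have U: "half_sob (zero_ext u)" by (rule zero_ext_half_sob[OF u])
  have U1: "sq_integrable lborel (zero_ext u)" using U by (simp add: half_sob_def)
  have Gm: "conj_op eps (zero_ext u) \<in> borel_measurable borel"
    by (rule conj_op_measurable) (rule zero_ext_measurable[OF um])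
  have "H12_normsq (conj_op eps (zero_ext u)) <= sqnorm lborel (conj_op eps (zero_ext u)) + sqnorm plane (dquot (conj_op eps (zero_ext u)))"
    by (rule H12_restrict[OF Gm])
  also have "... <= sqnorm lborel (zero_ext u) + sqnorm plane (dquot (zero_ext u))"
    by (intro add_mono conj_op_bound[OF e U1] conj_op_half_sob(2)[OF e U])
  also have "... <= H12_00_normsq u + 2 * H12_00_normsq u"
    unfolding sqnorm_zero_ext
    by (intro add_mono H12_00_zero_ext(2)[OF um]) (simp add: H12_00_normsq_eq[OF um] add.assoc add_increasing2)
  also have "... = 3 * ennreal ((H12_00_norm u)\<^sup>2)"
    unfolding H12_00_normsq_norm[OF u] using distrib_right[of 1 2 "ennreal ((H12_00_norm u)\<^sup>2)"] by simp
  also have "... <= ennreal ((2 * H12_00_norm u)\<^sup>2)"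
  proof -
    have "3 * ennreal ((H12_00_norm u)\<^sup>2) = ennreal (3 * (H12_00_norm u)\<^sup>2)" by (subst ennreal_mult') auto
    then show ?thesis by (simp only:) (intro ennreal_leI, simp add: power_mult_distrib)
  qed
  finally have le: "H12_normsq (conj_op eps (zero_ext u)) <= ennreal ((2 * H12_00_norm u)\<^sup>2)" .
  show "H12_norm (conj_op eps (zero_ext u)) <= 2 * H12_00_norm u" by (rule H12_norm_le_I[OF le]) simp
  show "conj_op eps (zero_ext u) \<in> H12_space"
    using le measurable_half_lineI[OF Gm] by (auto simp: H12_space_def intro: le_less_trans)
qed

text \<open>The energy limit is available only for smooth functions. The approximant is fixed first,
  with a replacement error uniform in eps, and eps is then chosen for that approximant; each of the
  three errors gets a third of \<eta>.\<close>

lemma time_form_conj: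
  fixes u :: "real => 'h::{real_inner,banach,second_countable_topology}"
  assumes u: "u \<in> H12_00_space" and \<eta>: "\<eta> > 0"
  obtains eps where "eps > 0" "time_form u (conj_op eps (zero_ext u)) >= (l2norm plane (dquot (zero_ext u)))\<^sup>2 / (2 * pi) - \<eta>"
proof -
  let ?M = plane
  obtain \<phi> where \<phi>: "\<And>n::nat. \<phi> n \<in> smooth_compact_0" and lim: "(\<lambda>n. H12_00_normsq (\<lambda>t. \<phi> n t - u t)) ---> 0"
    using Dp.dense[OF u] by auto
  have \<phi>S: "\<phi> n \<in> smooth_compact" for n using \<phi> by (simp add: smooth_compact_0_def)
  have \<phi>H: "\<phi> n \<in> H12_00_space" for n by (rule smooth_compact_0_H12_00[OF \<phi>])
  define w where "w n t = \<phi> n t - u t" for n t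
  have wH: "w n \<in> H12_00_space" for n
    using Dp.K_lin[OF \<phi>H[of n] u, of 1 "-1"] by (simp add: w_def[abs_def])
  define r where "r n = H12_00_norm (w n)" for n
  have r0: "r ---> 0"
  proof -
    have "(\<lambda>n. enn2real (H12_00_normsq (w n))) ---> 0"
      by (rule tendsto_enn2real) (use lim in \<open>auto simp: w_def[abs_def]\<close>)
    then have "(\<lambda>n. sqrt (enn2real (H12_00_normsq (w n)))) ---> sqrt 0" by (rule tendsto_real_sqrt)
    then show ?thesis by (simp add: r_def[abs_def] H12_00_norm_def)
  qed
  define b where "b = H12_00_norm u"
  have \<phi>b: "H12_00_norm (\<phi> n) <= 2 * (r n + b)" for n
  proof (rule H12_00_norm_le_I)
    have eq: "\<phi> n = (\<lambda>t. 1 *\<^sub>R w n t + 1 *\<^sub>R u t)" by (simp add: w_def)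
    have "H12_00_normsq (\<phi> n) <= 2 * H12_00_normsq (w n) + 2 * H12_00_normsq u"
      using Dp.N_lin[OF Dp.K_meas[OF wH[of n]] Dp.K_meas[OF u], of 1 1] unfolding eq[symmetric] by simp
    also have "... = ennreal (2 * (r n)\<^sup>2 + 2 * b\<^sup>2)"
      unfolding H12_00_normsq_norm[OF wH] H12_00_normsq_norm[OF u] r_def b_def
      by (simp add: ennreal_mult')
    also have "... <= ennreal ((2 * (r n + b))\<^sup>2)"
    proof (rule ennreal_leI)
      have "0 <= r n * b" by (simp add: r_def b_def)
      then show "2 * (r n)\<^sup>2 + 2 * b\<^sup>2 <= (2 * (r n + b))\<^sup>2"
        by (simp add: power_mult_distrib power2_sum)
    qed
    finally show "H12_00_normsq (\<phi> n) <= ennreal ((2 * (r n + b))\<^sup>2)" .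
  qed (simp add: r_def b_def)
  \<comment> \<open>Bounds the two errors of replacing u by its approximant: the difference w in the
    first slot against the conjugate of the approximant, and u against the conjugate of w. Here 12
    bounds the form, 2 the conjugate operator.\<close>
  define a where "a n = 12 * r n * (2 * (2 * (r n + b))) + 12 * b * (2 * r n)" for n
  have "(\<lambda>n. 12 * r n * (2 * (2 * (r n + b))) + 12 * b * (2 * r n)) ---> 12 * 0 * (2 * (2 * (0 + b))) + 12 * b * (2 * 0)"
    by (intro tendsto_intros r0)
  then have a0: "a ---> 0" by (simp add: a_def[abs_def])
  have zw: "zero_ext (w n) = (\<lambda>t. \<phi> n t - zero_ext u t)" for n
  proof
    fix t show "zero_ext (w n) t = \<phi> n t - zero_ext u t"
      using fun_cong[OF zero_ext_smooth_compact_0[OF \<phi>[of n]], of t] by (simp add: w_def zero_ext_def scaleR_diff_right)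
  qed
  have Us: "sq_integrable lborel (zero_ext u)" and Uq: "sq_integrable ?M (dquot (zero_ext u))"
    using zero_ext_half_sob[OF u] by (auto simp: half_sob_def)
  have \<phi>s: "sq_integrable lborel (\<phi> n)" and \<phi>q: "sq_integrable ?M (dquot (\<phi> n))" for n
    using smooth_compact_half_sob[OF \<phi>S] by (auto simp: half_sob_def)
  have diff: "\<bar>time_form (\<phi> n) (conj_op eps (\<phi> n)) - time_form u (conj_op eps (zero_ext u))\<bar> <= a n" if e: "eps > 0" for n eps
  proof -
    let ?G = "conj_op eps"
    have z\<phi>: "zero_ext (\<phi> n) = \<phi> n" by (rule zero_ext_smooth_compact_0[OF \<phi>])
    note g\<phi> = conj_op_H12[OF \<phi>H[of n] e, unfolded z\<phi>] and gu = conj_op_H12[OF u e] and gw = conj_op_H12[OF wH[of n] e]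
    have "?G (zero_ext (w n)) = (\<lambda>t. ?G (\<phi> n) t - ?G (zero_ext u) t)"
      unfolding zw using conj_op_diff[OF e \<phi>s Us] by auto
    then have eqG: "?G (\<phi> n) = (\<lambda>t. 1 *\<^sub>R ?G (zero_ext u) t + 1 *\<^sub>R ?G (zero_ext (w n)) t)" by auto
    have eq\<phi>: "\<phi> n = (\<lambda>t. 1 *\<^sub>R w n t + 1 *\<^sub>R u t)" by (simp add: w_def)
    have "time_form (\<phi> n) (?G (\<phi> n)) = time_form (w n) (?G (\<phi> n)) + time_form u (?G (\<phi> n))"
      using time_form_lincomb_left[OF wH[of n] u g\<phi>(1), of 1 1] unfolding eq\<phi>[symmetric] by simp
    also have "time_form u (?G (\<phi> n)) = time_form u (?G (zero_ext u)) + time_form u (?G (zero_ext (w n)))"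
      using time_form_lincomb_right[OF u gu(1) gw(1), of 1 1] unfolding eqG[symmetric] by simp
    finally have "\<bar>time_form (\<phi> n) (?G (\<phi> n)) - time_form u (?G (zero_ext u))\<bar> <= \<bar>time_form (w n) (?G (\<phi> n))\<bar> + \<bar>time_form u (?G (zero_ext (w n)))\<bar>" by simp
    also have "... <= 12 * r n * H12_norm (?G (\<phi> n)) + 12 * b * H12_norm (?G (zero_ext (w n)))"
      unfolding r_def b_def by (intro add_mono time_form_bound wH u g\<phi> gw)
    also have "... <= 12 * r n * (2 * (2 * (r n + b))) + 12 * b * (2 * r n)"
    proof (intro add_mono mult_left_mono)
      show "H12_norm (?G (\<phi> n)) <= 2 * (2 * (r n + b))" using g\<phi>(2) \<phi>b[of n] by linarith
      show "H12_norm (?G (zero_ext (w n))) <= 2 * r n" using gw(2) by (simp add: r_def)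
    qed (auto simp: r_def b_def)
    finally show ?thesis by (simp add: a_def)
  qed
  define E where "E n = (l2norm ?M (dquot (\<phi> n)))\<^sup>2" for n
  let ?E0 = "(l2norm ?M (dquot (zero_ext u)))\<^sup>2"
  have "E ---> ?E0"
  proof -
    have l: "(\<lambda>n. sqnorm ?M (\<lambda>x. dquot (\<phi> n) x - dquot (zero_ext u) x)) ---> 0"
    proof (rule tendsto_0_le_ennreal)
      show "(\<lambda>n. 2 * H12_00_normsq (w n) + 0 * H12_00_normsq (w n)) ---> 0"
        using lim by (intro tendsto_0_lincomb_ennreal) (auto simp: w_def[abs_def])
      show "sqnorm ?M (\<lambda>x. dquot (\<phi> n) x - dquot (zero_ext u) x) <= 2 * H12_00_normsq (w n) + 0 * H12_00_normsq (w n)" for n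
        using H12_00_zero_ext(2)[OF Dp.K_meas[OF wH[of n]]] by (simp add: zw dquot_diff)
    qed
    from inner_integral_tendsto[OF \<phi>q Uq \<phi>q Uq l l]
    show ?thesis using sq_integrable_integrable(2)[OF \<phi>q] sq_integrable_integrable(2)[OF Uq] by (simp add: E_def[abs_def] power2_norm_eq_inner)
  qed
  then have "(\<lambda>n. E n / (2 * pi)) ---> ?E0 / (2 * pi)" by (intro tendsto_intros) auto
  then have "\<forall>\<^sub>F n in sequentially. E n / (2 * pi) > ?E0 / (2 * pi) - \<eta> / 3"
    by (rule order_tendstoD) (use \<eta> in auto)
  moreover have "\<forall>\<^sub>F n in sequentially. a n < \<eta> / 3" by (rule order_tendstoD(2)[OF a0]) (use \<eta> in auto)
  ultimately have "\<forall>\<^sub>F n in sequentially. E n / (2 * pi) > ?E0 / (2 * pi) - \<eta> / 3 \<and> a n < \<eta> / 3" by (rule eventually_conj)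
  then obtain n where n: "E n / (2 * pi) > ?E0 / (2 * pi) - \<eta> / 3" "a n < \<eta> / 3" by (auto simp: eventually_sequentially)
  obtain f' where f': "\<And>t. (\<phi> n has_vector_derivative f' t) (at t)"
    by (rule smooth_compact_deriv[OF \<phi>S[of n]]) blast
  define \<delta> where "\<delta> k = 1 / real (Suc k)" for k
  have \<delta>: "\<delta> k > 0" "\<delta> ---> 0" for k
    using LIMSEQ_inverse_real_of_nat by (auto simp: \<delta>_def[abs_def] inverse_eq_divide)
  have tf: "time_form (\<phi> n) (conj_op eps (\<phi> n)) = (LINT s|lborel. f' s \<bullet> conj_op eps (\<phi> n) s)" if e: "eps > 0" for eps
  proof -
    have "time_form (\<phi> n) (conj_op eps (\<phi> n)) = (LINT t|half_line. f' t \<bullet> conj_op eps (\<phi> n) t)"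
      using conj_op_H12(1)[OF \<phi>H[of n] e] by (intro time_form_smooth[OF \<phi> f']) (simp add: zero_ext_smooth_compact_0[OF \<phi>])
    also have "... = (LINT s|lborel. f' s \<bullet> conj_op eps (\<phi> n) s)"
      unfolding integral_half_line
      by (intro Bochner_Integration.integral_cong) (auto simp: indicator_def smooth_compact_0_deriv_0[OF \<phi> f'])
    finally show ?thesis .
  qed
  have "(\<lambda>k. LINT s|lborel. f' s \<bullet> conj_op (\<delta> k) (\<phi> n) s) ---> E n / (2 * pi)"
    unfolding E_def by (rule conj_op_energy[OF \<phi>S f' \<delta>])
  then have "\<forall>\<^sub>F k in sequentially. (LINT s|lborel. f' s \<bullet> conj_op (\<delta> k) (\<phi> n) s) > E n / (2 * pi) - \<eta> / 3"
    by (rule order_tendstoD) (use \<eta> in auto)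
  then obtain k where k: "(LINT s|lborel. f' s \<bullet> conj_op (\<delta> k) (\<phi> n) s) > E n / (2 * pi) - \<eta> / 3" by (auto simp: eventually_sequentially)
  have "time_form u (conj_op (\<delta> k) (zero_ext u)) >= ?E0 / (2 * pi) - \<eta>"
    using diff[OF \<delta>(1)[of k], of n] k n unfolding tf[OF \<delta>(1)[of k]] by linarith
  then show thesis by (rule that[OF \<delta>(1)])
qed

subsection \<open>Riesz representation in complete semi-inner product spaces of functions\<close>

lemma nonneg_quadratic_linear_term_0:
  fixes b c :: real
  assumes "\<And>t. 0 <= t\<^sup>2 * c + 2 * t * b"
  shows "b = 0"
proof (rule ccontr)
  assume b: "b \<noteq> 0"
  define t where "t = - b / (\<bar>c\<bar> + 1)"
  have p: "\<bar>c\<bar> + 1 > 0" by simp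
  have "t\<^sup>2 * c <= t\<^sup>2 * (\<bar>c\<bar> + 1)" by (intro mult_left_mono) auto
  also have "... = b\<^sup>2 / (\<bar>c\<bar> + 1)" using p by (simp add: t_def power_divide power2_eq_square)
  finally have "0 <= b\<^sup>2 / (\<bar>c\<bar> + 1) + 2 * t * b" using assms[of t] by linarith
  also have "2 * t * b = - 2 * (b\<^sup>2 / (\<bar>c\<bar> + 1))" unfolding t_def by (simp add: power2_eq_square)
  finally have "b\<^sup>2 / (\<bar>c\<bar> + 1) <= 0" by linarith
  moreover have "b\<^sup>2 / (\<bar>c\<bar> + 1) > 0" using b p by (intro divide_pos_pos) auto
  ultimately show False by linarith
qed

text \<open>Elements are functions, not classes, so \<open>ip\<close> is only semi-definite and
  limits are determined up to null functions. Completeness is accordingly stated in the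
  seminorm.\<close>

locale semi_hilbert =
  fixes S :: "('i => 'v::real_vector) set" and ip :: "('i => 'v) => ('i => 'v) => real"
  assumes zero_in: "(\<lambda>t. 0) \<in> S"
    and lin_in: "\<And>u v a b. u \<in> S ==> v \<in> S ==> (\<lambda>t. a *\<^sub>R u t + b *\<^sub>R v t) \<in> S"
    and ip_sym: "\<And>u v. u \<in> S ==> v \<in> S ==> ip u v = ip v u"
    and ip_lin: "\<And>u u' v a b. u \<in> S ==> u' \<in> S ==> v \<in> S ==> ip (\<lambda>t. a *\<^sub>R u t + b *\<^sub>R u' t) v = a * ip u v + b * ip u' v"
    and ip_nonneg: "\<And>u. u \<in> S ==> 0 <= ip u u"
    and complete: "\<And>f. (\<And>n::nat. f n \<in> S) ==>
        (\<And>e. e > 0 ==> \<exists>M. \<forall>m\<ge>M. \<forall>n\<ge>M. ip (\<lambda>t. f m t - f n t) (\<lambda>t. f m t - f n t) < e) ==>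
        \<exists>g\<in>S. (\<lambda>n. ip (\<lambda>t. f n t - g t) (\<lambda>t. f n t - g t)) ---> 0"
begin

lemma ip_lin_right: "u \<in> S ==> u' \<in> S ==> v \<in> S ==> ip v (\<lambda>t. a *\<^sub>R u t + b *\<^sub>R u' t) = a * ip v u + b * ip v u'"
  using ip_lin[of u u' v a b] ip_sym[of v] lin_in[of u u'] by simp

lemma diff_in: "u \<in> S ==> v \<in> S ==> (\<lambda>t. u t - v t) \<in> S"
  using lin_in[of u v 1 "-1"] by simp

lemma ip_diff: "u \<in> S ==> u' \<in> S ==> v \<in> S ==> ip (\<lambda>t. u t - u' t) v = ip u v - ip u' v"
  using ip_lin[of u u' v 1 "-1"] by simp

lemma ip_expand:
  assumes "u \<in> S" "v \<in> S"
  shows "ip (\<lambda>t. a *\<^sub>R u t + b *\<^sub>R v t) (\<lambda>t. a *\<^sub>R u t + b *\<^sub>R v t) = a\<^sup>2 * ip u u + 2 * (a * b) * ip u v + b\<^sup>2 * ip v v"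
  using assms by (simp add: ip_lin ip_lin_right lin_in ip_sym[of v u] power2_eq_square algebra_simps)

lemma ip_Cauchy_Schwarz:
  assumes u: "u \<in> S" and v: "v \<in> S"
  shows "\<bar>ip u v\<bar> <= sqrt (ip u u) * sqrt (ip v v)"
proof -
  have q: "0 <= a\<^sup>2 * ip u u + 2 * (a * b) * ip u v + b\<^sup>2 * ip v v" for a b
    using ip_nonneg[OF lin_in[OF u v, of a b]] ip_expand[OF u v, of a b] by simp
  have "(ip u v)\<^sup>2 <= ip u u * ip v v"
  proof (cases "ip v v = 0")
    case True
    have "ip u v = 0"
    proof (rule nonneg_quadratic_linear_term_0[where c = "0"], rule ccontr)
      fix t :: real assume n: "\<not> 0 <= t\<^sup>2 * 0 + 2 * t * ip u v"
      \<comment> \<open>With \<open>ip v v = 0\<close> the quadratic form is affine in the second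
        coefficient. This k makes its linear part \<open>- (ip u u + 1)\<close>, so that the form
        takes the value -1.\<close>
      define k where "k = (ip u u + 1) / (- (2 * t * ip u v))"
      have neg: "2 * t * ip u v < 0" using n by simp
      have "X / (- Y) * Y = - X" if "Y < 0" for X Y :: real using that by simp
      from this[OF neg] have "k * (2 * t * ip u v) = - (ip u u + 1)" unfolding k_def .
      then have "2 * (k * t) * ip u v = - (ip u u + 1)" by (simp add: mult_ac)
      then show False using q[of 1 "k * t"] True by simp
    qed
    then show ?thesis using True by simp
  next
    case False
    then have p: "ip v v > 0" using ip_nonneg[OF v] by simp
    have "0 <= (ip v v)\<^sup>2 * ip u u + 2 * (ip v v * (- ip u v)) * ip u v + (- ip u v)\<^sup>2 * ip v v" by (rule q)
    also have "... = ip v v * (ip u u * ip v v - (ip u v)\<^sup>2)" by (simp add: power2_eq_square algebra_simps)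
    finally show ?thesis using p by (simp add: zero_le_mult_iff)
  qed
  then have "sqrt ((ip u v)\<^sup>2) <= sqrt (ip u u * ip v v)" by (rule real_sqrt_le_mono)
  then show ?thesis by (simp add: real_sqrt_mult)
qed

text \<open>The direct method: the quadratic functional J is bounded below, the parallelogram law
  makes a minimising sequence Cauchy, and the vanishing first variation at its limit is the
  representation.\<close>

theorem Riesz:
  assumes F_lin: "\<And>u v a b. u \<in> S ==> v \<in> S ==> F (\<lambda>t. a *\<^sub>R u t + b *\<^sub>R v t) = a * F u + b * F v"
    and F_bound: "\<And>u. u \<in> S ==> \<bar>F u\<bar> <= K * sqrt (ip u u)"
  shows "\<exists>r\<in>S. \<forall>v\<in>S. ip r v = F v"
proof -
  define J where "J u = ip u u - 2 * F u" for u
  have J_lb: "J u >= - K\<^sup>2" if u: "u \<in> S" for u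
  proof -
    have "0 <= (sqrt (ip u u) - K)\<^sup>2" by simp
    also have "... = ip u u - 2 * (K * sqrt (ip u u)) + K\<^sup>2" using ip_nonneg[OF u] by (simp add: power2_diff)
    finally show ?thesis using F_bound[OF u] by (simp add: J_def)
  qed
  define m where "m = (INF u\<in>S. J u)"
  have bdd: "bdd_below (J ` S)" using J_lb by (intro bdd_belowI2)
  have m_le: "m <= J u" if "u \<in> S" for u unfolding m_def by (rule cINF_lower[OF bdd that])
  have "\<exists>u\<in>S. J u < m + 1 / real (Suc n)" for n
  proof -
    have "(INF u\<in>S. J u) < m + 1 / real (Suc n)" by (simp add: m_def)
    then show ?thesis using cINF_less_iff[OF _ bdd] zero_in by blast
  qed
  then obtain f where f: "\<And>n. f n \<in> S" "\<And>n. J (f n) < m + 1 / real (Suc n)" by metis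
  have par: "ip (\<lambda>t. f k t - f n t) (\<lambda>t. f k t - f n t) <= 2 / real (Suc k) + 2 / real (Suc n)" for k n
  proof -
    let ?h = "\<lambda>t. (1/2) *\<^sub>R f k t + (1/2) *\<^sub>R f n t"
    have h: "?h \<in> S" by (rule lin_in[OF f(1) f(1)])
    have 1: "ip ?h ?h = (1/2)\<^sup>2 * ip (f k) (f k) + 2 * (1/2 * (1/2)) * ip (f k) (f n) + (1/2)\<^sup>2 * ip (f n) (f n)"
      by (rule ip_expand[OF f(1) f(1)])
    have 2: "ip (\<lambda>t. f k t - f n t) (\<lambda>t. f k t - f n t) = ip (f k) (f k) - 2 * ip (f k) (f n) + ip (f n) (f n)"
      using ip_expand[OF f(1)[of k] f(1)[of n], of 1 "-1"] by simp
    have 3: "F ?h = 1/2 * F (f k) + 1/2 * F (f n)" by (rule F_lin[OF f(1) f(1)])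
    \<comment> \<open>Parallelogram identity. Since F is linear its terms cancel between the two
      points and their midpoint; as J at the midpoint is at least m, the near-minimality of both
      points remains.\<close>
    have "ip (\<lambda>t. f k t - f n t) (\<lambda>t. f k t - f n t) = 2 * J (f k) + 2 * J (f n) - 4 * J ?h"
      unfolding 2 J_def 1 3 by (simp add: power2_eq_square)
    then show ?thesis using f(2)[of k] f(2)[of n] m_le[OF h] by simp
  qed
  have inv0: "(\<lambda>n. 1 / real (Suc n)) ---> 0"
    using LIMSEQ_inverse_real_of_nat by (simp add: inverse_eq_divide)
  obtain r where r: "r \<in> S" and lim: "(\<lambda>n. ip (\<lambda>t. f n t - r t) (\<lambda>t. f n t - r t)) ---> 0"
  proof -
    have "\<exists>M. \<forall>k\<ge>M. \<forall>n\<ge>M. ip (\<lambda>t. f k t - f n t) (\<lambda>t. f k t - f n t) < e" if e: "e > 0" for e :: real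
    proof -
      have "\<forall>\<^sub>F n in sequentially. 1 / real (Suc n) < e / 4" by (rule order_tendstoD(2)[OF inv0]) (use e in auto)
      then obtain M where M: "\<And>n. n >= M ==> 1 / real (Suc n) < e / 4" by (auto simp: eventually_sequentially)
      have "ip (\<lambda>t. f k t - f n t) (\<lambda>t. f k t - f n t) < e" if "k >= M" "n >= M" for k n
        using par[of k n] M[OF that(1)] M[OF that(2)] by simp
      then show ?thesis by blast
    qed
    from complete[OF f(1) this] show thesis using that by blast
  qed
  have "ip r v = F v" if v: "v \<in> S" for v
  proof -
    have conv: "(\<lambda>n. ip (f n) v) ---> ip r v"
    proof (rule LIM_zero_cancel, rule Lim_null_comparison)
      show "\<forall>\<^sub>F n in sequentially. norm (ip (f n) v - ip r v) <= sqrt (ip (\<lambda>t. f n t - r t) (\<lambda>t. f n t - r t)) * sqrt (ip v v)"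
        using ip_Cauchy_Schwarz[OF diff_in[OF f(1) r] v] by (intro always_eventually allI) (simp add: ip_diff[OF f(1) r v])
      have "(\<lambda>n. sqrt (ip (\<lambda>t. f n t - r t) (\<lambda>t. f n t - r t)) * sqrt (ip v v)) ---> sqrt 0 * sqrt (ip v v)"
        by (intro tendsto_intros lim)
      then show "(\<lambda>n. sqrt (ip (\<lambda>t. f n t - r t) (\<lambda>t. f n t - r t)) * sqrt (ip v v)) ---> 0" by simp
    qed
    \<comment> \<open>The variation is carried out along the minimising sequence with slack
      \<open>1 / (n + 1)\<close>, so the limit only involves continuity of \<open>ip\<close> in its
      first argument.\<close>
    have "0 <= t\<^sup>2 * ip v v + 2 * t * (ip r v - F v)" for t
    proof (rule LIMSEQ_le_const)
      have "(\<lambda>n. t\<^sup>2 * ip v v + 2 * t * (ip (f n) v - F v) + 1 / real (Suc n)) ---> t\<^sup>2 * ip v v + 2 * t * (ip r v - F v) + 0"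
        by (intro tendsto_intros conv inv0)
      then show "(\<lambda>n. t\<^sup>2 * ip v v + 2 * t * (ip (f n) v - F v) + 1 / real (Suc n)) ---> t\<^sup>2 * ip v v + 2 * t * (ip r v - F v)" by simp
      show "\<exists>N. \<forall>n\<ge>N. 0 <= t\<^sup>2 * ip v v + 2 * t * (ip (f n) v - F v) + 1 / real (Suc n)"
      proof (intro exI allI impI)
        fix n
        let ?h = "\<lambda>s. 1 *\<^sub>R f n s + t *\<^sub>R v s"
        have "m <= J ?h" by (rule m_le[OF lin_in[OF f(1) v]])
        also have "J ?h = J (f n) + (t\<^sup>2 * ip v v + 2 * t * (ip (f n) v - F v))"
          unfolding J_def ip_expand[OF f(1) v] F_lin[OF f(1) v] by (simp add: algebra_simps)
        finally show "0 <= t\<^sup>2 * ip v v + 2 * t * (ip (f n) v - F v) + 1 / real (Suc n)" using f(2)[of n] by linarith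
      qed
    qed
    from nonneg_quadratic_linear_term_0[OF this] show ?thesis by simp
  qed
  then show ?thesis using r by blast
qed

end

section \<open>L2 inner products and exceptional sets in the half plane\<close>

definition l2ip :: "'a measure => ('a => 'b::real_inner) => ('a => 'b) => real" where
  "l2ip M f g = (LINT x|M. f x \<bullet> g x)"

lemma l2ip_sym: "l2ip M f g = l2ip M g f"
  by (simp add: l2ip_def inner_commute)

lemma l2ip_self:
  fixes f :: "'a => 'b::{real_inner,second_countable_topology}"
  shows "sq_integrable M f ==> l2ip M f f = (l2norm M f)\<^sup>2"
  using sq_integrable_integrable(2)[of M f] by (simp add: l2ip_def power2_norm_eq_inner)

lemma l2ip_lin:
  fixes f f' g :: "'a => 'b::{real_inner,second_countable_topology}"
  assumes "sq_integrable M f" "sq_integrable M f'" "sq_integrable M g"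
  shows "l2ip M (\<lambda>x. a *\<^sub>R f x + b *\<^sub>R f' x) g = a * l2ip M f g + b * l2ip M f' g"
  unfolding l2ip_def using integrable_inner(1)[OF assms(1,3)] integrable_inner(1)[OF assms(2,3)]
  by (simp add: inner_add_left)

lemma AE_half_plane:
  assumes "AE t in half_line. P t"
  shows "AE x in half_plane. P (fst x) \<and> P (snd x)"
proof -
  interpret H: pair_sigma_finite half_line half_line ..
  obtain N where N: "{t \<in> space half_line. \<not> P t} \<subseteq> N" "emeasure half_line N = 0" "N \<in> sets half_line"
    using AE_E[OF assms] by blast
  have AEN: "AE t in half_line. t \<notin> N" by (rule AE_not_in) (use N in \<open>auto simp: null_sets_def\<close>)
  have "AE x in half_plane. fst x \<notin> N \<and> snd x \<notin> N"
  proof (rule H.AE_pair_measure)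
    have [measurable]: "N \<in> sets half_line" by (rule N)
    show "{x \<in> space half_plane. fst x \<notin> N \<and> snd x \<notin> N} \<in> sets half_plane" by measurable
    show "AE x in half_line. AE y in half_line. fst (x, y) \<notin> N \<and> snd (x, y) \<notin> N"
      using AEN by eventually_elim (use AEN in simp)
  qed
  then show ?thesis
    using AE_space
  proof eventually_elim
    case (elim x)
    then show ?case using N(1) by (auto simp: space_pair_measure)
  qed
qed

subsection \<open>The spaces \<open>X\<close> and \<open>Y\<close>\<close>

lemma L2_space_iff: "u \<in> L2_space \<longleftrightarrow> sq_integrable half_line u"
  by (simp add: L2_space_def sq_integrable_def L2_normsq_eq)

lemma L2_norm_eq: "L2_norm u = l2norm half_line u"
  by (simp add: L2_norm_def l2norm_def L2_normsq_eq)

lemma l2norm_0_iff: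
  fixes f :: "'a => 'b::{real_normed_vector,second_countable_topology}"
  assumes f: "sq_integrable M f"
  shows "l2norm M f = 0 \<longleftrightarrow> (AE x in M. f x = 0)"
proof -
  have "l2norm M f = 0 \<longleftrightarrow> sqnorm M f = 0"
    unfolding l2norm_def using f by (auto simp: enn2real_eq_0_iff sq_integrable_def)
  also have "... \<longleftrightarrow> (AE x in M. f x = 0)" by (rule sqnorm_eq_0_iff) (use f in \<open>simp add: sq_integrable_def\<close>)
  finally show ?thesis .
qed

lemma l2norm_cong_AE_0:
  assumes "AE x in M. f x = 0"
  shows "l2norm M f = 0"
proof -
  have "sqnorm M f = sqnorm M (\<lambda>x. 0)" by (rule sqnorm_cong_AE) (use assms in \<open>auto elim: eventually_mono\<close>)
  then show ?thesis by (simp add: l2norm_def)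
qed

text \<open>The norms of X and Y consist of several L2 pieces. One almost everywhere convergent
  subsequence serves them all, so the limits of the pieces are automatically the pieces of one limit
  function.\<close>

lemma L2_piece_limit:
  fixes F :: "nat => 'a => 'b::{banach,second_countable_topology}"
  assumes F: "\<And>n. sq_integrable M (F n)" and G: "G \<in> borel_measurable M"
    and cauchy: "\<And>e. e > 0 ==> \<exists>N. \<forall>m\<ge>N. \<forall>n\<ge>N. (l2norm M (\<lambda>x. F m x - F n x))\<^sup>2 < e"
    and r: "strict_mono (r::nat=>nat)" and AE: "AE x in M. (\<lambda>n. F (r n) x) ---> G x"
  shows "sq_integrable M G" "(\<lambda>n. (l2norm M (\<lambda>x. F n x - G x))\<^sup>2) ---> 0"
proof -
  have c: "\<exists>N. \<forall>m\<ge>N. \<forall>n\<ge>N. sqnorm M (\<lambda>x. F m x - F n x) < ennreal e" if "e > 0" for e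
    using cauchy[OF that] sqnorm_eq_l2norm[OF sq_integrable_diff[OF F F]] by (simp add: ennreal_less_iff)
  have lim: "(\<lambda>n. sqnorm M (\<lambda>x. F n x - G x)) ---> 0"
    by (rule sqnorm_AE_limit[OF _ G c r AE]) (use F in \<open>auto simp: sq_integrable_def\<close>)
  show "sq_integrable M G" by (rule sq_integrable_limit[OF F G lim])
  have "(\<lambda>n. (l2norm M (\<lambda>x. F n x - G x))\<^sup>2) ---> 0\<^sup>2"
    by (intro tendsto_power l2norm_tendsto lim)
  then show "(\<lambda>n. (l2norm M (\<lambda>x. F n x - G x))\<^sup>2) ---> 0" by simp
qed

locale parabolic =
  fixes j :: "'v::{real_inner,banach,second_countable_topology} => 'h::{real_inner,banach,second_countable_topology}"
    and A :: "'v \<Rightarrow>\<^sub>L ('v \<Rightarrow>\<^sub>L real)" and lm lp :: real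
  assumes gelfand: "gelfand_embedding j" and lm: "0 < lm" and lm_le: "lm <= lp"
    and coercive: "\<And>v. blinfun_apply (blinfun_apply A v) v >= lm * (norm v)\<^sup>2"
    and bounded: "\<And>v w. \<bar>blinfun_apply (blinfun_apply A v) w\<bar> <= lp * norm v * norm w"
begin

lemma j: "bounded_linear j" using gelfand by (simp add: gelfand_embedding_def)

sublocale j: bounded_linear j by (rule j)

lemma j_eq_0: "j x = 0 \<longleftrightarrow> x = 0"
  using gelfand j.zero by (auto simp: gelfand_embedding_def dest: injD[of j x 0])

lemma j_comp_lincomb: "j \<circ> (\<lambda>t. a *\<^sub>R u t + b *\<^sub>R v t) = (\<lambda>t. a *\<^sub>R (j \<circ> u) t + b *\<^sub>R (j \<circ> v) t)"
  by (auto simp: j.add j.scaleR)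

lemma j_comp_measurable: "u \<in> borel_measurable M ==> j \<circ> u \<in> borel_measurable M"
  using measurable_comp[OF _ borel_measurable_continuous_onI[OF j.continuous_on[OF continuous_on_id]]] by auto

lemma X_spaceD:
  assumes "w \<in> X_space j"
  shows "j \<circ> w \<in> H12_00_space" "sq_integrable half_line w" "j \<circ> w \<in> borel_measurable half_line" "w \<in> borel_measurable half_line"
  using assms by (auto simp: X_space_def L2_space_iff H12_00_space_def sq_integrable_def)

lemma Y_spaceD:
  assumes "v \<in> Y_space j"
  shows "j \<circ> v \<in> H12_space" "sq_integrable half_line v" "j \<circ> v \<in> borel_measurable half_line" "v \<in> borel_measurable half_line"
  using assms by (auto simp: Y_space_def L2_space_iff H12_space_def sq_integrable_def)

lemma X_subset_Y: "w \<in> X_space j ==> w \<in> Y_space j"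
  by (auto simp: X_space_def Y_space_def intro: H12_00_subset)

lemma X_lincomb:
  assumes "u \<in> X_space j" "v \<in> X_space j"
  shows "(\<lambda>t. a *\<^sub>R u t + b *\<^sub>R v t) \<in> X_space j"
  unfolding X_space_def mem_Collect_eq L2_space_iff j_comp_lincomb
  by (intro conjI Dp.K_lin sq_integrable_add sq_integrable_scale X_spaceD assms)

lemma Y_lincomb:
  assumes "u \<in> Y_space j" "v \<in> Y_space j"
  shows "(\<lambda>t. a *\<^sub>R u t + b *\<^sub>R v t) \<in> Y_space j"
  unfolding Y_space_def mem_Collect_eq L2_space_iff j_comp_lincomb
  by (intro conjI Dm.K_lin sq_integrable_add sq_integrable_scale Y_spaceD assms)

lemma norms_nonneg[simp]: "0 <= X_norm j w" "0 <= Y_norm j v"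
  by (auto simp: X_norm_def Y_norm_def)

lemma X_norm_sq: "(X_norm j w)\<^sup>2 = (H12_00_norm (j \<circ> w))\<^sup>2 + (l2norm half_line w)\<^sup>2"
  by (simp add: X_norm_def L2_norm_eq)

lemma Y_norm_sq: "(Y_norm j w)\<^sup>2 = (H12_norm (j \<circ> w))\<^sup>2 + (l2norm half_line w)\<^sup>2"
  by (simp add: Y_norm_def L2_norm_eq)

lemma X_norm_ge: "H12_00_norm (j \<circ> w) <= X_norm j w" "l2norm half_line w <= X_norm j w"
  by (auto simp: X_norm_def L2_norm_eq intro: real_le_rsqrt)

lemma Y_norm_ge: "H12_norm (j \<circ> w) <= Y_norm j w" "l2norm half_line w <= Y_norm j w"
  by (auto simp: Y_norm_def L2_norm_eq intro: real_le_rsqrt)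

lemma null_norms:
  assumes m: "w \<in> borel_measurable half_line" and w: "AE t in half_line. w t = 0"
  shows "X_norm j w = 0" "Y_norm j w = 0"
proof -
  have jm: "j \<circ> w \<in> borel_measurable half_line" by (rule j_comp_measurable[OF m])
  have jw: "AE t in half_line. (j \<circ> w) t = 0" using w by eventually_elim (simp add: j_eq_0)
  have 1: "sqnorm half_line (j \<circ> w) = 0" using jm jw by (simp add: sqnorm_eq_0_iff)
  have "sqnorm half_plane (dquot (j \<circ> w)) = sqnorm half_plane (\<lambda>x. 0 :: 'h)"
  proof (rule sqnorm_cong_AE)
    show "AE x in half_plane. norm (dquot (j \<circ> w) x) = norm (0 :: 'h)"
      using AE_half_plane[OF jw] by eventually_elim (auto simp: dquot_def case_prod_beta)
  qed
  then have 2: "sqnorm half_plane (dquot (j \<circ> w)) = 0" by simp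
  have "sqnorm half_line (\<lambda>s. (1 / sqrt s) *\<^sub>R (j \<circ> w) s) = sqnorm half_line (\<lambda>x. 0 :: 'h)"
  proof (rule sqnorm_cong_AE)
    show "AE s in half_line. norm ((1 / sqrt s) *\<^sub>R (j \<circ> w) s) = norm (0 :: 'h)"
      using jw by eventually_elim simp
  qed
  then have 3: "sqnorm half_line (\<lambda>s. (1 / sqrt s) *\<^sub>R (j \<circ> w) s) = 0" by simp
  show "X_norm j w = 0" "Y_norm j w = 0"
    using 1 2 3 l2norm_cong_AE_0[OF w]
    by (auto simp: X_norm_def Y_norm_def H12_norm_def H12_00_norm_def H12_normsq_eq[OF jm] H12_00_normsq_eq[OF jm] L2_norm_eq)
qed

lemma nonnull_iff:
  fixes w :: "real => 'v"
  shows "sq_integrable half_line w ==> nonnull w \<longleftrightarrow> l2norm half_line w > 0"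
  using l2norm_0_iff[of half_line w] l2norm_nonneg[of half_line w] by (auto simp: nonnull_def less_le simp del: l2norm_nonneg)

subsection \<open>Continuity\<close>

definition space_form :: "(real => 'v) => (real => 'v) => real" where
  "space_form w v = (LINT t|half_line. blinfun_apply (blinfun_apply A (w t)) (v t))"

lemma space_form_bound:
  assumes w: "sq_integrable half_line w" and v: "sq_integrable half_line v"
  shows "integrable half_line (\<lambda>t. blinfun_apply (blinfun_apply A (w t)) (v t))"
    and "\<bar>space_form w v\<bar> <= lp * (l2norm half_line w * l2norm half_line v)"
proof -
  have [measurable]: "w \<in> borel_measurable half_line" "v \<in> borel_measurable half_line"
    using w v by (auto simp: sq_integrable_def)
  have lp: "lp > 0" using lm lm_le by simp
  note iwv = integrable_norm_mult[OF w v]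
  have m: "(\<lambda>t. blinfun_apply (blinfun_apply A (w t)) (v t)) \<in> borel_measurable half_line"
    by (rule borel_measurable_continuous_Pair[where H = "\<lambda>x y. blinfun_apply (blinfun_apply A x) y"])
       (auto intro!: continuous_intros)
  show i: "integrable half_line (\<lambda>t. blinfun_apply (blinfun_apply A (w t)) (v t))"
    by (rule Bochner_Integration.integrable_bound[OF integrable_mult_right[OF iwv(1), of lp] m])
       (use bounded lp in \<open>auto simp: abs_mult mult.assoc\<close>)
  have "\<bar>space_form w v\<bar> <= (LINT t|half_line. \<bar>blinfun_apply (blinfun_apply A (w t)) (v t)\<bar>)"
    unfolding space_form_def by (rule integral_abs_bound)
  also have "... <= (LINT t|half_line. lp * (norm (w t) * norm (v t)))"
    by (intro integral_mono integrable_abs i integrable_mult_right iwv(1)) (use bounded in \<open>simp add: mult.assoc\<close>)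
  also have "... <= lp * (l2norm half_line w * l2norm half_line v)"
    using iwv(2) lp by simp
  finally show "\<bar>space_form w v\<bar> <= lp * (l2norm half_line w * l2norm half_line v)" .
qed

lemma space_form_lincomb_left:
  assumes "sq_integrable half_line w" "sq_integrable half_line w'" "sq_integrable half_line v"
  shows "space_form (\<lambda>t. a *\<^sub>R w t + b *\<^sub>R w' t) v = a * space_form w v + b * space_form w' v"
  unfolding space_form_def using space_form_bound(1)[OF assms(1,3)] space_form_bound(1)[OF assms(2,3)]
  by (simp add: blinfun.add_right blinfun.scaleR_right blinfun.add_left blinfun.scaleR_left)

lemma space_form_lincomb_right:
  assumes "sq_integrable half_line w" "sq_integrable half_line v" "sq_integrable half_line v'"
  shows "space_form w (\<lambda>t. a *\<^sub>R v t + b *\<^sub>R v' t) = a * space_form w v + b * space_form w v'"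
  unfolding space_form_def using space_form_bound(1)[OF assms(1,2)] space_form_bound(1)[OF assms(1,3)]
  by (simp add: blinfun.add_right blinfun.scaleR_right)

lemma B_form_eq:
  assumes w: "w \<in> X_space j" and v: "v \<in> Y_space j"
  shows "B_form j A w v = time_form (j \<circ> w) (j \<circ> v) + space_form w v"
  unfolding B_form_def time_form_def space_form_def
  by (intro Bochner_Integration.integral_add time_form_bound(1) space_form_bound(1) X_spaceD[OF w] Y_spaceD[OF v])

lemma B_form_lincomb_left:
  assumes "w \<in> X_space j" "w' \<in> X_space j" "v \<in> Y_space j"
  shows "B_form j A (\<lambda>t. a *\<^sub>R w t + b *\<^sub>R w' t) v = a * B_form j A w v + b * B_form j A w' v"
  unfolding B_form_eq[OF X_lincomb[OF assms(1,2)] assms(3)] B_form_eq[OF assms(1,3)] B_form_eq[OF assms(2,3)] j_comp_lincomb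
    time_form_lincomb_left[OF X_spaceD(1)[OF assms(1)] X_spaceD(1)[OF assms(2)] Y_spaceD(1)[OF assms(3)]]
    space_form_lincomb_left[OF X_spaceD(2)[OF assms(1)] X_spaceD(2)[OF assms(2)] Y_spaceD(2)[OF assms(3)]]
  by (simp add: distrib_left)

lemma B_form_lincomb_right:
  assumes "w \<in> X_space j" "v \<in> Y_space j" "v' \<in> Y_space j"
  shows "B_form j A w (\<lambda>t. a *\<^sub>R v t + b *\<^sub>R v' t) = a * B_form j A w v + b * B_form j A w v'"
  unfolding B_form_eq[OF assms(1) Y_lincomb[OF assms(2,3)]] B_form_eq[OF assms(1,2)] B_form_eq[OF assms(1,3)] j_comp_lincomb
    time_form_lincomb_right[OF X_spaceD(1)[OF assms(1)] Y_spaceD(1)[OF assms(2)] Y_spaceD(1)[OF assms(3)]]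
    space_form_lincomb_right[OF X_spaceD(2)[OF assms(1)] Y_spaceD(2)[OF assms(2)] Y_spaceD(2)[OF assms(3)]]
  by (simp add: distrib_left)

lemma B_form_bound:
  assumes w: "w \<in> X_space j" and v: "v \<in> Y_space j"
  shows "\<bar>B_form j A w v\<bar> <= (12 + lp) * X_norm j w * Y_norm j v"
proof -
  have lp: "lp > 0" using lm lm_le by simp
  have "\<bar>B_form j A w v\<bar> <= \<bar>time_form (j \<circ> w) (j \<circ> v)\<bar> + \<bar>space_form w v\<bar>"
    unfolding B_form_eq[OF w v] by simp
  also have "... <= 12 * H12_00_norm (j \<circ> w) * H12_norm (j \<circ> v) + lp * (l2norm half_line w * l2norm half_line v)"
    by (intro add_mono time_form_bound(2) space_form_bound(2) X_spaceD[OF w] Y_spaceD[OF v])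
  also have "... <= 12 * X_norm j w * Y_norm j v + lp * (X_norm j w * Y_norm j v)"
    using lp by (intro add_mono mult_mono mult_left_mono X_norm_ge Y_norm_ge mult_nonneg_nonneg) auto
  finally show ?thesis by (simp add: algebra_simps)
qed

subsection \<open>The inf-sup condition\<close>

lemma j_bound: obtains K where "K > 0" "\<And>x. norm (j x) <= K * norm x"
  using j.pos_bounded by (metis mult.commute)

text \<open>Stated without quotients and with the positivity of both norms, as it is used three
  times: for the inf-sup value, for the lower energy bound and for uniqueness. The test function is
  w plus d times the conjugate operator applied to the zero extension of the V-valued w.\<close>

lemma inf_sup_aux:
  "\<exists>\<gamma>>0. \<forall>w\<in>X_space j. nonnull w \<longrightarrow> (\<exists>v\<in>Y_space j. nonnull v \<and> \<gamma> * (X_norm j w * Y_norm j v) <= B_form j A w v \<and> 0 < X_norm j w \<and> 0 < Y_norm j v)"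
proof -
  obtain K where K: "K > 0" "\<And>x. norm (j x) <= K * norm x" using j_bound by blast
  have lp: "lp > 0" using lm lm_le by simp
  \<comment> \<open>With this d the spatial cross term costs at most half of the coercivity.\<close>
  define d where "d = lm / (2 * lp)"
  have d: "d > 0" using lm lp by (simp add: d_def)
  have dlp: "d * lp = lm / 2" using lp by (simp add: d_def)
  \<comment> \<open>The lower bound for the form is \<open>d / (2 * pi)\<close> times E plus
    \<open>lm / 4\<close> times the squared L2 norm, while the squared X norm is at most E plus
    \<open>K^2 + 1\<close> times that L2 norm; c compares the coefficients.\<close>
  define c where "c = min (d / (2 * pi)) (lm / (4 * (K\<^sup>2 + 1)))"
  have K1: "K\<^sup>2 + 1 > 0" by (intro add_nonneg_pos) auto
  have c: "c > 0" unfolding c_def using d lm K1 by (auto intro!: divide_pos_pos mult_pos_pos)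
  \<comment> \<open>Bounds the Y norm of v by the X norm of w: 2 from the doubling bound, and 8 as
    the doubling bound times the squared factor 2 in \<open>conj_op_H12\<close>.\<close>
  define C where "C = sqrt (2 + 8 * d\<^sup>2)"
  have C: "C > 0" unfolding C_def by (simp add: add_pos_nonneg)
  have "\<exists>v\<in>Y_space j. nonnull v \<and> (c / C) * (X_norm j w * Y_norm j v) <= B_form j A w v \<and> 0 < X_norm j w \<and> 0 < Y_norm j v"
    if w: "w \<in> X_space j" and nn: "nonnull w" for w
  proof -
    note wD = X_spaceD[OF w]
    let ?u = "j \<circ> w"
    let ?L = "l2norm half_line w"
    have L: "?L > 0" using nn nonnull_iff[OF wD(2)] by simp
    have X: "X_norm j w > 0" using L X_norm_ge(2)[of w] by linarith
    define E where "E = (l2norm plane (dquot (zero_ext ?u)))\<^sup>2"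
    \<comment> \<open>After multiplication by d, the loss in the energy identity is a quarter of the
      coercive term; together with the half spent on the cross term, a quarter remains.\<close>
    define \<eta> where "\<eta> = lm * ?L\<^sup>2 / (4 * d)"
    have \<eta>: "\<eta> > 0" unfolding \<eta>_def using lm L d by (intro divide_pos_pos mult_pos_pos) auto
    obtain eps where e: "eps > 0" and tc: "time_form ?u (conj_op eps (zero_ext ?u)) >= E / (2 * pi) - \<eta>"
      using time_form_conj[OF wD(1) \<eta>] unfolding E_def by metis
    let ?W = "zero_ext w"
    have Wm: "?W \<in> borel_measurable borel" by (rule zero_ext_measurable[OF wD(4)])
    have W: "sq_integrable lborel ?W"
      using wD(2) Wm by (simp add: sq_integrable_def sqnorm_zero_ext)
    let ?G = "conj_op eps ?W"
    have zj: "zero_ext ?u = (\<lambda>t. j (?W t))" by (auto simp: zero_ext_def j.scaleR)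
    have jG: "j \<circ> ?G = conj_op eps (zero_ext ?u)"
      unfolding zj using conj_op_linear_image[OF j e W] by auto
    note GH = conj_op_H12[OF wD(1) e, folded jG]
    have Gm: "?G \<in> borel_measurable borel" by (rule conj_op_measurable[OF Wm])
    have Gle: "sqnorm half_line ?G <= sqnorm half_line w"
      using order_trans[OF sqnorm_half_line_le conj_op_bound[OF e W]] by (simp add: sqnorm_zero_ext)
    have G2: "sq_integrable half_line ?G"
      using Gle wD(2) measurable_half_lineI[OF Gm] by (auto simp: sq_integrable_def)
    have GL: "l2norm half_line ?G <= ?L"
      unfolding l2norm_def by (intro real_sqrt_le_mono enn2real_mono Gle) (use wD(2) in \<open>simp add: sq_integrable_def\<close>)
    have GY: "?G \<in> Y_space j" using GH(1) G2 by (simp add: Y_space_def L2_space_iff)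
    have wY: "w \<in> Y_space j" by (rule X_subset_Y[OF w])
    define v where "v = (\<lambda>t. 1 *\<^sub>R w t + d *\<^sub>R ?G t)"
    have vY: "v \<in> Y_space j" unfolding v_def by (rule Y_lincomb[OF wY GY])
    have "B_form j A w v = 1 * B_form j A w w + d * B_form j A w ?G"
      unfolding v_def by (rule B_form_lincomb_right[OF w wY GY])
    also have "B_form j A w w = space_form w w"
      unfolding B_form_eq[OF w wY] time_form_self[OF wD(1)] by simp
    also have "B_form j A w ?G = time_form ?u (j \<circ> ?G) + space_form w ?G" by (rule B_form_eq[OF w GY])
    finally have B: "B_form j A w v = space_form w w + d * (time_form ?u (j \<circ> ?G) + space_form w ?G)" by simp
    have s1: "lm * ?L\<^sup>2 <= space_form w w"
    proof -
      have "lm * ?L\<^sup>2 = (LINT t|half_line. lm * (norm (w t))\<^sup>2)"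
        using sq_integrable_integrable[OF wD(2)] by simp
      also have "... <= space_form w w" unfolding space_form_def
        by (intro integral_mono integrable_mult_right sq_integrable_integrable(1)[OF wD(2)] space_form_bound(1) wD coercive)
      finally show ?thesis .
    qed
    have "\<bar>space_form w ?G\<bar> <= lp * (?L * l2norm half_line ?G)" by (rule space_form_bound(2)[OF wD(2) G2])
    also have "... <= lp * (?L * ?L)" using lp by (intro mult_left_mono GL) auto
    finally have "d * space_form w ?G >= d * (- (lp * ?L\<^sup>2))" using d by (intro mult_left_mono) (auto simp: power2_eq_square)
    moreover have "d * (- (lp * ?L\<^sup>2)) = - ((d * lp) * ?L\<^sup>2)" by simp
    ultimately have s2: "d * space_form w ?G >= - (lm / 2 * ?L\<^sup>2)" unfolding dlp by linarith
    have s3: "d * time_form ?u (j \<circ> ?G) >= d * (E / (2 * pi) - \<eta>)"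
      unfolding jG using tc d by (intro mult_left_mono) auto
    have d\<eta>: "d * \<eta> = lm / 4 * ?L\<^sup>2" using d by (simp add: \<eta>_def)
    have lower: "B_form j A w v >= d / (2 * pi) * E + lm / 4 * ?L\<^sup>2"
    proof -
      have "d * (E / (2 * pi) - \<eta>) = d / (2 * pi) * E - lm / 4 * ?L\<^sup>2"
        unfolding right_diff_distrib d\<eta> by simp
      then show ?thesis unfolding B distrib_left using s1 s2 s3 by linarith
    qed
    have H: "(H12_00_norm ?u)\<^sup>2 <= K\<^sup>2 * ?L\<^sup>2 + E"
    proof -
      have Uq: "sq_integrable plane (dquot (zero_ext ?u))"
        using zero_ext_half_sob[OF wD(1)] by (auto simp: half_sob_def)
      have "sqnorm lborel (zero_ext ?u) = sqnorm half_line ?u" by (rule sqnorm_zero_ext)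
      also have "... <= sqnorm half_line (\<lambda>t. K *\<^sub>R w t)"
        by (rule sqnorm_mono) (use K in auto)
      also have "... = ennreal (K\<^sup>2 * ?L\<^sup>2)"
        by (simp add: sqnorm_scale[OF wD(4)] sqnorm_eq_l2norm[OF wD(2)] ennreal_mult)
      finally have 1: "sqnorm lborel (zero_ext ?u) <= ennreal (K\<^sup>2 * ?L\<^sup>2)" .
      have "ennreal ((H12_00_norm ?u)\<^sup>2) <= ennreal (K\<^sup>2 * ?L\<^sup>2) + ennreal E"
        using order_trans[OF H12_00_zero_ext(1)[OF wD(3)] add_mono[OF 1 order_refl]] sqnorm_eq_l2norm[OF Uq]
        by (simp add: E_def H12_00_normsq_norm[OF wD(1)])
      also have "... = ennreal (K\<^sup>2 * ?L\<^sup>2 + E)" by (rule ennreal_plus[symmetric]) (auto simp: E_def)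
      finally show ?thesis by (subst (asm) ennreal_le_iff) (auto simp: E_def)
    qed
    have main: "c * (X_norm j w)\<^sup>2 <= B_form j A w v"
    proof -
      have E0: "E >= 0" by (simp add: E_def)
      have "c * (X_norm j w)\<^sup>2 <= c * (E + (K\<^sup>2 + 1) * ?L\<^sup>2)"
        using H c by (intro mult_left_mono) (auto simp: X_norm_sq algebra_simps)
      also have "... = c * E + (c * (K\<^sup>2 + 1)) * ?L\<^sup>2" by (simp add: algebra_simps)
      also have "... <= d / (2 * pi) * E + lm / 4 * ?L\<^sup>2"
      proof (intro add_mono mult_right_mono)
        show "c <= d / (2 * pi)" by (simp add: c_def)
        have "c * (K\<^sup>2 + 1) <= lm / (4 * (K\<^sup>2 + 1)) * (K\<^sup>2 + 1)" using K1 by (intro mult_right_mono) (auto simp: c_def)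
        also have "lm / (4 * y) * y = lm / 4" if "y > 0" for y :: real using that by simp
        note this[OF K1]
        finally show "c * (K\<^sup>2 + 1) <= lm / 4" .
      qed (use E0 in auto)
      also note lower
      finally show ?thesis .
    qed
    have Yn: "Y_norm j v <= C * X_norm j w"
    proof -
      have "H12_normsq (j \<circ> v) <= ennreal (2 * 1\<^sup>2) * H12_normsq ?u + ennreal (2 * d\<^sup>2) * H12_normsq (j \<circ> ?G)"
        unfolding v_def j_comp_lincomb by (rule H12_normsq_lincomb[OF Y_spaceD(3)[OF wY] Y_spaceD(3)[OF GY]])
      also have "... <= ennreal 2 * H12_00_normsq ?u + ennreal (2 * d\<^sup>2) * ennreal ((2 * H12_00_norm ?u)\<^sup>2)"
        unfolding H12_normsq_norm[OF GH(1)]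
        by (intro add_mono mult_mono ennreal_leI power_mono GH(2) H12_00_zero_ext(3)[OF wD(3)]) (use d in auto)
      also have "... = ennreal (2 * (H12_00_norm ?u)\<^sup>2 + (2 * d\<^sup>2) * (2 * H12_00_norm ?u)\<^sup>2)"
        unfolding H12_00_normsq_norm[OF wD(1)]
        by (subst ennreal_mult[symmetric], simp, simp, subst ennreal_mult[symmetric], simp, simp, rule ennreal_plus[symmetric]) auto
      finally have "ennreal ((H12_norm (j \<circ> v))\<^sup>2) <= ..." unfolding H12_normsq_norm[OF Y_spaceD(1)[OF vY]] .
      then have a: "(H12_norm (j \<circ> v))\<^sup>2 <= 2 * (H12_00_norm ?u)\<^sup>2 + (2 * d\<^sup>2) * (2 * H12_00_norm ?u)\<^sup>2"
        by (subst (asm) ennreal_le_iff) auto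
      have "sqnorm half_line v <= ennreal (2 * 1\<^sup>2) * sqnorm half_line w + ennreal (2 * d\<^sup>2) * sqnorm half_line ?G"
        unfolding v_def by (rule sqnorm_lincomb) (use wD(4) measurable_half_lineI[OF Gm] in auto)
      also have "... <= ennreal 2 * sqnorm half_line w + ennreal (2 * d\<^sup>2) * sqnorm half_line w"
        by (intro add_mono mult_left_mono Gle) auto
      also have "... = ennreal (2 * ?L\<^sup>2 + (2 * d\<^sup>2) * ?L\<^sup>2)"
        unfolding sqnorm_eq_l2norm[OF wD(2)]
        by (subst ennreal_mult[symmetric], simp, simp, subst ennreal_mult[symmetric], simp, simp, rule ennreal_plus[symmetric]) auto
      finally have "ennreal ((l2norm half_line v)\<^sup>2) <= ..." unfolding sqnorm_eq_l2norm[OF Y_spaceD(2)[OF vY]] .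
      then have b: "(l2norm half_line v)\<^sup>2 <= 2 * ?L\<^sup>2 + (2 * d\<^sup>2) * ?L\<^sup>2"
        by (subst (asm) ennreal_le_iff) auto
      have "(Y_norm j v)\<^sup>2 <= (2 + 8 * d\<^sup>2) * (X_norm j w)\<^sup>2"
      proof -
        have *: "(2 + 8 * d\<^sup>2) * (h\<^sup>2 + l\<^sup>2) = (2 * h\<^sup>2 + (2 * d\<^sup>2) * (2 * h)\<^sup>2) + (2 * l\<^sup>2 + (2 * d\<^sup>2) * l\<^sup>2) + 6 * (d\<^sup>2 * l\<^sup>2)" for h l
          by (simp add: power_mult_distrib algebra_simps)
        show ?thesis unfolding Y_norm_sq X_norm_sq * by (rule order_trans[OF add_mono[OF a b]]) simp
      qed
      also have "... = (C * X_norm j w)\<^sup>2" unfolding C_def by (simp add: power_mult_distrib)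
      finally show ?thesis by (rule power2_le_imp_le) (use C in simp)
    qed
    have Bpos: "B_form j A w v > 0" using main c X by (smt (verit) mult_pos_pos zero_less_power)
    \<comment> \<open>By continuity, the form could not be positive against a v of norm 0.\<close>
    have Ypos: "Y_norm j v > 0"
    proof (rule ccontr)
      assume "\<not> Y_norm j v > 0"
      then have "Y_norm j v = 0" using norms_nonneg(2)[of v] by linarith
      then show False using B_form_bound[OF w vY] Bpos by simp
    qed
    have vn: "nonnull v" unfolding nonnull_def
    proof
      assume "AE t in half_line. v t = 0"
      then have "Y_norm j v = 0" by (rule null_norms(2)[OF Y_spaceD(4)[OF vY]])
      then show False using Ypos by simp
    qed
    have "(c / C) * (X_norm j w * Y_norm j v) <= (c / C) * (X_norm j w * (C * X_norm j w))"
      using c C X Yn by (intro mult_left_mono) auto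
    also have "... = c * (X_norm j w)\<^sup>2" using C by (simp add: power2_eq_square)
    also note main
    finally show ?thesis using vY vn X Ypos by blast
  qed
  then show ?thesis using c C by (intro exI[of _ "c / C"]) auto
qed

subsection \<open>Injectivity of the adjoint\<close>

text \<open>A kernel supported in r <= -d looks at times s >= t + d only, so it is an admissible
  test function with zero initial value for every t >= 0.\<close>

lemma smooth_compact_kernel:
  fixes x :: "'b::{real_inner,banach,second_countable_topology}" and f :: "real => real"
  assumes f: "f \<in> smooth_compact" and supp: "\<And>r. r > - d ==> f r = 0" and d: "d > 0" and t: "t >= 0"
  shows "(\<lambda>s. f (t - s) *\<^sub>R x) \<in> smooth_compact_0"
proof -
  have "(\<lambda>s. f (t - s)) \<in> smooth_compact"
    using smooth_compact_affine[OF _ f, of "-1" t] by (simp add: add.commute)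
  from smooth_compact_linear_image[OF bounded_linear_scaleR_left this]
  have "(\<lambda>s. f (t - s) *\<^sub>R x) \<in> smooth_compact" .
  then show ?thesis unfolding smooth_compact_0_iff using d t supp by (auto intro!: exI[of _ d])
qed

lemma kernel_in_X:
  fixes f :: "real => real"
  assumes f: "f \<in> smooth_compact" and supp: "\<And>r. r > - d ==> f r = 0" and d: "d > 0" and t: "t >= 0"
  shows "(\<lambda>s. f (t - s) *\<^sub>R x) \<in> X_space j"
proof -
  let ?w = "\<lambda>s. f (t - s) *\<^sub>R x"
  have "half_sob ?w"
    by (rule smooth_compact_half_sob) (use smooth_compact_kernel[OF assms, of x] in \<open>simp add: smooth_compact_0_def\<close>)
  then have "sq_integrable lborel ?w" by (simp add: half_sob_def)
  then have 1: "sq_integrable half_line ?w"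
    unfolding sq_integrable_def
    by (intro conjI measurable_half_lineI le_less_trans[OF sqnorm_half_line_le]) (simp_all add: sq_integrable_def)
  have eq: "j \<circ> ?w = (\<lambda>s. f (t - s) *\<^sub>R j x)" by (auto simp: j.scaleR)
  have "j \<circ> ?w \<in> H12_00_space"
    unfolding eq by (rule smooth_compact_0_H12_00[OF smooth_compact_kernel[OF assms]])
  then show ?thesis using 1 by (simp add: X_space_def L2_space_iff)
qed

text \<open>A scalar kernel times a fixed vector turns the form into a mollification of v and its
  derivative at time t. The minus sign is the inner derivative of \<open>t - s\<close>.\<close>

lemma B_form_kernel:
  fixes f f' :: "real => real"
  assumes v: "v \<in> Y_space j" and f: "f \<in> smooth_compact" and supp: "\<And>r. r > - d ==> f r = 0" and d: "d > 0" and t: "t >= 0"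
    and f': "\<And>r. (f has_vector_derivative f' r) (at r)"
    and int: "integrable lborel (\<lambda>s. f (t - s) *\<^sub>R zero_ext v s)" "integrable lborel (\<lambda>s. f' (t - s) *\<^sub>R zero_ext v s)"
  shows "B_form j A (\<lambda>s. f (t - s) *\<^sub>R x) v =
    blinfun_apply (blinfun_apply A x) (LINT s|lborel. f (t - s) *\<^sub>R zero_ext v s)
    - j x \<bullet> j (LINT s|lborel. f' (t - s) *\<^sub>R zero_ext v s)"
proof -
  let ?w = "\<lambda>s. f (t - s) *\<^sub>R x"
  have w: "?w \<in> X_space j" by (rule kernel_in_X[OF f supp d t])
  have eq: "j \<circ> ?w = (\<lambda>s. f (t - s) *\<^sub>R j x)" by (auto simp: j.scaleR)
  have der: "((\<lambda>s. f (t - s) *\<^sub>R j x) has_vector_derivative - (f' (t - s) *\<^sub>R j x)) (at s)" for s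
  proof -
    have "((\<lambda>s. t - s) has_real_derivative - 1) (at s)" by (auto intro!: derivative_eq_intros)
    from DERIV_chain'[OF this] f' have "((\<lambda>s. f (t - s)) has_real_derivative f' (t - s) * (- 1)) (at s)"
      by (simp add: has_real_derivative_iff_has_vector_derivative)
    from has_vector_derivative_scaleR[OF this has_vector_derivative_const[of "j x"]] show ?thesis by simp
  qed
  have "time_form (j \<circ> ?w) (j \<circ> v) = (LINT s|half_line. - (f' (t - s) *\<^sub>R j x) \<bullet> (j \<circ> v) s)"
    unfolding eq by (rule time_form_smooth[OF smooth_compact_kernel[OF f supp d t] der Y_spaceD(1)[OF v]])
  also have "... = (LINT s|lborel. - (j x \<bullet> j (f' (t - s) *\<^sub>R zero_ext v s)))"
    unfolding integral_half_line by (intro Bochner_Integration.integral_cong) (auto simp: zero_ext_def indicator_def j.scaleR j.zero)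
  also have "... = - (j x \<bullet> j (LINT s|lborel. f' (t - s) *\<^sub>R zero_ext v s))"
    using integral_bounded_linear[OF bounded_linear_compose[OF bounded_linear_inner_right[of "j x"] j] int(2)] by simp
  finally have 1: "time_form (j \<circ> ?w) (j \<circ> v) = - (j x \<bullet> j (LINT s|lborel. f' (t - s) *\<^sub>R zero_ext v s))" .
  have "space_form ?w v = (LINT s|lborel. blinfun_apply (blinfun_apply A x) (f (t - s) *\<^sub>R zero_ext v s))"
    unfolding space_form_def integral_half_line
    by (intro Bochner_Integration.integral_cong) (auto simp: zero_ext_def indicator_def blinfun.scaleR_right blinfun.scaleR_left blinfun.zero_right)
  also have "... = blinfun_apply (blinfun_apply A x) (LINT s|lborel. f (t - s) *\<^sub>R zero_ext v s)"
    by (rule integral_bounded_linear[OF blinfun.bounded_linear_right int(1)])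
  finally show ?thesis unfolding B_form_eq[OF w v] 1 by simp
qed

lemma integral_lborel_reflect:
  fixes g :: "real => 'b::{banach,second_countable_topology}"
  shows "(LINT s|lborel. g s) = (LINT r|lborel. g (c - r))"
  by (subst lborel_integral_real_affine[where c = "-1" and t = c]) auto

lemma integrable_lborel_reflect:
  fixes g :: "real => 'b::{banach,second_countable_topology}"
  assumes "integrable lborel (\<lambda>r. g (- r))"
  shows "integrable lborel g"
  using assms lborel_integrable_real_affine_iff[of "-1" g 0] by simp

text \<open>Testing with \<open>f (t - s) x\<close> shows that the mollification \<open>Q\<close> of \<open>v\<close> solves the backward equation,
  so that the norm of \<open>j Q\<close> increases; being square integrable, it vanishes.\<close>

lemma adjoint_injective:
  assumes v: "v \<in> Y_space j" and B: "\<And>w. w \<in> X_space j ==> B_form j A w v = 0"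
  shows "AE t in half_line. v t = 0"
proof -
  note vD = Y_spaceD[OF v]
  let ?V = "zero_ext v"
  have Vm[measurable]: "?V \<in> borel_measurable borel" by (rule zero_ext_measurable[OF vD(4)])
  have V: "sq_integrable lborel ?V" using vD(2) by (simp add: sq_integrable_def sqnorm_zero_ext)
  have kV: "set_integrable lborel {a..b} (\<lambda>r. ?V (- r))" for a b
  proof (rule sq_integrable_set_integrable)
    show "sq_integrable lborel (\<lambda>r. ?V (- r))"
      using V nn_integral_real_affine[of "\<lambda>t. ennreal ((norm (?V t))\<^sup>2)" "-1" 0]
      by (simp add: sq_integrable_def sqnorm_def)
  qed
  \<comment> \<open>The mollification of v over later times is within \<eta> of v in L2 and turns
    out to vanish for t >= 0; hence v itself is that small.\<close>
  have small: "sqnorm half_line v <= ennreal \<eta>" if \<eta>: "\<eta> > 0" for \<eta>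
  proof -
    obtain e where e: "e > 0" "\<And>h. norm h < e ==> sqnorm lborel (\<lambda>x. ?V (x - h) - ?V x) <= ennreal \<eta>"
      using sq_integrable_translation_small[OF V \<eta>] by metis
    define d where "d = e / 4"
    have d: "d > 0" using e by (simp add: d_def)
    obtain \<rho> :: "real => real" where \<rho>: "\<rho> \<in> smooth_compact" "\<And>t. 0 <= \<rho> t"
      "\<And>t. t \<notin> {d<..<2*d} ==> \<rho> t = 0" "integrable lborel \<rho>" "(LINT t|lborel. \<rho> t) = 1"
      using mollifier_exists[OF d] by metis
    \<comment> \<open>The mollifier is reversed to average over later times. Averaging over earlier
      ones would reach below time 0 for small t, where the test function would not vanish at
      0.\<close>
    define f where "f r = \<rho> (- r)" for r
    have f: "f \<in> smooth_compact" using smooth_compact_affine[OF _ \<rho>(1), of "-1" 0] by (simp add: f_def[abs_def])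
    have supp: "f r = 0" if "r > - d" for r using \<rho>(3)[of "- r"] that by (auto simp: f_def)
    obtain f' where f'S: "f' \<in> smooth_compact" and f': "\<And>t. (f has_vector_derivative f' t) (at t)"
      using smooth_compact_deriv[OF f] by metis
    define Q where "Q t = (LINT r|lborel. f (t + r) *\<^sub>R ?V (- r))" for t
    define Q' where "Q' t = (LINT r|lborel. f' (t + r) *\<^sub>R ?V (- r))" for t
    have km: "(\<lambda>r. ?V (- r)) \<in> borel_measurable borel" by measurable
    have dQ: "(Q has_vector_derivative Q' t) (at t)" for t
      unfolding Q_def[abs_def] Q'_def by (rule has_vector_derivative_convolution(1)[OF bounded_bilinear_scaleR f f' km kV])
    have i1: "integrable lborel (\<lambda>r. f (t + r) *\<^sub>R ?V (- r))" for t
      by (rule has_vector_derivative_convolution(2)[OF bounded_bilinear_scaleR f f' km kV])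
    obtain f'' where f'': "\<And>t. (f' has_vector_derivative f'' t) (at t)"
      using smooth_compact_deriv[OF f'S] by metis
    have i2: "integrable lborel (\<lambda>r. f' (t + r) *\<^sub>R ?V (- r))" for t
      by (rule has_vector_derivative_convolution(2)[OF bounded_bilinear_scaleR f'S f'' km kV])
    have eqn: "j x \<bullet> j (Q' t) = blinfun_apply (blinfun_apply A x) (Q t)" if t: "t >= 0" for t x
    proof -
      have "B_form j A (\<lambda>s. f (t - s) *\<^sub>R x) v = blinfun_apply (blinfun_apply A x) (LINT s|lborel. f (t - s) *\<^sub>R ?V s)
        - j x \<bullet> j (LINT s|lborel. f' (t - s) *\<^sub>R ?V s)"
        by (rule B_form_kernel[OF v f _ d t f'], erule supp; rule integrable_lborel_reflect) (use i1[of t] i2[of t] in simp_all)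
      moreover have "B_form j A (\<lambda>s. f (t - s) *\<^sub>R x) v = 0" by (rule B[OF kernel_in_X[OF f supp d t]])
      moreover have "(LINT s|lborel. f (t - s) *\<^sub>R ?V s) = Q t"
        using integral_lborel_reflect[of "\<lambda>s. f (t - s) *\<^sub>R ?V s" 0] by (simp add: Q_def)
      moreover have "(LINT s|lborel. f' (t - s) *\<^sub>R ?V s) = Q' t"
        using integral_lborel_reflect[of "\<lambda>s. f' (t - s) *\<^sub>R ?V s" 0] by (simp add: Q'_def)
      ultimately show ?thesis by simp
    qed
    have mono: "(norm (j (Q S)))\<^sup>2 <= (norm (j (Q T)))\<^sup>2" if ST: "0 <= S" "S <= T" for S T
    proof (rule DERIV_nonneg_imp_nondecreasing[OF ST(2)])
      fix t assume t: "S <= t" "t <= T"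
      have jQ: "((\<lambda>t. j (Q t)) has_vector_derivative j (Q' t)) (at t)"
        by (rule bounded_linear.has_vector_derivative[OF j dQ])
      have "((\<lambda>t. j (Q t) \<bullet> j (Q t)) has_vector_derivative j (Q t) \<bullet> j (Q' t) + j (Q' t) \<bullet> j (Q t)) (at t)"
        by (rule bounded_bilinear.has_vector_derivative[OF bounded_bilinear_inner jQ jQ])
      then have "((\<lambda>t. (norm (j (Q t)))\<^sup>2) has_real_derivative 2 * (j (Q t) \<bullet> j (Q' t))) (at t)"
        by (simp add: has_real_derivative_iff_has_vector_derivative power2_norm_eq_inner inner_commute)
      \<comment> \<open>The equation tested with x = \<open>Q t\<close> gives the quadratic form of
        A, which coercivity makes nonnegative.\<close>
      moreover have "0 <= j (Q t) \<bullet> j (Q' t)"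
        using eqn[of t "Q t"] order_trans[OF mult_nonneg_nonneg coercive[of "Q t"]] lm t ST by simp
      ultimately show "\<exists>y. ((\<lambda>t. (norm (j (Q t)))\<^sup>2) has_real_derivative y) (at t) \<and> 0 <= y" by force
    qed
    have Qm[measurable]: "Q \<in> borel_measurable borel"
      by (intro borel_measurable_continuous_onI continuous_at_imp_continuous_on ballI has_vector_derivative_continuous[OF dQ])
    have QV: "(LINT h|lborel. \<rho> h *\<^sub>R (?V (t - h *\<^sub>R (-1)) - ?V t)) = Q t - ?V t" for t
    proof -
      have 1: "Q t = (LINT h|lborel. \<rho> h *\<^sub>R ?V (t + h))"
        unfolding Q_def by (subst integral_lborel_reflect[where c = "- t"]) (simp add: f_def add.commute)
      have 2: "integrable lborel (\<lambda>h. \<rho> h *\<^sub>R ?V (t + h))"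
        using i1[of t] lborel_integrable_real_affine_iff[of "-1" "\<lambda>r. f (t + r) *\<^sub>R ?V (- r)" "- t"]
        by (simp add: f_def add.commute)
      show ?thesis using 2 \<rho>(4,5) by (simp add: 1 scaleR_diff_right)
    qed
    have "sqnorm lborel (\<lambda>t. LINT h|lborel. \<rho> h *\<^sub>R (?V (t - h *\<^sub>R (-1)) - ?V t)) <= ennreal \<eta>"
    proof (rule sqnorm_mollify_diff[OF Vm \<rho>(2,4,5)])
      fix h assume "\<rho> h \<noteq> 0"
      then have "h \<in> {d<..<2*d}" using \<rho>(3)[of h] by blast
      then have "norm (h *\<^sub>R (-1::real)) < e" using d e(1) by (simp add: d_def)
      then show "sqnorm lborel (\<lambda>x. ?V (x - h *\<^sub>R (-1)) - ?V x) <= ennreal \<eta>" by (rule e(2))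
    qed
    then have diff: "sqnorm lborel (\<lambda>t. Q t - ?V t) <= ennreal \<eta>" unfolding QV .
    have Qfin: "sqnorm lborel Q < \<infinity>"
    proof -
      have "sq_integrable lborel (\<lambda>t. Q t - ?V t)"
        using le_less_trans[OF diff ennreal_less_top] by (simp add: sq_integrable_def)
      from sq_integrable_add[OF this V] show ?thesis by (simp add: sq_integrable_def)
    qed
    have Q0: "Q T = 0" if T: "T >= 0" for T
    proof (rule ccontr)
      assume "Q T \<noteq> 0"
      then have p: "norm (j (Q T)) > 0" by (simp add: j_eq_0)
      \<comment> \<open>Monotonicity concerns the H-norm, integrability the V-norm; continuity of j
        turns a lower bound for the former into one for the latter on an interval of infinite
        length.\<close>
      obtain K where K: "K > 0" "\<And>x. norm (j x) <= K * norm x" using j_bound by blast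
      define c where "c = (norm (j (Q T)) / K)\<^sup>2"
      have c: "c > 0" using p K by (simp add: c_def)
      have "(\<integral>\<^sup>+t. ennreal c * indicator {T..} t \<partial>lborel) <= sqnorm lborel Q"
        unfolding sqnorm_def
      proof (intro nn_integral_mono)
        fix t
        have "ennreal c <= ennreal ((norm (Q t))\<^sup>2)" if t: "t >= T"
        proof (rule ennreal_leI)
          have "norm (j (Q T)) <= norm (j (Q t))" by (rule power2_le_imp_le[OF mono[OF T t]]) simp
          also have "... <= K * norm (Q t)" by (rule K(2))
          finally have "norm (j (Q T)) / K <= norm (Q t)" using K by (simp add: field_simps)
          then show "c <= (norm (Q t))\<^sup>2" unfolding c_def using K by (intro power_mono) auto
        qed
        then show "ennreal c * indicator {T..} t <= ennreal ((norm (Q t))\<^sup>2)" by (auto simp: indicator_def)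
      qed
      moreover have "(\<integral>\<^sup>+t. ennreal c * indicator {T..} t \<partial>lborel) = \<infinity>"
      proof -
        have "emeasure lborel {T..} = \<infinity>"
        proof (rule ccontr)
          assume "emeasure lborel {T..} \<noteq> \<infinity>"
          then obtain M where M: "emeasure lborel {T..} = ennreal M" "M >= 0" by (cases "emeasure lborel {T..}") auto
          have "emeasure lborel {T..T + (M + 1)} <= emeasure lborel {T..}" by (rule emeasure_mono) auto
          then show False using M by (simp add: emeasure_lborel_Icc_eq)
        qed
        then show ?thesis using c by (simp add: nn_integral_cmult_indicator ennreal_mult_top)
      qed
      ultimately show False using Qfin by simp
    qed
    have "sqnorm half_line v = sqnorm half_line (\<lambda>t. Q t - ?V t)"
      by (rule sqnorm_cong) (simp add: Q0 zero_ext_simps space_half_line)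
    also have "... <= sqnorm lborel (\<lambda>t. Q t - ?V t)" by (rule sqnorm_half_line_le)
    also note diff
    finally show ?thesis .
  qed
  have "l2norm half_line v = 0"
  proof (rule ccontr)
    assume "l2norm half_line v \<noteq> 0"
    then have p: "(l2norm half_line v)\<^sup>2 > 0" by simp
    then have "ennreal ((l2norm half_line v)\<^sup>2) <= ennreal ((l2norm half_line v)\<^sup>2 / 2)"
      using small[of "(l2norm half_line v)\<^sup>2 / 2"] unfolding sqnorm_eq_l2norm[OF vD(2)] by simp
    then have "(l2norm half_line v)\<^sup>2 <= (l2norm half_line v)\<^sup>2 / 2" by (subst (asm) ennreal_le_iff) auto
    then show False using p by simp
  qed
  then show ?thesis using l2norm_0_iff[OF vD(2)] by simp
qed

lemma B_form_SUP_pos: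
  assumes v: "v \<in> Y_space j" and nn: "nonnull v"
  shows "(SUP w\<in>X_space j. ereal (B_form j A w v)) > 0"
proof -
  obtain w where w: "w \<in> X_space j" "B_form j A w v \<noteq> 0"
    using adjoint_injective[OF v] nn by (auto simp: nonnull_def)
  \<comment> \<open>The X side is a linear space, so multiplying by the sign makes a nonzero value
    positive.\<close>
  define s where "s = sgn (B_form j A w v)"
  have "(\<lambda>t. s *\<^sub>R w t + 0 *\<^sub>R w t) \<in> X_space j" by (rule X_lincomb[OF w(1) w(1)])
  moreover have "B_form j A (\<lambda>t. s *\<^sub>R w t + 0 *\<^sub>R w t) v > 0"
    unfolding B_form_lincomb_left[OF w(1) w(1) v] using w(2) by (simp add: s_def sgn_mult_self_eq abs_sgn_eq sgn_if)
  ultimately show ?thesis unfolding less_SUP_iff by (metis ereal_less(2))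
qed

lemma inf_sup:
  "\<exists>\<gamma>>0. (INF w\<in>{w \<in> X_space j. nonnull w}. SUP v\<in>{v \<in> Y_space j. nonnull v}.
      ereal (B_form j A w v / (X_norm j w * Y_norm j v))) >= ereal \<gamma>"
proof -
  obtain \<gamma> where \<gamma>: "\<gamma> > 0" and *: "\<And>w. w \<in> X_space j ==> nonnull w ==>
      (\<exists>v\<in>Y_space j. nonnull v \<and> \<gamma> * (X_norm j w * Y_norm j v) <= B_form j A w v \<and> 0 < X_norm j w \<and> 0 < Y_norm j v)"
    using inf_sup_aux by blast
  have "ereal \<gamma> <= (SUP v\<in>{v \<in> Y_space j. nonnull v}. ereal (B_form j A w v / (X_norm j w * Y_norm j v)))"
    if w: "w \<in> X_space j" "nonnull w" for w
  proof -
    obtain v where v: "v \<in> Y_space j" "nonnull v" "\<gamma> * (X_norm j w * Y_norm j v) <= B_form j A w v" "0 < X_norm j w" "0 < Y_norm j v"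
      using *[OF w] by blast
    show ?thesis
    proof (rule SUP_upper2)
      show "v \<in> {v \<in> Y_space j. nonnull v}" using v by simp
      show "ereal \<gamma> <= ereal (B_form j A w v / (X_norm j w * Y_norm j v))"
        using v by (simp add: pos_le_divide_eq)
    qed
  qed
  then show ?thesis using \<gamma> by (intro exI[of _ \<gamma>] conjI INF_greatest) auto
qed

subsection \<open>Well-posedness\<close>

definition ip_Y :: "(real => 'v) => (real => 'v) => real" where
  "ip_Y u v = l2ip half_line u v + l2ip half_line (j \<circ> u) (j \<circ> v) + l2ip half_plane (dquot (j \<circ> u)) (dquot (j \<circ> v))"

text \<open>Casts the weighted term of the norm as one more L2 piece, so that X is Y with an
  additional component.\<close>

definition hardy :: "(real => 'v) => real => 'h" where
  "hardy v = (\<lambda>s. (1 / sqrt s) *\<^sub>R (j \<circ> v) s)"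

lemma Y_space_iff: "v \<in> Y_space j \<longleftrightarrow> sq_integrable half_line v \<and> sq_integrable half_line (j \<circ> v) \<and> sq_integrable half_plane (dquot (j \<circ> v))"
proof (cases "v \<in> borel_measurable half_line")
  case True
  note jm = j_comp_measurable[OF True]
  show ?thesis using True jm borel_measurable_dquot_half_line[OF jm] H12_normsq_eq[OF jm]
    by (auto simp: Y_space_def L2_space_iff H12_space_def sq_integrable_def)
qed (auto simp: Y_space_def L2_space_iff sq_integrable_def)

lemma hardy_measurable:
  assumes "v \<in> borel_measurable half_line"
  shows "hardy v \<in> borel_measurable half_line"
  unfolding hardy_def by (intro borel_measurable_scaleR j_comp_measurable[OF assms] measurable_half_lineI) simp

lemma X_space_iff: "v \<in> X_space j \<longleftrightarrow> v \<in> Y_space j \<and> sq_integrable half_line (hardy v)"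
proof (cases "v \<in> borel_measurable half_line")
  case True
  note jm = j_comp_measurable[OF True]
  note hm = hardy_measurable[OF True]
  show ?thesis using True jm hm H12_00_normsq_eq[OF jm, folded hardy_def] H12_normsq_eq[OF jm]
    by (auto simp: X_space_def Y_space_def L2_space_iff H12_space_def H12_00_space_def sq_integrable_def)
qed (auto simp: X_space_def Y_space_def L2_space_iff sq_integrable_def)

lemma Y_norm_pieces:
  assumes v: "v \<in> Y_space j"
  shows "(Y_norm j v)\<^sup>2 = (l2norm half_line v)\<^sup>2 + (l2norm half_line (j \<circ> v))\<^sup>2 + (l2norm half_plane (dquot (j \<circ> v)))\<^sup>2"
proof -
  have s: "sq_integrable half_line (j \<circ> v)" "sq_integrable half_plane (dquot (j \<circ> v))" using v unfolding Y_space_iff by auto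
  have "ennreal ((H12_norm (j \<circ> v))\<^sup>2) = ennreal ((l2norm half_line (j \<circ> v))\<^sup>2) + ennreal ((l2norm half_plane (dquot (j \<circ> v)))\<^sup>2)"
    using H12_normsq_eq[OF Y_spaceD(3)[OF v]] unfolding H12_normsq_norm[OF Y_spaceD(1)[OF v]] s[THEN sqnorm_eq_l2norm] .
  also have "... = ennreal ((l2norm half_line (j \<circ> v))\<^sup>2 + (l2norm half_plane (dquot (j \<circ> v)))\<^sup>2)"
    by (rule ennreal_plus[symmetric]) auto
  finally have "(H12_norm (j \<circ> v))\<^sup>2 = (l2norm half_line (j \<circ> v))\<^sup>2 + (l2norm half_plane (dquot (j \<circ> v)))\<^sup>2"
    by (subst (asm) ennreal_inj) auto
  then show ?thesis unfolding Y_norm_sq by simp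
qed

lemma X_norm_pieces:
  assumes v: "v \<in> X_space j"
  shows "(X_norm j v)\<^sup>2 = (Y_norm j v)\<^sup>2 + (l2norm half_line (hardy v))\<^sup>2"
proof -
  have Y: "v \<in> Y_space j" and h: "sq_integrable half_line (hardy v)" using v unfolding X_space_iff by auto
  have "H12_00_normsq (j \<circ> v) = H12_normsq (j \<circ> v) + sqnorm half_line (hardy v)"
    unfolding H12_00_normsq_eq[OF X_spaceD(3)[OF v]] H12_normsq_eq[OF X_spaceD(3)[OF v]] hardy_def ..
  then have "ennreal ((H12_00_norm (j \<circ> v))\<^sup>2) = ennreal ((H12_norm (j \<circ> v))\<^sup>2) + ennreal ((l2norm half_line (hardy v))\<^sup>2)"
    unfolding H12_00_normsq_norm[OF X_spaceD(1)[OF v]] H12_normsq_norm[OF Y_spaceD(1)[OF Y]] sqnorm_eq_l2norm[OF h] .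
  also have "... = ennreal ((H12_norm (j \<circ> v))\<^sup>2 + (l2norm half_line (hardy v))\<^sup>2)"
    by (rule ennreal_plus[symmetric]) auto
  finally have "(H12_00_norm (j \<circ> v))\<^sup>2 = (H12_norm (j \<circ> v))\<^sup>2 + (l2norm half_line (hardy v))\<^sup>2"
    by (subst (asm) ennreal_inj) auto
  then show ?thesis unfolding Y_norm_sq X_norm_sq by simp
qed

lemma ip_Y_self:
  assumes v: "v \<in> Y_space j"
  shows "ip_Y v v = (Y_norm j v)\<^sup>2"
  unfolding ip_Y_def Y_norm_pieces[OF v] using v[unfolded Y_space_iff] by (simp add: l2ip_self)

lemma j_comp_diff: "j \<circ> (\<lambda>t. u t - v t) = (\<lambda>t. (j \<circ> u) t - (j \<circ> v) t)"
  by (auto simp: j.diff)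

lemma hardy_diff: "hardy (\<lambda>t. u t - v t) = (\<lambda>t. hardy u t - hardy v t)"
  by (auto simp: hardy_def j.diff scaleR_diff_right)

lemma Y_diff: "u \<in> Y_space j ==> v \<in> Y_space j ==> (\<lambda>t. u t - v t) \<in> Y_space j"
  using Y_lincomb[of u v 1 "-1"] by simp

lemma X_diff: "u \<in> X_space j ==> v \<in> X_space j ==> (\<lambda>t. u t - v t) \<in> X_space j"
  using X_lincomb[of u v 1 "-1"] by simp

text \<open>The subsequence and its almost everywhere convergence are part of the conclusion:
  completeness of X needs them to identify the limit of the additional weighted piece with the same
  function.\<close>

lemma Y_complete:
  assumes f: "\<And>n::nat. f n \<in> Y_space j"
    and cauchy: "\<And>e. e > 0 ==> \<exists>N. \<forall>m\<ge>N. \<forall>n\<ge>N. (Y_norm j (\<lambda>t. f m t - f n t))\<^sup>2 < e"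
  obtains r g where "strict_mono (r::nat=>nat)" "g \<in> Y_space j" "AE t in half_line. (\<lambda>n. f (r n) t) ---> g t"
    "(\<lambda>n. (Y_norm j (\<lambda>t. f n t - g t))\<^sup>2) ---> 0"
proof -
  have s: "sq_integrable half_line (f n)" "sq_integrable half_line (j \<circ> f n)" "sq_integrable half_plane (dquot (j \<circ> f n))" for n
    using f unfolding Y_space_iff by auto
  have pc: "(Y_norm j (\<lambda>t. f m t - g t))\<^sup>2 = (l2norm half_line (\<lambda>t. f m t - g t))\<^sup>2 + (l2norm half_line (\<lambda>t. (j \<circ> f m) t - (j \<circ> g) t))\<^sup>2
      + (l2norm half_plane (\<lambda>x. dquot (j \<circ> f m) x - dquot (j \<circ> g) x))\<^sup>2" if "g \<in> Y_space j" for m g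
    unfolding Y_norm_pieces[OF Y_diff[OF f that]] j_comp_diff dquot_diff ..
  have c1: "\<exists>N. \<forall>m\<ge>N. \<forall>n\<ge>N. (l2norm half_line (\<lambda>t. f m t - f n t))\<^sup>2 < e" if "e > 0" for e
    using cauchy[OF that] unfolding pc[OF f] by (smt (verit) zero_le_power2)
  have c2: "\<exists>N. \<forall>m\<ge>N. \<forall>n\<ge>N. (l2norm half_line (\<lambda>t. (j \<circ> f m) t - (j \<circ> f n) t))\<^sup>2 < e" if "e > 0" for e
    using cauchy[OF that] unfolding pc[OF f] by (smt (verit) zero_le_power2)
  have c3: "\<exists>N. \<forall>m\<ge>N. \<forall>n\<ge>N. (l2norm half_plane (\<lambda>x. dquot (j \<circ> f m) x - dquot (j \<circ> f n) x))\<^sup>2 < e" if "e > 0" for e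
    using cauchy[OF that] unfolding pc[OF f] by (smt (verit) zero_le_power2)
  have "\<exists>N. \<forall>m\<ge>N. \<forall>n\<ge>N. sqnorm half_line (\<lambda>x. f m x - f n x) < ennreal e" if "e > 0" for e
    using c1[OF that] sqnorm_eq_l2norm[OF sq_integrable_diff[OF s(1) s(1)]] by (simp add: ennreal_less_iff)
  from sqnorm_Cauchy_AE_convergent[OF _ this] obtain r g where r: "strict_mono (r::nat=>nat)"
    and gm: "g \<in> borel_measurable half_line" and AE: "AE t in half_line. (\<lambda>n. f (r n) t) ---> g t"
    using s(1) by (auto simp: sq_integrable_def)
  have jg: "j \<circ> g \<in> borel_measurable half_line" by (rule j_comp_measurable[OF gm])
  have AEj: "AE t in half_line. (\<lambda>n. (j \<circ> f (r n)) t) ---> (j \<circ> g) t"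
    using AE by eventually_elim (simp add: j.tendsto)
  have AEd: "AE x in half_plane. (\<lambda>n. dquot (j \<circ> f (r n)) x) ---> dquot (j \<circ> g) x"
    using AE_half_plane[OF AEj] by eventually_elim (simp add: dquot_def case_prod_beta tendsto_intros)
  note L1 = L2_piece_limit[OF s(1) gm c1 r AE]
  note L2 = L2_piece_limit[OF s(2) jg c2 r AEj]
  note L3 = L2_piece_limit[OF s(3) borel_measurable_dquot_half_line[OF jg] c3 r AEd]
  have g: "g \<in> Y_space j" unfolding Y_space_iff using L1(1) L2(1) L3(1) by blast
  have "(\<lambda>n. (Y_norm j (\<lambda>t. f n t - g t))\<^sup>2) ---> 0"
    unfolding pc[OF g] using tendsto_add[OF tendsto_add[OF L1(2) L2(2)] L3(2)] by (simp only: add_0_left)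
  then show thesis by (rule that[OF r g AE])
qed

lemma X_complete:
  assumes f: "\<And>n::nat. f n \<in> X_space j"
    and cauchy: "\<And>e. e > 0 ==> \<exists>N. \<forall>m\<ge>N. \<forall>n\<ge>N. (X_norm j (\<lambda>t. f m t - f n t))\<^sup>2 < e"
  obtains g where "g \<in> X_space j" "(\<lambda>n. (X_norm j (\<lambda>t. f n t - g t))\<^sup>2) ---> 0"
proof -
  have pc: "(X_norm j (\<lambda>t. f m t - g t))\<^sup>2 = (Y_norm j (\<lambda>t. f m t - g t))\<^sup>2 + (l2norm half_line (\<lambda>t. hardy (f m) t - hardy g t))\<^sup>2"
    if "g \<in> X_space j" for m g
    unfolding X_norm_pieces[OF X_diff[OF f that]] hardy_diff ..
  have s: "sq_integrable half_line (hardy (f n))" for n using f unfolding X_space_iff by auto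
  have c1: "\<exists>N. \<forall>m\<ge>N. \<forall>n\<ge>N. (Y_norm j (\<lambda>t. f m t - f n t))\<^sup>2 < e" if "e > 0" for e
    using cauchy[OF that] unfolding pc[OF f] by (smt (verit) zero_le_power2)
  have c2: "\<exists>N. \<forall>m\<ge>N. \<forall>n\<ge>N. (l2norm half_line (\<lambda>t. hardy (f m) t - hardy (f n) t))\<^sup>2 < e" if "e > 0" for e
    using cauchy[OF that] unfolding pc[OF f] by (smt (verit) zero_le_power2)
  obtain r g where r: "strict_mono (r::nat=>nat)" and gY: "g \<in> Y_space j"
    and AE: "AE t in half_line. (\<lambda>n. f (r n) t) ---> g t" and lim: "(\<lambda>n. (Y_norm j (\<lambda>t. f n t - g t))\<^sup>2) ---> 0"
    by (rule Y_complete[OF X_subset_Y[OF f] c1])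
  note hm = hardy_measurable[OF Y_spaceD(4)[OF gY]]
  have AEh: "AE t in half_line. (\<lambda>n. hardy (f (r n)) t) ---> hardy g t"
    using AE by eventually_elim (auto simp: hardy_def intro!: tendsto_intros j.tendsto)
  note L = L2_piece_limit[OF s hm c2 r AEh]
  have g: "g \<in> X_space j" unfolding X_space_iff using gY L(1) by blast
  have "(\<lambda>n. (X_norm j (\<lambda>t. f n t - g t))\<^sup>2) ---> 0"
    unfolding pc[OF g] using tendsto_add[OF lim L(2)] by (simp only: add_0_left)
  then show thesis by (rule that[OF g])
qed

lemma zero_in_X: "(\<lambda>t. 0) \<in> X_space j"
proof -
  have "j \<circ> (\<lambda>t. 0) = (\<lambda>t. 0)" by (auto simp: j.zero)
  moreover have "dquot (\<lambda>t. 0 :: 'h) = (\<lambda>x. 0)" by (auto simp: dquot_def)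
  ultimately show ?thesis by (simp add: X_space_iff Y_space_iff hardy_def j.zero sq_integrable_def)
qed

sublocale Y: semi_hilbert "Y_space j" ip_Y
proof
  show "(\<lambda>t. 0) \<in> Y_space j" by (rule X_subset_Y[OF zero_in_X])
  show "(\<lambda>t. a *\<^sub>R u t + b *\<^sub>R v t) \<in> Y_space j" if "u \<in> Y_space j" "v \<in> Y_space j" for u v a b
    by (rule Y_lincomb[OF that])
  show "ip_Y u v = ip_Y v u" for u v unfolding ip_Y_def by (simp add: l2ip_sym)
  show "ip_Y (\<lambda>t. a *\<^sub>R u t + b *\<^sub>R u' t) v = a * ip_Y u v + b * ip_Y u' v"
    if u: "u \<in> Y_space j" and u': "u' \<in> Y_space j" and v: "v \<in> Y_space j" for u u' v a b
  proof -
    have "sq_integrable half_line w" "sq_integrable half_line (j \<circ> w)" "sq_integrable half_plane (dquot (j \<circ> w))"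
      if "w \<in> Y_space j" for w using that unfolding Y_space_iff by auto
    note s = this[OF u] this[OF u'] this[OF v]
    show ?thesis unfolding ip_Y_def j_comp_lincomb dquot_lincomb
      l2ip_lin[OF s(1,4,7)] l2ip_lin[OF s(2,5,8)] l2ip_lin[OF s(3,6,9)] by (simp add: algebra_simps)
  qed
  show "0 <= ip_Y u u" if "u \<in> Y_space j" for u unfolding ip_Y_self[OF that] by simp
  fix f :: "nat => real => 'v"
  assume f: "\<And>n. f n \<in> Y_space j" and c: "\<And>e. e > 0 ==> \<exists>M. \<forall>m\<ge>M. \<forall>n\<ge>M. ip_Y (\<lambda>t. f m t - f n t) (\<lambda>t. f m t - f n t) < e"
  obtain r g where "strict_mono (r::nat=>nat)" "g \<in> Y_space j" "AE t in half_line. (\<lambda>n. f (r n) t) ---> g t"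
    "(\<lambda>n. (Y_norm j (\<lambda>t. f n t - g t))\<^sup>2) ---> 0"
    by (rule Y_complete[OF f c[unfolded ip_Y_self[OF Y_diff[OF f f]]]])
  then show "\<exists>g\<in>Y_space j. (\<lambda>n. ip_Y (\<lambda>t. f n t - g t) (\<lambda>t. f n t - g t)) ---> 0"
    using ip_Y_self[OF Y_diff[OF f]] by (intro bexI[of _ g]) simp_all
qed

lemma sqrt_ip_Y: "v \<in> Y_space j ==> sqrt (ip_Y v v) = Y_norm j v"
  by (simp add: ip_Y_self)

lemma ip_Y_le: "u \<in> Y_space j ==> v \<in> Y_space j ==> \<bar>ip_Y u v\<bar> <= Y_norm j u * Y_norm j v"
  using Y.ip_Cauchy_Schwarz[of u v] by (simp add: sqrt_ip_Y)

text \<open>The representer is determined only up to null functions, hence a choice. Linearity of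
  the energy product in its first argument comes from the form, not from this choice.\<close>

definition riesz :: "(real => 'v) => real => 'v" where
  "riesz w = (SOME r. r \<in> Y_space j \<and> (\<forall>v\<in>Y_space j. ip_Y r v = B_form j A w v))"

lemma riesz:
  assumes w: "w \<in> X_space j"
  shows "riesz w \<in> Y_space j" "v \<in> Y_space j ==> ip_Y (riesz w) v = B_form j A w v"
proof -
  have "\<exists>r\<in>Y_space j. \<forall>v\<in>Y_space j. ip_Y r v = B_form j A w v"
  proof (rule Y.Riesz)
    show "\<bar>B_form j A w u\<bar> <= ((12 + lp) * X_norm j w) * sqrt (ip_Y u u)" if "u \<in> Y_space j" for u
      unfolding sqrt_ip_Y[OF that] by (rule B_form_bound[OF w that])
  qed (rule B_form_lincomb_right[OF w])
  then have ex: "\<exists>r. r \<in> Y_space j \<and> (\<forall>v\<in>Y_space j. ip_Y r v = B_form j A w v)" by blast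
  from someI_ex[OF ex, folded riesz_def] show "riesz w \<in> Y_space j" "v \<in> Y_space j ==> ip_Y (riesz w) v = B_form j A w v" by auto
qed

text \<open>By the inf-sup condition and continuity, this energy product induces the topology of \<open>X\<close>.\<close>

definition energy :: "(real => 'v) => (real => 'v) => real" where
  "energy w z = B_form j A w (riesz z)"

lemma energy_eq: "w \<in> X_space j ==> z \<in> X_space j ==> energy w z = ip_Y (riesz w) (riesz z)"
  by (simp add: energy_def riesz)

lemma energy_self: "w \<in> X_space j ==> energy w w = (Y_norm j (riesz w))\<^sup>2"
  by (simp add: energy_eq riesz(1) ip_Y_self)

lemma energy_le:
  assumes w: "w \<in> X_space j"
  shows "energy w w <= (12 + lp)\<^sup>2 * (X_norm j w)\<^sup>2"
proof -
  let ?y = "Y_norm j (riesz w)"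
  have "?y * ?y <= (12 + lp) * X_norm j w * ?y"
    using B_form_bound[OF w riesz(1)[OF w]] energy_self[OF w] by (simp add: energy_def power2_eq_square)
  then have "?y <= (12 + lp) * X_norm j w"
    using lm lm_le by (cases "?y = 0") (auto simp: mult_le_cancel_right intro!: mult_nonneg_nonneg order.not_eq_order_implies_strict)
  then have "?y\<^sup>2 <= ((12 + lp) * X_norm j w)\<^sup>2" by (rule power_mono) simp
  then show ?thesis unfolding energy_self[OF w] by (simp add: power_mult_distrib)
qed

lemma energy_ge:
  obtains c where "c > 0" "\<And>w. w \<in> X_space j ==> c * (X_norm j w)\<^sup>2 <= energy w w"
proof -
  obtain \<gamma> where \<gamma>: "\<gamma> > 0" and *: "\<And>w. w \<in> X_space j ==> nonnull w ==>
      (\<exists>v\<in>Y_space j. nonnull v \<and> \<gamma> * (X_norm j w * Y_norm j v) <= B_form j A w v \<and> 0 < X_norm j w \<and> 0 < Y_norm j v)"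
    using inf_sup_aux by blast
  have "\<gamma>\<^sup>2 * (X_norm j w)\<^sup>2 <= energy w w" if w: "w \<in> X_space j" for w
  proof (cases "nonnull w")
    case True
    obtain v where v: "v \<in> Y_space j" "\<gamma> * (X_norm j w * Y_norm j v) <= B_form j A w v" "0 < Y_norm j v"
      using *[OF w True] by blast
    have "(\<gamma> * X_norm j w) * Y_norm j v <= Y_norm j (riesz w) * Y_norm j v"
      using v(2) ip_Y_le[OF riesz(1)[OF w] v(1)] riesz(2)[OF w v(1)] by (simp add: mult.assoc)
    \<comment> \<open>The inf-sup test function bounds the dual norm of the form at w from below,
      and this dual norm is the Y norm of the representer.\<close>
    then have "\<gamma> * X_norm j w <= Y_norm j (riesz w)" using v(3) by (simp only: mult_le_cancel_right_pos)
    then have "(\<gamma> * X_norm j w)\<^sup>2 <= (Y_norm j (riesz w))\<^sup>2" by (rule power_mono) (use \<gamma> in simp)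
    then show ?thesis unfolding energy_self[OF w] by (simp add: power_mult_distrib)
  next
    case False
    then have "X_norm j w = 0" using null_norms(1)[OF X_spaceD(4)[OF w]] by (simp add: nonnull_def)
    then show ?thesis by (simp add: energy_self[OF w])
  qed
  then show thesis using \<gamma> by (intro that[of "\<gamma>\<^sup>2"]) auto
qed

sublocale X: semi_hilbert "X_space j" energy
proof
  show "(\<lambda>t. 0) \<in> X_space j" by (rule zero_in_X)
  show "(\<lambda>t. a *\<^sub>R u t + b *\<^sub>R v t) \<in> X_space j" if "u \<in> X_space j" "v \<in> X_space j" for u v a b
    by (rule X_lincomb[OF that])
  show "energy u v = energy v u" if "u \<in> X_space j" "v \<in> X_space j" for u v
    using that by (simp add: energy_eq Y.ip_sym riesz(1))
  show "energy (\<lambda>t. a *\<^sub>R u t + b *\<^sub>R u' t) v = a * energy u v + b * energy u' v"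
    if "u \<in> X_space j" "u' \<in> X_space j" "v \<in> X_space j" for u u' v a b
    unfolding energy_def by (rule B_form_lincomb_left[OF that(1,2) riesz(1)[OF that(3)]])
  show "0 <= energy u u" if "u \<in> X_space j" for u unfolding energy_self[OF that] by simp
  fix f :: "nat => real => 'v"
  assume f: "\<And>n. f n \<in> X_space j" and cau: "\<And>e. e > 0 ==> \<exists>M. \<forall>m\<ge>M. \<forall>n\<ge>M. energy (\<lambda>t. f m t - f n t) (\<lambda>t. f m t - f n t) < e"
  obtain c where c: "c > 0" "\<And>w. w \<in> X_space j ==> c * (X_norm j w)\<^sup>2 <= energy w w" using energy_ge by blast
  have "\<exists>N. \<forall>m\<ge>N. \<forall>n\<ge>N. (X_norm j (\<lambda>t. f m t - f n t))\<^sup>2 < e" if e: "e > 0" for e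
  proof -
    obtain N where N: "\<And>m n. m >= N ==> n >= N ==> energy (\<lambda>t. f m t - f n t) (\<lambda>t. f m t - f n t) < c * e"
      using cau[of "c * e"] c e by auto
    have "(X_norm j (\<lambda>t. f m t - f n t))\<^sup>2 < e" if "m >= N" "n >= N" for m n
    proof -
      have "c * (X_norm j (\<lambda>t. f m t - f n t))\<^sup>2 < c * e"
        by (rule le_less_trans[OF c(2)[OF X_diff[OF f f]] N[OF that]])
      then show ?thesis using c(1) by simp
    qed
    then show ?thesis by blast
  qed
  then obtain g where g: "g \<in> X_space j" and lim: "(\<lambda>n. (X_norm j (\<lambda>t. f n t - g t))\<^sup>2) ---> 0"
    by (rule X_complete[OF f])
  have "(\<lambda>n. energy (\<lambda>t. f n t - g t) (\<lambda>t. f n t - g t)) ---> 0"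
  proof (rule tendsto_sandwich)
    show "\<forall>\<^sub>F n in sequentially. 0 <= energy (\<lambda>t. f n t - g t) (\<lambda>t. f n t - g t)"
      by (simp add: energy_self[OF X_diff[OF f g]])
    show "\<forall>\<^sub>F n in sequentially. energy (\<lambda>t. f n t - g t) (\<lambda>t. f n t - g t) <= (12 + lp)\<^sup>2 * (X_norm j (\<lambda>t. f n t - g t))\<^sup>2"
      by (intro always_eventually allI energy_le[OF X_diff[OF f g]])
    show "(\<lambda>n. (12 + lp)\<^sup>2 * (X_norm j (\<lambda>t. f n t - g t))\<^sup>2) ---> 0"
      using tendsto_mult_left[OF lim, of "(12 + lp)\<^sup>2"] by simp
  qed simp
  then show "\<exists>g\<in>X_space j. (\<lambda>n. energy (\<lambda>t. f n t - g t) (\<lambda>t. f n t - g t)) ---> 0" using g by blast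
qed

text \<open>The inf-sup condition makes the range of the representer map closed, and injectivity of
  the adjoint makes it dense. Both enter at once: Riesz in X yields the u whose representer is the
  projection of \<rho> onto the range, and the residual is annihilated by the form.\<close>

lemma well_posed:
  assumes f: "f \<in> Y_dual j"
  shows "\<exists>u\<in>X_space j. (\<forall>v\<in>Y_space j. B_form j A u v = f v) \<and>
    (\<forall>u'\<in>X_space j. (\<forall>v\<in>Y_space j. B_form j A u' v = f v) \<longrightarrow> (AE t in half_line. u' t = u t))"
proof -
  obtain K where K: "\<forall>v\<in>Y_space j. \<bar>f v\<bar> <= K * Y_norm j v" using f unfolding Y_dual_def by blast
  have f_lin: "f (\<lambda>t. a *\<^sub>R u t + b *\<^sub>R v t) = a * f u + b * f v" if u: "u \<in> Y_space j" and v: "v \<in> Y_space j" for u v a b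
  proof -
    have "(\<lambda>t. c *\<^sub>R w t) \<in> Y_space j" if "w \<in> Y_space j" for c w using Y_lincomb[OF that that, of c 0] by simp
    then show ?thesis using f u v by (auto simp: Y_dual_def)
  qed
  obtain \<rho> where \<rho>: "\<rho> \<in> Y_space j" "\<And>v. v \<in> Y_space j ==> ip_Y \<rho> v = f v"
    using Y.Riesz[of f K] f_lin K by (auto simp: sqrt_ip_Y)
  have "\<exists>u\<in>X_space j. \<forall>w\<in>X_space j. energy u w = B_form j A w \<rho>"
  proof (rule X.Riesz)
    show "B_form j A (\<lambda>t. a *\<^sub>R u t + b *\<^sub>R v t) \<rho> = a * B_form j A u \<rho> + b * B_form j A v \<rho>"
      if "u \<in> X_space j" "v \<in> X_space j" for u v a b by (rule B_form_lincomb_left[OF that \<rho>(1)])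
    show "\<bar>B_form j A w \<rho>\<bar> <= Y_norm j \<rho> * sqrt (energy w w)" if w: "w \<in> X_space j" for w
      using ip_Y_le[OF riesz(1)[OF w] \<rho>(1)] by (simp add: riesz(2)[OF w \<rho>(1)] energy_self[OF w] mult.commute)
  qed
  then obtain u where u: "u \<in> X_space j" "\<And>w. w \<in> X_space j ==> energy u w = B_form j A w \<rho>" by blast
  let ?e = "\<lambda>t. \<rho> t - riesz u t"
  have e: "?e \<in> Y_space j" by (rule Y_diff[OF \<rho>(1) riesz(1)[OF u(1)]])
  \<comment> \<open>The residual is orthogonal to the representers of all w, which says precisely
    that the form vanishes against it.\<close>
  have "AE t in half_line. ?e t = 0"
  proof (rule adjoint_injective[OF e])
    fix w assume w: "w \<in> X_space j"
    have "B_form j A w ?e = B_form j A w \<rho> - B_form j A w (riesz u)"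
      using B_form_lincomb_right[OF w \<rho>(1) riesz(1)[OF u(1)], of 1 "-1"] by simp
    also have "B_form j A w (riesz u) = energy u w" using X.ip_sym[OF u(1) w] by (simp add: energy_def)
    finally show "B_form j A w ?e = 0" using u(2)[OF w] by simp
  qed
  then have e0: "Y_norm j ?e = 0" by (rule null_norms(2)[OF Y_spaceD(4)[OF e]])
  have Bu: "B_form j A u v = f v" if v: "v \<in> Y_space j" for v
  proof -
    have "ip_Y ?e v = 0" using ip_Y_le[OF e v] e0 by simp
    then show ?thesis using Y.ip_diff[OF \<rho>(1) riesz(1)[OF u(1)] v] \<rho>(2)[OF v] riesz(2)[OF u(1) v] by simp
  qed
  have "AE t in half_line. u' t = u t" if u': "u' \<in> X_space j" and B: "\<And>v. v \<in> Y_space j ==> B_form j A u' v = f v" for u'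
  proof (rule ccontr)
    assume n: "\<not> (AE t in half_line. u' t = u t)"
    let ?d = "\<lambda>t. u' t - u t"
    have d: "?d \<in> X_space j" by (rule X_diff[OF u' u(1)])
    have nd: "nonnull ?d" using n by (simp add: nonnull_def)
    obtain \<gamma> where \<gamma>: "\<gamma> > 0" "\<forall>w\<in>X_space j. nonnull w \<longrightarrow> (\<exists>v\<in>Y_space j. nonnull v \<and>
      \<gamma> * (X_norm j w * Y_norm j v) <= B_form j A w v \<and> 0 < X_norm j w \<and> 0 < Y_norm j v)" using inf_sup_aux by blast
    obtain v where v: "v \<in> Y_space j" "\<gamma> * (X_norm j ?d * Y_norm j v) <= B_form j A ?d v" "0 < X_norm j ?d" "0 < Y_norm j v"
      using \<gamma>(2)[rule_format, OF d nd] by blast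
    \<comment> \<open>The difference of two solutions is annihilated by every v, whereas the inf-sup
      condition provides a v with a positive value unless the difference is null.\<close>
    have "B_form j A ?d v = 0"
      using B_form_lincomb_left[OF u' u(1) v(1), of 1 "-1"] B[OF v(1)] Bu[OF v(1)] by simp
    moreover have "0 < \<gamma> * (X_norm j ?d * Y_norm j v)" using \<gamma>(1) v(3,4) by simp
    ultimately show False using v(2) by simp
  qed
  then show ?thesis using u(1) Bu by blast
qed

end

theorem proposition3p2:
  fixes j :: "'v::{real_inner, banach, second_countable_topology} \<Rightarrow>
              'h::{real_inner, banach, second_countable_topology}"
    and A :: "'v \<Rightarrow>\<^sub>L ('v \<Rightarrow>\<^sub>L real)"
    and lambda_minus lambda_plus :: real
  assumes "gelfand_embedding j"
    and self_adjoint: "\<And>v w. blinfun_apply (blinfun_apply A v) w = blinfun_apply (blinfun_apply A w) v"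
    and "0 < lambda_minus" and "lambda_minus \<le> lambda_plus"
    and coercive: "\<And>v. blinfun_apply (blinfun_apply A v) v \<ge> lambda_minus * (norm v)\<^sup>2"
    and bounded: "\<And>v w. \<bar>blinfun_apply (blinfun_apply A v) w\<bar> \<le> lambda_plus * norm v * norm w"
  shows "(\<exists>C. \<forall>w\<in>X_space j. \<forall>v\<in>Y_space j. \<bar>B_form j A w v\<bar> \<le> C * X_norm j w * Y_norm j v) \<and>
    (\<exists>\<gamma>>0. (INF w\<in>{w \<in> X_space j. nonnull w}. SUP v\<in>{v \<in> Y_space j. nonnull v}.
              ereal (B_form j A w v / (X_norm j w * Y_norm j v))) \<ge> ereal \<gamma>) \<and>
    (\<forall>v\<in>Y_space j. nonnull v \<longrightarrow> (SUP w\<in>X_space j. ereal (B_form j A w v)) > 0) \<and>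
    (\<forall>f\<in>Y_dual j. \<exists>u\<in>X_space j. (\<forall>v\<in>Y_space j. B_form j A u v = f v) \<and>
       (\<forall>u'\<in>X_space j. (\<forall>v\<in>Y_space j. B_form j A u' v = f v) \<longrightarrow>
          (AE t in half_line. u' t = u t)))"
proof -
  interpret parabolic j A lambda_minus lambda_plus by unfold_locales (fact assms)+
  show ?thesis
  proof (intro conjI ballI impI)
    show "\<exists>C. \<forall>w\<in>X_space j. \<forall>v\<in>Y_space j. \<bar>B_form j A w v\<bar> <= C * X_norm j w * Y_norm j v"
      using B_form_bound by blast
  qed (rule inf_sup, erule (1) B_form_SUP_pos, erule well_posed)
qed

end
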